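(* Let $S$ be a left cancellative monoid. Suppose that the norm $\|\cdot\|_{e_2}$ on $C_c(\partial\mathcal G(S))$ coincides with the reduced norm and that $S$ is C$^*$-regular on the boundary. Then the canonical map $C^*_{e_2}(\partial\mathcal G(S))\to C^*_r(S)/I$ defines an isomorphism $C_r^*(\partial\mathcal G(S))\cong C_r^*(S)/I$.
   Context: **Monoids.** $S$ is a left cancellative monoid with identity $e$ ($st=st'\Rightarrow t=t'$). Identify $s\in S$ with the injection $S\to S$, $t\mapsto st$, and let $s^{-1}$ be the inverse partial bijection $sS\to S$. $I_\ell(S)$ (left inverse hull) is the inverse semigroup of partial bijections of $S$ generated by the left translations; its elements are the compositions $s_{2n}^{-1}s_{2n-1}\cdots s_2^{-1}s_1$. $\mathcal J(S)=\{\operatorname{dom} g: g\in I_\ell(S)\}$ is the set of constructible right ideals, a semigroup under intersection. $\bar{\mathcal J}(S)$ is the collection obtained from $\mathcal J(S)$ by adding all sets $X\setminus\bigcup_{i=1}^mX_i$ with $X,X_i\in\mathcal J(S)$. $p_X$ is the identity map on $X\subseteq S$. "$hs=s$" means $s\in\operatorname{dom}h$ and $h(s)=s$; "$hp_Y=p_Y$" means $Y\subseteq\operatorname{dom}h$ and $h$ fixes every point of $Y$. **Foundation sets.** A finite family $\{X_1,\dots,X_m\}\subseteq\bar{\mathcal J}(S)$ is a foundation set for $X\in\bar{\mathcal J}(S)$ if $X_i\subseteq X$ for all $i$ and every nonempty $Y\in\mathcal J(S)$ with $Y\subseteq X$ meets some $X_i$. **C$^*$-regularity on the boundary.** $S$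 is C$^*$-regular on the boundary if, whenever $h_1,\dots,h_n\in I_\ell(S)$ and $X,X_1,\dots,X_m\in\mathcal J(S)$ ($m\ge 0$, $X_i\subseteq X$) satisfy $\emptyset\ne X\setminus\bigcup_iX_i\subseteq\bigcup_{k=1}^n\{s\in S: h_ks=s\}$, there are $Y_1,\dots,Y_l\in\bar{\mathcal J}(S)$ ($l\ge0$) and indices $1\le k_j\le n$ with $h_{k_j}p_{Y_j}=p_{Y_j}$ for all $j$ and such that $\{X_1,\dots,X_m,Y_1,\dots,Y_l\}$ is a foundation set for $X$. **Groupoids.** Characters are nonzero semigroup homomorphisms $\chi:\mathcal J(S)\to\{0,1\}$, with the topology of pointwise convergence. $\chi_s(X)=1$ iff $s\in X$. $\Omega(S)=\overline{\{\chi_s:s\in S\}}$. Each $\chi\in\Omega(S)$ extends to $\bar{\mathcal J}(S)$ by $\chi(X\setminus\bigcup_iX_i)=1$ iff $\chi(X)=1$ and $\chi(X_i)=0$ for all $i$. $\mathcal G_P(S)$ is the set of classes $[g,\chi]$ of pairs $(g,\chi)\in I_\ell(S)\times\Omega(S)$ with $\chi(\operatorname{dom}g)=1$, where $(g_1,\chi_1)\sim(g_2,\chi_2)$ iff $\chi_1=\chi_2$ and $g_1|_A=g_2|_A$ for some $A\in\mathcal J(S)$ with $\chi_1(A)=1$. Product: $[g,\chi][h,\psi]=[gh,\psi]$ if $\chi=\psi(h^{-1}(\cdot))$; source $\chi$, range $\chi(g^{-1}(\cdot))$; unit space $\Omega(S)$ via $\chi\mapsto[p_S,\chi]$; a basis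 of topology consists of the sets $D(g,U)=\{[g,\chi]:\chi\in U\}$, $U\subseteq\{\chi\in\Omega(S):\chi(\operatorname{dom}g)=1\}$ open. $\mathcal G(S)=\mathcal G_P(S)/\sim_2$ is the quotient groupoid (with quotient topology), where $[g,\chi]\sim_2[h,\chi]$ iff $g|_X=h|_X$ for some $X\in\bar{\mathcal J}(S)$ with $\chi(X)=1$; it is a locally compact, possibly non-Hausdorff, étale groupoid with unit space $\Omega(S)$. A filter on $\mathcal J(S)$ is a nonempty family of nonempty members of $\mathcal J(S)$ closed under finite intersections and upward inclusion; $\Omega_{\max}(S)\subseteq\Omega(S)$ is the set of characters $\chi$ such that $\chi^{-1}(1)$ is a maximal filter. $\partial\Omega(S)=\overline{\Omega_{\max}(S)}$ is a closed invariant subset, and $\partial\mathcal G(S)$ is the reduction of $\mathcal G(S)$ to $\partial\Omega(S)$. **C$^*$-algebras.** For an étale groupoid $\mathcal G$, $C_c(\mathcal G)$ is the span of the functions in $C_c(V)$ ($V\subseteq\mathcal G$ open Hausdorff) extended by $0$, a convolution $*$-algebra; $\rho_x$ ($x\in\mathcal G^{(0)}$) is its left regular representation on $\ell^2(\mathcal G_x)$, $\mathcal G_x=s^{-1}(x)$, $(\rho_x(f)\xi)(g)=\sum_{h\in \mathcal G^{r(g)}}f(h)\xi(h^{-1}g)$; $\|f\|_r=\sup_x\|\rho_x(f)\|$, and $C^*_r(\mathcal G)$ is the completion. $C_r^*(\mathcal G(S)\setminus\partial\mathcal G(S))$ is a closed ideal of $C^*_r(\mathcal G(S))$, and $\|\cdot\|_{e_2}$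 is the unique C$^*$-norm on $C_c(\partial\mathcal G(S))$ for which restriction of functions induces a short exact sequence $0\to C_r^*(\mathcal G(S)\setminus\partial\mathcal G(S))\to C_r^*(\mathcal G(S))\xrightarrow{\phi_2}C^*_{e_2}(\partial\mathcal G(S))\to0$, where $C_{e_2}^*$ is the completion in $\|\cdot\|_{e_2}$. $C^*_r(S)\subseteq B(\ell^2(S))$ is generated by the isometries $\lambda_s\delta_t=\delta_{st}$. For $X\subseteq S$, $1_X$ is the projection onto $\overline{\mathrm{span}}\{\delta_s:s\in X\}$. $I$ is the closed two-sided ideal of $C_r^*(S)$ generated by the projections $1_{X\setminus\bigcup_{i=1}^mX_i}$ with $m\ge1$, $X,X_i\in\mathcal J(S)$, $\{X_1,\dots,X_m\}$ a foundation set for $X$. $q:C^*_r(S)\to C_r^*(S)/I$ is the quotient map. Identifying $\mathcal G(S)_{\chi_e}$ with $S$ via $[s,\chi_e]\leftrightarrow s$, the left regular representation of $\mathcal G(S)$ at $\chi_e$ becomes a surjective $*$-homomorphism $(\rho_{\chi_e})_2:C_r^*(\mathcal G(S))\to C_r^*(S)$ sending the indicator function of the image of $D(s,\Omega(S))$ to $\lambda_s$. The canonical map $C^*_{e_2}(\partial\mathcal G(S))\to C^*_r(S)/I$ is the unique $*$-homomorphism whose composition with $\phi_2$ equals $q\circ(\rho_{\chi_e})_2$ (it always exists). *)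

theory Defs
  imports "HOL-Analysis.Analysis"
begin

section \<open>The Hilbert space of square-summable functions and its bounded operators\<close>

definition square_summable :: "('a \<Rightarrow> complex) \<Rightarrow> bool" where
  "square_summable f \<longleftrightarrow> (\<lambda>i. (cmod (f i))\<^sup>2) summable_on UNIV"

lemma square_summable_add:
  assumes "square_summable f" "square_summable g"
  shows "square_summable (\<lambda>i. f i + g i)"
proof -
  have "(\<lambda>i. 2 * (cmod (f i))\<^sup>2 + 2 * (cmod (g i))\<^sup>2) summable_on UNIV"
    using assms unfolding square_summable_def
    by (intro summable_on_add summable_on_cmult_right) auto
  moreover have "(cmod (f i + g i))\<^sup>2 \<le> 2 * (cmod (f i))\<^sup>2 + 2 * (cmod (g i))\<^sup>2" for i
  proof -
    have "(cmod (f i + g i))\<^sup>2 \<le> (cmod (f i) + cmod (g i))\<^sup>2"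
      by (intro power_mono norm_triangle_ineq) auto
    also have "\<dots> \<le> 2 * (cmod (f i))\<^sup>2 + 2 * (cmod (g i))\<^sup>2"
      using sum_squares_bound[of "cmod (f i)" "cmod (g i)"] by (simp add: power2_sum)
    finally show ?thesis .
  qed
  ultimately show ?thesis
    unfolding square_summable_def by (rule summable_on_comparison_test) auto
qed

lemma square_summable_cmult:
  assumes "square_summable f"
  shows "square_summable (\<lambda>i. c * f i)"
  using assms unfolding square_summable_def
  by (auto simp: norm_mult power_mult_distrib intro: summable_on_cmult_right)

lemma square_summable_zero: "square_summable (\<lambda>_. 0)"
  by (simp add: square_summable_def)

typedef 'a ell2 = "{f :: 'a \<Rightarrow> complex. square_summable f}"
  morphisms ell2_apply Abs_ell2
  using square_summable_zero by blast

setup_lifting type_definition_ell2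

lemma square_summable_inner:
  assumes "square_summable f" "square_summable g"
  shows "(\<lambda>i. f i \<bullet> g i) summable_on UNIV"
proof -
  have "(\<lambda>i. (cmod (f i))\<^sup>2 + (cmod (g i))\<^sup>2) summable_on UNIV"
    using assms unfolding square_summable_def by (intro summable_on_add)
  moreover have "norm (f i \<bullet> g i) \<le> (cmod (f i))\<^sup>2 + (cmod (g i))\<^sup>2" for i
  proof -
    have "norm (f i \<bullet> g i) \<le> cmod (f i) * cmod (g i)"
      using Cauchy_Schwarz_ineq2[of "f i" "g i"] by simp
    also have "\<dots> \<le> (cmod (f i))\<^sup>2 + (cmod (g i))\<^sup>2"
      using sum_squares_bound[of "cmod (f i)" "cmod (g i)"]
        mult_nonneg_nonneg[OF norm_ge_zero[of "f i"] norm_ge_zero[of "g i"]] by linarith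
    finally show ?thesis .
  qed
  ultimately have "(\<lambda>i. norm (f i \<bullet> g i)) summable_on UNIV"
    by (rule summable_on_comparison_test) auto
  then show ?thesis by (rule abs_summable_summable)
qed

instantiation ell2 :: (type) real_inner
begin

lift_definition zero_ell2 :: "'a ell2" is "\<lambda>_. 0"
  by (rule square_summable_zero)
lift_definition plus_ell2 :: "'a ell2 \<Rightarrow> 'a ell2 \<Rightarrow> 'a ell2" is "\<lambda>f g i. f i + g i"
  by (rule square_summable_add)
lift_definition uminus_ell2 :: "'a ell2 \<Rightarrow> 'a ell2" is "\<lambda>f i. - f i"
  by (simp add: square_summable_def)
definition minus_ell2 :: "'a ell2 \<Rightarrow> 'a ell2 \<Rightarrow> 'a ell2" where
  "minus_ell2 x y = x + - y"
lift_definition scaleR_ell2 :: "real \<Rightarrow> 'a ell2 \<Rightarrow> 'a ell2" is "\<lambda>r f i. complex_of_real r * f i"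
  by (rule square_summable_cmult)
lift_definition inner_ell2 :: "'a ell2 \<Rightarrow> 'a ell2 \<Rightarrow> real"
  is "\<lambda>f g. \<Sum>\<^sub>\<infinity>i. f i \<bullet> g i" .
definition norm_ell2 :: "'a ell2 \<Rightarrow> real" where
  "norm_ell2 x = sqrt (inner x x)"
definition sgn_ell2 :: "'a ell2 \<Rightarrow> 'a ell2" where
  "sgn_ell2 x = scaleR (inverse (norm x)) x"
definition dist_ell2 :: "'a ell2 \<Rightarrow> 'a ell2 \<Rightarrow> real" where
  "dist_ell2 x y = norm (x - y)"
definition uniformity_ell2 :: "('a ell2 \<times> 'a ell2) filter" where
  "uniformity_ell2 = (INF e\<in>{0 <..}. principal {(x, y). dist x y < e})"
definition open_ell2 :: "'a ell2 set \<Rightarrow> bool" where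
  "open_ell2 U \<longleftrightarrow> (\<forall>x\<in>U. eventually (\<lambda>(x', y). x' = x \<longrightarrow> y \<in> U) uniformity)"

instance
proof
  fix x y z :: "'a ell2" and a b :: real
  show "x + y + z = x + (y + z)" by transfer (simp add: add.assoc)
  show "x + y = y + x" by transfer (simp add: add.commute)
  show "0 + x = x" by transfer simp
  show "- x + x = 0" by transfer simp
  show "x - y = x + - y" by (rule minus_ell2_def)
  show "a *\<^sub>R (x + y) = a *\<^sub>R x + a *\<^sub>R y" by transfer (simp add: distrib_left)
  show "(a + b) *\<^sub>R x = a *\<^sub>R x + b *\<^sub>R x" by transfer (simp add: distrib_right)
  show "a *\<^sub>R b *\<^sub>R x = (a * b) *\<^sub>R x" by transfer (simp add: mult.assoc)
  show "1 *\<^sub>R x = x" by transfer simp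
  show "sgn x = scaleR (inverse (norm x)) x" by (rule sgn_ell2_def)
  show "dist x y = norm (x - y)" by (rule dist_ell2_def)
  show "(uniformity :: ('a ell2 \<times> 'a ell2) filter) = (INF e\<in>{0 <..}. principal {(x, y). dist x y < e})"
    by (rule uniformity_ell2_def)
  show "open U \<longleftrightarrow> (\<forall>x\<in>U. eventually (\<lambda>(x', y). x' = x \<longrightarrow> y \<in> U) uniformity)"
    for U :: "'a ell2 set" by (rule open_ell2_def)
  show "inner x y = inner y x" by transfer (simp add: inner_commute)
  show "inner (x + y) z = inner x z + inner y z"
    by transfer (simp add: inner_add_left infsum_add square_summable_inner)
  show "inner (a *\<^sub>R x) y = a * inner x y"
  proof transfer
    fix r :: real and f g :: "'a \<Rightarrow> complex"
    assume fg: "square_summable f" "square_summable g"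
    have "(\<Sum>\<^sub>\<infinity>i. (complex_of_real r * f i) \<bullet> g i) = (\<Sum>\<^sub>\<infinity>i. r * (f i \<bullet> g i))"
      by (intro infsum_cong) (simp add: inner_complex_def algebra_simps)
    also have "\<dots> = r * (\<Sum>\<^sub>\<infinity>i. f i \<bullet> g i)"
      by (rule infsum_cmult_right')
    finally show "(\<Sum>\<^sub>\<infinity>i. (complex_of_real r * f i) \<bullet> g i) = r * (\<Sum>\<^sub>\<infinity>i. f i \<bullet> g i)" .
  qed
  show "0 \<le> inner x x" by transfer (simp add: infsum_nonneg)
  show "inner x x = 0 \<longleftrightarrow> x = 0"
  proof
    assume "inner x x = 0"
    then show "x = 0"
    proof transfer
      fix f :: "'a \<Rightarrow> complex"
      assume f: "square_summable f" and z: "(\<Sum>\<^sub>\<infinity>i. f i \<bullet> f i) = 0"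
      have "f i \<bullet> f i = 0" for i
        by (rule nonneg_infsum_le_0D[where A = UNIV and f = "\<lambda>i. f i \<bullet> f i"])
          (use z square_summable_inner[OF f f] in auto)
      then show "f = (\<lambda>_. 0)" by auto
    qed
  qed (transfer, simp)
  show "norm x = sqrt (inner x x)" by (rule norm_ell2_def)
qed

end

lemma norm_ell2: "norm x = sqrt (\<Sum>\<^sub>\<infinity>i. (cmod (ell2_apply x i))\<^sup>2)"
  unfolding norm_ell2_def inner_ell2.rep_eq by (simp add: power2_norm_eq_inner)

lift_definition ell2_scale :: "complex \<Rightarrow> 'a ell2 \<Rightarrow> 'a ell2" is "\<lambda>c f i. c * f i"
  by (rule square_summable_cmult)

definition ell2_cinner :: "'a ell2 \<Rightarrow> 'a ell2 \<Rightarrow> complex" where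
  "ell2_cinner x y = (\<Sum>\<^sub>\<infinity>i. ell2_apply x i * cnj (ell2_apply y i))"

lift_definition ell2_delta :: "'a \<Rightarrow> 'a ell2" is "\<lambda>s i. if i = s then 1 else 0"
proof -
  fix s :: 'a
  have "(\<lambda>i. (cmod (if i = s then 1 else 0))\<^sup>2) summable_on {s}" by simp
  then show "square_summable (\<lambda>i. if i = s then 1 else 0)"
    unfolding square_summable_def
    by (rule summable_on_cong_neutral[THEN iffD1, rotated -1]) auto
qed

text \<open>The library's bounded operators \<^typ>\<open>'a ell2 \<Rightarrow>\<^sub>L 'a ell2\<close> are only real linear.\<close>

definition complex_linear :: "('a ell2 \<Rightarrow>\<^sub>L 'a ell2) \<Rightarrow> bool" where
  "complex_linear T \<longleftrightarrow> (\<forall>c x. blinfun_apply T (ell2_scale c x) = ell2_scale c (blinfun_apply T x))"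

definition is_adjoint :: "('a ell2 \<Rightarrow>\<^sub>L 'a ell2) \<Rightarrow> ('a ell2 \<Rightarrow>\<^sub>L 'a ell2) \<Rightarrow> bool" where
  "is_adjoint T T' \<longleftrightarrow>
    (\<forall>x y. ell2_cinner (blinfun_apply T x) y = ell2_cinner x (blinfun_apply T' y))"

section \<open>Normed star-algebras, completions and quotients\<close>

record 'a star_algebra =
  acarrier :: "'a set"
  azero :: 'a
  aplus :: "'a \<Rightarrow> 'a \<Rightarrow> 'a"
  ascale :: "complex \<Rightarrow> 'a \<Rightarrow> 'a"
  amult :: "'a \<Rightarrow> 'a \<Rightarrow> 'a"
  astar :: "'a \<Rightarrow> 'a"
  anorm :: "'a \<Rightarrow> real"

definition aminus :: "'a star_algebra \<Rightarrow> 'a \<Rightarrow> 'a \<Rightarrow> 'a" where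
  "aminus A x y = aplus A x (ascale A (-1) y)"

definition star_hom :: "'a star_algebra \<Rightarrow> 'b star_algebra \<Rightarrow> ('a \<Rightarrow> 'b) \<Rightarrow> bool" where
  "star_hom A B f \<longleftrightarrow>
    (\<forall>x\<in>acarrier A. f x \<in> acarrier B) \<and>
    (\<forall>x\<in>acarrier A. \<forall>y\<in>acarrier A. f (aplus A x y) = aplus B (f x) (f y)) \<and>
    (\<forall>c. \<forall>x\<in>acarrier A. f (ascale A c x) = ascale B c (f x)) \<and>
    (\<forall>x\<in>acarrier A. \<forall>y\<in>acarrier A. f (amult A x y) = amult B (f x) (f y)) \<and>
    (\<forall>x\<in>acarrier A. f (astar A x) = astar B (f x))"

definition star_isomorphism :: "'a star_algebra \<Rightarrow> 'b star_algebra \<Rightarrow> ('a \<Rightarrow> 'b) \<Rightarrow> bool" where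
  "star_isomorphism A B f \<longleftrightarrow> star_hom A B f \<and> bij_betw f (acarrier A) (acarrier B)"

definition short_exact ::
  "'a star_algebra \<Rightarrow> 'b star_algebra \<Rightarrow> 'c star_algebra \<Rightarrow> ('a \<Rightarrow> 'b) \<Rightarrow> ('b \<Rightarrow> 'c) \<Rightarrow> bool" where
  "short_exact A B C f g \<longleftrightarrow>
    star_hom A B f \<and> star_hom B C g \<and>
    inj_on f (acarrier A) \<and>
    f ` acarrier A = {b \<in> acarrier B. g b = azero C} \<and>
    g ` acarrier B = acarrier C"

definition has_cstar_norm :: "'a star_algebra \<Rightarrow> bool" where
  "has_cstar_norm A \<longleftrightarrow>
    (\<forall>x\<in>acarrier A. 0 \<le> anorm A x \<and> (anorm A x = 0 \<longleftrightarrow> x = azero A)) \<and>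
    (\<forall>c. \<forall>x\<in>acarrier A. anorm A (ascale A c x) = cmod c * anorm A x) \<and>
    (\<forall>x\<in>acarrier A. \<forall>y\<in>acarrier A. anorm A (aplus A x y) \<le> anorm A x + anorm A y) \<and>
    (\<forall>x\<in>acarrier A. \<forall>y\<in>acarrier A. anorm A (amult A x y) \<le> anorm A x * anorm A y) \<and>
    (\<forall>x\<in>acarrier A. anorm A (amult A (astar A x) x) = (anorm A x)\<^sup>2)"

definition norm_tendsto :: "'a star_algebra \<Rightarrow> (nat \<Rightarrow> 'a) \<Rightarrow> 'a \<Rightarrow> bool" where
  "norm_tendsto A a x \<longleftrightarrow> (\<lambda>n. anorm A (aminus A (a n) x)) \<longlonglongrightarrow> 0"

definition norm_closed :: "'a star_algebra \<Rightarrow> 'a set \<Rightarrow> bool" where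
  "norm_closed A B \<longleftrightarrow>
    (\<forall>a x. (\<forall>n. a n \<in> B) \<and> x \<in> acarrier A \<and> norm_tendsto A a x \<longrightarrow> x \<in> B)"

definition closed_star_subalgebra :: "'a star_algebra \<Rightarrow> 'a set \<Rightarrow> bool" where
  "closed_star_subalgebra A B \<longleftrightarrow>
    B \<subseteq> acarrier A \<and> azero A \<in> B \<and>
    (\<forall>x\<in>B. \<forall>y\<in>B. aplus A x y \<in> B) \<and> (\<forall>c. \<forall>x\<in>B. ascale A c x \<in> B) \<and>
    (\<forall>x\<in>B. \<forall>y\<in>B. amult A x y \<in> B) \<and> (\<forall>x\<in>B. astar A x \<in> B) \<and>
    norm_closed A B"

definition closed_ideal :: "'a star_algebra \<Rightarrow> 'a set \<Rightarrow> bool" where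
  "closed_ideal A B \<longleftrightarrow>
    B \<subseteq> acarrier A \<and> azero A \<in> B \<and>
    (\<forall>x\<in>B. \<forall>y\<in>B. aplus A x y \<in> B) \<and> (\<forall>c. \<forall>x\<in>B. ascale A c x \<in> B) \<and>
    (\<forall>x\<in>acarrier A. \<forall>y\<in>B. amult A x y \<in> B \<and> amult A y x \<in> B) \<and>
    norm_closed A B"

definition generated_cstar_algebra :: "'a star_algebra \<Rightarrow> 'a set \<Rightarrow> 'a star_algebra" where
  "generated_cstar_algebra A X = A\<lparr>acarrier := \<Inter>{B. closed_star_subalgebra A B \<and> X \<subseteq> B}\<rparr>"

definition generated_closed_ideal :: "'a star_algebra \<Rightarrow> 'a set \<Rightarrow> 'a set" where
  "generated_closed_ideal A X = \<Inter>{B. closed_ideal A B \<and> X \<subseteq> B}"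

definition coset :: "'a star_algebra \<Rightarrow> 'a set \<Rightarrow> 'a \<Rightarrow> 'a set" where
  "coset A I x = aplus A x ` I"

definition quotient_algebra :: "'a star_algebra \<Rightarrow> 'a set \<Rightarrow> 'a set star_algebra" where
  "quotient_algebra A I =
    \<lparr>acarrier = coset A I ` acarrier A,
     azero = coset A I (azero A),
     aplus = (\<lambda>X Y. \<Union>x\<in>X. \<Union>y\<in>Y. coset A I (aplus A x y)),
     ascale = (\<lambda>c X. \<Union>x\<in>X. coset A I (ascale A c x)),
     amult = (\<lambda>X Y. \<Union>x\<in>X. \<Union>y\<in>Y. coset A I (amult A x y)),
     astar = (\<lambda>X. \<Union>x\<in>X. coset A I (astar A x)),
     anorm = (\<lambda>X. Inf (anorm A ` X))\<rparr>"

text \<open>The completion is the algebra of Cauchy sequences, with the seminorm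
  \<open>a \<mapsto> lim \<parallel>a\<^sub>n\<parallel>\<close>, modulo the sequences tending to zero.\<close>

definition cauchy_algebra :: "'a star_algebra \<Rightarrow> (nat \<Rightarrow> 'a) star_algebra" where
  "cauchy_algebra A =
    \<lparr>acarrier = {a. (\<forall>n. a n \<in> acarrier A) \<and>
       (\<forall>\<epsilon>>0. \<exists>M. \<forall>m\<ge>M. \<forall>n\<ge>M. anorm A (aminus A (a m) (a n)) < \<epsilon>)},
     azero = (\<lambda>_. azero A),
     aplus = (\<lambda>a b n. aplus A (a n) (b n)),
     ascale = (\<lambda>c a n. ascale A c (a n)),
     amult = (\<lambda>a b n. amult A (a n) (b n)),
     astar = (\<lambda>a n. astar A (a n)),
     anorm = (\<lambda>a. lim (\<lambda>n. anorm A (a n)))\<rparr>"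

definition null_sequences :: "'a star_algebra \<Rightarrow> (nat \<Rightarrow> 'a) set" where
  "null_sequences A = {a. (\<forall>n. a n \<in> acarrier A) \<and> (\<lambda>n. anorm A (a n)) \<longlonglongrightarrow> 0}"

definition completion :: "'a star_algebra \<Rightarrow> (nat \<Rightarrow> 'a) set star_algebra" where
  "completion A = quotient_algebra (cauchy_algebra A) (null_sequences A)"

definition completion_embed :: "'a star_algebra \<Rightarrow> 'a \<Rightarrow> (nat \<Rightarrow> 'a) set" where
  "completion_embed A x = coset (cauchy_algebra A) (null_sequences A) (\<lambda>_. x)"

definition norm_bounded_map :: "'a star_algebra \<Rightarrow> 'b star_algebra \<Rightarrow> ('a \<Rightarrow> 'b) \<Rightarrow> bool" where
  "norm_bounded_map A B f \<longleftrightarrow> (\<exists>K. \<forall>x\<in>acarrier A. anorm B (f x) \<le> K * anorm A x)"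

text \<open>The extension by continuity of a bounded linear \<open>f : A \<rightarrow> B\<close>, with \<open>B\<close> complete, to the
  completion of \<open>A\<close>.\<close>

definition continuous_extension ::
  "'a star_algebra \<Rightarrow> 'b star_algebra \<Rightarrow> ('a \<Rightarrow> 'b) \<Rightarrow> (nat \<Rightarrow> 'a) set \<Rightarrow> 'b" where
  "continuous_extension A B f =
    (\<lambda>X\<in>acarrier (completion A).
       THE y. y \<in> acarrier B \<and> (\<forall>a\<in>X. norm_tendsto B (\<lambda>n. f (a n)) y))"

definition completion_map ::
  "'a star_algebra \<Rightarrow> 'b star_algebra \<Rightarrow> ('a \<Rightarrow> 'b) \<Rightarrow> (nat \<Rightarrow> 'a) set \<Rightarrow> (nat \<Rightarrow> 'b) set" where
  "completion_map A B f = continuous_extension A (completion B) (\<lambda>x. completion_embed B (f x))"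

definition bounded_operators :: "('a ell2 \<Rightarrow>\<^sub>L 'a ell2) star_algebra" where
  "bounded_operators =
    \<lparr>acarrier = {T. complex_linear T},
     azero = 0,
     aplus = (+),
     ascale = (\<lambda>c T. Blinfun (\<lambda>x. ell2_scale c (blinfun_apply T x))),
     amult = (o\<^sub>L),
     astar = (\<lambda>T. THE T'. complex_linear T' \<and> is_adjoint T T'),
     anorm = norm\<rparr>"

section \<open>Groupoids and their reduced algebras\<close>

text \<open>The unit space \<open>gobj\<close> is a separate type; \<open>gunit\<close> embeds it into the arrows.\<close>

record ('g, 'x) groupoid =
  garr :: "'g set"
  gobj :: "'x set"
  gsrc :: "'g \<Rightarrow> 'x"
  grng :: "'g \<Rightarrow> 'x"
  gunit :: "'x \<Rightarrow> 'g"
  gmult :: "'g \<Rightarrow> 'g \<Rightarrow> 'g"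
  ginv :: "'g \<Rightarrow> 'g"
  gtop :: "'g topology"

definition reduction :: "('g, 'x) groupoid \<Rightarrow> 'x set \<Rightarrow> ('g, 'x) groupoid" where
  "reduction G U =
    (let A = {g \<in> garr G. gsrc G g \<in> U \<and> grng G g \<in> U}
     in G\<lparr>garr := A, gobj := gobj G \<inter> U, gtop := subtopology (gtop G) A\<rparr>)"

definition quotient_topology :: "'a topology \<Rightarrow> ('a \<times> 'a) set \<Rightarrow> 'a set topology" where
  "quotient_topology T R = topology (\<lambda>V. V \<subseteq> topspace T // R \<and> openin T (\<Union>V))"

lemma openin_quotient_topology:
  assumes "equiv (topspace T) R"
  shows "openin (quotient_topology T R) V \<longleftrightarrow> V \<subseteq> topspace T // R \<and> openin T (\<Union>V)"
proof -
  have "istopology (\<lambda>V. V \<subseteq> topspace T // R \<and> openin T (\<Union>V))"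
    unfolding istopology_def
  proof (intro conjI allI impI; (elim conjE)?)
    fix V W assume VW: "V \<subseteq> topspace T // R" "W \<subseteq> topspace T // R" "openin T (\<Union>V)" "openin T (\<Union>W)"
    have "\<Union>(V \<inter> W) = \<Union>V \<inter> \<Union>W"
      using VW(1,2) quotient_disj[OF assms] by blast
    then show "openin T (\<Union>(V \<inter> W))" using VW by auto
    show "V \<inter> W \<subseteq> topspace T // R" using VW by auto
  next
    fix K assume K: "\<forall>V\<in>K. V \<subseteq> topspace T // R \<and> openin T (\<Union>V)"
    then show "\<Union>K \<subseteq> topspace T // R" by blast
    have "\<Union>(\<Union>K) = \<Union>(Union ` K)" by blast
    then show "openin T (\<Union>(\<Union>K))" using K by auto
  qed
  then show ?thesis by (simp add: quotient_topology_def topology_inverse')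
qed

text \<open>Used for equivalence relations \<open>R\<close> on \<open>garr G\<close> relating only arrows with the same source
  and range and compatible with products and inverses.\<close>

definition quotient_groupoid :: "('g, 'x) groupoid \<Rightarrow> ('g \<times> 'g) set \<Rightarrow> ('g set, 'x) groupoid" where
  "quotient_groupoid G R =
    \<lparr>garr = garr G // R,
     gobj = gobj G,
     gsrc = (\<lambda>a. the_elem (gsrc G ` a)),
     grng = (\<lambda>a. the_elem (grng G ` a)),
     gunit = (\<lambda>x. R `` {gunit G x}),
     gmult = (\<lambda>a b. \<Union>g\<in>a. \<Union>h\<in>b. R `` {gmult G g h}),
     ginv = (\<lambda>a. \<Union>g\<in>a. R `` {ginv G g}),
     gtop = quotient_topology (gtop G) R\<rparr>"

definition continuous_compact_support :: "'g topology \<Rightarrow> 'g set \<Rightarrow> ('g \<Rightarrow> complex) set" where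
  "continuous_compact_support T V =
    {f. (\<forall>g. g \<notin> V \<longrightarrow> f g = 0) \<and>
        continuous_map (subtopology T V) euclidean f \<and>
        compactin (subtopology T V) (subtopology T V closure_of {g \<in> V. f g \<noteq> 0})}"

definition Cc :: "('g, 'x) groupoid \<Rightarrow> ('g \<Rightarrow> complex) set" where
  "Cc G =
    {f. \<exists>B c. finite B \<and>
       B \<subseteq> (\<Union>V\<in>{V. openin (gtop G) V \<and> Hausdorff_space (subtopology (gtop G) V)}.
              continuous_compact_support (gtop G) V) \<and>
       f = (\<lambda>g. \<Sum>b\<in>B. c b * b g)}"

definition groupoid_algebra ::
  "('g, 'x) groupoid \<Rightarrow> (('g \<Rightarrow> complex) \<Rightarrow> real) \<Rightarrow> ('g \<Rightarrow> complex) star_algebra" where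
  "groupoid_algebra G N =
    \<lparr>acarrier = Cc G,
     azero = (\<lambda>_. 0),
     aplus = (\<lambda>f1 f2 g. f1 g + f2 g),
     ascale = (\<lambda>c f g. c * f g),
     amult = (\<lambda>f1 f2 g. if g \<in> garr G
       then \<Sum>\<^sub>\<infinity>h\<in>{h \<in> garr G. grng G h = grng G g}. f1 h * f2 (gmult G (ginv G h) g) else 0),
     astar = (\<lambda>f g. if g \<in> garr G then cnj (f (ginv G g)) else 0),
     anorm = N\<rparr>"

text \<open>The left regular representation at \<open>x\<close> on \<open>\<ell>\<^sup>2(G\<^sub>x)\<close>. The latter is regarded as the subspace
  of functions on the whole type which vanish off \<open>G\<^sub>x\<close>; the operator is zero on its
  orthogonal complement.\<close>

definition regular_rep :: "('g, 'x) groupoid \<Rightarrow> 'x \<Rightarrow> ('g \<Rightarrow> complex) \<Rightarrow> 'g ell2 \<Rightarrow> 'g ell2" where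
  "regular_rep G x f \<xi> = Abs_ell2 (\<lambda>g. if g \<in> garr G \<and> gsrc G g = x
     then \<Sum>\<^sub>\<infinity>h\<in>{h \<in> garr G. grng G h = grng G g}. f h * ell2_apply \<xi> (gmult G (ginv G h) g)
     else 0)"

text \<open>The \<open>0\<close> only matters for the empty groupoid.\<close>

definition reduced_norm :: "('g, 'x) groupoid \<Rightarrow> ('g \<Rightarrow> complex) \<Rightarrow> real" where
  "reduced_norm G f = Sup (insert 0 ((\<lambda>x. onorm (regular_rep G x f)) ` gobj G))"

abbreviation reduced_algebra :: "('g, 'x) groupoid \<Rightarrow> ('g \<Rightarrow> complex) star_algebra" where
  "reduced_algebra G \<equiv> groupoid_algebra G (reduced_norm G)"

definition reduced_cstar_algebra :: "('g, 'x) groupoid \<Rightarrow> (nat \<Rightarrow> 'g \<Rightarrow> complex) set star_algebra" where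
  "reduced_cstar_algebra G = completion (reduced_algebra G)"

section \<open>Left cancellative monoids and constructible ideals\<close>

class left_cancel_monoid = monoid_mult +
  assumes mult_left_cancel_monoid: "s * t = s * t' \<Longrightarrow> t = t'"

text \<open>Partial bijections are represented by their graphs.\<close>

abbreviation pdom :: "'a rel \<Rightarrow> 'a set" where
  "pdom g \<equiv> Domain g"

abbreviation pcomp :: "'a rel \<Rightarrow> 'a rel \<Rightarrow> 'a rel" where
  "pcomp g h \<equiv> h O g"

abbreviation pid :: "'a set \<Rightarrow> 'a rel" where
  "pid X \<equiv> Id_on X"

abbreviation prestrict :: "'a rel \<Rightarrow> 'a set \<Rightarrow> 'a rel" where
  "prestrict g X \<equiv> pcomp g (pid X)"

definition translation :: "'s::left_cancel_monoid \<Rightarrow> 's rel" where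
  "translation s = {(t, s * t) | t. True}"

inductive_set left_inverse_hull :: "'s::left_cancel_monoid rel set" where
  translation: "translation s \<in> left_inverse_hull"
| inverse: "g \<in> left_inverse_hull \<Longrightarrow> g\<inverse> \<in> left_inverse_hull"
| comp: "g \<in> left_inverse_hull \<Longrightarrow> h \<in> left_inverse_hull \<Longrightarrow> pcomp g h \<in> left_inverse_hull"

definition constructible_ideals :: "'s::left_cancel_monoid set set" (\<open>\<J>\<close>) where
  "\<J> = pdom ` left_inverse_hull"

definition constructible_differences :: "'s::left_cancel_monoid set set" (\<open>\<J>\<^sub>d\<close>) where
  "\<J>\<^sub>d = \<J> \<union> {X - \<Union>F | X F. X \<in> \<J> \<and> finite F \<and> F \<subseteq> \<J>}"

definition foundation_set :: "'s::left_cancel_monoid set set \<Rightarrow> 's set \<Rightarrow> bool" where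
  "foundation_set F X \<longleftrightarrow>
    finite F \<and> F \<subseteq> \<J>\<^sub>d \<and> X \<in> \<J>\<^sub>d \<and> (\<forall>Z\<in>F. Z \<subseteq> X) \<and>
    (\<forall>Y\<in>\<J>. Y \<noteq> {} \<and> Y \<subseteq> X \<longrightarrow> (\<exists>Z\<in>F. Y \<inter> Z \<noteq> {}))"

definition cstar_regular_on_boundary :: "'s::left_cancel_monoid itself \<Rightarrow> bool" where
  "cstar_regular_on_boundary _ \<longleftrightarrow>
    (\<forall>(H :: 's rel set) X F.
       finite H \<and> H \<subseteq> left_inverse_hull \<and>
       X \<in> \<J> \<and> finite F \<and> F \<subseteq> \<J> \<and> (\<forall>Y\<in>F. Y \<subseteq> X) \<and>
       X - \<Union>F \<noteq> {} \<and> X - \<Union>F \<subseteq> (\<Union>h\<in>H. {s. (s, s) \<in> h}) \<longrightarrow>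
       (\<exists>E. finite E \<and> E \<subseteq> \<J>\<^sub>d \<and> (\<forall>Y\<in>E. \<exists>h\<in>H. pcomp h (pid Y) = pid Y) \<and>
            foundation_set (F \<union> E) X))"

lemma pid_UNIV_in_left_inverse_hull: "pid UNIV \<in> left_inverse_hull"
proof -
  have "translation (1 :: 's::left_cancel_monoid) = pid UNIV" by (auto simp: translation_def)
  then show ?thesis by (metis left_inverse_hull.translation)
qed

lemma UNIV_in_constructible_ideals: "UNIV \<in> \<J>"
  unfolding constructible_ideals_def using pid_UNIV_in_left_inverse_hull by force

lemma single_valued_left_inverse_hull:
  "g \<in> left_inverse_hull \<Longrightarrow> single_valued g \<and> single_valued (g\<inverse>)"
proof (induction rule: left_inverse_hull.induct)
  case (translation s)
  then show ?case
    by (auto simp: translation_def single_valued_def dest: mult_left_cancel_monoid)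
qed (auto intro: single_valued_relcomp simp: converse_relcomp)

lemma pid_in_left_inverse_hull: "X \<in> \<J> \<Longrightarrow> pid X \<in> left_inverse_hull"
proof -
  assume "X \<in> \<J>"
  then obtain g where g: "g \<in> left_inverse_hull" and X: "X = pdom g"
    by (auto simp: constructible_ideals_def)
  have "pcomp (g\<inverse>) g = pid X"
    using single_valued_left_inverse_hull[OF g] unfolding X single_valued_def by (auto simp: Id_on_iff)
  then show ?thesis by (metis g left_inverse_hull.comp left_inverse_hull.inverse)
qed

lemma constructible_ideals_Int: "X \<in> \<J> \<Longrightarrow> Y \<in> \<J> \<Longrightarrow> X \<inter> Y \<in> \<J>"
proof -
  assume "X \<in> \<J>" "Y \<in> \<J>"
  then have "pcomp (pid X) (pid Y) \<in> left_inverse_hull"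
    by (intro left_inverse_hull.comp pid_in_left_inverse_hull)
  moreover have "X \<inter> Y = pdom (pcomp (pid X) (pid Y))" by auto
  ultimately show ?thesis unfolding constructible_ideals_def by blast
qed

section \<open>Characters\<close>

text \<open>Characters with values in \<open>{0, 1}\<close> are encoded as extensional predicates on \<open>\<J>\<close>.\<close>

definition characters :: "('s::left_cancel_monoid set \<Rightarrow> bool) set" where
  "characters = {\<omega> \<in> (\<J> \<rightarrow>\<^sub>E UNIV).
     (\<exists>X\<in>\<J>. \<omega> X) \<and> (\<forall>X\<in>\<J>. \<forall>Y\<in>\<J>. \<omega> (X \<inter> Y) \<longleftrightarrow> \<omega> X \<and> \<omega> Y)}"

definition character_topology :: "('s::left_cancel_monoid set \<Rightarrow> bool) topology" where
  "character_topology =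
    subtopology (product_topology (\<lambda>_. discrete_topology UNIV) \<J>) characters"

definition point_character :: "'s::left_cancel_monoid \<Rightarrow> 's set \<Rightarrow> bool" where
  "point_character s = (\<lambda>X\<in>\<J>. s \<in> X)"

definition Omega :: "('s::left_cancel_monoid set \<Rightarrow> bool) set" where
  "Omega = character_topology closure_of (range point_character)"

lemma point_character_in_characters: "point_character s \<in> characters"
  using UNIV_in_constructible_ideals
  by (force simp: characters_def point_character_def constructible_ideals_Int)

lemma point_character_in_Omega: "point_character s \<in> Omega"
proof -
  have "range point_character \<subseteq> topspace character_topology"
    using point_character_in_characters
    by (fastforce simp: character_topology_def characters_def)
  then show ?thesis unfolding Omega_def using closure_of_subset by fast
qed

definition Omega_topology :: "('s::left_cancel_monoid set \<Rightarrow> bool) topology" where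
  "Omega_topology = subtopology character_topology Omega"

definition character_extension :: "('s::left_cancel_monoid set \<Rightarrow> bool) \<Rightarrow> 's set \<Rightarrow> bool" where
  "character_extension \<omega> Z \<longleftrightarrow>
    (\<exists>X F. X \<in> \<J> \<and> finite F \<and> F \<subseteq> \<J> \<and> Z = X - \<Union>F \<and> \<omega> X \<and> (\<forall>Y\<in>F. \<not> \<omega> Y))"

lemma character_extension_point:
  assumes "Z \<in> \<J>\<^sub>d"
  shows "character_extension (point_character s) Z \<longleftrightarrow> s \<in> Z"
proof
  show "character_extension (point_character s) Z \<Longrightarrow> s \<in> Z"
    by (auto simp: character_extension_def point_character_def split: if_splits)
  assume "s \<in> Z"
  moreover obtain X F where "X \<in> \<J>" "finite F" "F \<subseteq> \<J>" "Z = X - \<Union>F"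
  proof (cases "Z \<in> \<J>")
    case True
    then show ?thesis using that[of Z "{}"] by simp
  next
    case False
    then show ?thesis using assms that by (auto simp: constructible_differences_def)
  qed
  ultimately show "character_extension (point_character s) Z"
    by (auto simp: character_extension_def point_character_def subset_iff intro!: exI[of _ X] exI[of _ F])
qed

definition ideal_filter :: "'s::left_cancel_monoid set set \<Rightarrow> bool" where
  "ideal_filter \<F> \<longleftrightarrow>
    \<F> \<subseteq> \<J> \<and> \<F> \<noteq> {} \<and> {} \<notin> \<F> \<and>
    (\<forall>X\<in>\<F>. \<forall>Y\<in>\<F>. X \<inter> Y \<in> \<F>) \<and>
    (\<forall>X\<in>\<F>. \<forall>Y\<in>\<J>. X \<subseteq> Y \<longrightarrow> Y \<in> \<F>)"

definition maximal_ideal_filter :: "'s::left_cancel_monoid set set \<Rightarrow> bool" where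
  "maximal_ideal_filter \<F> \<longleftrightarrow>
    ideal_filter \<F> \<and> (\<forall>\<F>'. ideal_filter \<F>' \<and> \<F> \<subseteq> \<F>' \<longrightarrow> \<F>' = \<F>)"

definition Omega_max :: "('s::left_cancel_monoid set \<Rightarrow> bool) set" where
  "Omega_max = {\<omega> \<in> Omega. maximal_ideal_filter {X \<in> \<J>. \<omega> X}}"

definition boundary_Omega :: "('s::left_cancel_monoid set \<Rightarrow> bool) set" where
  "boundary_Omega = Omega_topology closure_of Omega_max"

section \<open>The groupoids of a left cancellative monoid\<close>

type_synonym 's pgerm = "('s rel \<times> ('s set \<Rightarrow> bool)) set"
type_synonym 's germ = "'s pgerm set"

definition germ_pairs :: "('s::left_cancel_monoid rel \<times> ('s set \<Rightarrow> bool)) set" where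
  "germ_pairs = {(g, \<omega>). g \<in> left_inverse_hull \<and> \<omega> \<in> Omega \<and> \<omega> (pdom g)}"

definition germ_relation ::
  "(('s::left_cancel_monoid rel \<times> ('s set \<Rightarrow> bool)) \<times> ('s rel \<times> ('s set \<Rightarrow> bool))) set" where
  "germ_relation = {((g1, \<omega>1), (g2, \<omega>2)).
     (g1, \<omega>1) \<in> germ_pairs \<and> (g2, \<omega>2) \<in> germ_pairs \<and> \<omega>1 = \<omega>2 \<and>
     (\<exists>A\<in>\<J>. \<omega>1 A \<and> prestrict g1 A = prestrict g2 A)}"

definition germ_P :: "'s::left_cancel_monoid rel \<Rightarrow> ('s set \<Rightarrow> bool) \<Rightarrow> 's pgerm" where
  "germ_P g \<omega> = germ_relation `` {(g, \<omega>)}"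

text \<open>Pointwise, \<open>translate_character g \<omega>\<close> is \<open>\<omega>(g\<^sup>-\<^sup>1(\<cdot>))\<close>.\<close>

definition translate_character ::
  "'s::left_cancel_monoid rel \<Rightarrow> ('s set \<Rightarrow> bool) \<Rightarrow> 's set \<Rightarrow> bool" where
  "translate_character g \<omega> = (\<lambda>X\<in>\<J>. \<omega> (g\<inverse> `` X))"

definition basic_open ::
  "'s::left_cancel_monoid rel \<Rightarrow> ('s set \<Rightarrow> bool) set \<Rightarrow> 's pgerm set" where
  "basic_open g U = germ_P g ` U"

definition groupoid_P :: "('s::left_cancel_monoid pgerm, 's set \<Rightarrow> bool) groupoid" where
  "groupoid_P =
    \<lparr>garr = germ_pairs // germ_relation,
     gobj = Omega,
     gsrc = (\<lambda>a. the_elem ((\<lambda>(g, \<omega>). \<omega>) ` a)),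
     grng = (\<lambda>a. the_elem ((\<lambda>(g, \<omega>). translate_character g \<omega>) ` a)),
     gunit = (\<lambda>\<omega>. germ_P (pid UNIV) \<omega>),
     gmult = (\<lambda>a b. \<Union>(g, \<omega>)\<in>a. \<Union>(h, \<psi>)\<in>b. germ_P (pcomp g h) \<psi>),
     ginv = (\<lambda>a. \<Union>(g, \<omega>)\<in>a. germ_P (g\<inverse>) (translate_character g \<omega>)),
     gtop = topology_generated_by
       {basic_open g U | g U. g \<in> left_inverse_hull \<and> openin Omega_topology U \<and>
          U \<subseteq> {\<omega> \<in> Omega. \<omega> (pdom g)}}\<rparr>"

definition germ_relation_2 :: "('s::left_cancel_monoid pgerm \<times> 's pgerm) set" where
  "germ_relation_2 = {(a, b). \<exists>g h \<omega>.
     (g, \<omega>) \<in> germ_pairs \<and> (h, \<omega>) \<in> germ_pairs \<and> a = germ_P g \<omega> \<and> b = germ_P h \<omega> \<and>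
     (\<exists>X\<in>\<J>\<^sub>d. character_extension \<omega> X \<and> prestrict g X = prestrict h X)}"

definition monoid_groupoid :: "('s::left_cancel_monoid germ, 's set \<Rightarrow> bool) groupoid" where
  "monoid_groupoid = quotient_groupoid groupoid_P germ_relation_2"

definition boundary_groupoid :: "('s::left_cancel_monoid germ, 's set \<Rightarrow> bool) groupoid" where
  "boundary_groupoid = reduction monoid_groupoid boundary_Omega"

definition off_boundary_groupoid :: "('s::left_cancel_monoid germ, 's set \<Rightarrow> bool) groupoid" where
  "off_boundary_groupoid = reduction monoid_groupoid (Omega - boundary_Omega)"

section \<open>The exotic completion on the boundary\<close>

definition restrict_to_boundary ::
  "('s::left_cancel_monoid germ \<Rightarrow> complex) \<Rightarrow> 's germ \<Rightarrow> complex" where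
  "restrict_to_boundary f = (\<lambda>a. if a \<in> garr boundary_groupoid then f a else 0)"

definition e2_cstar_algebra ::
  "(('s::left_cancel_monoid germ \<Rightarrow> complex) \<Rightarrow> real) \<Rightarrow> (nat \<Rightarrow> 's germ \<Rightarrow> complex) set star_algebra"
  where "e2_cstar_algebra N = completion (groupoid_algebra boundary_groupoid N)"

definition phi_2 ::
  "(('s::left_cancel_monoid germ \<Rightarrow> complex) \<Rightarrow> real) \<Rightarrow>
   (nat \<Rightarrow> 's germ \<Rightarrow> complex) set \<Rightarrow> (nat \<Rightarrow> 's germ \<Rightarrow> complex) set" where
  "phi_2 N = completion_map (reduced_algebra monoid_groupoid) (groupoid_algebra boundary_groupoid N)
     restrict_to_boundary"

text \<open>Functions in \<^term>\<open>Cc G\<close> vanish off \<^term>\<open>garr G\<close>, so extension by zero of functions on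
  \<^term>\<open>off_boundary_groupoid\<close> is the identity map. The boundedness condition says that
  restriction does extend by continuity, so that \<^term>\<open>phi_2 N\<close> is meaningful.\<close>

definition is_e2_norm :: "(('s::left_cancel_monoid germ \<Rightarrow> complex) \<Rightarrow> real) \<Rightarrow> bool" where
  "is_e2_norm N \<longleftrightarrow>
    has_cstar_norm (groupoid_algebra boundary_groupoid N) \<and>
    norm_bounded_map (reduced_algebra monoid_groupoid) (groupoid_algebra boundary_groupoid N)
      restrict_to_boundary \<and>
    short_exact (reduced_cstar_algebra off_boundary_groupoid)
      (reduced_cstar_algebra monoid_groupoid)
      (e2_cstar_algebra N)
      (completion_map (reduced_algebra off_boundary_groupoid) (reduced_algebra monoid_groupoid) (\<lambda>f. f))
      (phi_2 N)"

section \<open>The reduced algebra of the monoid and the canonical map\<close>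

definition left_regular :: "'s::left_cancel_monoid \<Rightarrow> 's ell2 \<Rightarrow>\<^sub>L 's ell2" where
  "left_regular s = Blinfun (\<lambda>\<xi>. Abs_ell2 (\<lambda>u. \<Sum>t | s * t = u. ell2_apply \<xi> t))"

lemma left_regular_sum:
  fixes f :: "'s::left_cancel_monoid \<Rightarrow> complex"
  shows "(\<Sum>t | s * t = s * t'. f t) = f t'"
proof -
  have "{t. s * t = s * t'} = {t'}"
    using mult_left_cancel_monoid by blast
  then show ?thesis by simp
qed

lemma left_regular_sum_notin:
  fixes f :: "'s::left_cancel_monoid \<Rightarrow> complex"
  shows "u \<notin> range ((*) s) \<Longrightarrow> (\<Sum>t | s * t = u. f t) = 0"
  by (rule sum.neutral) auto

lemma left_regular_isometric:
  fixes f :: "'s::left_cancel_monoid \<Rightarrow> complex"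
  assumes "square_summable f"
  shows "((\<lambda>u. (cmod (\<Sum>t | s * t = u. f t))\<^sup>2) has_sum (\<Sum>\<^sub>\<infinity>t. (cmod (f t))\<^sup>2)) UNIV"
proof -
  have inj: "inj ((*) s)" by (rule injI) (rule mult_left_cancel_monoid)
  have "((\<lambda>t. (cmod (f t))\<^sup>2) has_sum (\<Sum>\<^sub>\<infinity>t. (cmod (f t))\<^sup>2)) UNIV"
    using assms unfolding square_summable_def by (rule has_sum_infsum)
  then have "(((\<lambda>u. (cmod (\<Sum>t | s * t = u. f t))\<^sup>2) \<circ> (*) s)
      has_sum (\<Sum>\<^sub>\<infinity>t. (cmod (f t))\<^sup>2)) UNIV"
    by (simp add: o_def left_regular_sum)
  then have "((\<lambda>u. (cmod (\<Sum>t | s * t = u. f t))\<^sup>2)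
      has_sum (\<Sum>\<^sub>\<infinity>t. (cmod (f t))\<^sup>2)) (range ((*) s))"
    by (subst has_sum_reindex[OF inj])
  then show ?thesis
    by (rule has_sum_cong_neutral[THEN iffD1, rotated -1]) (auto simp: left_regular_sum_notin)
qed

lemma left_regular_apply:
  "ell2_apply (blinfun_apply (left_regular s) \<xi>) u = (\<Sum>t | s * t = u. ell2_apply \<xi> t)"
proof -
  define F where "F = (\<lambda>\<xi>. Abs_ell2 (\<lambda>u. \<Sum>t | s * t = u. ell2_apply \<xi> t))"
  have sq: "square_summable (\<lambda>u. \<Sum>t | s * t = u. ell2_apply \<eta> t)" for \<eta>
    using left_regular_isometric[of "ell2_apply \<eta>" s] ell2_apply[of \<eta>]
    by (auto simp: square_summable_def summable_on_def)
  have F: "ell2_apply (F \<eta>) u = (\<Sum>t | s * t = u. ell2_apply \<eta> t)" for \<eta> u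
    unfolding F_def by (subst Abs_ell2_inverse) (use sq in auto)
  have "bounded_linear F"
  proof (rule bounded_linear_intro[where K = 1])
    show "F (x + y) = F x + F y" for x y
      by (subst ell2_apply_inject[symmetric]) (auto simp: fun_eq_iff F plus_ell2.rep_eq sum.distrib)
    show "F (r *\<^sub>R x) = r *\<^sub>R F x" for r x
      by (subst ell2_apply_inject[symmetric])
        (auto simp: fun_eq_iff F scaleR_ell2.rep_eq sum_distrib_left)
    show "norm (F x) \<le> norm x * 1" for x
      using left_regular_isometric[of "ell2_apply x" s, THEN infsumI] ell2_apply[of x]
      by (simp add: norm_ell2 F)
  qed
  then show ?thesis
    unfolding left_regular_def F_def[symmetric] by (simp add: bounded_linear_Blinfun_apply F)
qed

lemma left_regular_delta: "blinfun_apply (left_regular s) (ell2_delta t) = ell2_delta (s * t)"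
proof -
  have "(\<Sum>t' | s * t' = u. if t' = t then 1 else 0 :: complex) = (if u = s * t then 1 else 0)" for u
    by (cases "u \<in> range ((*) s)")
      (auto simp: left_regular_sum left_regular_sum_notin dest: mult_left_cancel_monoid)
  then show ?thesis
    by (subst ell2_apply_inject[symmetric]) (simp add: fun_eq_iff left_regular_apply ell2_delta.rep_eq)
qed

definition projection :: "'s set \<Rightarrow> 's ell2 \<Rightarrow>\<^sub>L 's ell2" where
  "projection X = Blinfun (\<lambda>\<xi>. Abs_ell2 (\<lambda>s. if s \<in> X then ell2_apply \<xi> s else 0))"

definition monoid_cstar_algebra :: "('s::left_cancel_monoid ell2 \<Rightarrow>\<^sub>L 's ell2) star_algebra" where
  "monoid_cstar_algebra = generated_cstar_algebra bounded_operators (range left_regular)"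

definition boundary_ideal :: "('s::left_cancel_monoid ell2 \<Rightarrow>\<^sub>L 's ell2) set" where
  "boundary_ideal = generated_closed_ideal monoid_cstar_algebra
     {projection (X - \<Union>F) | X F. X \<in> \<J> \<and> F \<subseteq> \<J> \<and> F \<noteq> {} \<and> foundation_set F X}"

definition boundary_quotient :: "('s::left_cancel_monoid ell2 \<Rightarrow>\<^sub>L 's ell2) set star_algebra" where
  "boundary_quotient = quotient_algebra monoid_cstar_algebra boundary_ideal"

definition unit_orbit :: "'s::left_cancel_monoid \<Rightarrow> 's germ" where
  "unit_orbit s = germ_relation_2 `` {germ_P (translation s) (point_character 1)}"

text \<open>The left regular representation at \<^term>\<open>point_character 1\<close>, transported to \<open>\<ell>\<^sup>2(S)\<close> along the
  identification \<^const>\<open>unit_orbit\<close> of \<open>S\<close> with the fibre over that character.\<close>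

definition regular_rep_unit ::
  "('s::left_cancel_monoid germ \<Rightarrow> complex) \<Rightarrow> 's ell2 \<Rightarrow>\<^sub>L 's ell2" where
  "regular_rep_unit f = Blinfun (\<lambda>\<xi>. Abs_ell2 (\<lambda>s.
     ell2_apply
       (regular_rep monoid_groupoid (point_character 1) f
         (Abs_ell2 (\<lambda>a. if a \<in> range unit_orbit then ell2_apply \<xi> (inv unit_orbit a) else 0)))
       (unit_orbit s)))"

definition rho_2 ::
  "(nat \<Rightarrow> 's::left_cancel_monoid germ \<Rightarrow> complex) set \<Rightarrow> 's ell2 \<Rightarrow>\<^sub>L 's ell2" where
  "rho_2 = continuous_extension (reduced_algebra monoid_groupoid) monoid_cstar_algebra
     regular_rep_unit"

definition canonical_map ::
  "(('s::left_cancel_monoid germ \<Rightarrow> complex) \<Rightarrow> real) \<Rightarrow>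
   (nat \<Rightarrow> 's germ \<Rightarrow> complex) set \<Rightarrow> ('s ell2 \<Rightarrow>\<^sub>L 's ell2) set" where
  "canonical_map N =
    (THE \<Psi>. \<Psi> \<in> extensional (acarrier (e2_cstar_algebra N)) \<and>
       star_hom (e2_cstar_algebra N) boundary_quotient \<Psi> \<and>
       (\<forall>x\<in>acarrier (reduced_cstar_algebra monoid_groupoid).
          \<Psi> (phi_2 N x) = coset monoid_cstar_algebra boundary_ideal (rho_2 x)))"

end

theory Submission
  imports Defs
begin

text \<open>
  A character of the constructible ideals is encoded as a filter on \<open>S\<close>: germs are classes of partial
  maps that agree along it, and an operator in the boundary ideal tends to \<open>0\<close> on basis vectors along
  the filter of every boundary character. If \<open>S\<close> is C*-regular on the boundary, there are points of
  \<open>S\<close> arbitrarily close to a boundary character \<open>\<omega>\<close> that are moved by any finitely many elements of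
  the hull with nontrivial germ at \<open>\<omega>\<close>. Finite pieces of the fibre over \<open>\<omega>\<close> can therefore be copied
  isometrically into \<open>S\<close>, and \<open>\<parallel>\<rho>\<^sub>\<omega>(f)\<parallel> \<le> \<parallel>\<lambda>(f) + a\<parallel>\<close> for all compactly supported \<open>f\<close> and all \<open>a\<close> in
  the boundary ideal, where \<open>\<lambda>\<close> is the regular representation at the character of the identity.
  This lower bound makes the canonical map injective. It also makes the restrictions to the boundary
  of a sequence with convergent images in the reduced algebra of \<open>S\<close> a Cauchy sequence; since the
  restriction homomorphism is open, its limit is a preimage, so the canonical map is surjective.
\<close>

section \<open>Hilbert spaces, completions and open mappings, independent of the monoid\<close>

section \<open>Square-summable functions\<close>

text \<open>The groupoid need not be Hausdorff, so functions in \<open>Cc\<close> are not treated as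
  continuous functions on arrows. They are finite sums of \<open>bump g \<phi>\<close>: a continuous
  function \<open>\<phi>\<close> of the source, placed on the bisection of one hull element. On a
  bump every regular representation is a weighted partial permutation of basis vectors, and bounds,
  adjoints and products are checked there. Regularity enters through pairs of arrows. Partial maps
  \<open>r\<close>, \<open>r'\<close> with distinct germs collide at \<open>s\<close> exactly when
  \<open>s\<close> is fixed by \<open>pcomp (r'\<inverse>) r\<close>, so keeping finitely many germs
  apart means avoiding finitely many fixed-point sets at one point. If those sets covered a
  neighbourhood, regularity would make one of the maps fix points eventually along the filter, and
  two of the germs would coincide. The summand from the ideal is carried along because a bound valid
  for all such summands is a bound by the quotient norm. Surjectivity rests on lifts of controlled
  norm: of the quotient by the ideal only the algebraic operations are used, never its norm.\<close>

lemma ell2_eqI: "(\<And>i. ell2_apply x i = ell2_apply y i) \<Longrightarrow> x = y"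
  by (metis ell2_apply_inject ext)

lemma ell2_apply_simps [simp]:
  "ell2_apply 0 i = 0" "ell2_apply (x + y) i = ell2_apply x i + ell2_apply y i"
  "ell2_apply (- x) i = - ell2_apply x i" "ell2_apply (x - y) i = ell2_apply x i - ell2_apply y i"
  "ell2_apply (r *\<^sub>R x) i = complex_of_real r * ell2_apply x i"
  "ell2_apply (ell2_scale c x) i = c * ell2_apply x i"
  "ell2_apply (ell2_delta s) i = (if i = s then 1 else 0)"
  by (simp_all only: zero_ell2.rep_eq plus_ell2.rep_eq uminus_ell2.rep_eq minus_ell2_def
      scaleR_ell2.rep_eq ell2_scale.rep_eq ell2_delta.rep_eq diff_conv_add_uminus)

lemma ell2_apply_sum: "ell2_apply (sum f A) i = (\<Sum>a\<in>A. ell2_apply (f a) i)"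
  by (induction A rule: infinite_finite_induct) auto

lemma Abs_ell2_apply: "square_summable f \<Longrightarrow> ell2_apply (Abs_ell2 f) i = f i"
  by (simp add: Abs_ell2_inverse)

lemma square_summable_ell2 [simp]: "square_summable (ell2_apply x)"
  using ell2_apply by blast

lemma ell2_norm_has_sum: "((\<lambda>i. (cmod (ell2_apply x i))\<^sup>2) has_sum (norm x)\<^sup>2) UNIV"
  using has_sum_infsum[of "\<lambda>i. (cmod (ell2_apply x i))\<^sup>2" UNIV] square_summable_ell2[of x]
  by (simp add: norm_ell2 square_summable_def infsum_nonneg)

lemma ell2_finite_le: "finite F \<Longrightarrow> (\<Sum>i\<in>F. (cmod (ell2_apply x i))\<^sup>2) \<le> (norm x)\<^sup>2"
  using ell2_norm_has_sum[of x] finite_sum_le_has_sum[of "\<lambda>i. (cmod (ell2_apply x i))\<^sup>2" UNIV] by auto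

lemma ell2_apply_le: "cmod (ell2_apply x i) \<le> norm x"
  using ell2_finite_le[of "{i}" x] by (simp add: power2_le_iff_abs_le)

lemma square_summable_bound:
  assumes "\<And>F. finite F \<Longrightarrow> (\<Sum>i\<in>F. (cmod (f i))\<^sup>2) \<le> C"
  shows "square_summable f"
  unfolding square_summable_def
  by (rule nonneg_bdd_above_summable_on) (auto simp: bdd_above_def intro!: exI[of _ C] assms)

lemma norm_ell2_le:
  assumes "\<And>F. finite F \<Longrightarrow> (\<Sum>i\<in>F. (cmod (ell2_apply x i))\<^sup>2) \<le> C\<^sup>2" "0 \<le> C"
  shows "norm x \<le> C"
proof -
  have "(norm x)\<^sup>2 \<le> C\<^sup>2"
    by (rule has_sum_le_finite_sums[OF ell2_norm_has_sum]) (use assms in auto)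
  then show ?thesis using assms(2) by (rule power2_le_imp_le)
qed

text \<open>Coordinates of a Cauchy sequence converge, and a bound on finite partial sums survives
  the limit uniformly in the finite set; this gives square summability of the limit and norm
  convergence at once. Completeness is needed so that Cauchy sequences of operators
  converge.\<close>

instance ell2 :: (type) banach
proof
  fix X :: "nat \<Rightarrow> 'a ell2" assume X: "Cauchy X"
  have "Cauchy (\<lambda>n. ell2_apply (X n) i)" for i
  proof (rule CauchyI)
    fix e :: real assume "0 < e"
    then obtain M where "\<forall>m\<ge>M. \<forall>n\<ge>M. norm (X m - X n) < e" using X CauchyD by blast
    then show "\<exists>M. \<forall>m\<ge>M. \<forall>n\<ge>M. cmod (ell2_apply (X m) i - ell2_apply (X n) i) < e"
      using ell2_apply_le[of "X m - X n" i for m n] by (metis ell2_apply_simps(4) le_less_trans)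
  qed
  then have "\<exists>l. (\<lambda>n. ell2_apply (X n) i) \<longlonglongrightarrow> l" for i
    using Cauchy_convergent_iff convergent_def by blast
  then obtain f where f: "\<And>i. (\<lambda>n. ell2_apply (X n) i) \<longlonglongrightarrow> f i" by metis
  have bound: "(\<Sum>i\<in>F. (cmod (ell2_apply (X n) i - f i))\<^sup>2) \<le> e\<^sup>2"
    if "finite F" "\<And>m. m \<ge> M \<Longrightarrow> norm (X n - X m) \<le> e" for F n e M
  proof (rule tendsto_upperbound)
    show "(\<lambda>m. \<Sum>i\<in>F. (cmod (ell2_apply (X n) i - ell2_apply (X m) i))\<^sup>2) \<longlonglongrightarrow>
        (\<Sum>i\<in>F. (cmod (ell2_apply (X n) i - f i))\<^sup>2)"
      by (intro tendsto_intros f)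
    have "(\<Sum>i\<in>F. (cmod (ell2_apply (X n) i - ell2_apply (X m) i))\<^sup>2) \<le> e\<^sup>2" if "m \<ge> M" for m
    proof -
      have "(\<Sum>i\<in>F. (cmod (ell2_apply (X n) i - ell2_apply (X m) i))\<^sup>2) \<le> (norm (X n - X m))\<^sup>2"
        using ell2_finite_le[OF \<open>finite F\<close>, of "X n - X m"] by simp
      also have "\<dots> \<le> e\<^sup>2" using \<open>\<And>m. m \<ge> M \<Longrightarrow> norm (X n - X m) \<le> e\<close>[OF that] by (intro power_mono) auto
      finally show ?thesis .
    qed
    then show "\<forall>\<^sub>F m in sequentially. (\<Sum>i\<in>F. (cmod (ell2_apply (X n) i - ell2_apply (X m) i))\<^sup>2) \<le> e\<^sup>2"
      unfolding eventually_sequentially by blast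
  qed simp
  have unif: "\<exists>M. \<forall>n\<ge>M. \<forall>m\<ge>M. norm (X n - X m) \<le> e" if "0 < e" for e
    using CauchyD[OF X that] less_imp_le by meson
  \<comment> \<open>The value 1 is arbitrary: any finite bound shows that \<open>X M1\<close> minus
    the coordinatewise limit is square summable, and hence so is the limit.\<close>
  obtain M1 where M1: "\<And>n m. n \<ge> M1 \<Longrightarrow> m \<ge> M1 \<Longrightarrow> norm (X n - X m) \<le> 1" using unif[of 1] by auto
  have d: "square_summable (\<lambda>i. ell2_apply (X M1) i - f i)"
    by (rule square_summable_bound[of _ "1\<^sup>2"], rule bound[where M = M1]) (auto intro: M1)
  have "square_summable (\<lambda>i. ell2_apply (X M1) i + (-1) * (ell2_apply (X M1) i - f i))"
    by (intro square_summable_add square_summable_cmult d) simp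
  then have sf: "square_summable f" by simp
  have "X \<longlonglongrightarrow> Abs_ell2 f"
  proof (rule LIMSEQ_I)
    fix r :: real assume "0 < r"
    then obtain M where M: "\<And>n m. n \<ge> M \<Longrightarrow> m \<ge> M \<Longrightarrow> norm (X n - X m) \<le> r / 2" using unif[of "r / 2"] by auto
    have "norm (X n - Abs_ell2 f) \<le> r / 2" if "n \<ge> M" for n
      by (rule norm_ell2_le)
        (use bound[where M = M and n = n and e = "r / 2"] M that \<open>0 < r\<close> in \<open>auto simp: Abs_ell2_apply[OF sf]\<close>)
    then show "\<exists>no. \<forall>n\<ge>no. norm (X n - Abs_ell2 f) < r" using \<open>0 < r\<close> by (intro exI[of _ M]) force
  qed
  then show "convergent X" unfolding convergent_def by blast
qed

lemma ell2_inner: "inner x y = (\<Sum>\<^sub>\<infinity>i. ell2_apply x i \<bullet> ell2_apply y i)"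
  by (rule inner_ell2.rep_eq)

lemma inner_delta: "inner x (ell2_scale c (ell2_delta i)) = ell2_apply x i \<bullet> c"
proof -
  have "inner x (ell2_scale c (ell2_delta i)) = (\<Sum>\<^sub>\<infinity>j\<in>{i}. ell2_apply x j \<bullet> c)"
    unfolding ell2_inner by (rule infsum_cong_neutral) auto
  then show ?thesis by simp
qed

text \<open>The imaginary part of the complex product is the real product against
  \<open>\<i> y\<close>. This links the complex notion of adjoint with the real inner product for
  which Cauchy-Schwarz and bilinearity are at hand.\<close>

lemma cinner_conv_inner: "ell2_cinner x y = Complex (inner x y) (inner x (ell2_scale \<i> y))"
proof -
  have s: "(\<lambda>i. ell2_apply x i * cnj (ell2_apply y i)) summable_on UNIV"
  proof (rule abs_summable_summable, rule summable_on_comparison_test)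
    show "(\<lambda>i. (cmod (ell2_apply x i))\<^sup>2 + (cmod (ell2_apply y i))\<^sup>2) summable_on UNIV"
      using square_summable_ell2[of x] square_summable_ell2[of y]
      unfolding square_summable_def by (intro summable_on_add)
    show "cmod (ell2_apply x i * cnj (ell2_apply y i)) \<le> (cmod (ell2_apply x i))\<^sup>2 + (cmod (ell2_apply y i))\<^sup>2" for i
      using sum_squares_bound[of "cmod (ell2_apply x i)" "cmod (ell2_apply y i)"]
        mult_nonneg_nonneg[OF norm_ge_zero[of "ell2_apply x i"] norm_ge_zero[of "ell2_apply y i"]]
      unfolding norm_mult complex_mod_cnj by linarith
    show "0 \<le> cmod (ell2_apply x i * cnj (ell2_apply y i))" for i by simp
  qed
  show ?thesis
  proof (rule complex_eqI)
    have "Re (ell2_cinner x y) = (\<Sum>\<^sub>\<infinity>i. Re (ell2_apply x i * cnj (ell2_apply y i)))"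
      unfolding ell2_cinner_def by (rule infsum_Re[OF s, symmetric])
    also have "\<dots> = inner x y" unfolding ell2_inner by (simp add: inner_complex_def)
    finally show "Re (ell2_cinner x y) = Re (Complex (inner x y) (inner x (ell2_scale \<i> y)))" by simp
    have "Im (ell2_cinner x y) = (\<Sum>\<^sub>\<infinity>i. Im (ell2_apply x i * cnj (ell2_apply y i)))"
      unfolding ell2_cinner_def by (rule infsum_Im[OF s, symmetric])
    also have "\<dots> = inner x (ell2_scale \<i> y)" unfolding ell2_inner by (simp add: inner_complex_def algebra_simps)
    finally show "Im (ell2_cinner x y) = Im (Complex (inner x y) (inner x (ell2_scale \<i> y)))" by simp
  qed
qed

text \<open>Since \<open>T'\<close> commutes with multiplication by \<open>\<i>\<close>, the real
  identity at \<open>\<i> y\<close> supplies the imaginary part of the complex identity at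
  \<open>y\<close>.\<close>

lemma is_adjoint_iff:
  assumes "complex_linear T'"
  shows "is_adjoint T T' \<longleftrightarrow> (\<forall>x y. inner (blinfun_apply T x) y = inner x (blinfun_apply T' y))"
  using assms unfolding is_adjoint_def cinner_conv_inner complex_linear_def by (metis complex.inject)

lemma adjoint_unique:
  assumes "complex_linear T'" "complex_linear T''" "is_adjoint T T'" "is_adjoint T T''"
  shows "T' = T''"
proof (rule blinfun_eqI)
  fix y
  have "inner x (blinfun_apply T' y) = inner x (blinfun_apply T'' y)" for x
    using assms by (auto simp: is_adjoint_iff)
  then show "blinfun_apply T' y = blinfun_apply T'' y"
    by (metis inner_commute vector_eq_ldot)
qed

text \<open>Cauchy-Schwarz applied to the square of the norm of \<open>S' y\<close>, written as the
  product of \<open>S (S' y)\<close> with \<open>y\<close>. Plain functions are used so that it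
  serves both for \<open>rr\<close> and for bounded operators.\<close>

lemma norm_adjoint_le:
  assumes "\<And>x y. inner (S x) y = inner x (S' y)" "\<And>x. norm (S x) \<le> K * norm x" "0 \<le> K"
  shows "norm (S' (y :: 'b ell2) :: 'a ell2) \<le> K * norm y"
proof (cases "norm (S' y) = 0")
  case False
  have "(norm (S' y))\<^sup>2 = inner (S (S' y)) y" by (simp add: assms(1) power2_norm_eq_inner)
  also have "\<dots> \<le> norm (S (S' y)) * norm y" by (rule norm_cauchy_schwarz)
  also have "\<dots> \<le> (K * norm (S' y)) * norm y" by (intro mult_right_mono assms) auto
  finally have "norm (S' y) * norm (S' y) \<le> norm (S' y) * (K * norm y)" by (simp add: power2_eq_square mult_ac)
  then show ?thesis using False by simp
qed (use assms in simp)

lemma ell2_scale_scale [simp]: "ell2_scale c (ell2_scale d x) = ell2_scale (c * d) x"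
  by (rule ell2_eqI) simp

lemma ell2_scale_add: "ell2_scale c (x + y) = ell2_scale c x + ell2_scale c y"
  by (rule ell2_eqI) (simp add: distrib_left)

lemma norm_ell2_scale: "norm (ell2_scale c x) = cmod c * norm x"
  unfolding norm_ell2 by (simp add: norm_mult power_mult_distrib infsum_cmult_right' real_sqrt_mult)

lemma norm_delta [simp]: "norm (ell2_delta s) = 1"
proof -
  have "(\<Sum>\<^sub>\<infinity>i. (cmod (ell2_apply (ell2_delta s) i))\<^sup>2) = (\<Sum>\<^sub>\<infinity>i\<in>{s}. 1)"
    by (rule infsum_cong_neutral) auto
  then show ?thesis by (simp add: norm_ell2)
qed

lemma bounded_linear_ell2_scale: "bounded_linear (ell2_scale c)"
  by (rule bounded_linear_intro[where K = "cmod c"])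
    (auto simp: ell2_scale_add norm_ell2_scale intro!: ell2_eqI)

text \<open>The squared norm expands into products of pairs of terms, each nonzero only if the two
  indices coincide, so only the pattern of coincidences matters. This is what allows arrows of a
  fibre to be replaced by points of the monoid.\<close>

lemma norm_sum_delta_cong:
  assumes "finite M" "\<And>m n. m \<in> M \<Longrightarrow> n \<in> M \<Longrightarrow> u m = u n \<longleftrightarrow> v m = v n"
  shows "norm (\<Sum>m\<in>M. ell2_scale (c m) (ell2_delta (u m))) = norm (\<Sum>m\<in>M. ell2_scale (c m) (ell2_delta (v m)))"
proof -
  have i: "inner (ell2_scale a (ell2_delta s)) (ell2_scale b (ell2_delta t)) = (if s = t then a \<bullet> b else 0)" for a b s t
    unfolding inner_delta by auto
  have "(norm (\<Sum>m\<in>M. ell2_scale (c m) (ell2_delta (u m))))\<^sup>2 = (norm (\<Sum>m\<in>M. ell2_scale (c m) (ell2_delta (v m))))\<^sup>2"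
    unfolding power2_norm_eq_inner inner_sum_left inner_sum_right i
    by (intro sum.cong refl) (use assms(2) in auto)
  then show ?thesis by (simp add: power2_eq_iff_nonneg)
qed

text \<open>The truncation to a finite set is an orthogonal projection, so the squared distance is
  the tail of the norm series.\<close>

lemma ell2_finite_approx:
  assumes "0 < e"
  obtains F where "finite F" "norm (x - (\<Sum>i\<in>F. ell2_scale (ell2_apply x i) (ell2_delta i))) < e"
proof -
  have "((\<lambda>F. \<Sum>i\<in>F. (cmod (ell2_apply x i))\<^sup>2) \<longlongrightarrow> (norm x)\<^sup>2) (finite_subsets_at_top UNIV)"
    using ell2_norm_has_sum[of x] by (simp add: has_sum_def)
  then have "\<forall>\<^sub>F F in finite_subsets_at_top UNIV. dist (\<Sum>i\<in>F. (cmod (ell2_apply x i))\<^sup>2) ((norm x)\<^sup>2) < e\<^sup>2"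
    using assms by (intro tendstoD) auto
  then obtain F where F: "finite F" "dist (\<Sum>i\<in>F. (cmod (ell2_apply x i))\<^sup>2) ((norm x)\<^sup>2) < e\<^sup>2"
    unfolding eventually_finite_subsets_at_top by auto
  define y where "y = (\<Sum>i\<in>F. ell2_scale (ell2_apply x i) (ell2_delta i))"
  have y: "ell2_apply y i = (if i \<in> F then ell2_apply x i else 0)" for i
    using F by (simp add: y_def ell2_apply_sum if_distrib[of "(*) _"] sum.delta cong: if_cong)
  have zy: "inner z y = (\<Sum>i\<in>F. ell2_apply z i \<bullet> ell2_apply x i)" for z
    unfolding y_def inner_sum_right inner_delta ..
  have xy: "inner x y = (\<Sum>i\<in>F. (cmod (ell2_apply x i))\<^sup>2)"
    unfolding zy by (simp add: power2_norm_eq_inner)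
  have yy: "inner y y = (\<Sum>i\<in>F. (cmod (ell2_apply x i))\<^sup>2)"
    unfolding zy by (simp add: y power2_norm_eq_inner)
  have "(norm (x - y))\<^sup>2 = (norm x)\<^sup>2 - (\<Sum>i\<in>F. (cmod (ell2_apply x i))\<^sup>2)"
    using xy yy by (simp add: power2_norm_eq_inner inner_diff_left inner_diff_right inner_commute)
  also have "\<dots> < e\<^sup>2" using F(2) by (simp add: dist_real_def)
  finally have "norm (x - y) < e" using assms by (simp add: power2_less_imp_less)
  then show thesis using that F by (simp add: y_def)
qed

section \<open>Weighted compositions\<close>

text \<open>The common shape of the operators below: bumps in a regular representation, the
  identification of a fibre with the monoid, and coordinate projections all reindex by a partial
  injection and multiply by a bounded weight.\<close>

definition wcomp :: "'a set \<Rightarrow> ('a \<Rightarrow> 'b) \<Rightarrow> ('a \<Rightarrow> complex) \<Rightarrow> 'b ell2 \<Rightarrow> 'a ell2" where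
  "wcomp D p w \<xi> = Abs_ell2 (\<lambda>i. if i \<in> D then w i * ell2_apply \<xi> (p i) else 0)"

context
  fixes D :: "'a set" and p :: "'a \<Rightarrow> 'b" and w :: "'a \<Rightarrow> complex" and K :: real
  assumes inj: "inj_on p D" and w: "\<And>i. i \<in> D \<Longrightarrow> cmod (w i) \<le> K" and K: "0 \<le> K"
begin

lemma wcomp_finite_le:
  assumes "finite F"
  shows "(\<Sum>i\<in>F. (cmod (if i \<in> D then w i * ell2_apply \<xi> (p i) else 0))\<^sup>2) \<le> (K * norm \<xi>)\<^sup>2"
proof -
  have "(\<Sum>i\<in>F. (cmod (if i \<in> D then w i * ell2_apply \<xi> (p i) else 0))\<^sup>2)
      = (\<Sum>i\<in>F \<inter> D. (cmod (w i))\<^sup>2 * (cmod (ell2_apply \<xi> (p i)))\<^sup>2)"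
    using assms by (intro sum.mono_neutral_cong_right) (auto simp: norm_mult power_mult_distrib)
  also have "\<dots> \<le> (\<Sum>i\<in>F \<inter> D. K\<^sup>2 * (cmod (ell2_apply \<xi> (p i)))\<^sup>2)"
    using w by (intro sum_mono mult_right_mono power_mono) auto
  also have "\<dots> = K\<^sup>2 * (\<Sum>j\<in>p ` (F \<inter> D). (cmod (ell2_apply \<xi> j))\<^sup>2)"
    using inj_on_subset[OF inj] by (simp add: sum_distrib_left sum.reindex)
  also have "\<dots> \<le> K\<^sup>2 * (norm \<xi>)\<^sup>2" using assms by (intro mult_left_mono ell2_finite_le) auto
  finally show ?thesis by (simp add: power_mult_distrib)
qed

lemma wcomp_apply: "ell2_apply (wcomp D p w \<xi>) i = (if i \<in> D then w i * ell2_apply \<xi> (p i) else 0)"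
  unfolding wcomp_def by (rule Abs_ell2_apply, rule square_summable_bound, rule wcomp_finite_le)

lemma norm_wcomp_le: "norm (wcomp D p w \<xi>) \<le> K * norm \<xi>"
  by (rule norm_ell2_le) (use wcomp_finite_le K in \<open>auto simp: wcomp_apply\<close>)

lemma bounded_linear_wcomp: "bounded_linear (wcomp D p w)"
  by (rule bounded_linear_intro[where K = K])
    (use norm_wcomp_le in \<open>auto intro!: ell2_eqI simp: wcomp_apply distrib_left mult_ac\<close>)

end

text \<open>Substituting \<open>j = p i\<close> in the inner product moves the weight, conjugated,
  to the inverse reindexing \<open>r\<close>.\<close>

lemma wcomp_adjoint:
  assumes D: "bij_betw p D E" "\<And>j. j \<in> E \<Longrightarrow> r j \<in> D \<and> p (r j) = j"
    and w: "\<And>i. i \<in> D \<Longrightarrow> cmod (w i) \<le> K" "0 \<le> K" and v: "\<And>j. j \<in> E \<Longrightarrow> v j = cnj (w (r j))"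
  shows "inner (wcomp D p w \<xi>) \<eta> = inner \<xi> (wcomp E r v \<eta>)"
proof -
  have inj: "inj_on p D" and E: "E = p ` D" using D(1) by (auto simp: bij_betw_def)
  have injr: "inj_on r E" using D(2) by (metis inj_onI)
  have rp: "r (p i) = i" if "i \<in> D" for i using D(2)[of "p i"] inj that E by (auto dest: inj_onD)
  have v': "cmod (v j) \<le> K" if "j \<in> E" for j using v[OF that] w(1) D(2)[OF that] by simp
  have "inner (wcomp D p w \<xi>) \<eta> = (\<Sum>\<^sub>\<infinity>i\<in>D. (w i * ell2_apply \<xi> (p i)) \<bullet> ell2_apply \<eta> i)"
    unfolding ell2_inner by (rule infsum_cong_neutral) (auto simp: wcomp_apply[OF inj w])
  also have "\<dots> = (\<Sum>\<^sub>\<infinity>i\<in>D. ell2_apply \<xi> (p i) \<bullet> (v (p i) * ell2_apply \<eta> (r (p i))))"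
    by (rule infsum_cong) (use rp v E in \<open>auto simp: inner_complex_def algebra_simps\<close>)
  also have "\<dots> = (\<Sum>\<^sub>\<infinity>j\<in>E. ell2_apply \<xi> j \<bullet> (v j * ell2_apply \<eta> (r j)))"
    unfolding E by (subst infsum_reindex[OF inj]) (simp add: o_def)
  also have "\<dots> = inner \<xi> (wcomp E r v \<eta>)"
    unfolding ell2_inner by (rule infsum_cong_neutral) (auto simp: wcomp_apply[OF injr v' w(2)])
  finally show ?thesis .
qed

section \<open>Vector spaces, quotients and completions of algebra records\<close>

text \<open>Negatives are multiples by \<open>-1\<close>, as in \<open>aminus\<close>;
  \<open>scale_zero\<close> and \<open>plus_scale\<close> therefore take the place of an axiom on
  inverses.\<close>

locale vector_record =
  fixes A :: "'a star_algebra"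
  assumes zero_closed [simp, intro]: "azero A \<in> acarrier A"
    and plus_closed [simp, intro]: "x \<in> acarrier A \<Longrightarrow> y \<in> acarrier A \<Longrightarrow> aplus A x y \<in> acarrier A"
    and scale_closed [simp, intro]: "x \<in> acarrier A \<Longrightarrow> ascale A c x \<in> acarrier A"
    and plus_assoc: "x \<in> acarrier A \<Longrightarrow> y \<in> acarrier A \<Longrightarrow> z \<in> acarrier A \<Longrightarrow>
      aplus A (aplus A x y) z = aplus A x (aplus A y z)"
    and plus_commute: "x \<in> acarrier A \<Longrightarrow> y \<in> acarrier A \<Longrightarrow> aplus A x y = aplus A y x"
    and plus_zero [simp]: "x \<in> acarrier A \<Longrightarrow> aplus A x (azero A) = x"
    and scale_scale [simp]: "x \<in> acarrier A \<Longrightarrow> ascale A c (ascale A d x) = ascale A (c * d) x"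
    and scale_one [simp]: "x \<in> acarrier A \<Longrightarrow> ascale A 1 x = x"
    and scale_zero [simp]: "x \<in> acarrier A \<Longrightarrow> ascale A 0 x = azero A"
    and scale_plus: "x \<in> acarrier A \<Longrightarrow> y \<in> acarrier A \<Longrightarrow>
      ascale A c (aplus A x y) = aplus A (ascale A c x) (ascale A c y)"
    and plus_scale: "x \<in> acarrier A \<Longrightarrow> ascale A (c + d) x = aplus A (ascale A c x) (ascale A d x)"
begin

abbreviation carr where "carr \<equiv> acarrier A"
abbreviation add (infixl "\<oplus>" 65) where "x \<oplus> y \<equiv> aplus A x y"
abbreviation sub (infixl "\<ominus>" 65) where "x \<ominus> y \<equiv> aminus A x y"

lemma plus_left_commute: "x \<in> carr \<Longrightarrow> y \<in> carr \<Longrightarrow> z \<in> carr \<Longrightarrow> x \<oplus> (y \<oplus> z) = y \<oplus> (x \<oplus> z)"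
  by (metis plus_assoc plus_commute)

lemmas plus_ac = plus_assoc plus_commute plus_left_commute

lemma zero_plus [simp]: "x \<in> carr \<Longrightarrow> azero A \<oplus> x = x"
  by (metis plus_commute plus_zero zero_closed)

lemma scale_azero [simp]: "ascale A c (azero A) = azero A"
  by (metis mult_zero_right scale_scale scale_zero zero_closed)

lemma minus_closed [simp, intro]: "x \<in> carr \<Longrightarrow> y \<in> carr \<Longrightarrow> x \<ominus> y \<in> carr"
  by (simp add: aminus_def)

lemma neg_plus [simp]: "x \<in> carr \<Longrightarrow> x \<oplus> ascale A (-1) x = azero A"
  using plus_scale[of x 1 "-1"] by simp

lemma minus_self [simp]: "x \<in> carr \<Longrightarrow> x \<ominus> x = azero A"
  by (simp add: aminus_def)

lemma neg_plus_cancel [simp]: "x \<in> carr \<Longrightarrow> y \<in> carr \<Longrightarrow> x \<oplus> (ascale A (-1) x \<oplus> y) = y"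
  by (metis neg_plus plus_assoc scale_closed zero_plus)

lemma plus_minus_cancel [simp]: "x \<in> carr \<Longrightarrow> y \<in> carr \<Longrightarrow> y \<oplus> (x \<ominus> y) = x"
  unfolding aminus_def by (metis neg_plus plus_assoc plus_commute plus_zero scale_closed)

lemma minus_plus_minus: "x \<in> carr \<Longrightarrow> y \<in> carr \<Longrightarrow> z \<in> carr \<Longrightarrow> (x \<ominus> y) \<oplus> (y \<ominus> z) = x \<ominus> z"
  unfolding aminus_def by (simp add: plus_ac)

lemma plus_minus_plus:
  "x \<in> carr \<Longrightarrow> y \<in> carr \<Longrightarrow> x' \<in> carr \<Longrightarrow> y' \<in> carr \<Longrightarrow> (x \<oplus> y) \<ominus> (x' \<oplus> y') = (x \<ominus> x') \<oplus> (y \<ominus> y')"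
  unfolding aminus_def by (simp add: scale_plus plus_ac)

lemma scale_minus: "x \<in> carr \<Longrightarrow> y \<in> carr \<Longrightarrow> ascale A c (x \<ominus> y) = ascale A c x \<ominus> ascale A c y"
  unfolding aminus_def by (simp add: scale_plus mult.commute)

lemma minus_swap: "x \<in> carr \<Longrightarrow> y \<in> carr \<Longrightarrow> ascale A (-1) (x \<ominus> y) = y \<ominus> x"
  unfolding aminus_def by (simp add: scale_plus plus_ac)

lemma minus_zero [simp]: "x \<in> carr \<Longrightarrow> x \<ominus> azero A = x"
  by (simp add: aminus_def)

lemma minus_eq_zero_iff: "x \<in> carr \<Longrightarrow> y \<in> carr \<Longrightarrow> x \<ominus> y = azero A \<longleftrightarrow> x = y"
  by (metis minus_self plus_minus_cancel plus_zero)

lemma plus_minus_cancel_left [simp]: "x \<in> carr \<Longrightarrow> y \<in> carr \<Longrightarrow> (x \<oplus> y) \<ominus> x = y"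
  unfolding aminus_def by (metis neg_plus_cancel plus_assoc plus_commute scale_closed)

end

text \<open>Quotient operations are defined as unions over representatives. Evaluating one amounts
  to showing that the united family is constant.\<close>

lemma UN_const: "x \<in> X \<Longrightarrow> (\<And>x'. x' \<in> X \<Longrightarrow> f x' = c) \<Longrightarrow> (\<Union>x\<in>X. f x) = c"
  by auto

definition subspace_record :: "'a star_algebra \<Rightarrow> 'a set \<Rightarrow> bool" where
  "subspace_record A I \<longleftrightarrow> I \<subseteq> acarrier A \<and> azero A \<in> I \<and>
    (\<forall>x\<in>I. \<forall>y\<in>I. aplus A x y \<in> I) \<and> (\<forall>c. \<forall>x\<in>I. ascale A c x \<in> I)"

locale quotient_record = vector_record +
  fixes I :: "'a set"
  assumes subspace: "subspace_record A I"
begin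

lemma sub_carr [simp, intro]: "x \<in> I \<Longrightarrow> x \<in> carr"
  and sub_zero [simp, intro]: "azero A \<in> I"
  and sub_plus [simp, intro]: "x \<in> I \<Longrightarrow> y \<in> I \<Longrightarrow> x \<oplus> y \<in> I"
  and sub_scale [simp, intro]: "x \<in> I \<Longrightarrow> ascale A c x \<in> I"
  using subspace by (auto simp: subspace_record_def)

lemma mem_coset: "x \<in> carr \<Longrightarrow> y \<in> coset A I x \<longleftrightarrow> y \<in> carr \<and> y \<ominus> x \<in> I"
  unfolding coset_def by (auto simp: image_iff) (metis plus_minus_cancel)

lemma coset_eq:
  assumes "x \<in> carr" "y \<in> carr"
  shows "coset A I x = coset A I y \<longleftrightarrow> x \<ominus> y \<in> I"
proof
  assume "coset A I x = coset A I y"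
  then show "x \<ominus> y \<in> I" using mem_coset[of x x] mem_coset[of y x] assms by auto
next
  assume i: "x \<ominus> y \<in> I"
  then have j: "y \<ominus> x \<in> I" using minus_swap[OF assms] sub_scale by metis
  show "coset A I x = coset A I y"
    using assms minus_plus_minus[of _ x y] minus_plus_minus[of _ y x] i j
    by (auto simp: mem_coset) (metis sub_plus)+
qed

lemma coset_self: "x \<in> carr \<Longrightarrow> x \<in> coset A I x"
  by (simp add: mem_coset)

lemma quotient_carrier: "acarrier (quotient_algebra A I) = coset A I ` carr"
  by (simp add: quotient_algebra_def)

lemma quotient_zero: "azero (quotient_algebra A I) = coset A I (azero A)"
  by (simp add: quotient_algebra_def)

lemma quotient_plus:
  assumes "x \<in> carr" "y \<in> carr"
  shows "aplus (quotient_algebra A I) (coset A I x) (coset A I y) = coset A I (x \<oplus> y)"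
proof -
  have "coset A I (x' \<oplus> y') = coset A I (x \<oplus> y)" if "x' \<in> coset A I x" "y' \<in> coset A I y" for x' y'
    using that assms by (subst coset_eq) (auto simp: mem_coset plus_minus_plus)
  then show ?thesis
    unfolding quotient_algebra_def star_algebra.simps
    by (intro UN_const[OF coset_self[OF assms(1)]] UN_const[OF coset_self[OF assms(2)]])
qed

lemma quotient_scale:
  assumes "x \<in> carr"
  shows "ascale (quotient_algebra A I) c (coset A I x) = coset A I (ascale A c x)"
proof -
  have "coset A I (ascale A c x') = coset A I (ascale A c x)" if "x' \<in> coset A I x" for x'
    using that assms by (subst coset_eq) (auto simp: mem_coset scale_minus[symmetric])
  then show ?thesis
    unfolding quotient_algebra_def star_algebra.simps by (intro UN_const[OF coset_self[OF assms(1)]])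
qed

text \<open>Independence of representatives is left as a premise because its reason varies:
  boundedness of Cauchy sequences in a completion, the two-sided ideal property for the boundary
  ideal.\<close>

lemma quotient_mult:
  assumes "x \<in> carr" "y \<in> carr"
    and "\<And>x' y'. x' \<in> carr \<Longrightarrow> y' \<in> carr \<Longrightarrow> x' \<ominus> x \<in> I \<Longrightarrow> y' \<ominus> y \<in> I \<Longrightarrow>
      amult A x' y' \<in> carr \<and> amult A x' y' \<ominus> amult A x y \<in> I"
  shows "amult (quotient_algebra A I) (coset A I x) (coset A I y) = coset A I (amult A x y)"
proof -
  have xy: "amult A x y \<in> carr" using assms(3)[of x y] assms by simp
  have "coset A I (amult A x' y') = coset A I (amult A x y)" if "x' \<in> coset A I x" "y' \<in> coset A I y" for x' y'
    using that assms(1,2) assms(3)[of x' y'] xy by (subst coset_eq) (auto simp: mem_coset)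
  then show ?thesis
    unfolding quotient_algebra_def star_algebra.simps
    by (intro UN_const[OF coset_self[OF assms(1)]] UN_const[OF coset_self[OF assms(2)]])
qed

lemma quotient_star:
  assumes "x \<in> carr"
    and "\<And>x'. x' \<in> carr \<Longrightarrow> x' \<ominus> x \<in> I \<Longrightarrow> astar A x' \<in> carr \<and> astar A x' \<ominus> astar A x \<in> I"
  shows "astar (quotient_algebra A I) (coset A I x) = coset A I (astar A x)"
proof -
  have sx: "astar A x \<in> carr" using assms(2)[of x] assms by simp
  have "coset A I (astar A x') = coset A I (astar A x)" if "x' \<in> coset A I x" for x'
    using that assms(1) assms(2)[of x'] sx by (subst coset_eq) (auto simp: mem_coset)
  then show ?thesis
    unfolding quotient_algebra_def star_algebra.simps by (intro UN_const[OF coset_self[OF assms(1)]])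
qed

lemma vector_record_quotient: "vector_record (quotient_algebra A I)"
  by unfold_locales
    (auto simp: quotient_carrier quotient_zero quotient_plus quotient_scale scale_plus plus_scale
      plus_assoc, (metis plus_commute)+)

lemma quotient_minus:
  "x \<in> carr \<Longrightarrow> y \<in> carr \<Longrightarrow>
    aminus (quotient_algebra A I) (coset A I x) (coset A I y) = coset A I (x \<ominus> y)"
  by (simp add: aminus_def quotient_scale quotient_plus)

end

text \<open>Only a seminorm. Definiteness and completeness are the separate predicates
  \<open>definite\<close> and \<open>complete\<close>, which every completion satisfies.\<close>

locale normed_record = vector_record +
  assumes norm_nonneg [simp]: "x \<in> acarrier A \<Longrightarrow> 0 \<le> anorm A x"
    and norm_scale: "x \<in> acarrier A \<Longrightarrow> anorm A (ascale A c x) = cmod c * anorm A x"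
    and norm_triangle: "x \<in> acarrier A \<Longrightarrow> y \<in> acarrier A \<Longrightarrow> anorm A (aplus A x y) \<le> anorm A x + anorm A y"
begin

abbreviation nrm where "nrm \<equiv> anorm A"

lemma norm_azero [simp]: "nrm (azero A) = 0"
  using norm_scale[of "azero A" 0] by simp

lemma norm_minus_commute: "x \<in> carr \<Longrightarrow> y \<in> carr \<Longrightarrow> nrm (x \<ominus> y) = nrm (y \<ominus> x)"
  using norm_scale[of "x \<ominus> y" "-1"] by (simp add: minus_swap)

lemma norm_minus_triangle: "x \<in> carr \<Longrightarrow> y \<in> carr \<Longrightarrow> z \<in> carr \<Longrightarrow> nrm (x \<ominus> z) \<le> nrm (x \<ominus> y) + nrm (y \<ominus> z)"
  using norm_triangle[of "x \<ominus> y" "y \<ominus> z"] by (simp add: minus_plus_minus)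

lemma norm_minus_le: "x \<in> carr \<Longrightarrow> y \<in> carr \<Longrightarrow> nrm (x \<ominus> y) \<le> nrm x + nrm y"
  using norm_triangle[of x "ascale A (-1) y"] norm_scale[of y "-1"] by (simp add: aminus_def)

lemma norm_le_minus: "x \<in> carr \<Longrightarrow> y \<in> carr \<Longrightarrow> nrm x \<le> nrm y + nrm (x \<ominus> y)"
  using norm_triangle[of y "x \<ominus> y"] by simp

lemma norm_diff_le: "x \<in> carr \<Longrightarrow> y \<in> carr \<Longrightarrow> \<bar>nrm x - nrm y\<bar> \<le> nrm (x \<ominus> y)"
  using norm_le_minus[of x y] norm_le_minus[of y x] norm_minus_commute[of x y] by linarith

definition cauchy :: "(nat \<Rightarrow> 'a) \<Rightarrow> bool" where
  "cauchy a \<longleftrightarrow> (\<forall>n. a n \<in> carr) \<and> (\<forall>\<epsilon>>0. \<exists>M. \<forall>m\<ge>M. \<forall>n\<ge>M. nrm (a m \<ominus> a n) < \<epsilon>)"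

lemma cauchy_carrier: "acarrier (cauchy_algebra A) = Collect cauchy"
  by (auto simp: cauchy_algebra_def cauchy_def)

lemma cauchy_carr: "cauchy a \<Longrightarrow> a n \<in> carr" by (simp add: cauchy_def)

lemma cauchy_ops: "azero (cauchy_algebra A) = (\<lambda>_. azero A)"
  "aplus (cauchy_algebra A) a b = (\<lambda>n. a n \<oplus> b n)"
  "ascale (cauchy_algebra A) c a = (\<lambda>n. ascale A c (a n))"
  "amult (cauchy_algebra A) a b = (\<lambda>n. amult A (a n) (b n))"
  "astar (cauchy_algebra A) a = (\<lambda>n. astar A (a n))"
  "aminus (cauchy_algebra A) a b = (\<lambda>n. a n \<ominus> b n)"
  by (simp_all add: cauchy_algebra_def aminus_def)

text \<open>One criterion for sums, scalar multiples, products and stars of Cauchy sequences; in the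
  unary cases \<open>b\<close> and \<open>c\<close> are the same sequence.\<close>

lemma cauchy_from_bound:
  assumes "\<And>n. a n \<in> carr" "\<And>m n. nrm (a m \<ominus> a n) \<le> K * nrm (b m \<ominus> b n) + L * nrm (c m \<ominus> c n)"
    and "cauchy b" "cauchy c" "0 \<le> K" "0 \<le> L"
  shows "cauchy a"
  unfolding cauchy_def
proof (intro conjI allI impI)
  fix e :: real assume e: "0 < e"
  \<comment> \<open>The added 1 covers \<open>K = L = 0\<close> and makes the final inequality
    strict.\<close>
  define d where "d = e / (K + L + 1)"
  have d: "0 < d" using e assms by (simp add: d_def)
  obtain M1 where M1: "\<And>m n. m \<ge> M1 \<Longrightarrow> n \<ge> M1 \<Longrightarrow> nrm (b m \<ominus> b n) < d"
    using assms(3) d unfolding cauchy_def by blast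
  obtain M2 where M2: "\<And>m n. m \<ge> M2 \<Longrightarrow> n \<ge> M2 \<Longrightarrow> nrm (c m \<ominus> c n) < d"
    using assms(4) d unfolding cauchy_def by blast
  have "nrm (a m \<ominus> a n) < e" if "m \<ge> max M1 M2" "n \<ge> max M1 M2" for m n
  proof -
    have "nrm (a m \<ominus> a n) \<le> K * d + L * d"
      using assms(2)[of m n] mult_left_mono[OF less_imp_le[OF M1[of m n]] assms(5)]
        mult_left_mono[OF less_imp_le[OF M2[of m n]] assms(6)] that by simp
    also have "\<dots> < (K + L + 1) * d" using d by (simp add: algebra_simps)
    also have "\<dots> = e" using assms by (simp add: d_def)
    finally show ?thesis .
  qed
  then show "\<exists>M. \<forall>m\<ge>M. \<forall>n\<ge>M. nrm (a m \<ominus> a n) < e" by blast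
qed (rule assms)

lemma cauchy_const: "x \<in> carr \<Longrightarrow> cauchy (\<lambda>_. x)" by (simp add: cauchy_def)

lemma cauchy_plus: "cauchy a \<Longrightarrow> cauchy b \<Longrightarrow> cauchy (\<lambda>n. a n \<oplus> b n)"
  by (rule cauchy_from_bound[where K = 1 and L = 1 and b = a and c = b])
    (auto simp: cauchy_carr plus_minus_plus intro!: norm_triangle)

lemma cauchy_scale: "cauchy a \<Longrightarrow> cauchy (\<lambda>n. ascale A c (a n))"
  by (rule cauchy_from_bound[where K = "cmod c" and L = 0 and b = a and c = a])
    (auto simp: cauchy_carr scale_minus[symmetric] norm_scale)

lemma vector_record_cauchy: "vector_record (cauchy_algebra A)"
  by unfold_locales
    (auto simp: cauchy_carrier cauchy_ops cauchy_carr cauchy_const cauchy_plus cauchy_scale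
      scale_plus plus_scale fun_eq_iff plus_assoc intro: plus_commute)

lemma null_iff: "a \<in> null_sequences A \<longleftrightarrow> (\<forall>n. a n \<in> carr) \<and> (\<lambda>n. nrm (a n)) \<longlonglongrightarrow> 0"
  by (simp add: null_sequences_def)

lemma null_cauchy: assumes "a \<in> null_sequences A" shows "cauchy a"
  unfolding cauchy_def
proof (intro conjI allI impI)
  show c: "a n \<in> carr" for n using assms by (simp add: null_iff)
  fix e :: real assume "0 < e"
  then obtain M where M: "\<And>n. n \<ge> M \<Longrightarrow> nrm (a n) < e / 2"
    using assms LIMSEQ_D[of "\<lambda>n. nrm (a n)" 0 "e / 2"] by (auto simp: null_iff)
  have "nrm (a m \<ominus> a n) < e" if "m \<ge> M" "n \<ge> M" for m n
    using norm_minus_le[OF c c, of m n] M[OF that(1)] M[OF that(2)] by linarith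
  then show "\<exists>M. \<forall>m\<ge>M. \<forall>n\<ge>M. nrm (a m \<ominus> a n) < e" by blast
qed

lemma null_bound:
  assumes "\<And>n. a n \<in> carr" "\<And>n. nrm (a n) \<le> f n" "f \<longlonglongrightarrow> 0"
  shows "a \<in> null_sequences A"
  unfolding null_iff
  using assms by (auto intro: tendsto_sandwich[of "\<lambda>_. 0" "\<lambda>n. nrm (a n)" sequentially f 0])

lemma quotient_record_cauchy: "quotient_record (cauchy_algebra A) (null_sequences A)"
proof (intro quotient_record.intro vector_record_cauchy quotient_record_axioms.intro)
  show "subspace_record (cauchy_algebra A) (null_sequences A)"
    unfolding subspace_record_def cauchy_ops cauchy_carrier
  proof (intro conjI ballI allI)
    fix a b assume ab: "a \<in> null_sequences A" "b \<in> null_sequences A"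
    show "(\<lambda>n. a n \<oplus> b n) \<in> null_sequences A"
      by (rule null_bound[where f = "\<lambda>n. nrm (a n) + nrm (b n)"])
        (use ab in \<open>auto simp: null_iff intro!: norm_triangle tendsto_add_zero\<close>)
  next
    fix a c assume a: "a \<in> null_sequences A"
    show "(\<lambda>n. ascale A c (a n)) \<in> null_sequences A"
      by (rule null_bound[where f = "\<lambda>n. cmod c * nrm (a n)"])
        (use a in \<open>auto simp: null_iff norm_scale intro!: tendsto_mult_right_zero\<close>)
  qed (auto simp: null_cauchy null_iff)
qed

sublocale Q: quotient_record "cauchy_algebra A" "null_sequences A"
  by (rule quotient_record_cauchy)

abbreviation cls where "cls \<equiv> coset (cauchy_algebra A) (null_sequences A)"

lemma mem_cls: "cauchy a \<Longrightarrow> b \<in> cls a \<longleftrightarrow> cauchy b \<and> (\<lambda>n. nrm (b n \<ominus> a n)) \<longlonglongrightarrow> 0"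
  using Q.mem_coset[of a b] by (auto simp: cauchy_carrier cauchy_ops null_iff cauchy_carr)

lemma cls_eq_iff: "cauchy a \<Longrightarrow> cauchy b \<Longrightarrow> cls a = cls b \<longleftrightarrow> (\<lambda>n. nrm (a n \<ominus> b n)) \<longlonglongrightarrow> 0"
  using Q.coset_eq[of a b] by (auto simp: cauchy_carrier cauchy_ops null_iff cauchy_carr)

lemma completion_carrier: "acarrier (completion A) = cls ` Collect cauchy"
  using Q.quotient_carrier by (simp add: completion_def cauchy_carrier)

lemma completion_cases:
  assumes "X \<in> acarrier (completion A)" obtains a where "cauchy a" "X = cls a"
  using assms by (auto simp: completion_carrier)

lemma completion_plus: "cauchy a \<Longrightarrow> cauchy b \<Longrightarrow> aplus (completion A) (cls a) (cls b) = cls (\<lambda>n. a n \<oplus> b n)"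
  using Q.quotient_plus[of a b] by (simp add: completion_def cauchy_carrier cauchy_ops)

lemma completion_scale: "cauchy a \<Longrightarrow> ascale (completion A) c (cls a) = cls (\<lambda>n. ascale A c (a n))"
  using Q.quotient_scale[of a c] by (simp add: completion_def cauchy_carrier cauchy_ops)

lemma completion_zero: "azero (completion A) = cls (\<lambda>_. azero A)"
  using Q.quotient_zero by (simp add: completion_def cauchy_ops)

lemma completion_minus: "cauchy a \<Longrightarrow> cauchy b \<Longrightarrow> aminus (completion A) (cls a) (cls b) = cls (\<lambda>n. a n \<ominus> b n)"
  using Q.quotient_minus[of a b] by (simp add: completion_def cauchy_carrier cauchy_ops)

lemma cauchy_minus: "cauchy a \<Longrightarrow> cauchy b \<Longrightarrow> cauchy (\<lambda>n. a n \<ominus> b n)"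
  using Q.minus_closed[of a b] by (simp add: cauchy_carrier cauchy_ops)

lemma cauchy_norm_convergent: assumes "cauchy a" shows "convergent (\<lambda>n. nrm (a n))"
proof (rule Cauchy_convergent, rule CauchyI)
  fix e :: real assume "0 < e"
  then obtain M where "\<forall>m\<ge>M. \<forall>n\<ge>M. nrm (a m \<ominus> a n) < e" using assms by (auto simp: cauchy_def)
  then show "\<exists>M. \<forall>m\<ge>M. \<forall>n\<ge>M. norm (nrm (a m) - nrm (a n)) < e"
    using norm_diff_le[OF cauchy_carr[OF assms] cauchy_carr[OF assms]] le_less_trans
    by (metis real_norm_def)
qed

text \<open>The quotient norm is an infimum over representatives. Equivalent Cauchy sequences have
  norms differing by a null sequence, so the infimum is taken over a single number.\<close>

lemma completion_norm_lim: assumes "cauchy a" shows "(\<lambda>n. nrm (a n)) \<longlonglongrightarrow> anorm (completion A) (cls a)"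
proof -
  have l: "(\<lambda>n. nrm (a n)) \<longlonglongrightarrow> lim (\<lambda>n. nrm (a n))"
    using cauchy_norm_convergent[OF assms] convergent_LIMSEQ_iff by blast
  have "lim (\<lambda>n. nrm (b n)) = lim (\<lambda>n. nrm (a n))" if "b \<in> cls a" for b
  proof (rule limI)
    have b: "cauchy b" "(\<lambda>n. nrm (b n \<ominus> a n)) \<longlonglongrightarrow> 0" using that assms by (auto simp: mem_cls)
    have "(\<lambda>n. nrm (b n) - nrm (a n)) \<longlonglongrightarrow> 0"
      by (rule Lim_null_comparison[OF _ b(2)])
        (use norm_diff_le[OF cauchy_carr[OF b(1)] cauchy_carr[OF assms]] in auto)
    from tendsto_add[OF this l] show "(\<lambda>n. nrm (b n)) \<longlonglongrightarrow> lim (\<lambda>n. nrm (a n))" by simp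
  qed
  then have "(\<lambda>b. lim (\<lambda>n. nrm (b n))) ` cls a = (\<lambda>b. lim (\<lambda>n. nrm (a n))) ` cls a"
    by (rule image_cong[OF refl])
  also have "\<dots> = {lim (\<lambda>n. nrm (a n))}"
    using Q.coset_self[of a] assms by (intro image_constant[of a]) (simp add: cauchy_carrier)
  finally have "(\<lambda>b. lim (\<lambda>n. nrm (b n))) ` cls a = {lim (\<lambda>n. nrm (a n))}" .
  then have "anorm (completion A) (cls a) = lim (\<lambda>n. nrm (a n))"
    by (simp add: completion_def quotient_algebra_def cauchy_algebra_def)
  then show ?thesis using l by simp
qed

lemma completion_norm_eq: "cauchy a \<Longrightarrow> (\<lambda>n. nrm (a n)) \<longlonglongrightarrow> L \<Longrightarrow> anorm (completion A) (cls a) = L"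
  using completion_norm_lim LIMSEQ_unique by blast

lemma normed_record_completion: "normed_record (completion A)"
proof (intro normed_record.intro normed_record_axioms.intro)
  show "vector_record (completion A)" unfolding completion_def by (rule Q.vector_record_quotient)
  fix X assume "X \<in> acarrier (completion A)"
  then obtain a where a: "cauchy a" "X = cls a" by (rule completion_cases)
  note la = completion_norm_lim[OF a(1)]
  show "0 \<le> anorm (completion A) X"
    unfolding a(2) by (rule tendsto_lowerbound[OF la]) (auto simp: cauchy_carr[OF a(1)])
  show "anorm (completion A) (ascale (completion A) c X) = cmod c * anorm (completion A) X" for c
    unfolding a(2) completion_scale[OF a(1)]
    by (rule completion_norm_eq[OF cauchy_scale[OF a(1)]])
      (use tendsto_mult_left[OF la, of "cmod c"] in \<open>simp add: norm_scale cauchy_carr[OF a(1)]\<close>)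
  fix Y assume "Y \<in> acarrier (completion A)"
  then obtain b where b: "cauchy b" "Y = cls b" by (rule completion_cases)
  show "anorm (completion A) (aplus (completion A) X Y) \<le> anorm (completion A) X + anorm (completion A) Y"
    unfolding a(2) b(2) completion_plus[OF a(1) b(1)]
    by (rule tendsto_le[OF _ tendsto_add[OF la completion_norm_lim[OF b(1)]]
          completion_norm_lim[OF cauchy_plus[OF a(1) b(1)]]])
      (auto intro!: always_eventually norm_triangle simp: cauchy_carr a b)
qed

definition definite where "definite \<longleftrightarrow> (\<forall>x\<in>carr. nrm x = 0 \<longrightarrow> x = azero A)"

definition complete where "complete \<longleftrightarrow> (\<forall>a. cauchy a \<longrightarrow> (\<exists>x\<in>carr. norm_tendsto A a x))"

lemma completion_definite: "normed_record.definite (completion A)"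
  unfolding normed_record.definite_def[OF normed_record_completion]
proof (intro ballI impI)
  fix X assume X: "X \<in> acarrier (completion A)" "anorm (completion A) X = 0"
  then obtain a where a: "cauchy a" "X = cls a" by (auto elim: completion_cases)
  then have "(\<lambda>n. nrm (a n)) \<longlonglongrightarrow> 0" using completion_norm_lim[OF a(1)] X by simp
  then show "X = azero (completion A)"
    using a by (simp add: completion_zero cls_eq_iff cauchy_const cauchy_carr)
qed

lemma embed_cls: "completion_embed A x = cls (\<lambda>_. x)"
  by (simp add: completion_embed_def)

lemma norm_embed_minus:
  "x \<in> carr \<Longrightarrow> y \<in> carr \<Longrightarrow>
    anorm (completion A) (aminus (completion A) (completion_embed A x) (completion_embed A y)) = nrm (x \<ominus> y)"
  by (simp add: embed_cls completion_minus cauchy_const completion_norm_eq)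

lemma embed_tendsto:
  assumes "cauchy b"
  shows "norm_tendsto (completion A) (\<lambda>n. completion_embed A (b n)) (cls b)"
  unfolding norm_tendsto_def
proof (rule LIMSEQ_I)
  fix r :: real assume r: "0 < r"
  then obtain M where M: "\<And>m n. m \<ge> M \<Longrightarrow> n \<ge> M \<Longrightarrow> nrm (b m \<ominus> b n) < r / 2"
    using assms unfolding cauchy_def by (meson half_gt_zero)
  interpret C: normed_record "completion A" by (rule normed_record_completion)
  have "\<bar>anorm (completion A) (aminus (completion A) (completion_embed A (b n)) (cls b))\<bar> < r" if "n \<ge> M" for n
  proof -
    have c: "cauchy (\<lambda>m. b n \<ominus> b m)" by (intro cauchy_minus cauchy_const assms cauchy_carr)
    have "anorm (completion A) (cls (\<lambda>m. b n \<ominus> b m)) \<le> r / 2"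
      by (rule tendsto_upperbound[OF completion_norm_lim[OF c]])
        (use M that less_imp_le in \<open>auto simp: eventually_sequentially intro!: exI[of _ M]\<close>)
    moreover have "0 \<le> anorm (completion A) (cls (\<lambda>m. b n \<ominus> b m))"
      using c by (intro C.norm_nonneg) (auto simp: completion_carrier)
    ultimately show ?thesis
      using r by (simp add: embed_cls completion_minus cauchy_const assms cauchy_carr)
  qed
  then show "\<exists>no. \<forall>n\<ge>no. norm (anorm (completion A)
      (aminus (completion A) (completion_embed A (b n)) (cls b)) - 0) < r" by auto
qed

lemma embed_carrier: "x \<in> carr \<Longrightarrow> completion_embed A x \<in> acarrier (completion A)"
  by (auto simp: embed_cls completion_carrier cauchy_const)

text \<open>Each \<open>X n\<close> is replaced by an embedded element \<open>b n\<close> within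
  \<open>1 / (n + 1)\<close>. The embedding is isometric, so \<open>b\<close> is Cauchy, and its
  class is the limit.\<close>

lemma completion_complete: "normed_record.complete (completion A)"
  unfolding normed_record.complete_def[OF normed_record_completion]
proof (intro allI impI)
  interpret C: normed_record "completion A" by (rule normed_record_completion)
  fix X assume X: "C.cauchy X"
  have "\<exists>x\<in>carr. C.nrm (C.sub (X n) (completion_embed A x)) < inverse (Suc n)" for n
  proof -
    obtain a where a: "cauchy a" "X n = cls a" using C.cauchy_carr[OF X, of n] by (rule completion_cases)
    have "(\<lambda>k. C.nrm (C.sub (completion_embed A (a k)) (cls a))) \<longlonglongrightarrow> 0"
      using embed_tendsto[OF a(1)] by (simp add: norm_tendsto_def)
    from LIMSEQ_D[OF this, of "inverse (Suc n)"]
    obtain k where "\<bar>C.nrm (C.sub (completion_embed A (a k)) (cls a))\<bar> < inverse (Suc n)" by auto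
    then show ?thesis
      using a C.cauchy_carr[OF X, of n] C.norm_minus_commute[of "X n" "completion_embed A (a k)"]
      by (intro bexI[of _ "a k"]) (auto simp: embed_carrier cauchy_carr)
  qed
  then obtain b where b: "\<And>n. b n \<in> carr" "\<And>n. C.nrm (C.sub (X n) (completion_embed A (b n))) < inverse (Suc n)"
    by metis
  have bound: "nrm (b m \<ominus> b n) \<le> inverse (Suc m) + C.nrm (C.sub (X m) (X n)) + inverse (Suc n)" for m n
  proof -
    let ?e = "\<lambda>n. completion_embed A (b n)"
    have e: "?e n \<in> C.carr" "X n \<in> C.carr" for n using b embed_carrier C.cauchy_carr[OF X] by auto
    have "nrm (b m \<ominus> b n) = C.nrm (C.sub (?e m) (?e n))" using norm_embed_minus b by simp
    also have "\<dots> \<le> C.nrm (C.sub (?e m) (X m)) + (C.nrm (C.sub (X m) (X n)) + C.nrm (C.sub (X n) (?e n)))"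
      using C.norm_minus_triangle[of "?e m" "X m" "?e n"] C.norm_minus_triangle[of "X m" "X n" "?e n"] e by force
    also have "C.nrm (C.sub (?e m) (X m)) = C.nrm (C.sub (X m) (?e m))" using C.norm_minus_commute e by blast
    finally show ?thesis using b(2)[of m] b(2)[of n] by linarith
  qed
  have inv: "\<exists>M. \<forall>n\<ge>M. inverse (real (Suc n)) < e" if "0 < e" for e
    using LIMSEQ_D[OF LIMSEQ_inverse_real_of_nat that] by auto
  have cb: "cauchy b"
    unfolding cauchy_def
  proof (intro conjI allI impI b)
    fix e :: real assume e: "0 < e"
    obtain M1 where M1: "\<And>n. n \<ge> M1 \<Longrightarrow> inverse (real (Suc n)) < e / 3" using inv[of "e / 3"] e by auto
    have "0 < e / 3" using e by simp
    then obtain M2 where M2: "\<And>m n. m \<ge> M2 \<Longrightarrow> n \<ge> M2 \<Longrightarrow> C.nrm (C.sub (X m) (X n)) < e / 3"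
      using X unfolding C.cauchy_def by blast
    have "nrm (b m \<ominus> b n) < e" if "m \<ge> max M1 M2" "n \<ge> max M1 M2" for m n
      using bound[of m n] M1[of m] M1[of n] M2[of m n] that by simp
    then show "\<exists>M. \<forall>m\<ge>M. \<forall>n\<ge>M. nrm (b m \<ominus> b n) < e" by blast
  qed
  have clb: "cls b \<in> C.carr" using cb by (auto simp: completion_carrier)
  have "(\<lambda>n. inverse (real (Suc n)) + C.nrm (C.sub (completion_embed A (b n)) (cls b))) \<longlonglongrightarrow> 0 + 0"
    using embed_tendsto[OF cb] by (intro tendsto_add LIMSEQ_inverse_real_of_nat) (simp add: norm_tendsto_def)
  then have lim: "(\<lambda>n. inverse (real (Suc n)) + C.nrm (C.sub (completion_embed A (b n)) (cls b))) \<longlonglongrightarrow> 0" by simp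
  have "norm_tendsto (completion A) X (cls b)"
    unfolding norm_tendsto_def
  proof (rule Lim_null_comparison[OF _ lim], intro always_eventually allI)
    fix n
    have e: "completion_embed A (b n) \<in> C.carr" "X n \<in> C.carr" using b embed_carrier C.cauchy_carr[OF X] by auto
    show "norm (C.nrm (C.sub (X n) (cls b))) \<le>
        inverse (real (Suc n)) + C.nrm (C.sub (completion_embed A (b n)) (cls b))"
      using C.norm_minus_triangle[OF e(2,1) clb] b(2)[of n] e clb by simp
  qed
  then show "\<exists>x\<in>C.carr. norm_tendsto (completion A) X x" using clb by blast
qed

lemma norm_tendsto_unique:
  assumes "definite" "\<And>n. a n \<in> carr" "x \<in> carr" "y \<in> carr" "norm_tendsto A a x" "norm_tendsto A a y"
  shows "x = y"
proof -
  have "(\<lambda>n. nrm (a n \<ominus> x) + nrm (a n \<ominus> y)) \<longlonglongrightarrow> 0 + 0"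
    using assms unfolding norm_tendsto_def by (intro tendsto_add)
  moreover have "nrm (x \<ominus> y) \<le> nrm (a n \<ominus> x) + nrm (a n \<ominus> y)" for n
    using norm_minus_triangle[of x "a n" y] norm_minus_commute[of x "a n"] assms by simp
  ultimately have "nrm (x \<ominus> y) \<le> 0" by (intro tendsto_lowerbound) auto
  then have "nrm (x \<ominus> y) = 0" using norm_nonneg[of "x \<ominus> y"] assms(3,4) by (intro antisym) auto
  then show ?thesis using assms minus_eq_zero_iff[of x y] by (auto simp: definite_def)
qed

lemma norm_tendsto_norm:
  assumes "\<And>n. a n \<in> carr" "x \<in> carr" "norm_tendsto A a x"
  shows "(\<lambda>n. nrm (a n)) \<longlonglongrightarrow> nrm x"
proof -
  have "(\<lambda>n. nrm (a n) - nrm x) \<longlonglongrightarrow> 0"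
    by (rule Lim_null_comparison[where g = "\<lambda>n. nrm (a n \<ominus> x)"])
      (use assms norm_diff_le in \<open>auto simp: norm_tendsto_def\<close>)
  then show ?thesis using Lim_null by blast
qed

end

text \<open>The Lipschitz bound forces all sequences of a class to the same limit, and definiteness
  of the target makes that limit unique. Hence one representing sequence determines the
  \<open>THE\<close> in \<open>continuous_extension\<close>.\<close>

lemma (in normed_record) continuous_extension_eq:
  assumes B: "normed_record B" "normed_record.definite B"
    and f: "\<And>x. x \<in> carr \<Longrightarrow> f x \<in> acarrier B"
    and bd: "\<And>x y. x \<in> carr \<Longrightarrow> y \<in> carr \<Longrightarrow> anorm B (aminus B (f x) (f y)) \<le> K * nrm (x \<ominus> y)"
    and a: "cauchy a" and y: "y \<in> acarrier B" "norm_tendsto B (\<lambda>n. f (a n)) y"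
  shows "continuous_extension A B f (cls a) = y"
proof -
  interpret B: normed_record B by (rule B)
  have t: "norm_tendsto B (\<lambda>n. f (b n)) y" if "b \<in> cls a" for b
  proof -
    have b: "cauchy b" "(\<lambda>n. nrm (b n \<ominus> a n)) \<longlonglongrightarrow> 0" using that a by (auto simp: mem_cls)
    have l: "(\<lambda>n. K * nrm (b n \<ominus> a n) + anorm B (aminus B (f (a n)) y)) \<longlonglongrightarrow> K * 0 + 0"
      using y b by (intro tendsto_add tendsto_mult_left) (auto simp: norm_tendsto_def)
    show ?thesis
      unfolding norm_tendsto_def
    proof (rule Lim_null_comparison)
      show "(\<lambda>n. K * nrm (b n \<ominus> a n) + anorm B (aminus B (f (a n)) y)) \<longlonglongrightarrow> 0" using l by simp
      show "\<forall>\<^sub>F n in sequentially. norm (anorm B (aminus B (f (b n)) y))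
          \<le> K * nrm (b n \<ominus> a n) + anorm B (aminus B (f (a n)) y)"
      proof (intro always_eventually allI)
        fix n
        have "f (a n) \<in> B.carr" "f (b n) \<in> B.carr" using f cauchy_carr a b by auto
        then show "norm (anorm B (aminus B (f (b n)) y)) \<le> K * nrm (b n \<ominus> a n) + anorm B (aminus B (f (a n)) y)"
          using B.norm_minus_triangle[of "f (b n)" "f (a n)" y] bd[of "b n" "a n"] y(1) cauchy_carr a b by force
      qed
    qed
  qed
  have "(THE y. y \<in> acarrier B \<and> (\<forall>a'\<in>cls a. norm_tendsto B (\<lambda>n. f (a' n)) y)) = y"
  proof (rule the_equality)
    show "y \<in> acarrier B \<and> (\<forall>a'\<in>cls a. norm_tendsto B (\<lambda>n. f (a' n)) y)" using t y by blast
    fix z assume z: "z \<in> acarrier B \<and> (\<forall>a'\<in>cls a. norm_tendsto B (\<lambda>n. f (a' n)) z)"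
    have "a \<in> cls a" using a Q.coset_self[of a] by (simp add: cauchy_carrier)
    then have "norm_tendsto B (\<lambda>n. f (a n)) z" using z by blast
    then show "z = y"
      using B.norm_tendsto_unique[OF B(2), of "\<lambda>n. f (a n)" z y] y z f cauchy_carr[OF a] by blast
  qed
  then show ?thesis
    unfolding continuous_extension_def using a by (auto simp: completion_carrier)
qed

lemma (in normed_record) completion_map_eq:
  assumes B: "normed_record B"
    and f: "\<And>x. x \<in> carr \<Longrightarrow> f x \<in> acarrier B"
    and bd: "\<And>x y. x \<in> carr \<Longrightarrow> y \<in> carr \<Longrightarrow> anorm B (aminus B (f x) (f y)) \<le> K * nrm (x \<ominus> y)"
    and K: "0 \<le> K" and a: "cauchy a"
  shows "completion_map A B f (cls a) = coset (cauchy_algebra B) (null_sequences B) (\<lambda>n. f (a n))"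
    "normed_record.cauchy B (\<lambda>n. f (a n))"
proof -
  interpret B: normed_record B by (rule B)
  show c: "B.cauchy (\<lambda>n. f (a n))"
    unfolding B.cauchy_def
  proof (intro conjI allI impI f cauchy_carr a)
    fix e :: real assume "0 < e"
    then have "0 < e / (K + 1)" using K by simp
    then obtain M where M: "\<And>m n. m \<ge> M \<Longrightarrow> n \<ge> M \<Longrightarrow> nrm (a m \<ominus> a n) < e / (K + 1)"
      using a unfolding cauchy_def by blast
    have "B.nrm (B.sub (f (a m)) (f (a n))) < e" if "m \<ge> M" "n \<ge> M" for m n
    proof -
      have "B.nrm (B.sub (f (a m)) (f (a n))) \<le> K * nrm (a m \<ominus> a n)" using bd cauchy_carr[OF a] by blast
      also have "\<dots> \<le> K * (e / (K + 1))" using M[OF that] K by (intro mult_left_mono) auto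
      also have "\<dots> < e" using \<open>0 < e\<close> K by (simp add: field_simps)
      finally show ?thesis .
    qed
    then show "\<exists>M. \<forall>m\<ge>M. \<forall>n\<ge>M. B.nrm (B.sub (f (a m)) (f (a n))) < e" by blast
  qed
  show "completion_map A B f (cls a) = B.cls (\<lambda>n. f (a n))"
    unfolding completion_map_def
    by (rule continuous_extension_eq[where K = K])
      (use B.normed_record_completion B.completion_definite f bd a c B.embed_carrier B.norm_embed_minus B.embed_tendsto in
        \<open>auto simp: B.completion_carrier\<close>)
qed

section \<open>The open mapping theorem\<close>

text \<open>Baire's argument: the closures of the images of balls of radius \<open>n\<close> cover
  the target, so one of them has interior. Differences of approximants move that interior to the
  origin, and scaling handles arbitrary size.\<close>

lemma open_mapping_approximate:
  assumes A: "normed_record A" and B: "normed_record B" "normed_record.definite B" "normed_record.complete B"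
    and p: "\<And>x. x \<in> acarrier A \<Longrightarrow> p x \<in> acarrier B"
    and p_minus: "\<And>x y. x \<in> acarrier A \<Longrightarrow> y \<in> acarrier A \<Longrightarrow> p (aminus A x y) = aminus B (p x) (p y)"
    and p_scale: "\<And>c x. x \<in> acarrier A \<Longrightarrow> p (ascale A c x) = ascale B c (p x)"
    and surj: "p ` acarrier A = acarrier B"
  shows "\<exists>K\<ge>0. \<forall>z\<in>acarrier B. \<forall>\<delta>>0. \<exists>x\<in>acarrier A. anorm A x \<le> K * anorm B z \<and> anorm B (aminus B z (p x)) < \<delta>"
proof -
  interpret A: normed_record A by (rule A)
  interpret B: normed_record B by (rule B)
  \<comment> \<open>The distance is 0 off the carrier because the metric space locale requires
    nonnegativity and symmetry for all arguments.\<close>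
  define d where "d x y = (if x \<in> B.carr \<and> y \<in> B.carr then B.nrm (B.sub x y) else 0)" for x y
  have dB: "d x y = B.nrm (B.sub x y)" if "x \<in> B.carr" "y \<in> B.carr" for x y using that by (simp add: d_def)
  interpret M: Metric_space B.carr d
  proof
    show "0 \<le> d x y" for x y by (simp add: d_def)
    show "d x y = d y x" for x y using B.norm_minus_commute by (auto simp: d_def)
    show "d x y = 0 \<longleftrightarrow> x = y" if "x \<in> B.carr" "y \<in> B.carr" for x y
    proof
      assume "d x y = 0"
      then have "B.sub x y = azero B" using B(2) that by (auto simp: dB B.definite_def)
      then show "x = y" using B.minus_eq_zero_iff that by blast
    qed (use that in \<open>simp add: dB\<close>)
    show "d x z \<le> d x y + d y z" if "x \<in> B.carr" "y \<in> B.carr" "z \<in> B.carr" for x y z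
      using B.norm_minus_triangle that by (simp add: dB)
  qed
  have comp: "M.mcomplete"
    unfolding M.mcomplete_def
  proof (intro allI impI)
    fix a assume a: "M.MCauchy a"
    then have c: "\<And>n. a n \<in> B.carr" by (auto simp: M.MCauchy_def)
    have "B.cauchy a"
      unfolding B.cauchy_def
    proof (intro conjI allI impI c)
      fix e :: real assume "0 < e"
      then obtain N where "\<And>n n'. N \<le> n \<Longrightarrow> N \<le> n' \<Longrightarrow> d (a n) (a n') < e"
        using a unfolding M.MCauchy_def by blast
      then show "\<exists>M. \<forall>m\<ge>M. \<forall>n\<ge>M. B.nrm (B.sub (a m) (a n)) < e" using c by (auto simp: dB)
    qed
    then obtain x where x: "x \<in> B.carr" "norm_tendsto B a x" using B(3) unfolding B.complete_def by blast
    have "limitin M.mtopology a x sequentially"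
      unfolding M.limitin_metric
    proof (intro conjI x allI impI)
      fix e :: real assume "0 < e"
      from order_tendstoD(2)[OF x(2)[unfolded norm_tendsto_def] this]
      show "\<forall>\<^sub>F n in sequentially. a n \<in> B.carr \<and> d (a n) x < e"
        by eventually_elim (use c x in \<open>auto simp: dB\<close>)
    qed
    then show "\<exists>x. limitin M.mtopology a x sequentially" ..
  qed
  define D where "D n = p ` {x \<in> A.carr. A.nrm x \<le> real n}" for n
  have D: "D n \<subseteq> B.carr" for n using p by (auto simp: D_def)
  have "\<exists>n. M.mtopology interior_of (M.mtopology closure_of D n) \<noteq> {}"
  proof (rule ccontr)
    assume "\<not> ?thesis"
    then have "M.mtopology interior_of \<Union>(range (\<lambda>n. M.mtopology closure_of D n)) = {}"
      by (intro M.metric_Baire_category_alt comp) auto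
    moreover have "\<Union>(range (\<lambda>n. M.mtopology closure_of D n)) = B.carr"
    proof
      show "\<Union>(range (\<lambda>n. M.mtopology closure_of D n)) \<subseteq> B.carr"
        using closure_of_subset_topspace[of M.mtopology] by auto
      show "B.carr \<subseteq> \<Union>(range (\<lambda>n. M.mtopology closure_of D n))"
      proof
        fix z assume "z \<in> B.carr"
        then obtain x where x: "x \<in> A.carr" "z = p x" using surj by auto
        obtain n where "A.nrm x \<le> real n" using real_arch_simple by blast
        then have "z \<in> D n" using x by (auto simp: D_def)
        moreover have "D n \<subseteq> M.mtopology closure_of D n" using D by (intro closure_of_subset) auto
        ultimately show "z \<in> \<Union>(range (\<lambda>n. M.mtopology closure_of D n))" by blast
      qed
    qed
    moreover have "M.mtopology interior_of B.carr = B.carr"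
      using interior_of_topspace[of M.mtopology] by simp
    ultimately show False using B.zero_closed by auto
  qed
  then obtain n z0 e where z0: "z0 \<in> B.carr" "0 < e" "M.mball z0 e \<subseteq> M.mtopology closure_of D n"
    unfolding M.metric_interior_of by blast
  have near: "\<exists>x\<in>A.carr. A.nrm x \<le> real n \<and> B.nrm (B.sub z (p x)) < \<delta>"
    if z: "z \<in> B.carr" "B.nrm (B.sub z0 z) < e" "0 < \<delta>" for z \<delta>
  proof -
    have "z \<in> M.mball z0 e" using z z0 by (simp add: M.in_mball dB)
    then have "\<exists>y\<in>D n. y \<in> M.mball z \<delta>" using z0 z(3) by (auto simp: M.metric_closure_of)
    then obtain y where y: "y \<in> D n" "y \<in> M.mball z \<delta>" by blast
    then obtain x where "x \<in> A.carr" "A.nrm x \<le> real n" "y = p x" by (auto simp: D_def)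
    then show ?thesis using y z p by (auto simp: M.in_mball dB)
  qed
  \<comment> \<open>Approximants of \<open>z0 + z\<close> and of \<open>z0\<close> are subtracted;
    this costs the factor 2 in the norm and half of \<open>\<delta>\<close> for each.\<close>
  have small: "\<exists>x\<in>A.carr. A.nrm x \<le> 2 * real n \<and> B.nrm (B.sub z (p x)) < \<delta>"
    if z: "z \<in> B.carr" "B.nrm z < e" "0 < \<delta>" for z \<delta>
  proof -
    have "B.sub z0 (B.add z0 z) = ascale B (-1) z"
      using B.minus_swap[of "B.add z0 z" z0] z z0 by simp
    then have "B.nrm (B.sub z0 (B.add z0 z)) < e" using z B.norm_scale[of z "-1"] by simp
    then obtain x1 where x1: "x1 \<in> A.carr" "A.nrm x1 \<le> real n" "B.nrm (B.sub (B.add z0 z) (p x1)) < \<delta> / 2"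
      using near[of "B.add z0 z" "\<delta> / 2"] z z0 by auto
    obtain x2 where x2: "x2 \<in> A.carr" "A.nrm x2 \<le> real n" "B.nrm (B.sub z0 (p x2)) < \<delta> / 2"
      using near[of z0 "\<delta> / 2"] z z0 by auto
    have q: "p x1 \<in> B.carr" "p x2 \<in> B.carr" using p x1 x2 by auto
    have "B.sub z (p (A.sub x1 x2)) = B.sub (B.sub (B.add z0 z) z0) (B.sub (p x1) (p x2))"
      using x1 x2 z z0 by (simp add: p_minus)
    also have "\<dots> = B.sub (B.sub (B.add z0 z) (p x1)) (B.sub z0 (p x2))"
      using q z z0 unfolding aminus_def by (simp add: B.scale_plus B.plus_ac)
    finally have "B.nrm (B.sub z (p (A.sub x1 x2))) \<le> B.nrm (B.sub (B.add z0 z) (p x1)) + B.nrm (B.sub z0 (p x2))"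
      using B.norm_minus_le[of "B.sub (B.add z0 z) (p x1)" "B.sub z0 (p x2)"] q z z0 by simp
    moreover have "A.nrm (A.sub x1 x2) \<le> 2 * real n" using A.norm_minus_le[OF x1(1) x2(1)] x1 x2 by simp
    ultimately show ?thesis using x1 x2 by (intro bexI[of _ "A.sub x1 x2"]) auto
  qed
  \<comment> \<open>A vector rescaled to norm \<open>e / 2\<close> is approximated with norm at most
    \<open>2 n\<close>; undoing the factor \<open>c = e / (2 \<parallel>z\<parallel>)\<close> yields
    \<open>4 n / e\<close>.\<close>
  define K where "K = 4 * real n / e"
  have "\<exists>x\<in>A.carr. A.nrm x \<le> K * B.nrm z \<and> B.nrm (B.sub z (p x)) < \<delta>"
    if z: "z \<in> B.carr" "0 < \<delta>" for z \<delta>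
  proof (cases "B.nrm z = 0")
    case True
    have "p (azero A) = azero B"
      using p_scale[of "azero A" 0] p[of "azero A"] by simp
    then show ?thesis using True z by (intro bexI[of _ "azero A"]) auto
  next
    case False
    then have nz: "0 < B.nrm z" using B.norm_nonneg[OF z(1)] by linarith
    define c where "c = e / (2 * B.nrm z)"
    have c: "0 < c" using nz z0 by (simp add: c_def)
    have "B.nrm (ascale B (complex_of_real c) z) = c * B.nrm z" using z c by (simp add: B.norm_scale)
    also have "\<dots> < e" using z0 nz by (simp add: c_def)
    finally have "B.nrm (ascale B (complex_of_real c) z) < e" .
    moreover have "0 < c * \<delta>" using c z by simp
    ultimately obtain x where x: "x \<in> A.carr" "A.nrm x \<le> 2 * real n"
        "B.nrm (B.sub (ascale B (complex_of_real c) z) (p x)) < c * \<delta>"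
      using small[of "ascale B (complex_of_real c) z" "c * \<delta>"] z by auto
    let ?x = "ascale A (complex_of_real (inverse c)) x"
    have px: "p x \<in> B.carr" using p x by auto
    have "B.sub z (p ?x) = ascale B (complex_of_real (inverse c)) (B.sub (ascale B (complex_of_real c) z) (p x))"
      using c z px x by (simp add: B.scale_minus p_scale flip: of_real_mult)
    then have "B.nrm (B.sub z (p ?x)) = inverse c * B.nrm (B.sub (ascale B (complex_of_real c) z) (p x))"
      using px z c by (simp add: B.norm_scale norm_inverse)
    also have "\<dots> < inverse c * (c * \<delta>)" using x(3) c by (intro mult_strict_left_mono) auto
    also have "\<dots> = \<delta>" using c by simp
    finally have "B.nrm (B.sub z (p ?x)) < \<delta>" .
    moreover have "A.nrm ?x \<le> K * B.nrm z"
    proof -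
      have "A.nrm ?x = inverse c * A.nrm x" using x c by (simp add: A.norm_scale norm_inverse)
      also have "\<dots> \<le> inverse c * (2 * real n)" using x c by (intro mult_left_mono) auto
      also have "\<dots> = K * B.nrm z" using nz z0 by (simp add: c_def K_def field_simps)
      finally show ?thesis .
    qed
    ultimately show ?thesis using x by (intro bexI[of _ ?x]) auto
  qed
  moreover have "0 \<le> K" using z0 by (simp add: K_def)
  ultimately show ?thesis by blast
qed

text \<open>Approximate lifts are corrected repeatedly with halved error. The corrections form a
  geometric series, so completeness of the source gives an exact lift, with twice the constant of
  the approximate one.\<close>

lemma open_mapping:
  assumes A: "normed_record A" "normed_record.complete A"
    and B: "normed_record B" "normed_record.definite B" "normed_record.complete B"
    and p: "\<And>x. x \<in> acarrier A \<Longrightarrow> p x \<in> acarrier B"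
    and p_minus: "\<And>x y. x \<in> acarrier A \<Longrightarrow> y \<in> acarrier A \<Longrightarrow> p (aminus A x y) = aminus B (p x) (p y)"
    and p_scale: "\<And>c x. x \<in> acarrier A \<Longrightarrow> p (ascale A c x) = ascale B c (p x)"
    and bounded: "\<And>x. x \<in> acarrier A \<Longrightarrow> anorm B (p x) \<le> L * anorm A x"
    and surj: "p ` acarrier A = acarrier B"
  shows "\<exists>C\<ge>0. \<forall>z\<in>acarrier B. \<exists>x\<in>acarrier A. p x = z \<and> anorm A x \<le> C * anorm B z"
proof -
  interpret A: normed_record A by (rule A)
  interpret B: normed_record B by (rule B)
  obtain K where K: "0 \<le> K" "\<And>z \<delta>. z \<in> B.carr \<Longrightarrow> 0 < \<delta> \<Longrightarrow>
      \<exists>x\<in>A.carr. A.nrm x \<le> K * B.nrm z \<and> B.nrm (B.sub z (p x)) < \<delta>"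
    using open_mapping_approximate[OF A(1) B p p_minus p_scale surj] by blast
  have "\<exists>x\<in>A.carr. p x = z \<and> A.nrm x \<le> (2 * K) * B.nrm z" if z: "z \<in> B.carr" for z
  proof (cases "B.nrm z = 0")
    case True
    then have "z = azero B" using B(2) z by (auto simp: B.definite_def)
    moreover have "p (azero A) = azero B"
      using p_scale[of "azero A" 0] p[of "azero A"] by simp
    ultimately show ?thesis by (intro bexI[of _ "azero A"]) auto
  next
    case False
    define e where "e = B.nrm z"
    have e: "0 < e" using False B.norm_nonneg[OF z] by (simp add: e_def)
    obtain X where X: "\<And>y \<delta>. y \<in> B.carr \<Longrightarrow> 0 < \<delta> \<Longrightarrow> X y \<delta> \<in> A.carr"
      "\<And>y \<delta>. y \<in> B.carr \<Longrightarrow> 0 < \<delta> \<Longrightarrow> A.nrm (X y \<delta>) \<le> K * B.nrm y"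
      "\<And>y \<delta>. y \<in> B.carr \<Longrightarrow> 0 < \<delta> \<Longrightarrow> B.nrm (B.sub y (p (X y \<delta>))) < \<delta>"
      using K(2) by metis
    \<comment> \<open>After \<open>k\<close> corrections the residual is at most
      \<open>e / 2 ^ k\<close>, so the next correction has norm at most
      \<open>K * e / 2 ^ k\<close>.\<close>
    define s where "s = rec_nat (azero A) (\<lambda>k s. A.add s (X (B.sub z (p s)) (e / 2 ^ Suc k)))"
    have s0: "s 0 = azero A" and sS: "s (Suc k) = A.add (s k) (X (B.sub z (p (s k))) (e / 2 ^ Suc k))" for k
      by (simp_all add: s_def)
    have pos: "0 < e / 2 ^ k" for k :: nat using e by simp
    have p0: "p (azero A) = azero B"
      using p_scale[of "azero A" 0] p[of "azero A"] by simp
    have inv: "s k \<in> A.carr \<and> B.nrm (B.sub z (p (s k))) \<le> e / 2 ^ k" for k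
    proof (induction k)
      case 0
      then show ?case using z by (simp add: s0 p0 e_def)
    next
      case (Suc k)
      let ?y = "B.sub z (p (s k))"
      let ?x = "X ?y (e / 2 ^ Suc k)"
      have c: "s k \<in> A.carr" "p (s k) \<in> B.carr" "?y \<in> B.carr" using Suc p z by auto
      have x: "?x \<in> A.carr" by (rule X(1)[OF c(3) pos])
      have px: "p ?x \<in> B.carr" using p x by auto
      have "p (s (Suc k)) = B.add (p (s k)) (p ?x)"
      proof -
        have "p ?x = B.sub (p (s (Suc k))) (p (s k))"
          using p_minus[of "s (Suc k)" "s k"] c x by (simp add: sS)
        then show ?thesis using c x p[of "s (Suc k)"] by (simp add: sS)
      qed
      then have "B.sub z (p (s (Suc k))) = B.sub ?y (p ?x)"
        using c px z unfolding aminus_def by (simp add: B.scale_plus B.plus_ac)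
      then show ?case using X(3)[OF c(3) pos, of "Suc k"] c x by (simp add: sS)
    qed
    have sc: "s k \<in> A.carr" for k using inv by blast
    have psc: "p (s k) \<in> B.carr" for k using p sc by blast
    have step: "A.nrm (A.sub (s (Suc k)) (s k)) \<le> K * e / 2 ^ k" for k
    proof -
      have y: "B.sub z (p (s k)) \<in> B.carr" using z psc by auto
      have "A.nrm (A.sub (s (Suc k)) (s k)) = A.nrm (X (B.sub z (p (s k))) (e / 2 ^ Suc k))"
        unfolding sS by (simp only: A.plus_minus_cancel_left[OF sc[of k] X(1)[OF y pos]])
      also have "\<dots> \<le> K * B.nrm (B.sub z (p (s k)))" by (rule X(2)[OF y pos])
      also have "\<dots> \<le> K * (e / 2 ^ k)" using inv K by (intro mult_left_mono) auto
      finally show ?thesis by simp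
    qed
    \<comment> \<open>The subtracted tail of the geometric series makes the induction close with
      equality; it is dropped in \<open>far'\<close>.\<close>
    have far: "A.nrm (A.sub (s (k + j)) (s k)) \<le> 2 * K * e / 2 ^ k - 2 * K * e / 2 ^ (k + j)" for k j
    proof (induction j)
      case 0
      then show ?case using sc by simp
    next
      case (Suc j)
      have "A.nrm (A.sub (s (k + Suc j)) (s k)) \<le>
          A.nrm (A.sub (s (Suc (k + j))) (s (k + j))) + A.nrm (A.sub (s (k + j)) (s k))"
        using A.norm_minus_triangle[OF sc sc sc] by simp
      also have "\<dots> \<le> K * e / 2 ^ (k + j) + (2 * K * e / 2 ^ k - 2 * K * e / 2 ^ (k + j))"
        using step Suc by (intro add_mono) auto
      also have "\<dots> = 2 * K * e / 2 ^ k - 2 * K * e / 2 ^ (k + Suc j)"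
        by (simp add: field_simps)
      finally show ?case .
    qed
    have Ke: "0 \<le> K * e" using K e by simp
    have far': "A.nrm (A.sub (s m) (s k)) \<le> 2 * K * e / 2 ^ k" if "k \<le> m" for k m
    proof -
      have "0 \<le> 2 * K * e / 2 ^ m" using Ke by simp
      then show ?thesis using far[of k "m - k"] that by simp
    qed
    have lim0: "(\<lambda>k. c / 2 ^ k) \<longlonglongrightarrow> 0" for c :: real
      using tendsto_mult_right_zero[OF LIMSEQ_inverse_realpow_zero[of 2], of c] by (simp add: divide_inverse)
    have "A.cauchy s"
      unfolding A.cauchy_def
    proof (intro conjI allI impI sc)
      fix r :: real assume "0 < r"
      then have "0 < r / 2" by simp
      from order_tendstoD(2)[OF lim0[of "2 * K * e"] this]
      have "\<forall>\<^sub>F k in sequentially. 2 * K * e / 2 ^ k < r / 2" .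
      then obtain N where N: "2 * K * e / 2 ^ N < r / 2" by (auto simp: eventually_sequentially)
      have "A.nrm (A.sub (s m) (s n)) < r" if "m \<ge> N" "n \<ge> N" for m n
        using A.norm_minus_triangle[OF sc sc sc, of m n N] A.norm_minus_commute[OF sc sc, of N n]
          far'[OF that(1)] far'[OF that(2)] N by linarith
      then show "\<exists>M. \<forall>m\<ge>M. \<forall>n\<ge>M. A.nrm (A.sub (s m) (s n)) < r" by blast
    qed
    then obtain x where x: "x \<in> A.carr" "norm_tendsto A s x" using A(2) unfolding A.complete_def by blast
    have px: "p x \<in> B.carr" using p x by auto
    have "A.nrm x \<le> 2 * K * e"
    proof (rule tendsto_upperbound[OF A.norm_tendsto_norm[OF sc x]])
      show "\<forall>\<^sub>F k in sequentially. A.nrm (s k) \<le> 2 * K * e"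
        using far'[of 0] sc by (intro always_eventually allI) (simp add: s0)
    qed simp
    moreover have "p x = z"
    proof -
      have "(\<lambda>k. L * A.nrm (A.sub (s k) x) + e / 2 ^ k) \<longlonglongrightarrow> L * 0 + 0"
        using x(2) lim0 by (intro tendsto_add tendsto_mult_left) (auto simp: norm_tendsto_def)
      moreover have "B.nrm (B.sub z (p x)) \<le> L * A.nrm (A.sub (s k) x) + e / 2 ^ k" for k
      proof -
        have "B.nrm (B.sub z (p x)) \<le> B.nrm (B.sub z (p (s k))) + B.nrm (B.sub (p (s k)) (p x))"
          by (rule B.norm_minus_triangle[OF z psc px])
        also have "B.sub (p (s k)) (p x) = p (A.sub (s k) x)" using p_minus sc x by simp
        finally show ?thesis using inv[of k] bounded[of "A.sub (s k) x"] sc x by force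
      qed
      ultimately have "B.nrm (B.sub z (p x)) \<le> 0" by (intro tendsto_lowerbound) auto
      then have "B.nrm (B.sub z (p x)) = 0" using B.norm_nonneg[of "B.sub z (p x)"] z px by (intro antisym) auto
      then show "p x = z" using B(2) z px B.minus_eq_zero_iff[OF z px] by (auto simp: B.definite_def)
    qed
    ultimately show ?thesis using x by (auto simp: e_def)
  qed
  then show ?thesis using K(1) by (intro exI[of _ "2 * K"]) auto
qed

section \<open>Completions of normed star-algebras\<close>

text \<open>Products and stars are used through estimates of differences, which is why
  distributivity and additivity are stated for \<open>aminus\<close>.\<close>

locale normed_star_record = normed_record +
  assumes mult_closed [simp, intro]: "x \<in> acarrier A \<Longrightarrow> y \<in> acarrier A \<Longrightarrow> amult A x y \<in> acarrier A"
    and star_closed [simp, intro]: "x \<in> acarrier A \<Longrightarrow> astar A x \<in> acarrier A"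
    and mult_minus_left: "x \<in> acarrier A \<Longrightarrow> x' \<in> acarrier A \<Longrightarrow> y \<in> acarrier A \<Longrightarrow>
      amult A (aminus A x x') y = aminus A (amult A x y) (amult A x' y)"
    and mult_minus_right: "x \<in> acarrier A \<Longrightarrow> y \<in> acarrier A \<Longrightarrow> y' \<in> acarrier A \<Longrightarrow>
      amult A x (aminus A y y') = aminus A (amult A x y) (amult A x y')"
    and norm_mult: "x \<in> acarrier A \<Longrightarrow> y \<in> acarrier A \<Longrightarrow> anorm A (amult A x y) \<le> anorm A x * anorm A y"
    and star_minus: "x \<in> acarrier A \<Longrightarrow> y \<in> acarrier A \<Longrightarrow> astar A (aminus A x y) = aminus A (astar A x) (astar A y)"
    and norm_star: "x \<in> acarrier A \<Longrightarrow> anorm A (astar A x) \<le> anorm A x"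
begin

lemma mult_diff_bound:
  assumes "x \<in> carr" "y \<in> carr" "x' \<in> carr" "y' \<in> carr"
  shows "nrm (amult A x y \<ominus> amult A x' y') \<le> nrm (x \<ominus> x') * nrm y + nrm x' * nrm (y \<ominus> y')"
proof -
  have "nrm (amult A x y \<ominus> amult A x' y') \<le> nrm (amult A x y \<ominus> amult A x' y) + nrm (amult A x' y \<ominus> amult A x' y')"
    using assms by (intro norm_minus_triangle) auto
  also have "\<dots> = nrm (amult A (x \<ominus> x') y) + nrm (amult A x' (y \<ominus> y'))"
    using assms by (simp add: mult_minus_left mult_minus_right)
  also have "\<dots> \<le> nrm (x \<ominus> x') * nrm y + nrm x' * nrm (y \<ominus> y')"
    using assms by (intro add_mono norm_mult) auto
  finally show ?thesis .
qed

lemma cauchy_bounded: assumes "cauchy a" obtains K where "0 \<le> K" "\<And>n. nrm (a n) \<le> K"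
proof -
  have "Bseq (\<lambda>n. nrm (a n))" using cauchy_norm_convergent[OF assms] convergent_imp_Bseq by blast
  then obtain K where "0 < K" "\<And>n. norm (nrm (a n)) \<le> K" by (auto simp: Bseq_def)
  then show thesis using that[of K] by (metis abs_le_D1 less_imp_le real_norm_def)
qed

lemma cauchy_mult: assumes "cauchy a" "cauchy b" shows "cauchy (\<lambda>n. amult A (a n) (b n))"
proof -
  obtain K where K: "0 \<le> K" "\<And>n. nrm (a n) \<le> K" using cauchy_bounded[OF assms(1)] by blast
  obtain L where L: "0 \<le> L" "\<And>n. nrm (b n) \<le> L" using cauchy_bounded[OF assms(2)] by blast
  show ?thesis
  proof (rule cauchy_from_bound[OF _ _ assms L(1) K(1)])
    fix m n
    have c: "a m \<in> carr" "b m \<in> carr" "a n \<in> carr" "b n \<in> carr" using assms cauchy_carr by auto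
    then show "amult A (a n) (b n) \<in> carr" by simp
    have "nrm (amult A (a m) (b m) \<ominus> amult A (a n) (b n)) \<le> nrm (a m \<ominus> a n) * nrm (b m) + nrm (a n) * nrm (b m \<ominus> b n)"
      using c by (intro mult_diff_bound)
    also have "\<dots> \<le> nrm (a m \<ominus> a n) * L + K * nrm (b m \<ominus> b n)"
      using c K L by (intro add_mono mult_left_mono mult_right_mono) auto
    finally show "nrm (amult A (a m) (b m) \<ominus> amult A (a n) (b n)) \<le> L * nrm (a m \<ominus> a n) + K * nrm (b m \<ominus> b n)"
      by (simp add: mult.commute)
  qed
qed

lemma cauchy_star: "cauchy a \<Longrightarrow> cauchy (\<lambda>n. astar A (a n))"
  by (rule cauchy_from_bound[where K = 1 and L = 0 and b = a and c = a])
    (auto simp: cauchy_carr star_minus[symmetric] intro: norm_star)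

lemma completion_mult:
  assumes a: "cauchy a" and b: "cauchy b"
  shows "amult (completion A) (cls a) (cls b) = cls (\<lambda>n. amult A (a n) (b n))"
proof -
  have "amult (quotient_algebra (cauchy_algebra A) (null_sequences A)) (cls a) (cls b)
      = cls (amult (cauchy_algebra A) a b)"
  proof (rule Q.quotient_mult)
    fix a' b' assume "a' \<in> Q.carr" "b' \<in> Q.carr" and
      n: "aminus (cauchy_algebra A) a' a \<in> null_sequences A" "aminus (cauchy_algebra A) b' b \<in> null_sequences A"
    then have c: "cauchy a'" "cauchy b'" by (auto simp: cauchy_carrier)
    obtain K where K: "0 \<le> K" "\<And>n. nrm (a n) \<le> K" using cauchy_bounded[OF a] by blast
    obtain L where L: "0 \<le> L" "\<And>n. nrm (b' n) \<le> L" using cauchy_bounded[OF c(2)] by blast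
    have "(\<lambda>n. amult A (a' n) (b' n) \<ominus> amult A (a n) (b n)) \<in> null_sequences A"
    proof (rule null_bound)
      fix n
      have cc: "a n \<in> carr" "b n \<in> carr" "a' n \<in> carr" "b' n \<in> carr" using a b c cauchy_carr by auto
      then show "amult A (a' n) (b' n) \<ominus> amult A (a n) (b n) \<in> carr" by simp
      have "nrm (amult A (a' n) (b' n) \<ominus> amult A (a n) (b n))
          \<le> nrm (a' n \<ominus> a n) * nrm (b' n) + nrm (a n) * nrm (b' n \<ominus> b n)"
        using cc by (intro mult_diff_bound)
      also have "\<dots> \<le> nrm (a' n \<ominus> a n) * L + K * nrm (b' n \<ominus> b n)"
        using cc K L by (intro add_mono mult_left_mono mult_right_mono) auto
      finally show "nrm (amult A (a' n) (b' n) \<ominus> amult A (a n) (b n)) \<le> nrm (a' n \<ominus> a n) * L + K * nrm (b' n \<ominus> b n)" .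
    next
      have "(\<lambda>n. nrm (a' n \<ominus> a n) * L + K * nrm (b' n \<ominus> b n)) \<longlonglongrightarrow> 0 * L + K * 0"
        using n by (intro tendsto_add tendsto_mult tendsto_const) (auto simp: null_iff cauchy_ops)
      then show "(\<lambda>n. nrm (a' n \<ominus> a n) * L + K * nrm (b' n \<ominus> b n)) \<longlonglongrightarrow> 0" by simp
    qed
    then show "amult (cauchy_algebra A) a' b' \<in> Q.carr \<and>
        aminus (cauchy_algebra A) (amult (cauchy_algebra A) a' b') (amult (cauchy_algebra A) a b) \<in> null_sequences A"
      using c by (simp add: cauchy_ops cauchy_carrier cauchy_mult)
  qed (use a b in \<open>auto simp: cauchy_carrier\<close>)
  then show ?thesis by (simp add: completion_def cauchy_ops)
qed

lemma completion_star:
  assumes a: "cauchy a"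
  shows "astar (completion A) (cls a) = cls (\<lambda>n. astar A (a n))"
proof -
  have "astar (quotient_algebra (cauchy_algebra A) (null_sequences A)) (cls a) = cls (astar (cauchy_algebra A) a)"
  proof (rule Q.quotient_star)
    fix a' assume "a' \<in> Q.carr" and n: "aminus (cauchy_algebra A) a' a \<in> null_sequences A"
    then have c: "cauchy a'" by (auto simp: cauchy_carrier)
    have "(\<lambda>n. astar A (a' n) \<ominus> astar A (a n)) \<in> null_sequences A"
      by (rule null_bound[where f = "\<lambda>n. nrm (a' n \<ominus> a n)"])
        (use n a c cauchy_carr in \<open>auto simp: null_iff cauchy_ops star_minus[symmetric] intro!: norm_star\<close>)
    then show "astar (cauchy_algebra A) a' \<in> Q.carr \<and>
        aminus (cauchy_algebra A) (astar (cauchy_algebra A) a') (astar (cauchy_algebra A) a) \<in> null_sequences A"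
      using c by (simp add: cauchy_ops cauchy_carrier cauchy_star)
  qed (use a in \<open>auto simp: cauchy_carrier\<close>)
  then show ?thesis by (simp add: completion_def cauchy_ops)
qed

end

section \<open>The spectrum of the constructible ideals and its boundary\<close>

section \<open>Constructible ideals and characters\<close>

lemma pdom_in_J: "g \<in> left_inverse_hull \<Longrightarrow> Domain g \<in> \<J>"
  by (auto simp: constructible_ideals_def)

lemma hull_preimage_in_J:
  assumes "g \<in> left_inverse_hull" "X \<in> \<J>"
  shows "g\<inverse> `` X \<in> \<J>"
proof -
  have "pcomp (pid X) g \<in> left_inverse_hull"
    using assms by (intro left_inverse_hull.comp pid_in_left_inverse_hull)
  then have "Domain (pcomp (pid X) g) \<in> \<J>" by (rule pdom_in_J)
  moreover have "Domain (pcomp (pid X) g) = g\<inverse> `` X" by auto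
  ultimately show ?thesis by simp
qed

lemma hull_image_in_J: "g \<in> left_inverse_hull \<Longrightarrow> X \<in> \<J> \<Longrightarrow> g `` X \<in> \<J>"
  using hull_preimage_in_J[of "g\<inverse>" X] left_inverse_hull.inverse by auto

lemma hull_functional:
  assumes "g \<in> left_inverse_hull"
  shows "(s, t) \<in> g \<Longrightarrow> (s, t') \<in> g \<Longrightarrow> t = t'" "(s, t) \<in> g \<Longrightarrow> (s', t) \<in> g \<Longrightarrow> s = s'"
  using single_valued_left_inverse_hull[OF assms] by (auto simp: single_valued_def)

lemma J_Inter: "finite K \<Longrightarrow> K \<subseteq> \<J> \<Longrightarrow> \<Inter>K \<in> \<J>"
  by (induction K rule: finite_induct)
    (auto intro: constructible_ideals_Int UNIV_in_constructible_ideals)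

text \<open>Left translations commute with right multiplication by associativity, and inverses and
  compositions inherit this. As a consequence a hull element defined at 1 is everywhere a left
  translation, see \<open>germ_e1\<close>.\<close>

lemma hull_mult: "g \<in> left_inverse_hull \<Longrightarrow> (s, u) \<in> g \<Longrightarrow> (s * t, u * t) \<in> g"
proof (induction arbitrary: s u rule: left_inverse_hull.induct)
  case (comp g h)
  then show ?case by (meson relcomp.cases relcomp.relcompI)
qed (auto simp: translation_def mult.assoc)

lemma character_UNIV: "\<omega> \<in> characters \<Longrightarrow> \<omega> UNIV"
  using UNIV_in_constructible_ideals by (fastforce simp: characters_def)

lemma character_Int: "\<omega> \<in> characters \<Longrightarrow> X \<in> \<J> \<Longrightarrow> Y \<in> \<J> \<Longrightarrow> \<omega> (X \<inter> Y) \<longleftrightarrow> \<omega> X \<and> \<omega> Y"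
  by (auto simp: characters_def)

lemma character_mono: "\<omega> \<in> characters \<Longrightarrow> X \<in> \<J> \<Longrightarrow> Y \<in> \<J> \<Longrightarrow> X \<subseteq> Y \<Longrightarrow> \<omega> X \<Longrightarrow> \<omega> Y"
  using character_Int[of \<omega> X Y] by (auto simp: inf.absorb1)

lemma character_Inter:
  assumes "\<omega> \<in> characters"
  shows "finite K \<Longrightarrow> K \<subseteq> \<J> \<Longrightarrow> \<omega> (\<Inter>K) \<longleftrightarrow> (\<forall>A\<in>K. \<omega> A)"
  by (induction K rule: finite_induct)
    (auto simp: character_Int[OF assms] J_Inter character_UNIV[OF assms])

lemma topspace_character_topology: "topspace character_topology = characters"
  by (auto simp: character_topology_def characters_def)

text \<open>The basic compact open sets of the spectrum; the corresponding diagonal projection is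
  the one onto \<open>X - \<Union>F\<close>, see \<open>projection_mop\<close>.\<close>

definition cylinder :: "'s::left_cancel_monoid set \<Rightarrow> 's set set \<Rightarrow> ('s set \<Rightarrow> bool) set" where
  "cylinder X F = {\<omega> \<in> Omega. \<omega> X \<and> (\<forall>Y\<in>F. \<not> \<omega> Y)}"

lemma openin_finite_coordinates:
  assumes "finite K" "K \<subseteq> \<J>" "S \<subseteq> \<J> \<rightarrow>\<^sub>E (UNIV :: bool set)"
    and "\<And>\<omega> \<eta>. \<omega> \<in> S \<Longrightarrow> \<eta> \<in> \<J> \<rightarrow>\<^sub>E UNIV \<Longrightarrow> (\<And>A. A \<in> K \<Longrightarrow> \<eta> A = \<omega> A) \<Longrightarrow> \<eta> \<in> S"
  shows "openin (product_topology (\<lambda>_. discrete_topology (UNIV :: bool set)) \<J>) S"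
  unfolding openin_product_topology_alt
proof
  fix \<omega> assume w: "\<omega> \<in> S"
  show "\<exists>U. finite {i \<in> \<J>. U i \<noteq> topspace (discrete_topology (UNIV :: bool set))} \<and>
        (\<forall>i\<in>\<J>. openin (discrete_topology UNIV) (U i)) \<and> \<omega> \<in> Pi\<^sub>E \<J> U \<and> Pi\<^sub>E \<J> U \<subseteq> S"
  proof (intro exI[of _ "\<lambda>A. if A \<in> K then {\<omega> A} else UNIV"] conjI ballI)
    show "finite {i \<in> \<J>. (if i \<in> K then {\<omega> i} else UNIV) \<noteq> topspace (discrete_topology UNIV)}"
      by (rule finite_subset[OF _ assms(1)]) auto
    show "\<omega> \<in> (\<Pi>\<^sub>E A\<in>\<J>. if A \<in> K then {\<omega> A} else UNIV)"
      using w assms(3) by (force simp: PiE_iff)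
    show "(\<Pi>\<^sub>E A\<in>\<J>. if A \<in> K then {\<omega> A} else UNIV) \<subseteq> S"
    proof
      fix \<eta> assume e: "\<eta> \<in> (\<Pi>\<^sub>E A\<in>\<J>. if A \<in> K then {\<omega> A} else UNIV)"
      show "\<eta> \<in> S"
      proof (rule assms(4)[OF w])
        show "\<eta> A = \<omega> A" if "A \<in> K" for A
          using e that assms(2) by (auto simp: PiE_iff split: if_splits dest!: bspec[of \<J> _ A])
      qed (use e in \<open>auto simp: PiE_iff\<close>)
    qed
  qed auto
qed

text \<open>A basic neighbourhood fixes finitely many coordinates. Multiplicativity merges those
  with value 1 into one ideal, whereas those with value 0 must be kept as a finite family.\<close>

lemma character_nbhd:
  assumes "openin character_topology U" "\<omega> \<in> U"
  obtains X F where "X \<in> \<J>" "finite F" "F \<subseteq> \<J>" "\<omega> X" "\<forall>Y\<in>F. \<not> \<omega> Y"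
    "\<And>\<eta>. \<eta> \<in> characters \<Longrightarrow> \<eta> X \<Longrightarrow> \<forall>Y\<in>F. \<not> \<eta> Y \<Longrightarrow> \<eta> \<in> U"
proof -
  obtain T where T: "openin (product_topology (\<lambda>_. discrete_topology (UNIV :: bool set)) \<J>) T"
      "U = T \<inter> characters"
    using assms(1) by (auto simp: character_topology_def openin_subtopology)
  then obtain B where B: "finite {i \<in> \<J>. B i \<noteq> (UNIV :: bool set)}" "\<omega> \<in> Pi\<^sub>E \<J> B" "Pi\<^sub>E \<J> B \<subseteq> T"
    using assms(2) unfolding openin_product_topology_alt by fastforce
  define K where "K = {i \<in> \<J>. B i \<noteq> UNIV}"
  have w: "\<omega> \<in> characters" using assms(2) T by auto
  have K: "finite K" "K \<subseteq> \<J>" using B by (auto simp: K_def)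
  show thesis
  \<comment> \<open>If no coordinate has value 1, the empty intersection is \<open>UNIV\<close>,
    where every character has value 1.\<close>
  proof (rule that[of "\<Inter>{A\<in>K. \<omega> A}" "{A\<in>K. \<not> \<omega> A}"])
    show "\<Inter>{A\<in>K. \<omega> A} \<in> \<J>" using K by (intro J_Inter) auto
    show "\<omega> (\<Inter>{A\<in>K. \<omega> A})" using K by (subst character_Inter[OF w]) auto
    fix \<eta> assume e: "\<eta> \<in> characters" "\<eta> (\<Inter>{A\<in>K. \<omega> A})" "\<forall>Y\<in>{A\<in>K. \<not> \<omega> A}. \<not> \<eta> Y"
    have pos: "\<eta> A" if "A \<in> K" "\<omega> A" for A
      using e(2) K that by (subst (asm) character_Inter[OF e(1)]) auto
    have same: "\<eta> A = \<omega> A" if "A \<in> K" for A using pos e(3) that by blast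
    have "\<eta> \<in> Pi\<^sub>E \<J> B"
      unfolding PiE_iff
    proof (intro conjI ballI)
      show "\<eta> A \<in> B A" if "A \<in> \<J>" for A
        using same[of A] B(2) that by (cases "A \<in> K") (auto simp: K_def PiE_iff)
      show "\<eta> \<in> extensional \<J>" using e(1) by (auto simp: characters_def PiE_def)
    qed
    then show "\<eta> \<in> U" using B(3) T(2) e(1) by auto
  qed (use K in auto)
qed

lemma openin_character_cylinder:
  assumes "X \<in> \<J>" "finite F" "F \<subseteq> \<J>"
  shows "openin character_topology {\<eta> \<in> characters. \<eta> X \<and> (\<forall>Y\<in>F. \<not> \<eta> Y)}"
proof -
  have "openin (product_topology (\<lambda>_. discrete_topology (UNIV :: bool set)) \<J>)
          {\<eta> \<in> \<J> \<rightarrow>\<^sub>E UNIV. \<eta> X \<and> (\<forall>Y\<in>F. \<not> \<eta> Y)}"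
    by (rule openin_finite_coordinates[where K = "insert X F"]) (use assms in auto)
  moreover have "{\<eta> \<in> characters. \<eta> X \<and> (\<forall>Y\<in>F. \<not> \<eta> Y)} =
      {\<eta> \<in> \<J> \<rightarrow>\<^sub>E UNIV. \<eta> X \<and> (\<forall>Y\<in>F. \<not> \<eta> Y)} \<inter> characters"
    by (auto simp: characters_def)
  ultimately show ?thesis unfolding character_topology_def openin_subtopology by blast
qed

text \<open>A point character \<open>point_character s\<close> lies in the basic neighbourhood given
  by \<open>X\<close> and \<open>F\<close> exactly when \<open>s\<close> is in
  \<open>X - \<Union>F\<close>; membership in the closure thus becomes nonemptiness of these
  differences.\<close>

lemma Omega_iff:
  "\<omega> \<in> Omega \<longleftrightarrow> \<omega> \<in> characters \<and>
    (\<forall>X F. X \<in> \<J> \<and> finite F \<and> F \<subseteq> \<J> \<and> \<omega> X \<and> (\<forall>Y\<in>F. \<not> \<omega> Y) \<longrightarrow> X - \<Union>F \<noteq> {})" (is "?l = ?r")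
proof
  assume l: ?l
  then have w: "\<omega> \<in> characters"
    by (simp add: Omega_def in_closure_of topspace_character_topology)
  moreover have "X - \<Union>F \<noteq> {}"
    if "X \<in> \<J>" "finite F" "F \<subseteq> \<J>" "\<omega> X" "\<forall>Y\<in>F. \<not> \<omega> Y" for X F
  proof -
    define U where "U = {\<eta> \<in> characters. \<eta> X \<and> (\<forall>Y\<in>F. \<not> \<eta> Y)}"
    have "\<omega> \<in> U" using w that by (simp add: U_def)
    moreover have "openin character_topology U"
      using openin_character_cylinder[OF that(1-3)] by (simp add: U_def)
    ultimately have "\<exists>y\<in>range point_character. y \<in> U"
      using l unfolding Omega_def in_closure_of by blast
    then obtain s where "point_character s \<in> U" by blast
    then have "point_character s X" "\<forall>Y\<in>F. \<not> point_character s Y" by (auto simp: U_def)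
    then have "s \<in> X - \<Union>F" using that by (fastforce simp: point_character_def)
    then show ?thesis by auto
  qed
  ultimately show ?r by blast
next
  assume r: ?r
  show ?l unfolding Omega_def in_closure_of topspace_character_topology
  proof (intro conjI allI impI)
    fix T assume T: "\<omega> \<in> T \<and> openin character_topology T"
    obtain X F where XF: "X \<in> \<J>" "finite F" "F \<subseteq> \<J>" "\<omega> X" "\<forall>Y\<in>F. \<not> \<omega> Y"
      "\<And>\<eta>. \<eta> \<in> characters \<Longrightarrow> \<eta> X \<Longrightarrow> \<forall>Y\<in>F. \<not> \<eta> Y \<Longrightarrow> \<eta> \<in> T"
      by (rule character_nbhd[of T \<omega>]) (use T in auto)
    then obtain s where "s \<in> X - \<Union>F" using r by blast
    then have "point_character s \<in> T"
      using XF by (intro XF(6) point_character_in_characters) (auto simp: point_character_def)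
    then show "\<exists>y. y \<in> range point_character \<and> y \<in> T" by auto
  qed (use r in auto)
qed

lemma Omega_subset: "\<omega> \<in> Omega \<Longrightarrow> \<omega> \<in> characters" by (simp add: Omega_iff)

lemma Omega_nonempty:
  "\<omega> \<in> Omega \<Longrightarrow> X \<in> \<J> \<Longrightarrow> finite F \<Longrightarrow> F \<subseteq> \<J> \<Longrightarrow> \<omega> X \<Longrightarrow> \<forall>Y\<in>F. \<not> \<omega> Y \<Longrightarrow> X - \<Union>F \<noteq> {}"
  unfolding Omega_iff by (elim conjE allE[of _ X] allE[of _ F]) simp

lemma Omega_empty: "\<omega> \<in> Omega \<Longrightarrow> ({} :: 's::left_cancel_monoid set) \<in> \<J> \<Longrightarrow> \<not> \<omega> ({} :: 's set)"
  using Omega_nonempty[of \<omega> "{}" "{}"] by auto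

lemma topspace_Omega: "topspace Omega_topology = Omega"
  by (auto simp: Omega_topology_def topspace_character_topology Omega_subset)

lemma openin_Omega:
  "openin Omega_topology U \<longleftrightarrow>
     U \<subseteq> Omega \<and> (\<forall>\<omega>\<in>U. \<exists>X F. X \<in> \<J> \<and> finite F \<and> F \<subseteq> \<J> \<and> \<omega> \<in> cylinder X F \<and> cylinder X F \<subseteq> U)"
  (is "?l = ?r")
proof
  assume l: ?l
  then obtain T where T: "openin character_topology T" "U = T \<inter> Omega"
    by (auto simp: Omega_topology_def openin_subtopology)
  show ?r
  proof (intro conjI ballI)
    fix \<omega> assume w: "\<omega> \<in> U"
    obtain X F where XF: "X \<in> \<J>" "finite F" "F \<subseteq> \<J>" "\<omega> X" "\<forall>Y\<in>F. \<not> \<omega> Y"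
      "\<And>\<eta>. \<eta> \<in> characters \<Longrightarrow> \<eta> X \<Longrightarrow> \<forall>Y\<in>F. \<not> \<eta> Y \<Longrightarrow> \<eta> \<in> T"
      by (rule character_nbhd[of T \<omega>]) (use T w in auto)
    then show "\<exists>X F. X \<in> \<J> \<and> finite F \<and> F \<subseteq> \<J> \<and> \<omega> \<in> cylinder X F \<and> cylinder X F \<subseteq> U"
      using w T by (intro exI[of _ X] exI[of _ F]) (auto simp: cylinder_def Omega_subset)
  qed (use T in auto)
next
  assume r: ?r
  have cyl: "openin Omega_topology (cylinder X F)" if "X \<in> \<J>" "finite F" "F \<subseteq> \<J>" for X and F :: "'a set set"
    unfolding Omega_topology_def openin_subtopology
    by (intro exI[of _ "{\<eta> \<in> characters. \<eta> X \<and> (\<forall>Y\<in>F. \<not> \<eta> Y)}"] conjI openin_character_cylinder that)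
      (auto simp: cylinder_def Omega_subset)
  show ?l
    by (subst openin_subopen) (meson r cyl)
qed

lemma openin_cylinder: "X \<in> \<J> \<Longrightarrow> finite F \<Longrightarrow> F \<subseteq> \<J> \<Longrightarrow> openin Omega_topology (cylinder X F)"
  unfolding openin_Omega by (auto simp: cylinder_def)

lemma closedin_cylinder:
  assumes "X \<in> \<J>" "finite F" "F \<subseteq> \<J>"
  shows "closedin Omega_topology (cylinder X F)"
proof -
  have "Omega - cylinder X F = cylinder UNIV {X} \<union> (\<Union>Y\<in>F. cylinder Y {})"
    using character_UNIV Omega_subset by (auto simp: cylinder_def)
  moreover have "openin Omega_topology (cylinder UNIV {X} \<union> (\<Union>Y\<in>F. cylinder Y {}))"
    using assms UNIV_in_constructible_ideals by (intro openin_Un openin_Union openin_cylinder) (auto intro: openin_cylinder)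
  ultimately show ?thesis
    by (auto simp: closedin_def topspace_Omega cylinder_def)
qed

text \<open>For a multiplicative map being nonzero is equivalent to value 1 at \<open>UNIV\<close>,
  a condition on one coordinate. Every defect of a non-character is then visible in finitely many
  coordinates.\<close>

lemma closedin_characters:
  "closedin (product_topology (\<lambda>_. discrete_topology (UNIV :: bool set)) \<J>)
     (characters :: ('s::left_cancel_monoid set \<Rightarrow> bool) set)"
proof -
  let ?T = "product_topology (\<lambda>_. discrete_topology (UNIV :: bool set)) (\<J> :: 's set set)"
  let ?U = "{\<omega> \<in> \<J> \<rightarrow>\<^sub>E UNIV. \<not> \<omega> (UNIV :: 's set)}"
  let ?V = "\<lambda>X Y :: 's set. {\<omega> \<in> \<J> \<rightarrow>\<^sub>E UNIV. \<omega> (X \<inter> Y) \<noteq> (\<omega> X \<and> \<omega> Y)}"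
  have 1: "topspace ?T - characters = ?U \<union> (\<Union>X\<in>\<J>. \<Union>Y\<in>\<J>. ?V X Y)"
  proof (intro equalityI subsetI)
    fix \<omega> :: "'s set \<Rightarrow> bool" assume w: "\<omega> \<in> topspace ?T - characters"
    show "\<omega> \<in> ?U \<union> (\<Union>X\<in>\<J>. \<Union>Y\<in>\<J>. ?V X Y)"
    proof (cases "\<omega> UNIV")
      case True
      then obtain X Y where "X \<in> \<J>" "Y \<in> \<J>" "\<omega> (X \<inter> Y) \<noteq> (\<omega> X \<and> \<omega> Y)"
        using w UNIV_in_constructible_ideals unfolding characters_def by auto
      then show ?thesis using w by auto
    qed (use w in auto)
  next
    fix \<omega> :: "'s set \<Rightarrow> bool" assume w: "\<omega> \<in> ?U \<union> (\<Union>X\<in>\<J>. \<Union>Y\<in>\<J>. ?V X Y)"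
    then have "\<omega> \<notin> characters" using character_UNIV character_Int by blast
    then show "\<omega> \<in> topspace ?T - characters" using w by auto
  qed
  have 2: "openin ?T ?U"
    by (rule openin_finite_coordinates[where K = "{UNIV}"]) (use UNIV_in_constructible_ideals in auto)
  have 3: "openin ?T (?V X Y)" if "X \<in> \<J>" "Y \<in> \<J>" for X Y
  proof (rule openin_finite_coordinates[where K = "{X \<inter> Y, X, Y}"])
    fix \<omega> \<eta> assume "\<omega> \<in> ?V X Y" "\<eta> \<in> \<J> \<rightarrow>\<^sub>E UNIV" "\<And>A. A \<in> {X \<inter> Y, X, Y} \<Longrightarrow> \<eta> A = \<omega> A"
    then show "\<eta> \<in> ?V X Y" by simp
  qed (use that constructible_ideals_Int in auto)
  have "openin ?T (?U \<union> (\<Union>X\<in>\<J>. \<Union>Y\<in>\<J>. ?V X Y))"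
    using 2 3 by (intro openin_Un openin_Union) blast+
  then show ?thesis
    unfolding closedin_def 1[symmetric] by (auto simp: characters_def)
qed

lemma compact_Omega: "compact_space Omega_topology"
proof -
  have 1: "compact_space (product_topology (\<lambda>_. discrete_topology (UNIV :: bool set)) (\<J> :: 'a set set))"
    by (auto simp: compact_space_product_topology compact_space_discrete_topology)
  have 2: "compact_space (character_topology :: ('a set \<Rightarrow> bool) topology)"
    unfolding character_topology_def
    by (rule compact_space_subtopology[OF closedin_compact_space[OF 1 closedin_characters]])
  show ?thesis
    unfolding Omega_topology_def
    by (rule compact_space_subtopology[OF closedin_compact_space[OF 2]]) (auto simp: Omega_def)
qed

lemma Hausdorff_Omega: "Hausdorff_space Omega_topology"
  unfolding Omega_topology_def character_topology_def
  by (intro Hausdorff_space_subtopology) (auto simp: Hausdorff_space_product_topology)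

lemma Omega_ext: "\<omega> \<in> Omega \<Longrightarrow> \<eta> \<in> Omega \<Longrightarrow> (\<And>X. X \<in> \<J> \<Longrightarrow> \<omega> X = \<eta> X) \<Longrightarrow> \<omega> = \<eta>"
  by (rule extensionalityI[of _ \<J>]) (auto dest: Omega_subset simp: characters_def PiE_def)

section \<open>The filter of a character\<close>

text \<open>A character is recovered from this filter by \<open>\<omega> X \<longleftrightarrow> eventually (\<lambda>s. s \<in> X) (char_filter \<omega>)\<close>,
  germs become equality of partial maps along the filter, and translation of characters becomes
  pushing the filter forward.\<close>

definition char_filter :: "('s::left_cancel_monoid set \<Rightarrow> bool) \<Rightarrow> 's filter" where
  "char_filter \<omega> = (INF (X, F) \<in> {(X, F). X \<in> \<J> \<and> finite F \<and> F \<subseteq> \<J> \<and> \<omega> X \<and> (\<forall>Y\<in>F. \<not> \<omega> Y)}. principal (X - \<Union>F))"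

lemma eventually_char_filter:
  assumes "\<omega> \<in> characters"
  shows "eventually P (char_filter \<omega>) \<longleftrightarrow>
    (\<exists>X F. X \<in> \<J> \<and> finite F \<and> F \<subseteq> \<J> \<and> \<omega> X \<and> (\<forall>Y\<in>F. \<not> \<omega> Y) \<and> (\<forall>s\<in>X - \<Union>F. P s))"
proof -
  let ?B = "{(X, F). X \<in> \<J> \<and> finite F \<and> F \<subseteq> \<J> \<and> \<omega> X \<and> (\<forall>Y\<in>F. \<not> \<omega> Y)}"
  have ne: "?B \<noteq> {}"
    using character_UNIV[OF assms] UNIV_in_constructible_ideals by fastforce
  have "eventually P (char_filter \<omega>) \<longleftrightarrow> (\<exists>b\<in>?B. eventually P (case b of (X, F) \<Rightarrow> principal (X - \<Union>F)))"
    unfolding char_filter_def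
  proof (rule eventually_INF_base[OF ne])
    fix a b assume "a \<in> ?B" "b \<in> ?B"
    then obtain X F Y G where ab: "a = (X, F)" "b = (Y, G)"
      "X \<in> \<J>" "finite F" "F \<subseteq> \<J>" "\<omega> X" "\<forall>Y\<in>F. \<not> \<omega> Y"
      "Y \<in> \<J>" "finite G" "G \<subseteq> \<J>" "\<omega> Y" "\<forall>Y\<in>G. \<not> \<omega> Y" by auto
    then show "\<exists>x\<in>?B. (case x of (X, F) \<Rightarrow> principal (X - \<Union>F)) \<le>
        inf (case a of (X, F) \<Rightarrow> principal (X - \<Union>F)) (case b of (X, F) \<Rightarrow> principal (X - \<Union>F))"
      by (intro bexI[of _ "(X \<inter> Y, F \<union> G)"]) (auto simp: character_Int[OF assms] constructible_ideals_Int)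
  qed
  then show ?thesis by (auto simp: eventually_principal Ball_def)
qed

text \<open>Here approximability by point characters is what counts: the base sets of the filter are
  nonempty for characters in \<open>Omega\<close>.\<close>

lemma char_filter_ne_bot: "\<omega> \<in> Omega \<Longrightarrow> char_filter \<omega> \<noteq> bot"
  unfolding trivial_limit_def
  by (subst eventually_char_filter) (auto dest: Omega_subset Omega_nonempty)

text \<open>The filter decides every constructible ideal, as an ultrafilter would: where the
  character is 0, points are eventually outside.\<close>

lemma eventually_mem_ideal:
  assumes "\<omega> \<in> Omega" "X \<in> \<J>"
  shows "eventually (\<lambda>s. s \<in> X) (char_filter \<omega>) \<longleftrightarrow> \<omega> X" "\<not> \<omega> X \<Longrightarrow> eventually (\<lambda>s. s \<notin> X) (char_filter \<omega>)"
proof -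
  have w: "\<omega> \<in> characters" using assms Omega_subset by auto
  show 1: "eventually (\<lambda>s. s \<notin> X) (char_filter \<omega>)" if "\<not> \<omega> X"
    unfolding eventually_char_filter[OF w]
    by (rule exI[of _ UNIV], rule exI[of _ "{X}"])
      (use that assms character_UNIV[OF w] UNIV_in_constructible_ideals in auto)
  show "eventually (\<lambda>s. s \<in> X) (char_filter \<omega>) \<longleftrightarrow> \<omega> X"
  proof
    assume "\<omega> X"
    then show "eventually (\<lambda>s. s \<in> X) (char_filter \<omega>)"
      unfolding eventually_char_filter[OF w]
      by - (rule exI[of _ X], rule exI[of _ "{}"], use assms in auto)
  next
    assume e: "eventually (\<lambda>s. s \<in> X) (char_filter \<omega>)"
    show "\<omega> X"
    proof (rule ccontr)
      assume "\<not> \<omega> X"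
      then have "eventually (\<lambda>s. False) (char_filter \<omega>)"
        using eventually_conj[OF e 1] by simp
      then show False using char_filter_ne_bot[OF assms(1)] by (simp add: trivial_limit_def)
    qed
  qed
qed

lemma eventually_cylinder:
  assumes "\<omega> \<in> Omega"
  shows "eventually P (char_filter \<omega>) \<longleftrightarrow>
    (\<exists>X F. X \<in> \<J> \<and> finite F \<and> F \<subseteq> \<J> \<and> \<omega> \<in> cylinder X F \<and> (\<forall>s. point_character s \<in> cylinder X F \<longrightarrow> P s))"
proof -
  have *: "point_character s \<in> cylinder X F \<longleftrightarrow> s \<in> X - \<Union>F" if "X \<in> \<J>" "F \<subseteq> \<J>" for s X and F :: "'a set set"
    using that point_character_in_Omega[of s] by (auto simp: cylinder_def point_character_def)
  show ?thesis
    unfolding eventually_char_filter[OF Omega_subset[OF assms]]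
  proof (intro ex_cong1)
    fix X F
    show "(X \<in> \<J> \<and> finite F \<and> F \<subseteq> \<J> \<and> \<omega> X \<and> (\<forall>Y\<in>F. \<not> \<omega> Y) \<and> (\<forall>s\<in>X - \<Union>F. P s)) \<longleftrightarrow>
      (X \<in> \<J> \<and> finite F \<and> F \<subseteq> \<J> \<and> \<omega> \<in> cylinder X F \<and> (\<forall>s. point_character s \<in> cylinder X F \<longrightarrow> P s))"
    proof -
      have "\<omega> \<in> cylinder X F \<longleftrightarrow> \<omega> X \<and> (\<forall>Y\<in>F. \<not> \<omega> Y)" using assms by (simp add: cylinder_def)
      then show ?thesis using *[of X F] by blast
    qed
  qed
qed

lemma eventually_open:
  assumes "openin Omega_topology U" "\<omega> \<in> U"
  shows "eventually (\<lambda>s. point_character s \<in> U) (char_filter \<omega>)"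
proof -
  have "\<omega> \<in> Omega" using assms openin_subset topspace_Omega by blast
  then show ?thesis using assms unfolding openin_Omega
    by (subst eventually_cylinder) blast+
qed

lemma char_filter_tendsto:
  assumes "continuous_map Omega_topology euclidean \<phi>" "\<omega> \<in> Omega"
  shows "((\<lambda>s. \<phi> (point_character s)) \<longlongrightarrow> \<phi> \<omega>) (char_filter \<omega>)"
proof (rule topological_tendstoI)
  fix S assume S: "open S" "\<phi> \<omega> \<in> S"
  have "openin Omega_topology {\<eta> \<in> topspace Omega_topology. \<phi> \<eta> \<in> S}"
    using assms(1) S by (auto simp: continuous_map_def)
  from eventually_open[OF this, of \<omega>]
  show "eventually (\<lambda>s. \<phi> (point_character s) \<in> S) (char_filter \<omega>)"
    using assms S by (auto simp: topspace_Omega elim: eventually_mono)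
qed

text \<open>The way back from filters to characters: multiplicativity and approximability are read
  off a proper filter that decides each ideal as \<open>\<eta>\<close> does. It applies to filters
  pushed forward by hull elements.\<close>

lemma Omega_filter_iff:
  assumes "\<eta> \<in> \<J> \<rightarrow>\<^sub>E UNIV" "A \<noteq> bot"
    "\<And>X. X \<in> \<J> \<Longrightarrow> \<eta> X \<Longrightarrow> eventually (\<lambda>s. s \<in> X) A"
    "\<And>X. X \<in> \<J> \<Longrightarrow> \<not> \<eta> X \<Longrightarrow> eventually (\<lambda>s. s \<notin> X) A"
  shows "\<eta> \<in> Omega"
proof -
  have ev: "\<eta> X \<longleftrightarrow> eventually (\<lambda>s. s \<in> X) A" if "X \<in> \<J>" for X
  proof
    assume e: "eventually (\<lambda>s. s \<in> X) A"
    show "\<eta> X"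
    proof (rule ccontr)
      assume "\<not> \<eta> X"
      from eventually_conj[OF e assms(4)[OF that this]] show False using assms(2)
        by (simp add: trivial_limit_def)
    qed
  qed (rule assms(3)[OF that])
  show ?thesis
    unfolding Omega_iff characters_def
  proof (intro conjI CollectI allI impI ballI)
    show "\<exists>X\<in>\<J>. \<eta> X" using ev[OF UNIV_in_constructible_ideals] UNIV_in_constructible_ideals by auto
    show "\<eta> (X \<inter> Y) \<longleftrightarrow> \<eta> X \<and> \<eta> Y" if "X \<in> \<J>" "Y \<in> \<J>" for X Y
      using that by (simp add: ev constructible_ideals_Int eventually_conj_iff)
    fix X F assume XF: "X \<in> \<J> \<and> finite F \<and> F \<subseteq> \<J> \<and> \<eta> X \<and> (\<forall>Y\<in>F. \<not> \<eta> Y)"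
    then have "eventually (\<lambda>s. \<forall>Y\<in>F. s \<notin> Y) A"
      by (intro eventually_ball_finite ballI assms(4)) auto
    moreover have "eventually (\<lambda>s. s \<in> X) A" using XF assms(3) by auto
    ultimately have "eventually (\<lambda>s. s \<in> X \<and> (\<forall>Y\<in>F. s \<notin> Y)) A" by (rule eventually_conj[rotated])
    then obtain s where "s \<in> X \<and> (\<forall>Y\<in>F. s \<notin> Y)"
      using eventually_happens[of _ A] assms(2) by (auto simp: trivial_limit_def)
    then show "X - \<Union>F \<noteq> {}" by auto
  qed (use assms in auto)
qed

section \<open>Translation of characters\<close>

definition papply :: "'s rel \<Rightarrow> 's \<Rightarrow> 's" where
  "papply g s = (THE t. (s, t) \<in> g)"

lemma papply_eq: "g \<in> left_inverse_hull \<Longrightarrow> (s, t) \<in> g \<Longrightarrow> papply g s = t"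
  unfolding papply_def by (rule the_equality) (auto dest: hull_functional)

lemma papply_in: "g \<in> left_inverse_hull \<Longrightarrow> s \<in> Domain g \<Longrightarrow> (s, papply g s) \<in> g"
  using papply_eq by fastforce

context
  fixes g :: "'s::left_cancel_monoid rel" and \<omega>
  assumes g: "g \<in> left_inverse_hull" and w: "\<omega> \<in> Omega" and wg: "\<omega> (Domain g)"
begin

lemma eventually_dom: "eventually (\<lambda>s. s \<in> Domain g) (char_filter \<omega>)"
  using eventually_mem_ideal(1)[OF w pdom_in_J[OF g]] wg by simp

lemma translate_character_eventually:
  assumes "X \<in> \<J>"
  shows "translate_character g \<omega> X \<longleftrightarrow> eventually (\<lambda>s. papply g s \<in> X) (char_filter \<omega>)"
    "\<not> translate_character g \<omega> X \<Longrightarrow> eventually (\<lambda>s. papply g s \<notin> X) (char_filter \<omega>)"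
proof -
  have m: "s \<in> g\<inverse> `` X \<longleftrightarrow> papply g s \<in> X" if "s \<in> Domain g" for s
    using that papply_eq[OF g] by blast
  have "translate_character g \<omega> X \<longleftrightarrow> eventually (\<lambda>s. s \<in> g\<inverse> `` X) (char_filter \<omega>)"
    using assms eventually_mem_ideal(1)[OF w hull_preimage_in_J[OF g assms]]
    by (simp add: translate_character_def)
  also have "\<dots> \<longleftrightarrow> eventually (\<lambda>s. papply g s \<in> X) (char_filter \<omega>)"
    by (rule eventually_cong[OF eventually_dom m])
  finally show "translate_character g \<omega> X \<longleftrightarrow> eventually (\<lambda>s. papply g s \<in> X) (char_filter \<omega>)" .
  assume "\<not> translate_character g \<omega> X"
  then have "eventually (\<lambda>s. s \<notin> g\<inverse> `` X) (char_filter \<omega>)"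
    using assms eventually_mem_ideal(2)[OF w hull_preimage_in_J[OF g assms]]
    by (simp add: translate_character_def)
  with eventually_dom show "eventually (\<lambda>s. papply g s \<notin> X) (char_filter \<omega>)"
    by eventually_elim (simp add: m)
qed

lemma translate_in_Omega: "translate_character g \<omega> \<in> Omega"
proof (rule Omega_filter_iff[where A = "filtermap (papply g) (char_filter \<omega>)"])
  show "translate_character g \<omega> \<in> \<J> \<rightarrow>\<^sub>E UNIV" by (simp add: translate_character_def)
qed (use char_filter_ne_bot[OF w] translate_character_eventually in
    \<open>auto simp: filtermap_bot_iff eventually_filtermap\<close>)

text \<open>Allows any statement holding eventually at the range character to be pulled back to the
  source character.\<close>

lemma filterlim_translate:
  "filterlim (papply g) (char_filter (translate_character g \<omega>)) (char_filter \<omega>)"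
  unfolding filterlim_iff
proof (intro allI impI)
  fix P assume "eventually P (char_filter (translate_character g \<omega>))"
  then obtain X F where XF: "X \<in> \<J>" "finite F" "F \<subseteq> \<J>"
     "translate_character g \<omega> X" "\<forall>Y\<in>F. \<not> translate_character g \<omega> Y" "\<forall>s\<in>X - \<Union>F. P s"
    using eventually_char_filter[OF Omega_subset[OF translate_in_Omega]] by auto
  then have "eventually (\<lambda>s. \<forall>Y\<in>F. papply g s \<notin> Y) (char_filter \<omega>)"
    by (intro eventually_ball_finite ballI translate_character_eventually) auto
  moreover have "eventually (\<lambda>s. papply g s \<in> X) (char_filter \<omega>)"
    using XF translate_character_eventually by auto
  ultimately show "eventually (\<lambda>s. P (papply g s)) (char_filter \<omega>)"
    by eventually_elim (use XF in auto)
qed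

lemma translate_range: "translate_character g \<omega> (Domain (g\<inverse>))"
proof -
  have "g\<inverse> `` (Domain (g\<inverse>)) = Domain g" by auto
  then show ?thesis
    using wg pdom_in_J[OF left_inverse_hull.inverse[OF g]] by (simp add: translate_character_def)
qed

end

lemma translate_compose:
  assumes "g \<in> left_inverse_hull" "h \<in> left_inverse_hull"
  shows "translate_character (pcomp g h) \<omega> = translate_character g (translate_character h \<omega>)"
  using assms by (auto simp: translate_character_def fun_eq_iff hull_preimage_in_J converse_relcomp relcomp_Image)

lemma translate_Domain_compose:
  assumes "g \<in> left_inverse_hull" "h \<in> left_inverse_hull"
  shows "translate_character h \<omega> (Domain g) \<longleftrightarrow> \<omega> (Domain (pcomp g h))"
proof -
  have "h\<inverse> `` Domain g = Domain (pcomp g h)" by auto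
  then show ?thesis using pdom_in_J[OF assms(1)] by (simp add: translate_character_def)
qed

lemma translate_pid: "\<omega> \<in> Omega \<Longrightarrow> X \<in> \<J> \<Longrightarrow> \<omega> X \<Longrightarrow> translate_character (pid X) \<omega> = \<omega>"
  using Omega_subset[of \<omega>]
  by (intro extensionalityI[of _ \<J>])
    (auto simp: translate_character_def characters_def PiE_def Int_commute)

lemma translate_inverse:
  assumes "g \<in> left_inverse_hull" "\<omega> \<in> Omega" "\<omega> (Domain g)"
  shows "translate_character (g\<inverse>) (translate_character g \<omega>) = \<omega>"
proof -
  have "pcomp (g\<inverse>) g = pid (Domain g)"
    using hull_functional[OF assms(1)] by (auto simp: Id_on_iff)
  then show ?thesis
    using assms translate_pid[OF assms(2) pdom_in_J[OF assms(1)]]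
    by (metis translate_compose left_inverse_hull.inverse)
qed

lemma translate_point:
  assumes "g \<in> left_inverse_hull" "(s, t) \<in> g"
  shows "translate_character g (point_character s) = point_character t"
  using assms hull_functional[OF assms(1)]
  by (auto simp: translate_character_def point_character_def fun_eq_iff hull_preimage_in_J)

lemma eventually_translate_cylinder:
  assumes "g \<in> left_inverse_hull" "X \<in> \<J>" "finite F" "F \<subseteq> \<J>"
  shows "{\<omega> \<in> Omega. \<omega> (Domain g) \<and> translate_character g \<omega> \<in> cylinder X F} =
    cylinder (g\<inverse> `` X) ((\<lambda>Y. g\<inverse> `` Y) ` F)"
proof -
  have "\<omega> (Domain g)" if "\<omega> \<in> Omega" "\<omega> (g\<inverse> `` X)" for \<omega>
    using that assms by (intro character_mono[OF Omega_subset, of \<omega> "g\<inverse> `` X" "Domain g"] hull_preimage_in_J pdom_in_J) auto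
  then show ?thesis
    using assms translate_in_Omega[OF assms(1)] by (auto simp: cylinder_def translate_character_def)
qed

section \<open>The boundary\<close>

lemma ideal_filterD:
  assumes "ideal_filter \<F>"
  shows "X \<in> \<F> \<Longrightarrow> X \<in> \<J>" "X \<in> \<F> \<Longrightarrow> X \<noteq> {}" "X \<in> \<F> \<Longrightarrow> Y \<in> \<F> \<Longrightarrow> X \<inter> Y \<in> \<F>"
    "X \<in> \<F> \<Longrightarrow> Y \<in> \<J> \<Longrightarrow> X \<subseteq> Y \<Longrightarrow> Y \<in> \<F>"
  using assms by (auto simp: ideal_filter_def)

lemma ideal_filter_UNIV: "ideal_filter \<F> \<Longrightarrow> UNIV \<in> \<F>"
  using UNIV_in_constructible_ideals unfolding ideal_filter_def by blast

text \<open>If \<open>Y\<close> met every member, the ideals containing some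
  \<open>Z \<inter> Y\<close> would form a filter extending the given one and containing
  \<open>Y\<close>, against maximality.\<close>

lemma maximal_filter_avoid:
  assumes "maximal_ideal_filter \<F>" "Y \<in> \<J>" "Y \<notin> \<F>"
  shows "\<exists>Z\<in>\<F>. Z \<inter> Y = {}"
proof (rule ccontr)
  assume ne: "\<not> (\<exists>Z\<in>\<F>. Z \<inter> Y = {})"
  have f: "ideal_filter \<F>" and sub: "\<F> \<subseteq> \<J>"
    using assms(1) by (auto simp: maximal_ideal_filter_def ideal_filter_def)
  define \<G> where "\<G> = {W \<in> \<J>. \<exists>Z\<in>\<F>. Z \<inter> Y \<subseteq> W}"
  have "ideal_filter \<G>"
    unfolding ideal_filter_def
  proof (intro conjI ballI impI)
    show "\<G> \<noteq> {}" using assms ideal_filter_UNIV[OF f] by (auto simp: \<G>_def)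
    show "{} \<notin> \<G>" using ne by (auto simp: \<G>_def)
    fix V W assume "V \<in> \<G>" "W \<in> \<G>"
    then obtain A B where AB: "A \<in> \<F>" "B \<in> \<F>" "A \<inter> Y \<subseteq> V" "B \<inter> Y \<subseteq> W" "V \<in> \<J>" "W \<in> \<J>"
      by (auto simp: \<G>_def)
    then have "A \<inter> B \<in> \<F>" using f by (auto simp: ideal_filter_def)
    then show "V \<inter> W \<in> \<G>" using AB by (auto simp: \<G>_def constructible_ideals_Int intro!: bexI[of _ "A \<inter> B"])
  qed (auto simp: \<G>_def)
  moreover have "\<F> \<subseteq> \<G>" using sub by (auto simp: \<G>_def)
  ultimately have "\<G> = \<F>" using assms(1) by (auto simp: maximal_ideal_filter_def)
  moreover have "Y \<in> \<G>" using assms ideal_filter_UNIV[OF f] by (auto simp: \<G>_def)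
  ultimately show False using assms by simp
qed

lemma maximal_filter_avoid_finite:
  assumes "maximal_ideal_filter \<F>" "X \<in> \<F>"
  shows "finite F \<Longrightarrow> F \<subseteq> \<J> \<Longrightarrow> \<forall>Y\<in>F. Y \<notin> \<F> \<Longrightarrow> \<exists>Z\<in>\<F>. Z \<subseteq> X \<and> (\<forall>Y\<in>F. Z \<inter> Y = {})"
proof (induction F rule: finite_induct)
  case (insert Y F)
  then obtain Z where Z: "Z \<in> \<F>" "Z \<subseteq> X" "\<forall>Y\<in>F. Z \<inter> Y = {}" by auto
  obtain Z' where Z': "Z' \<in> \<F>" "Z' \<inter> Y = {}" using maximal_filter_avoid[OF assms(1), of Y] insert by auto
  have "Z \<inter> Z' \<in> \<F>" using Z Z' assms(1) by (auto simp: maximal_ideal_filter_def ideal_filter_def)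
  then show ?case using Z Z' by (intro bexI[of _ "Z \<inter> Z'"]) auto
qed (use assms in auto)

text \<open>A member of the filter that misses finitely many excluded ideals is a nonempty subset of
  \<open>X - \<Union>F\<close>, so the criterion \<open>Omega_iff\<close> holds automatically for
  maximal filters.\<close>

lemma maximal_filter_character:
  assumes "maximal_ideal_filter \<F>"
  shows "(\<lambda>X\<in>\<J>. X \<in> \<F>) \<in> Omega_max"
proof -
  have f: "ideal_filter \<F>" and sub: "\<F> \<subseteq> \<J>"
    using assms(1) by (auto simp: maximal_ideal_filter_def ideal_filter_def)
  have inter: "X \<inter> Y \<in> \<F> \<longleftrightarrow> X \<in> \<F> \<and> Y \<in> \<F>" if "X \<in> \<J>" "Y \<in> \<J>" for X Y
  proof
    assume "X \<inter> Y \<in> \<F>"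
    then show "X \<in> \<F> \<and> Y \<in> \<F>" using f that unfolding ideal_filter_def by (meson inf_le1 inf_le2)
  qed (use f in \<open>auto simp: ideal_filter_def\<close>)
  have "(\<lambda>X\<in>\<J>. X \<in> \<F>) \<in> Omega"
    unfolding Omega_iff
  proof (intro conjI allI impI)
    show "(\<lambda>X\<in>\<J>. X \<in> \<F>) \<in> characters"
      unfolding characters_def
      using UNIV_in_constructible_ideals ideal_filter_UNIV[OF f]
      by (auto simp: constructible_ideals_Int inter)
    fix X F assume *: "X \<in> \<J> \<and> finite F \<and> F \<subseteq> \<J> \<and> (\<lambda>X\<in>\<J>. X \<in> \<F>) X \<and> (\<forall>Y\<in>F. \<not> (\<lambda>X\<in>\<J>. X \<in> \<F>) Y)"
    then have "\<forall>Y\<in>F. Y \<notin> \<F>" by (auto simp: subset_iff split: if_splits)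
    with * obtain Z where Z: "Z \<in> \<F>" "Z \<subseteq> X" "\<forall>Y\<in>F. Z \<inter> Y = {}"
      using maximal_filter_avoid_finite[OF assms, of X F] by auto
    have "Z \<noteq> {}" using f Z by (auto simp: ideal_filter_def)
    then show "X - \<Union>F \<noteq> {}" using Z by blast
  qed
  moreover have "{X \<in> \<J>. (\<lambda>X\<in>\<J>. X \<in> \<F>) X} = \<F>" using sub by auto
  ultimately show ?thesis using assms by (simp add: Omega_max_def)
qed

text \<open>Zorn's lemma for the filters containing \<open>Z\<close>; the ideals above
  \<open>Z\<close> form one of them.\<close>

lemma exists_Omega_max:
  assumes "Z \<in> \<J>" "Z \<noteq> {}"
  shows "\<exists>\<omega>\<in>Omega_max. \<omega> Z"
proof -
  define \<A> where "\<A> = {\<F>. ideal_filter \<F> \<and> Z \<in> \<F>}"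
  have "ideal_filter {W \<in> \<J>. Z \<subseteq> W}"
    using assms UNIV_in_constructible_ideals by (auto simp: ideal_filter_def constructible_ideals_Int)
  then have ne: "\<A> \<noteq> {}" using assms by (auto simp: \<A>_def)
  have "\<exists>M\<in>\<A>. \<forall>X\<in>\<A>. M \<subseteq> X \<longrightarrow> X = M"
  proof (rule subset_Zorn_nonempty[OF ne])
    fix \<C> assume C: "\<C> \<noteq> {}" "subset.chain \<A> \<C>"
    have sub: "\<And>\<F>. \<F> \<in> \<C> \<Longrightarrow> ideal_filter \<F> \<and> Z \<in> \<F>"
      using C by (auto simp: subset.chain_def \<A>_def)
    have "ideal_filter (\<Union>\<C>)"
      unfolding ideal_filter_def
    proof (intro conjI ballI impI)
      fix X Y assume "X \<in> \<Union>\<C>" "Y \<in> \<Union>\<C>"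
      then obtain \<F> \<G> where FG: "X \<in> \<F>" "Y \<in> \<G>" "\<F> \<in> \<C>" "\<G> \<in> \<C>" by auto
      then consider "\<F> \<subseteq> \<G>" | "\<G> \<subseteq> \<F>" using C by (auto simp: subset_chain_def)
      then show "X \<inter> Y \<in> \<Union>\<C>"
      proof cases
        case 1
        then have "X \<inter> Y \<in> \<G>" using FG sub[of \<G>] by (intro ideal_filterD(3)) auto
        then show ?thesis using FG by auto
      next
        case 2
        then have "X \<inter> Y \<in> \<F>" using FG sub[of \<F>] by (intro ideal_filterD(3)) auto
        then show ?thesis using FG by auto
      qed
    next
      fix X Y assume "X \<in> \<Union>\<C>" "Y \<in> \<J>" "X \<subseteq> Y"
      then show "Y \<in> \<Union>\<C>" using sub by (meson UnionE UnionI ideal_filterD(4))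
    next
      show "\<Union>\<C> \<noteq> {}" using sub C by auto
      show "\<Union>\<C> \<subseteq> \<J>" using sub ideal_filterD(1) by blast
      show "{} \<notin> \<Union>\<C>" using sub ideal_filterD(2) by blast
    qed
    then show "\<Union>\<C> \<in> \<A>" using sub C by (auto simp: \<A>_def)
  qed
  then obtain \<F> where F: "\<F> \<in> \<A>" "\<forall>X\<in>\<A>. \<F> \<subseteq> X \<longrightarrow> X = \<F>" by blast
  have "maximal_ideal_filter \<F>"
    using F by (auto simp: maximal_ideal_filter_def \<A>_def)
  then show ?thesis
    using maximal_filter_character[of \<F>] F assms by (intro bexI[of _ "\<lambda>X\<in>\<J>. X \<in> \<F>"]) (auto simp: \<A>_def)
qed

text \<open>Turns a closure into a condition on ideals. A maximal character in the cylinder supplies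
  the ideal \<open>Z\<close> by \<open>maximal_filter_avoid_finite\<close>; conversely every maximal
  character with value 1 at such a \<open>Z\<close> lies in the cylinder.\<close>

lemma boundary_iff:
  "\<omega> \<in> boundary_Omega \<longleftrightarrow> \<omega> \<in> Omega \<and> (\<forall>X F. X \<in> \<J> \<and> finite F \<and> F \<subseteq> \<J> \<and> \<omega> \<in> cylinder X F \<longrightarrow>
     (\<exists>Z\<in>\<J>. Z \<noteq> {} \<and> Z \<subseteq> X \<and> (\<forall>Y\<in>F. Z \<inter> Y = {})))" (is "?l \<longleftrightarrow> ?r")
proof
  assume l: ?l
  show ?r
  proof (intro conjI allI impI)
    show "\<omega> \<in> Omega" using l by (simp add: boundary_Omega_def in_closure_of topspace_Omega)
    fix X F assume XF: "X \<in> \<J> \<and> finite F \<and> F \<subseteq> \<J> \<and> \<omega> \<in> cylinder X F"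
    then have "openin Omega_topology (cylinder X F)" by (simp add: openin_cylinder)
    with XF l obtain \<eta> where e: "\<eta> \<in> Omega_max" "\<eta> \<in> cylinder X F"
      unfolding boundary_Omega_def in_closure_of by blast
    then have m: "maximal_ideal_filter {X \<in> \<J>. \<eta> X}" by (simp add: Omega_max_def)
    have "\<exists>Z\<in>{X \<in> \<J>. \<eta> X}. Z \<subseteq> X \<and> (\<forall>Y\<in>F. Z \<inter> Y = {})"
      by (rule maximal_filter_avoid_finite[OF m]) (use XF e in \<open>auto simp: cylinder_def\<close>)
    then obtain Z where Z: "Z \<in> \<J>" "\<eta> Z" "Z \<subseteq> X \<and> (\<forall>Y\<in>F. Z \<inter> Y = {})" by auto
    moreover have "Z \<noteq> {}" using Z Omega_empty[of \<eta>] e by (auto simp: Omega_max_def)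
    ultimately show "\<exists>Z\<in>\<J>. Z \<noteq> {} \<and> Z \<subseteq> X \<and> (\<forall>Y\<in>F. Z \<inter> Y = {})" by auto
  qed
next
  assume r: ?r
  show ?l
    unfolding boundary_Omega_def in_closure_of topspace_Omega
  proof (intro conjI allI impI)
    fix T assume T: "\<omega> \<in> T \<and> openin Omega_topology T"
    then obtain X F where XF: "X \<in> \<J>" "finite F" "F \<subseteq> \<J>" "\<omega> \<in> cylinder X F" "cylinder X F \<subseteq> T"
      unfolding openin_Omega by blast
    then obtain Z where Z: "Z \<in> \<J>" "Z \<noteq> {}" "Z \<subseteq> X" "\<forall>Y\<in>F. Z \<inter> Y = {}" using r by blast
    obtain \<eta> where e: "\<eta> \<in> Omega_max" "\<eta> Z" using exists_Omega_max[OF Z(1,2)] by auto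
    have eo: "\<eta> \<in> Omega" using e by (simp add: Omega_max_def)
    have "\<eta> X" using character_mono[OF Omega_subset[OF eo] Z(1) XF(1) Z(3) e(2)] .
    moreover have "\<not> \<eta> Y" if "Y \<in> F" for Y
    proof
      assume "\<eta> Y"
      moreover have Y: "Y \<in> \<J>" using that XF by auto
      ultimately have "\<eta> (Z \<inter> Y)" using character_Int[OF Omega_subset[OF eo] Z(1) Y] e by simp
      moreover have "Z \<inter> Y = {}" using that Z by auto
      ultimately show False using Omega_empty[OF eo] constructible_ideals_Int[OF Z(1) Y] by simp
    qed
    ultimately have "\<eta> \<in> cylinder X F" using eo by (simp add: cylinder_def)
    then show "\<exists>y. y \<in> Omega_max \<and> y \<in> T" using XF e by auto
  qed (use r in auto)
qed

lemma boundaryE: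
  assumes "\<omega> \<in> boundary_Omega" "X \<in> \<J>" "finite F" "F \<subseteq> \<J>" "\<omega> \<in> cylinder X F"
  obtains Z where "Z \<in> \<J>" "Z \<noteq> {}" "Z \<subseteq> X" "\<And>Y. Y \<in> F \<Longrightarrow> Z \<inter> Y = {}"
  using assms unfolding boundary_iff by (elim conjE allE[of _ X] allE[of _ F]) (simp, metis)

lemma boundary_subset: "\<omega> \<in> boundary_Omega \<Longrightarrow> \<omega> \<in> Omega" by (simp add: boundary_iff)

lemma closedin_boundary: "closedin Omega_topology boundary_Omega"
  by (simp add: boundary_Omega_def)

lemma translate_boundary:
  assumes "g \<in> left_inverse_hull" "\<omega> \<in> boundary_Omega" "\<omega> (Domain g)"
  shows "translate_character g \<omega> \<in> boundary_Omega"
  unfolding boundary_iff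
proof (intro conjI allI impI)
  have w: "\<omega> \<in> Omega" using assms boundary_subset by auto
  show t: "translate_character g \<omega> \<in> Omega" by (rule translate_in_Omega[OF assms(1) w assms(3)])
  fix X F assume XF: "X \<in> \<J> \<and> finite F \<and> F \<subseteq> \<J> \<and> translate_character g \<omega> \<in> cylinder X F"
  have "\<omega> \<in> cylinder (g\<inverse> `` X) ((\<lambda>Y. g\<inverse> `` Y) ` F)"
    using eventually_translate_cylinder[of g X F] assms XF w by auto
  moreover have "g\<inverse> `` X \<in> \<J>" "finite ((\<lambda>Y. g\<inverse> `` Y) ` F)" "(\<lambda>Y. g\<inverse> `` Y) ` F \<subseteq> \<J>"
    using XF assms hull_preimage_in_J by auto
  ultimately obtain Z where Z: "Z \<in> \<J>" "Z \<noteq> {}" "Z \<subseteq> g\<inverse> `` X" "\<And>Y. Y \<in> (\<lambda>Y. g\<inverse> `` Y) ` F \<Longrightarrow> Z \<inter> Y = {}"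
    using boundaryE[OF assms(2), of "g\<inverse> `` X" "(\<lambda>Y. g\<inverse> `` Y) ` F"] by metis
  show "\<exists>Z\<in>\<J>. Z \<noteq> {} \<and> Z \<subseteq> X \<and> (\<forall>Y\<in>F. Z \<inter> Y = {})"
  proof (intro bexI[of _ "g `` Z"] conjI ballI)
    show "g `` Z \<in> \<J>" by (rule hull_image_in_J[OF assms(1) Z(1)])
    show "g `` Z \<noteq> {}" using Z by blast
    show "g `` Z \<subseteq> X" using Z(3) hull_functional(1)[OF assms(1)] by blast
    show "g `` Z \<inter> Y = {}" if "Y \<in> F" for Y using Z(4)[of "g\<inverse> `` Y"] that by blast
  qed
qed

lemma translate_boundary_iff:
  assumes "g \<in> left_inverse_hull" "\<omega> \<in> Omega" "\<omega> (Domain g)"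
  shows "translate_character g \<omega> \<in> boundary_Omega \<longleftrightarrow> \<omega> \<in> boundary_Omega"
  using translate_boundary[of g \<omega>] translate_boundary[of "g\<inverse>" "translate_character g \<omega>"]
    translate_range[OF assms] translate_inverse[OF assms] left_inverse_hull.inverse[OF assms(1)] assms
  by auto

section \<open>Foundation sets and generic points\<close>

lemma character_extension_eventually:
  assumes "\<omega> \<in> Omega" "Z \<in> \<J>\<^sub>d"
  shows "character_extension \<omega> Z \<longleftrightarrow> eventually (\<lambda>s. s \<in> Z) (char_filter \<omega>)"
proof
  assume "character_extension \<omega> Z"
  then obtain X F where XF: "X \<in> \<J>" "finite F" "F \<subseteq> \<J>" "Z = X - \<Union>F" "\<omega> X" "\<forall>Y\<in>F. \<not> \<omega> Y"
    by (auto simp: character_extension_def)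
  then show "eventually (\<lambda>s. s \<in> Z) (char_filter \<omega>)"
    using eventually_char_filter[OF Omega_subset[OF assms(1)]] by blast
next
  assume e: "eventually (\<lambda>s. s \<in> Z) (char_filter \<omega>)"
  have "\<exists>X F. X \<in> \<J> \<and> finite F \<and> F \<subseteq> \<J> \<and> Z = X - \<Union>F"
  proof (cases "Z \<in> \<J>")
    case True
    then show ?thesis by (intro exI[of _ Z] exI[of _ "{}"]) simp
  qed (use assms in \<open>auto simp: constructible_differences_def\<close>)
  then obtain X F where XF: "X \<in> \<J>" "finite F" "F \<subseteq> \<J>" "Z = X - \<Union>F" by blast
  have "eventually (\<lambda>s. s \<in> X) (char_filter \<omega>)" using e XF by (auto elim: eventually_mono)
  then have "\<omega> X" using eventually_mem_ideal(1)[OF assms(1)] XF by auto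
  moreover have "\<not> \<omega> Y" if "Y \<in> F" for Y
  proof
    assume "\<omega> Y"
    then have "eventually (\<lambda>s. s \<in> Y) (char_filter \<omega>)" using eventually_mem_ideal(1)[OF assms(1)] XF that by auto
    with e have "eventually (\<lambda>s. False) (char_filter \<omega>)" by eventually_elim (use XF that in auto)
    then show False using char_filter_ne_bot[OF assms(1)] by (simp add: trivial_limit_def)
  qed
  ultimately show "character_extension \<omega> Z" using XF unfolding character_extension_def by blast
qed

text \<open>Suppose no member holds eventually. Intersecting \<open>X\<close> with, and removing
  from it, finitely many suitable ideals gives a neighbourhood of the character that avoids all
  members. By \<open>boundary_iff\<close> it contains a nonempty ideal, which contradicts the
  foundation property.\<close>

lemma foundation_set_boundary:
  assumes "\<omega> \<in> boundary_Omega" "foundation_set F X" "X \<in> \<J>" "\<omega> X"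
  shows "\<exists>Z\<in>F. eventually (\<lambda>s. s \<in> Z) (char_filter \<omega>)"
proof (rule ccontr)
  assume "\<not> ?thesis"
  then have none: "\<not> character_extension \<omega> Z" if "Z \<in> F" for Z
    using that assms(2) character_extension_eventually[OF boundary_subset[OF assms(1)]]
    by (auto simp: foundation_set_def)
  have w: "\<omega> \<in> characters" using assms(1) boundary_subset Omega_subset by auto
  \<comment> \<open>One ideal per member suffices. For \<open>Z = W - \<Union>G\<close>, if the
    character is 0 at \<open>W\<close> then \<open>W\<close> contains \<open>Z\<close>; otherwise
    some \<open>Y\<close> in \<open>G\<close> has value 1 and is disjoint from
    \<open>Z\<close>.\<close>
  have "\<exists>A. A \<in> \<J> \<and> (if \<omega> A then Z \<inter> A = {} else Z \<subseteq> A)" if ZF: "Z \<in> F" for Z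
  proof -
    have "Z \<in> \<J>\<^sub>d" using ZF assms(2) by (auto simp: foundation_set_def)
    then consider "Z \<in> \<J>" | W G where "W \<in> \<J>" "finite G" "G \<subseteq> \<J>" "Z = W - \<Union>G"
      by (auto simp: constructible_differences_def)
    then show ?thesis
    proof cases
      case 1
      have "\<not> \<omega> Z"
      proof
        assume "\<omega> Z"
        then have "character_extension \<omega> Z"
          unfolding character_extension_def using 1 by (intro exI[of _ Z] exI[of _ "{}"]) auto
        then show False using none[OF ZF] by simp
      qed
      then show ?thesis using 1 by auto
    next
      case 2
      show ?thesis
      proof (cases "\<omega> W")
        case True
        then obtain Y where "Y \<in> G" "\<omega> Y"
          using none[OF ZF] 2 unfolding character_extension_def by blast
        then show ?thesis using 2 by (intro exI[of _ Y]) auto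
      qed (use 2 in auto)
    qed
  qed
  then obtain A where A: "\<And>Z. Z \<in> F \<Longrightarrow> A Z \<in> \<J>" "\<And>Z. Z \<in> F \<Longrightarrow> if \<omega> (A Z) then Z \<inter> A Z = {} else Z \<subseteq> A Z"
    by metis
  have finF: "finite F" using assms(2) by (simp add: foundation_set_def)
  define X' where "X' = X \<inter> \<Inter>(A ` {Z \<in> F. \<omega> (A Z)})"
  define F' where "F' = A ` {Z \<in> F. \<not> \<omega> (A Z)}"
  have sub: "finite (A ` {Z \<in> F. \<omega> (A Z)})" "(A ` {Z \<in> F. \<omega> (A Z)}) \<subseteq> \<J>" "finite F'" "F' \<subseteq> \<J>"
    using finF A by (auto simp: F'_def)
  have X': "X' \<in> \<J>" unfolding X'_def by (intro constructible_ideals_Int assms J_Inter sub)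
  have "\<omega> X'" unfolding X'_def
    using sub assms J_Inter[OF sub(1,2)] by (auto simp: character_Int[OF w] character_Inter[OF w])
  then have "\<omega> \<in> cylinder X' F'" using assms boundary_subset by (auto simp: cylinder_def F'_def)
  then obtain V where V: "V \<in> \<J>" "V \<noteq> {}" "V \<subseteq> X'" "\<And>Y. Y \<in> F' \<Longrightarrow> V \<inter> Y = {}"
    using boundaryE[OF assms(1) X' sub(3,4)] by metis
  then have "V \<subseteq> X" by (auto simp: X'_def)
  have "\<forall>Y\<in>\<J>. Y \<noteq> {} \<and> Y \<subseteq> X \<longrightarrow> (\<exists>Z\<in>F. Y \<inter> Z \<noteq> {})"
    using assms(2) by (simp add: foundation_set_def)
  from bspec[OF this V(1)] obtain Z where Z: "Z \<in> F" "V \<inter> Z \<noteq> {}"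
    using V(2) \<open>V \<subseteq> X\<close> by blast
  show False
  proof (cases "\<omega> (A Z)")
    case True
    then have "V \<subseteq> A Z" "Z \<inter> A Z = {}" using V(3) Z A(2)[OF Z(1)] by (auto simp: X'_def)
    then show False using Z by auto
  next
    case False
    then have "V \<inter> A Z = {}" using V(4)[of "A Z"] Z unfolding F'_def by blast
    moreover have "Z \<subseteq> A Z" using False A(2)[OF Z(1)] by simp
    ultimately show False using Z by auto
  qed
qed

text \<open>The negated criterion of \<open>boundary_iff\<close> says that \<open>F\<close> meets
  every nonempty ideal inside \<open>X\<close>. Cutting its members down to \<open>X\<close> yields
  a foundation set, nonempty because \<open>X\<close> itself is such an ideal.\<close>

lemma off_boundary_foundation:
  assumes "\<omega> \<in> Omega" "\<omega> \<notin> boundary_Omega"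
  obtains X F where "X \<in> \<J>" "finite F" "F \<subseteq> \<J>" "F \<noteq> {}" "foundation_set F X" "\<omega> \<in> cylinder X F"
proof -
  obtain X F where XF: "X \<in> \<J>" "finite F" "F \<subseteq> \<J>" "\<omega> \<in> cylinder X F"
    "\<not> (\<exists>Z\<in>\<J>. Z \<noteq> {} \<and> Z \<subseteq> X \<and> (\<forall>Y\<in>F. Z \<inter> Y = {}))"
    using assms unfolding boundary_iff by blast
  let ?F = "(\<lambda>Y. Y \<inter> X) ` F"
  have wX: "\<omega> X" using XF by (auto simp: cylinder_def)
  have "X \<noteq> {}" using Omega_empty[OF assms(1)] wX XF by auto
  then have ne: "F \<noteq> {}" using XF by auto
  have sub: "?F \<subseteq> \<J>" using XF constructible_ideals_Int by blast
  show thesis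
  proof (rule that[of X ?F])
    show "foundation_set ?F X"
      unfolding foundation_set_def
    proof (intro conjI ballI impI)
      show "?F \<subseteq> \<J>\<^sub>d" "X \<in> \<J>\<^sub>d" using sub XF by (auto simp: constructible_differences_def)
      fix Y assume Y: "Y \<in> \<J>" "Y \<noteq> {} \<and> Y \<subseteq> X"
      then obtain Z where "Z \<in> F" "Y \<inter> Z \<noteq> {}" using XF(5) by blast
      then have "Z \<inter> X \<in> ?F" "Y \<inter> (Z \<inter> X) \<noteq> {}" using Y by auto
      then show "\<exists>Z\<in>?F. Y \<inter> Z \<noteq> {}" by (rule bexI[rotated])
    qed (use XF in auto)
    show "\<omega> \<in> cylinder X ?F"
    proof -
      have "\<not> \<omega> (Y \<inter> X)" if "Y \<in> F" for Y
      proof -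
        have "Y \<in> \<J>" "\<not> \<omega> Y" using XF that by (auto simp: cylinder_def)
        then show ?thesis using XF(1) character_Int[OF Omega_subset[OF assms(1)], of Y X] by simp
      qed
      then show ?thesis using wX assms by (auto simp: cylinder_def)
    qed
  qed (use XF ne sub in auto)
qed

text \<open>C*-regularity on the boundary provides points near a boundary character that are moved by
  every element of the hull whose germ there is not a unit.\<close>

lemma generic_point:
  assumes reg: "cstar_regular_on_boundary TYPE('s::left_cancel_monoid)"
    and \<omega>: "(\<omega> :: 's set \<Rightarrow> bool) \<in> boundary_Omega"
    and H: "finite H" "H \<subseteq> left_inverse_hull"
    and moved: "\<And>h. h \<in> H \<Longrightarrow> \<not> eventually (\<lambda>s. (s, s) \<in> h) (char_filter \<omega>)"
    and P: "eventually P (char_filter \<omega>)"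
  shows "\<exists>s. P s \<and> (\<forall>h\<in>H. (s, s) \<notin> h)"
proof (rule ccontr)
  assume no: "\<not> ?thesis"
  have w: "\<omega> \<in> Omega" using \<omega> boundary_subset by auto
  obtain X F where XF: "X \<in> \<J>" "finite F" "F \<subseteq> \<J>" "\<omega> X" "\<forall>Y\<in>F. \<not> \<omega> Y" "\<forall>s\<in>X - \<Union>F. P s"
    using P unfolding eventually_char_filter[OF Omega_subset[OF w]] by blast
  \<comment> \<open>Regularity is stated for subideals of \<open>X\<close>; intersecting with
    \<open>X\<close> does not change the difference.\<close>
  let ?F = "(\<lambda>Y. Y \<inter> X) ` F"
  have dif: "X - \<Union>?F = X - \<Union>F" by auto
  have sub: "?F \<subseteq> \<J>" using XF constructible_ideals_Int by blast
  have "X - \<Union>F \<noteq> {}" by (rule Omega_nonempty[OF w XF(1-5)])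
  moreover have "X - \<Union>F \<subseteq> (\<Union>h\<in>H. {s. (s, s) \<in> h})"
  proof
    fix s assume "s \<in> X - \<Union>F"
    then have "P s" using XF(6) by blast
    then show "s \<in> (\<Union>h\<in>H. {s. (s, s) \<in> h})" using no by auto
  qed
  ultimately have "\<exists>E. finite E \<and> E \<subseteq> \<J>\<^sub>d \<and> (\<forall>Y\<in>E. \<exists>h\<in>H. pcomp h (pid Y) = pid Y) \<and> foundation_set (?F \<union> E) X"
    using reg H XF(1,2) sub unfolding cstar_regular_on_boundary_def
    by (elim allE[of _ H] allE[of _ X] allE[of _ ?F]) (simp only: dif, auto)
  then obtain E where E: "\<forall>Y\<in>E. \<exists>h\<in>H. pcomp h (pid Y) = pid Y" "foundation_set (?F \<union> E) X" by blast
  \<comment> \<open>Members of \<open>?F\<close> have value 0 at the character, so the member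
    holding eventually comes from \<open>E\<close> and is fixed pointwise by some
    \<open>h\<close>.\<close>
  obtain Z where Z: "Z \<in> ?F \<union> E" "eventually (\<lambda>s. s \<in> Z) (char_filter \<omega>)"
    using foundation_set_boundary[OF \<omega> E(2) XF(1,4)] by blast
  show False
  proof (cases "Z \<in> ?F")
    case True
    then obtain Y where Y: "Y \<in> F" "Z = Y \<inter> X" by auto
    then have "eventually (\<lambda>s. s \<in> Y) (char_filter \<omega>)" using Z(2) by (auto elim: eventually_mono)
    then show False using eventually_mem_ideal(1)[OF w, of Y] XF Y by auto
  next
    case False
    then obtain h where h: "h \<in> H" "pcomp h (pid Z) = pid Z" using E(1) Z by auto
    have "(s, s) \<in> h" if "s \<in> Z" for s
    proof -
      have "(s, s) \<in> pcomp h (pid Z)" using h(2) that by (simp add: Id_onI)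
      then show ?thesis by auto
    qed
    then have "eventually (\<lambda>s. (s, s) \<in> h) (char_filter \<omega>)" using Z(2) by (rule eventually_mono[rotated])
    then show False using moved[OF h(1)] by simp
  qed
qed

section \<open>Arrows, products and topology of the germ groupoid\<close>

section \<open>Germs\<close>

text \<open>Images of singletons are compared instead of values, so agreement includes agreement on
  where the maps are undefined.\<close>

definition near :: "('s::left_cancel_monoid set \<Rightarrow> bool) \<Rightarrow> 's rel \<Rightarrow> 's rel \<Rightarrow> bool" where
  "near \<omega> g h \<longleftrightarrow> eventually (\<lambda>s. g `` {s} = h `` {s}) (char_filter \<omega>)"

lemma near_refl [simp]: "near \<omega> g g" by (simp add: near_def)

lemma near_sym: "near \<omega> g h \<Longrightarrow> near \<omega> h g"
  unfolding near_def by (simp only: eq_commute)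

lemma near_trans:
  assumes "near \<omega> g h" "near \<omega> h k"
  shows "near \<omega> g k"
  using assms unfolding near_def by eventually_elim simp

lemma prestrict_eq_iff: "prestrict g A = prestrict h A \<longleftrightarrow> (\<forall>s\<in>A. g `` {s} = h `` {s})"
proof -
  have *: "(s, t) \<in> prestrict k A \<longleftrightarrow> s \<in> A \<and> (s, t) \<in> k" for s t and k :: "'a rel" by auto
  show ?thesis unfolding set_eq_iff split_paired_All * Image_singleton_iff by blast
qed

definition dom_set :: "'s::left_cancel_monoid rel \<Rightarrow> ('s set \<Rightarrow> bool) set" where
  "dom_set g = {\<omega> \<in> Omega. \<omega> (Domain g)}"

lemma dom_set_cylinder: "dom_set g = cylinder (Domain g) {}"
  by (auto simp: dom_set_def cylinder_def)

lemma germ_pairs_iff: "(g, \<omega>) \<in> germ_pairs \<longleftrightarrow> g \<in> left_inverse_hull \<and> \<omega> \<in> dom_set g"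
  by (auto simp: germ_pairs_def dom_set_def)

lemma dom_set_Omega: "\<omega> \<in> dom_set g \<Longrightarrow> \<omega> \<in> Omega" by (simp add: dom_set_def)

lemma near_dom_set:
  assumes "near \<omega> g h" "g \<in> left_inverse_hull" "h \<in> left_inverse_hull" "\<omega> \<in> dom_set g"
  shows "\<omega> \<in> dom_set h"
proof -
  have w: "\<omega> \<in> Omega" "\<omega> (Domain g)" using assms(4) by (auto simp: dom_set_def)
  have "eventually (\<lambda>s. s \<in> Domain h) (char_filter \<omega>)"
    using assms(1)[unfolded near_def] eventually_dom[OF assms(2) w] by eventually_elim auto
  then show ?thesis using eventually_mem_ideal(1)[OF w(1) pdom_in_J[OF assms(3)]] w by (simp add: dom_set_def)
qed

lemma equiv_germ_relation: "equiv germ_pairs (germ_relation :: (('s::left_cancel_monoid rel \<times> ('s set \<Rightarrow> bool)) \<times> _) set)"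
proof (rule equivI)
  show "germ_relation \<subseteq> germ_pairs \<times> germ_pairs" by (auto simp: germ_relation_def)
  show "refl_on germ_pairs (germ_relation :: (('s rel \<times> ('s set \<Rightarrow> bool)) \<times> _) set)"
    unfolding refl_on_def using pdom_in_J by (fastforce simp: germ_relation_def germ_pairs_def)
  show "sym (germ_relation :: (('s rel \<times> ('s set \<Rightarrow> bool)) \<times> _) set)"
    unfolding sym_def by (fastforce simp: germ_relation_def)
  show "trans (germ_relation :: (('s rel \<times> ('s set \<Rightarrow> bool)) \<times> _) set)"
  proof (rule transI)
    fix x y z :: "'s rel \<times> ('s set \<Rightarrow> bool)"
    assume xy: "(x, y) \<in> germ_relation" "(y, z) \<in> germ_relation"
    obtain g h k \<omega> where e: "x = (g, \<omega>)" "y = (h, \<omega>)" "z = (k, \<omega>)"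
      using xy by (auto simp: germ_relation_def)
    obtain A B where AB: "A \<in> \<J>" "\<omega> A" "prestrict g A = prestrict h A"
      "B \<in> \<J>" "\<omega> B" "prestrict h B = prestrict k B"
      using xy unfolding e by (auto simp: germ_relation_def)
    have w: "\<omega> \<in> Omega" using xy unfolding e by (auto simp: germ_relation_def germ_pairs_def)
    have "A \<inter> B \<in> \<J>" "\<omega> (A \<inter> B)" "prestrict g (A \<inter> B) = prestrict k (A \<inter> B)"
      using AB character_Int[OF Omega_subset[OF w]] unfolding prestrict_eq_iff by (auto simp: constructible_ideals_Int)
    then show "(x, z) \<in> germ_relation" using xy unfolding e by (auto simp: germ_relation_def)
  qed
qed

lemma mem_germ_P:
  assumes "(g, \<omega>) \<in> germ_pairs"
  shows "(h, \<eta>) \<in> germ_P g \<omega> \<longleftrightarrow> \<eta> = \<omega> \<and> (h, \<omega>) \<in> germ_pairs \<and> (\<exists>A\<in>\<J>. \<omega> A \<and> (\<forall>s\<in>A. g `` {s} = h `` {s}))"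
  using assms unfolding germ_P_def germ_relation_def prestrict_eq_iff by auto

lemma germ_P_cases:
  assumes "(g, \<omega>) \<in> germ_pairs" "x \<in> germ_P g \<omega>"
  obtains h A where "x = (h, \<omega>)" "h \<in> left_inverse_hull" "\<omega> \<in> dom_set h"
    "A \<in> \<J>" "\<omega> A" "\<forall>s\<in>A. g `` {s} = h `` {s}"
proof -
  obtain h \<eta> where x: "x = (h, \<eta>)" by (cases x)
  then have "\<eta> = \<omega>" "(h, \<omega>) \<in> germ_pairs" "\<exists>A\<in>\<J>. \<omega> A \<and> (\<forall>s\<in>A. g `` {s} = h `` {s})"
    using assms(2) mem_germ_P[OF assms(1), of h \<eta>] by auto
  then show thesis using that x by (auto simp: germ_pairs_iff)
qed

lemma germ_P_eq_iff:
  assumes "(g, \<omega>) \<in> germ_pairs" "(h, \<eta>) \<in> germ_pairs"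
  shows "germ_P g \<omega> = germ_P h \<eta> \<longleftrightarrow> \<omega> = \<eta> \<and> (\<exists>A\<in>\<J>. \<omega> A \<and> (\<forall>s\<in>A. g `` {s} = h `` {s}))"
  using eq_equiv_class_iff[OF equiv_germ_relation assms] assms
  unfolding germ_P_def germ_relation_def prestrict_eq_iff by auto

lemma self_in_germ_P: "(g, \<omega>) \<in> germ_pairs \<Longrightarrow> (g, \<omega>) \<in> germ_P g \<omega>"
  using equiv_germ_relation unfolding germ_P_def by (rule equiv_class_self)

lemma near_if_ideal:
  assumes "\<omega> \<in> Omega" "A \<in> \<J>" "\<omega> A" "\<forall>s\<in>A. g `` {s} = h `` {s}"
  shows "near \<omega> g h"
proof -
  have "eventually (\<lambda>s. s \<in> A) (char_filter \<omega>)" using eventually_mem_ideal(1) assms by blast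
  then show ?thesis unfolding near_def by eventually_elim (use assms in auto)
qed

text \<open>The differences \<open>X - \<Union>F\<close> on which the extended character is 1 form a
  base of the filter. The second identification of germs is therefore agreement along the
  filter.\<close>

lemma near_iff_difference:
  assumes "\<omega> \<in> Omega"
  shows "near \<omega> g h \<longleftrightarrow> (\<exists>X\<in>\<J>\<^sub>d. character_extension \<omega> X \<and> prestrict g X = prestrict h X)"
proof
  assume "near \<omega> g h"
  then obtain X F where XF: "X \<in> \<J>" "finite F" "F \<subseteq> \<J>" "\<omega> X" "\<forall>Y\<in>F. \<not> \<omega> Y"
      "\<forall>s\<in>X - \<Union>F. g `` {s} = h `` {s}"
    unfolding near_def eventually_char_filter[OF Omega_subset[OF assms]] by blast
  have "X - \<Union>F \<in> \<J>\<^sub>d" using XF unfolding constructible_differences_def by blast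
  moreover have "character_extension \<omega> (X - \<Union>F)" using XF unfolding character_extension_def by blast
  ultimately show "\<exists>X\<in>\<J>\<^sub>d. character_extension \<omega> X \<and> prestrict g X = prestrict h X"
    using XF(6) unfolding prestrict_eq_iff by blast
next
  assume "\<exists>X\<in>\<J>\<^sub>d. character_extension \<omega> X \<and> prestrict g X = prestrict h X"
  then obtain X where X: "X \<in> \<J>\<^sub>d" "character_extension \<omega> X" "prestrict g X = prestrict h X" by blast
  have "eventually (\<lambda>s. s \<in> X) (char_filter \<omega>)" using character_extension_eventually[OF assms X(1)] X(2) by simp
  then show "near \<omega> g h" unfolding near_def by eventually_elim (use X(3) in \<open>auto simp: prestrict_eq_iff\<close>)
qed

lemma germ_P_eq_near:
  assumes "(g, \<omega>) \<in> germ_pairs" "(h, \<eta>) \<in> germ_pairs" "germ_P g \<omega> = germ_P h \<eta>"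
  shows "\<omega> = \<eta>" "near \<omega> g h"
  using assms near_if_ideal germ_P_eq_iff[OF assms(1,2)] by (auto simp: germ_pairs_def)

lemma germ_relation_2_iff:
  assumes "(g, \<omega>) \<in> germ_pairs" "(h, \<eta>) \<in> germ_pairs"
  shows "(germ_P g \<omega>, germ_P h \<eta>) \<in> germ_relation_2 \<longleftrightarrow> \<omega> = \<eta> \<and> near \<omega> g h"
proof
  assume "(germ_P g \<omega>, germ_P h \<eta>) \<in> germ_relation_2"
  then obtain g' h' \<omega>' where *: "(g', \<omega>') \<in> germ_pairs" "(h', \<omega>') \<in> germ_pairs"
    "germ_P g \<omega> = germ_P g' \<omega>'" "germ_P h \<eta> = germ_P h' \<omega>'"
    "\<exists>X\<in>\<J>\<^sub>d. character_extension \<omega>' X \<and> prestrict g' X = prestrict h' X"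
    unfolding germ_relation_2_def by blast
  have w: "\<omega>' \<in> Omega" using * by (simp add: germ_pairs_def)
  have 1: "\<omega> = \<omega>'" "near \<omega> g g'" using germ_P_eq_near[OF assms(1) *(1,3)] by auto
  have 2: "\<eta> = \<omega>'" "near \<eta> h h'" using germ_P_eq_near[OF assms(2) *(2,4)] by auto
  have "near \<omega>' g' h'" using *(5) near_iff_difference[OF w] by blast
  then show "\<omega> = \<eta> \<and> near \<omega> g h" using 1 2 near_trans near_sym by blast
next
  assume *: "\<omega> = \<eta> \<and> near \<omega> g h"
  have "\<omega> \<in> Omega" using assms by (simp add: germ_pairs_def)
  then show "(germ_P g \<omega>, germ_P h \<eta>) \<in> germ_relation_2"
    using * assms near_iff_difference[of \<omega> g h] unfolding germ_relation_2_def
    by (intro CollectI case_prodI exI[of _ g] exI[of _ h] exI[of _ \<omega>]) auto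
qed

lemma garr_groupoid_P: "garr groupoid_P = {germ_P g \<omega> | g \<omega>. (g, \<omega>) \<in> germ_pairs}"
  by (auto simp: groupoid_P_def quotient_def germ_P_def)

lemma germ_relation_2_subset: "germ_relation_2 \<subseteq> garr groupoid_P \<times> garr groupoid_P"
  unfolding germ_relation_2_def garr_groupoid_P by blast

lemma equiv_germ_relation_2: "equiv (garr groupoid_P) germ_relation_2"
proof (rule equivI)
  show "germ_relation_2 \<subseteq> garr groupoid_P \<times> garr groupoid_P" by (rule germ_relation_2_subset)
  show "refl_on (garr groupoid_P) germ_relation_2"
    unfolding refl_on_def garr_groupoid_P using germ_relation_2_iff by fastforce
  show "sym germ_relation_2"
  proof (rule symI)
    fix a b assume ab: "(a, b) \<in> germ_relation_2"
    then obtain g \<omega> h \<eta> where "a = germ_P g \<omega>" "b = germ_P h \<eta>" "(g, \<omega>) \<in> germ_pairs" "(h, \<eta>) \<in> germ_pairs"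
      unfolding germ_relation_2_def by blast
    then show "(b, a) \<in> germ_relation_2" using ab by (auto simp: germ_relation_2_iff near_sym)
  qed
  show "trans germ_relation_2"
  proof (rule transI)
    fix a b c assume ab: "(a, b) \<in> germ_relation_2" "(b, c) \<in> germ_relation_2"
    then have "a \<in> garr groupoid_P" "b \<in> garr groupoid_P" "c \<in> garr groupoid_P"
      using germ_relation_2_subset by auto
    then obtain g \<omega> h \<eta> k \<theta> where "a = germ_P g \<omega>" "b = germ_P h \<eta>" "c = germ_P k \<theta>"
      "(g, \<omega>) \<in> germ_pairs" "(h, \<eta>) \<in> germ_pairs" "(k, \<theta>) \<in> germ_pairs"
      unfolding garr_groupoid_P by blast
    then show "(a, c) \<in> germ_relation_2" using ab by (auto simp: germ_relation_2_iff intro: near_trans)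
  qed
qed

definition germ :: "'s::left_cancel_monoid rel \<Rightarrow> ('s set \<Rightarrow> bool) \<Rightarrow> 's germ" where
  "germ g \<omega> = germ_relation_2 `` {germ_P g \<omega>}"

lemma germ_eq_iff:
  assumes "g \<in> left_inverse_hull" "\<omega> \<in> dom_set g" "h \<in> left_inverse_hull" "\<eta> \<in> dom_set h"
  shows "germ g \<omega> = germ h \<eta> \<longleftrightarrow> \<omega> = \<eta> \<and> near \<omega> g h"
proof -
  have p: "(g, \<omega>) \<in> germ_pairs" "(h, \<eta>) \<in> germ_pairs" using assms by (auto simp: germ_pairs_iff)
  then have "germ_P g \<omega> \<in> garr groupoid_P" "germ_P h \<eta> \<in> garr groupoid_P" by (auto simp: garr_groupoid_P)
  from eq_equiv_class_iff[OF equiv_germ_relation_2 this] show ?thesis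
    unfolding germ_def using germ_relation_2_iff[OF p] by simp
qed

lemma garr_monoid_groupoid: "garr monoid_groupoid = {germ g \<omega> | g \<omega>. g \<in> left_inverse_hull \<and> \<omega> \<in> dom_set g}"
proof -
  have "garr monoid_groupoid = garr groupoid_P // germ_relation_2"
    by (simp add: monoid_groupoid_def quotient_groupoid_def)
  also have "\<dots> = {germ g \<omega> | g \<omega>. (g, \<omega>) \<in> germ_pairs}"
    unfolding quotient_def garr_groupoid_P germ_def by blast
  finally show ?thesis by (simp add: germ_pairs_iff)
qed

lemma garr_cases:
  assumes "\<gamma> \<in> garr monoid_groupoid"
  obtains g \<omega> where "g \<in> left_inverse_hull" "\<omega> \<in> dom_set g" "\<gamma> = germ g \<omega>"
  using assms by (auto simp: garr_monoid_groupoid)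

lemma germ_in_garr: "g \<in> left_inverse_hull \<Longrightarrow> \<omega> \<in> dom_set g \<Longrightarrow> germ g \<omega> \<in> garr monoid_groupoid"
  by (auto simp: garr_monoid_groupoid)

lemma mem_germ:
  assumes "g \<in> left_inverse_hull" "\<omega> \<in> dom_set g"
  shows "a \<in> germ g \<omega> \<longleftrightarrow> (\<exists>h. h \<in> left_inverse_hull \<and> \<omega> \<in> dom_set h \<and> near \<omega> g h \<and> a = germ_P h \<omega>)"
proof
  assume "a \<in> germ g \<omega>"
  then have r: "(germ_P g \<omega>, a) \<in> germ_relation_2" by (simp add: germ_def)
  then have "a \<in> garr groupoid_P" using germ_relation_2_subset by auto
  then obtain h \<eta> where h: "a = germ_P h \<eta>" "(h, \<eta>) \<in> germ_pairs" unfolding garr_groupoid_P by blast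
  have "\<omega> = \<eta> \<and> near \<omega> g h" using r germ_relation_2_iff[OF _ h(2), of g \<omega>] h(1) assms unfolding germ_pairs_iff by blast
  then show "\<exists>h. h \<in> left_inverse_hull \<and> \<omega> \<in> dom_set h \<and> near \<omega> g h \<and> a = germ_P h \<omega>"
    using h by (auto simp: germ_pairs_iff)
next
  assume "\<exists>h. h \<in> left_inverse_hull \<and> \<omega> \<in> dom_set h \<and> near \<omega> g h \<and> a = germ_P h \<omega>"
  then show "a \<in> germ g \<omega>" using germ_relation_2_iff assms by (auto simp: germ_def germ_pairs_iff)
qed

lemma the_elem_const: "a \<in> X \<Longrightarrow> (\<And>x. x \<in> X \<Longrightarrow> f x = c) \<Longrightarrow> the_elem (f ` X) = c"
  by (metis image_cong image_constant the_elem_eq)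

lemma near_translate:
  assumes "near \<omega> g h" "g \<in> left_inverse_hull" "\<omega> \<in> dom_set g" "h \<in> left_inverse_hull"
  shows "translate_character g \<omega> = translate_character h \<omega>"
proof -
  have w: "\<omega> \<in> Omega" "\<omega> (Domain g)" "\<omega> (Domain h)"
    using assms near_dom_set[OF assms(1,2,4,3)] by (auto simp: dom_set_def)
  have p: "eventually (\<lambda>s. papply g s = papply h s) (char_filter \<omega>)"
    using assms(1)[unfolded near_def] eventually_dom[OF assms(2) w(1,2)] eventually_dom[OF assms(4) w(1,3)]
  proof eventually_elim
    case (elim s)
    have "(s, papply g s) \<in> h" using papply_in[OF assms(2) elim(2)] elim(1) by auto
    then show ?case using papply_eq[OF assms(4)] by metis
  qed
  show ?thesis
  proof (rule Omega_ext)
    fix X :: "'a set" assume X: "X \<in> \<J>"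
    show "translate_character g \<omega> X = translate_character h \<omega> X"
      unfolding translate_character_eventually(1)[OF assms(2) w(1,2) X]
        translate_character_eventually(1)[OF assms(4) w(1,3) X]
      by (rule eventually_cong[OF p]) simp
  qed (use w assms translate_in_Omega in auto)
qed

lemma gsrc_germ:
  assumes "g \<in> left_inverse_hull" "\<omega> \<in> dom_set g"
  shows "gsrc monoid_groupoid (germ g \<omega>) = \<omega>"
proof -
  have 1: "gsrc groupoid_P (germ_P h \<omega>) = \<omega>" if "(h, \<omega>) \<in> germ_pairs" for h
    unfolding groupoid_P_def groupoid.simps
    by (rule the_elem_const[OF self_in_germ_P[OF that]]) (use that in \<open>auto simp: mem_germ_P\<close>)
  have "germ_P g \<omega> \<in> germ g \<omega>" using assms by (auto simp: mem_germ)
  then show ?thesis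
    unfolding monoid_groupoid_def quotient_groupoid_def groupoid.simps
    by (rule the_elem_const) (use assms 1 in \<open>auto simp: mem_germ germ_pairs_iff\<close>)
qed

lemma grng_germ:
  assumes "g \<in> left_inverse_hull" "\<omega> \<in> dom_set g"
  shows "grng monoid_groupoid (germ g \<omega>) = translate_character g \<omega>"
proof -
  have 1: "grng groupoid_P (germ_P h \<omega>) = translate_character h \<omega>" if hp: "(h, \<omega>) \<in> germ_pairs" for h
    unfolding groupoid_P_def groupoid.simps
  proof (rule the_elem_const[OF self_in_germ_P[OF hp]])
    fix x assume xh: "x \<in> germ_P h \<omega>"
    obtain k A where k: "x = (k, \<omega>)" "k \<in> left_inverse_hull" "\<omega> \<in> dom_set k"
      "A \<in> \<J>" "\<omega> A" "\<forall>s\<in>A. h `` {s} = k `` {s}"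
      by (rule germ_P_cases[OF hp xh])
    have "near \<omega> h k" by (rule near_if_ideal[where A = A]) (use hp k in \<open>simp_all add: germ_pairs_def\<close>)
    then show "(case x of (g, \<omega>) \<Rightarrow> translate_character g \<omega>) = translate_character h \<omega>"
      using near_translate[of \<omega> h k] hp k by (simp add: germ_pairs_iff)
  qed
  have "germ_P g \<omega> \<in> germ g \<omega>" using assms by (auto simp: mem_germ)
  then show ?thesis
    unfolding monoid_groupoid_def quotient_groupoid_def groupoid.simps
  proof (rule the_elem_const)
    fix x assume "x \<in> germ g \<omega>"
    then obtain h where "h \<in> left_inverse_hull" "\<omega> \<in> dom_set h" "near \<omega> g h" "x = germ_P h \<omega>"
      using mem_germ[OF assms] by blast
    then show "grng groupoid_P x = translate_character g \<omega>"
      using 1 near_translate[of \<omega> g h] assms by (simp add: germ_pairs_iff)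
  qed
qed

lemma dom_set_compose:
  assumes "g \<in> left_inverse_hull" "h \<in> left_inverse_hull" "\<omega> \<in> dom_set h"
  shows "translate_character h \<omega> \<in> dom_set g \<longleftrightarrow> \<omega> \<in> dom_set (pcomp g h)"
  using assms translate_Domain_compose[of g h \<omega>] translate_in_Omega[of h \<omega>] by (auto simp: dom_set_def)

lemma dom_set_compose_subset:
  assumes "g \<in> left_inverse_hull" "h \<in> left_inverse_hull" "\<omega> \<in> dom_set (pcomp g h)"
  shows "\<omega> \<in> dom_set h"
proof -
  have "Domain (pcomp g h) \<subseteq> Domain h" by auto
  then show ?thesis
    using assms character_mono[OF Omega_subset, of \<omega> "Domain (pcomp g h)" "Domain h"]
      pdom_in_J[OF left_inverse_hull.comp[OF assms(1,2)]] pdom_in_J[OF assms(2)]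
    unfolding dom_set_def by blast
qed

lemma dom_set_inverse: "g \<in> left_inverse_hull \<Longrightarrow> \<omega> \<in> dom_set g \<Longrightarrow> translate_character g \<omega> \<in> dom_set (g\<inverse>)"
  using translate_in_Omega[of g \<omega>] translate_range[of g \<omega>] by (auto simp: dom_set_def)

lemma Image_single:
  assumes "h \<in> left_inverse_hull" "s \<in> Domain h"
  shows "h `` {s} = {papply h s}" "pcomp g h `` {s} = g `` {papply h s}"
proof -
  show 1: "h `` {s} = {papply h s}" using assms papply_in[OF assms] papply_eq[OF assms(1)] by blast
  show "pcomp g h `` {s} = g `` {papply h s}" unfolding relcomp_Image 1 ..
qed

text \<open>Agreement of \<open>g\<close> and \<open>g'\<close> holds near the range character;
  \<open>filterlim_translate\<close> pulls it back through \<open>h\<close>.\<close>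

lemma near_compose:
  assumes "near (translate_character h \<omega>) g g'" "near \<omega> h h'"
    and h: "h \<in> left_inverse_hull" "\<omega> \<in> dom_set h"
  shows "near \<omega> (pcomp g h) (pcomp g' h')"
proof -
  have w: "\<omega> \<in> Omega" "\<omega> (Domain h)" using h by (auto simp: dom_set_def)
  have "eventually (\<lambda>s. g `` {papply h s} = g' `` {papply h s}) (char_filter \<omega>)"
    using assms(1) filterlim_translate[OF h(1) w] unfolding near_def by (rule eventually_compose_filterlim)
  then show ?thesis
    using assms(2) eventually_dom[OF h(1) w] unfolding near_def
    by eventually_elim (simp add: Image_single[OF h(1)] relcomp_Image)
qed

lemma near_inverse:
  assumes "near \<omega> g g'" "g \<in> left_inverse_hull" "\<omega> \<in> dom_set g" "g' \<in> left_inverse_hull"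
  shows "near (translate_character g \<omega>) (g\<inverse>) (g'\<inverse>)"
proof -
  have w: "\<omega> \<in> Omega" "\<omega> (Domain g)" using assms by (auto simp: dom_set_def)
  have i: "g\<inverse> \<in> left_inverse_hull" "translate_character g \<omega> \<in> Omega" "translate_character g \<omega> (Domain (g\<inverse>))"
    using assms(2) w translate_in_Omega translate_range by (auto intro: left_inverse_hull.inverse)
  have "filterlim (papply (g\<inverse>)) (char_filter \<omega>) (char_filter (translate_character g \<omega>))"
    using filterlim_translate[OF i] translate_inverse[OF assms(2) w] by simp
  then have "eventually (\<lambda>t. g `` {papply (g\<inverse>) t} = g' `` {papply (g\<inverse>) t}) (char_filter (translate_character g \<omega>))"
    using assms(1) unfolding near_def by (rule eventually_compose_filterlim[rotated])
  then show ?thesis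
    using eventually_dom[OF i] unfolding near_def
  proof eventually_elim
    case (elim t)
    have st: "(papply (g\<inverse>) t, t) \<in> g" using papply_in[OF i(1) elim(2)] by simp
    then have "(papply (g\<inverse>) t, t) \<in> g'" using elim(1) by blast
    then show ?case using st hull_functional(2)[OF assms(2)] hull_functional(2)[OF assms(4)] by blast
  qed
qed

lemma UN_const2: "x \<in> X \<Longrightarrow> y \<in> Y \<Longrightarrow> (\<And>x' y'. x' \<in> X \<Longrightarrow> y' \<in> Y \<Longrightarrow> f x' y' = c) \<Longrightarrow> (\<Union>x\<in>X. \<Union>y\<in>Y. f x y) = c"
  by auto

lemma gmult_germ_P:
  assumes g: "g \<in> left_inverse_hull" "translate_character h \<omega> \<in> dom_set g"
    and h: "h \<in> left_inverse_hull" "\<omega> \<in> dom_set h"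
  shows "gmult groupoid_P (germ_P g (translate_character h \<omega>)) (germ_P h \<omega>) = germ_P (pcomp g h) \<omega>"
proof -
  let ?\<eta> = "translate_character h \<omega>"
  have p: "(g, ?\<eta>) \<in> germ_pairs" "(h, \<omega>) \<in> germ_pairs" using assms by (auto simp: germ_pairs_iff)
  have eq: "(case x of (g', \<eta>') \<Rightarrow> case y of (h', \<omega>') \<Rightarrow> germ_P (pcomp g' h') \<omega>') = germ_P (pcomp g h) \<omega>"
    if xy: "x \<in> germ_P g ?\<eta>" "y \<in> germ_P h \<omega>" for x y
  proof -
    obtain g' A where x: "x = (g', ?\<eta>)" "g' \<in> left_inverse_hull" "?\<eta> \<in> dom_set g'"
      "A \<in> \<J>" "?\<eta> A" "\<forall>s\<in>A. g `` {s} = g' `` {s}"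
      by (rule germ_P_cases[OF p(1) xy(1)])
    obtain h' B where y: "y = (h', \<omega>)" "h' \<in> left_inverse_hull" "\<omega> \<in> dom_set h'"
      "B \<in> \<J>" "\<omega> B" "\<forall>s\<in>B. h `` {s} = h' `` {s}"
      by (rule germ_P_cases[OF p(2) xy(2)])
    have w: "\<omega> \<in> Omega" using h dom_set_Omega by blast
    have nh: "near \<omega> h h'" using near_if_ideal[OF w y(4-6)] .
    have pre: "h\<inverse> `` A \<in> \<J>" using h x hull_preimage_in_J by blast
    have "\<omega> (h\<inverse> `` A)" using x by (simp add: translate_character_def)
    then have wC: "\<omega> (B \<inter> h\<inverse> `` A)" using character_Int[OF Omega_subset[OF w] y(4) pre] y by simp
    have same: "\<forall>s\<in>B \<inter> h\<inverse> `` A. pcomp g h `` {s} = pcomp g' h' `` {s}"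
    proof
      fix s assume s: "s \<in> B \<inter> h\<inverse> `` A"
      then obtain t where t: "(s, t) \<in> h" "t \<in> A" by auto
      then have "h `` {s} = {t}" using hull_functional(1)[OF h(1)] by auto
      then show "pcomp g h `` {s} = pcomp g' h' `` {s}" using x y s t by (simp add: relcomp_Image)
    qed
    have d: "\<omega> \<in> dom_set (pcomp g h)" using dom_set_compose[OF g(1) h] g by simp
    have "near \<omega> (pcomp g h) (pcomp g' h')"
      by (rule near_if_ideal[OF w constructible_ideals_Int[OF y(4) pre] wC same])
    then have d': "\<omega> \<in> dom_set (pcomp g' h')"
      using near_dom_set d g h x y left_inverse_hull.comp by blast
    have "germ_P (pcomp g h) \<omega> = germ_P (pcomp g' h') \<omega>"
    proof (subst germ_P_eq_iff)
      show "(pcomp g h, \<omega>) \<in> germ_pairs" "(pcomp g' h', \<omega>) \<in> germ_pairs"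
        using d d' g h x y by (auto simp: germ_pairs_iff intro: left_inverse_hull.comp)
    qed (use constructible_ideals_Int[OF y(4) pre] wC same in blast)
    then show ?thesis using x y by simp
  qed
  have "gmult groupoid_P (germ_P g ?\<eta>) (germ_P h \<omega>) =
      (\<Union>x\<in>germ_P g ?\<eta>. \<Union>y\<in>germ_P h \<omega>. case x of (g', \<eta>') \<Rightarrow> case y of (h', \<omega>') \<Rightarrow> germ_P (pcomp g' h') \<omega>')"
    unfolding groupoid_P_def groupoid.simps by (intro SUP_cong refl) (auto split: prod.splits)
  also have "\<dots> = germ_P (pcomp g h) \<omega>"
    by (rule UN_const2[OF self_in_germ_P[OF p(1)] self_in_germ_P[OF p(2)] eq])
  finally show ?thesis .
qed

lemma ginv_germ_P:
  assumes g: "g \<in> left_inverse_hull" "\<omega> \<in> dom_set g"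
  shows "ginv groupoid_P (germ_P g \<omega>) = germ_P (g\<inverse>) (translate_character g \<omega>)"
proof -
  let ?\<eta> = "translate_character g \<omega>"
  have p: "(g, \<omega>) \<in> germ_pairs" using assms by (auto simp: germ_pairs_iff)
  have eq: "(case x of (g', \<omega>') \<Rightarrow> germ_P (g'\<inverse>) (translate_character g' \<omega>')) = germ_P (g\<inverse>) ?\<eta>"
    if xg: "x \<in> germ_P g \<omega>" for x
  proof -
    obtain g' A where x: "x = (g', \<omega>)" "g' \<in> left_inverse_hull" "\<omega> \<in> dom_set g'"
      "A \<in> \<J>" "\<omega> A" "\<forall>s\<in>A. g `` {s} = g' `` {s}"
      by (rule germ_P_cases[OF p xg])
    have w: "\<omega> \<in> Omega" using g dom_set_Omega by blast
    have t: "translate_character g' \<omega> = ?\<eta>"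
      using near_translate[OF near_if_ideal[OF w x(4-6)] g x(2)] by simp
    have i: "g `` A \<in> \<J>" using hull_image_in_J g x by blast
    have "g\<inverse> `` (g `` A) = A \<inter> Domain g" using hull_functional(2)[OF g(1)] by blast
    then have wA: "?\<eta> (g `` A)"
      using i x g character_Int[OF Omega_subset[OF w] x(4) pdom_in_J[OF g(1)]]
      by (simp add: translate_character_def dom_set_def)
    have same: "\<forall>t\<in>g `` A. g\<inverse> `` {t} = g'\<inverse> `` {t}"
    proof
      fix t assume "t \<in> g `` A"
      then obtain s where s: "s \<in> A" "(s, t) \<in> g" by auto
      then have "(s, t) \<in> g'" using x(6) by blast
      then show "g\<inverse> `` {t} = g'\<inverse> `` {t}"
        using s hull_functional(2)[OF g(1)] hull_functional(2)[OF x(2)] by blast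
    qed
    have "germ_P (g\<inverse>) ?\<eta> = germ_P (g'\<inverse>) ?\<eta>"
    proof (subst germ_P_eq_iff)
      show "(g\<inverse>, ?\<eta>) \<in> germ_pairs" "(g'\<inverse>, ?\<eta>) \<in> germ_pairs"
        using dom_set_inverse[OF g] dom_set_inverse[OF x(2,3)] g x t
        by (auto simp: germ_pairs_iff intro: left_inverse_hull.inverse)
    qed (use i wA same in blast)
    then show ?thesis using x t by simp
  qed
  have "ginv groupoid_P (germ_P g \<omega>) = (\<Union>x\<in>germ_P g \<omega>. case x of (g', \<omega>') \<Rightarrow> germ_P (g'\<inverse>) (translate_character g' \<omega>'))"
    unfolding groupoid_P_def groupoid.simps ..
  also have "\<dots> = germ_P (g\<inverse>) ?\<eta>" using self_in_germ_P[OF p] eq by auto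
  finally show ?thesis .
qed

lemma gmult_germ:
  assumes g: "g \<in> left_inverse_hull" "translate_character h \<omega> \<in> dom_set g"
    and h: "h \<in> left_inverse_hull" "\<omega> \<in> dom_set h"
  shows "gmult monoid_groupoid (germ g (translate_character h \<omega>)) (germ h \<omega>) = germ (pcomp g h) \<omega>"
proof -
  let ?\<eta> = "translate_character h \<omega>"
  have eq: "germ_relation_2 `` {gmult groupoid_P a b} = germ (pcomp g h) \<omega>"
    if ab: "a \<in> germ g ?\<eta>" "b \<in> germ h \<omega>" for a b
  proof -
    obtain g' where a: "a = germ_P g' ?\<eta>" "g' \<in> left_inverse_hull" "?\<eta> \<in> dom_set g'" "near ?\<eta> g g'"
      using ab(1) mem_germ[OF g] by blast
    obtain h' where b: "b = germ_P h' \<omega>" "h' \<in> left_inverse_hull" "\<omega> \<in> dom_set h'" "near \<omega> h h'"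
      using ab(2) mem_germ[OF h] by blast
    have t: "translate_character h' \<omega> = ?\<eta>" using near_translate[OF b(4) h b(2)] by simp
    have d: "\<omega> \<in> dom_set (pcomp g h)" using dom_set_compose[OF g(1) h] g by simp
    have d': "\<omega> \<in> dom_set (pcomp g' h')" using dom_set_compose[OF a(2) b(2,3)] a t by simp
    have "gmult groupoid_P a b = germ_P (pcomp g' h') \<omega>"
      using gmult_germ_P[OF a(2) _ b(2,3)] a b t by simp
    moreover have "germ (pcomp g h) \<omega> = germ (pcomp g' h') \<omega>"
      using germ_eq_iff[OF left_inverse_hull.comp[OF g(1) h(1)] d left_inverse_hull.comp[OF a(2) b(2)] d']
        near_compose[OF a(4) b(4) h] by simp
    ultimately show ?thesis by (simp add: germ_def)
  qed
  show ?thesis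
    unfolding monoid_groupoid_def quotient_groupoid_def groupoid.simps
    by (rule UN_const2[where x = "germ_P g ?\<eta>" and y = "germ_P h \<omega>", OF _ _ eq]) (use g h in \<open>auto simp: mem_germ\<close>)
qed

lemma ginv_germ:
  assumes g: "g \<in> left_inverse_hull" "\<omega> \<in> dom_set g"
  shows "ginv monoid_groupoid (germ g \<omega>) = germ (g\<inverse>) (translate_character g \<omega>)"
proof -
  have eq: "germ_relation_2 `` {ginv groupoid_P a} = germ (g\<inverse>) (translate_character g \<omega>)"
    if ab: "a \<in> germ g \<omega>" for a
  proof -
    obtain g' where a: "a = germ_P g' \<omega>" "g' \<in> left_inverse_hull" "\<omega> \<in> dom_set g'" "near \<omega> g g'"
      using ab mem_germ[OF g] by blast
    have t: "translate_character g' \<omega> = translate_character g \<omega>" using near_translate[OF a(4) g a(2)] by simp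
    have "germ (g\<inverse>) (translate_character g \<omega>) = germ (g'\<inverse>) (translate_character g \<omega>)"
      using germ_eq_iff[OF left_inverse_hull.inverse[OF g(1)] dom_set_inverse[OF g]
          left_inverse_hull.inverse[OF a(2)]] dom_set_inverse[OF a(2,3)] near_inverse[OF a(4) g a(2)] t by simp
    then show ?thesis using ginv_germ_P[OF a(2,3)] a t by (simp add: germ_def)
  qed
  have "germ_P g \<omega> \<in> germ g \<omega>" using g by (auto simp: mem_germ)
  then show ?thesis
    unfolding monoid_groupoid_def quotient_groupoid_def groupoid.simps using eq by blast
qed

section \<open>The topology of the groupoid\<close>

lemma openin_dom_set: "g \<in> left_inverse_hull \<Longrightarrow> openin Omega_topology (dom_set g)"
  unfolding dom_set_cylinder by (rule openin_cylinder) (auto intro: pdom_in_J)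

lemma closedin_dom_set: "g \<in> left_inverse_hull \<Longrightarrow> closedin Omega_topology (dom_set g)"
  unfolding dom_set_cylinder by (rule closedin_cylinder) (auto intro: pdom_in_J)

definition basic_opens :: "'s::left_cancel_monoid pgerm set set" where
  "basic_opens = {basic_open g U | g U. g \<in> left_inverse_hull \<and> openin Omega_topology U \<and> U \<subseteq> {\<omega> \<in> Omega. \<omega> (Domain g)}}"

lemma gtop_groupoid_P: "gtop groupoid_P = topology_generated_by basic_opens"
  by (simp add: groupoid_P_def basic_opens_def)

text \<open>Equality of germs is an open condition: a witnessing ideal \<open>A\<close> works for
  every character with value 1 at \<open>A\<close>.\<close>

lemma basic_open_pullback:
  assumes "W \<in> basic_opens" "g \<in> left_inverse_hull"
  shows "openin Omega_topology {\<omega> \<in> dom_set g. germ_P g \<omega> \<in> W}"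
proof -
  obtain h U where W: "W = basic_open h U" "h \<in> left_inverse_hull" "openin Omega_topology U" "U \<subseteq> dom_set h"
    using assms(1) by (auto simp: basic_opens_def dom_set_def)
  have mem: "germ_P g \<omega> \<in> W \<longleftrightarrow> \<omega> \<in> U \<and> (\<exists>A\<in>\<J>. \<omega> A \<and> (\<forall>s\<in>A. g `` {s} = h `` {s}))" if "\<omega> \<in> dom_set g" for \<omega>
  proof -
    have "germ_P g \<omega> = germ_P h \<eta> \<longleftrightarrow> \<omega> = \<eta> \<and> (\<exists>A\<in>\<J>. \<omega> A \<and> (\<forall>s\<in>A. g `` {s} = h `` {s}))" if "\<eta> \<in> U" for \<eta>
      using germ_P_eq_iff[of g \<omega> h \<eta>] W assms \<open>\<omega> \<in> dom_set g\<close> that by (auto simp: germ_pairs_iff)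
    then show ?thesis unfolding W(1) basic_open_def by (auto simp: image_iff)
  qed
  have "{\<omega> \<in> dom_set g. germ_P g \<omega> \<in> W} =
     dom_set g \<inter> U \<inter> (\<Union>A\<in>{A \<in> \<J>. \<forall>s\<in>A. g `` {s} = h `` {s}}. cylinder A {})"
    using mem by (auto simp: cylinder_def dom_set_def)
  moreover have "openin Omega_topology (\<Union>A\<in>{A \<in> \<J>. \<forall>s\<in>A. g `` {s} = h `` {s}}. cylinder A {})"
    by (intro openin_Union) (auto intro: openin_cylinder)
  ultimately show ?thesis using W openin_dom_set[OF assms(2)] by (auto intro: openin_Int)
qed

text \<open>Replaces the generated topology by the final topology for the sections
  \<open>germ_P g\<close>. Generation preserves the pullback condition, and conversely a set
  satisfying it is the union of the basic open sets obtained from its pullbacks.\<close>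

lemma openin_groupoid_P:
  "openin (gtop groupoid_P) W \<longleftrightarrow> W \<subseteq> garr groupoid_P \<and>
    (\<forall>g\<in>left_inverse_hull. openin Omega_topology {\<omega> \<in> dom_set g. germ_P g \<omega> \<in> W})" (is "?l = ?r")
proof
  assume ?l
  then have "generate_topology_on basic_opens W"
    by (simp add: gtop_groupoid_P openin_topology_generated_by_iff)
  then show ?r
  proof (induction rule: generate_topology_on.induct)
    case (Int a b)
    have "{\<omega> \<in> dom_set g. germ_P g \<omega> \<in> a \<inter> b} = {\<omega> \<in> dom_set g. germ_P g \<omega> \<in> a} \<inter> {\<omega> \<in> dom_set g. germ_P g \<omega> \<in> b}" for g
      by auto
    then show ?case using Int by auto
  next
    case (UN K)
    have "{\<omega> \<in> dom_set g. germ_P g \<omega> \<in> \<Union>K} = (\<Union>a\<in>K. {\<omega> \<in> dom_set g. germ_P g \<omega> \<in> a})" for g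
      by auto
    moreover have "\<Union>K \<subseteq> garr groupoid_P" using UN by blast
    moreover have "openin Omega_topology (\<Union>a\<in>K. {\<omega> \<in> dom_set g. germ_P g \<omega> \<in> a})"
      if "g \<in> left_inverse_hull" for g
      using UN that by (intro openin_Union) auto
    ultimately show ?case by simp
  next
    case (Basis s)
    have "s \<subseteq> garr groupoid_P"
      using Basis unfolding basic_opens_def basic_open_def garr_groupoid_P
      by (auto simp: germ_pairs_def)
    then show ?case using basic_open_pullback[OF Basis] by blast
  qed auto
next
  assume r: ?r
  have "openin (gtop groupoid_P) (basic_open g {\<omega> \<in> dom_set g. germ_P g \<omega> \<in> W})" if "g \<in> left_inverse_hull" for g
    unfolding gtop_groupoid_P openin_topology_generated_by_iff
    by (rule generate_topology_on.Basis) (use r that in \<open>auto simp: basic_opens_def dom_set_def intro!: exI[of _ g]\<close>)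
  then have "openin (gtop groupoid_P) (\<Union>g\<in>left_inverse_hull. basic_open g {\<omega> \<in> dom_set g. germ_P g \<omega> \<in> W})"
    by (intro openin_Union) auto
  moreover have "(\<Union>g\<in>left_inverse_hull. basic_open g {\<omega> \<in> dom_set g. germ_P g \<omega> \<in> W}) = W"
  proof (intro equalityI subsetI)
    fix a assume a: "a \<in> W"
    then obtain g \<omega> where "g \<in> left_inverse_hull" "\<omega> \<in> dom_set g" "a = germ_P g \<omega>"
      using r unfolding garr_groupoid_P germ_pairs_iff by blast
    then show "a \<in> (\<Union>g\<in>left_inverse_hull. basic_open g {\<omega> \<in> dom_set g. germ_P g \<omega> \<in> W})"
      using a by (auto simp: basic_open_def)
  qed (auto simp: basic_open_def)
  ultimately show ?l by simp
qed

lemma topspace_groupoid_P: "topspace (gtop groupoid_P) = (garr groupoid_P :: 'a::left_cancel_monoid pgerm set)"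
proof
  show "topspace (gtop groupoid_P) \<subseteq> garr groupoid_P"
    using openin_topspace[of "gtop groupoid_P"] openin_groupoid_P by blast
  have "openin (gtop groupoid_P) (garr groupoid_P :: 'a pgerm set)"
    unfolding openin_groupoid_P
  proof (intro conjI subset_refl ballI)
    fix g :: "'a rel" assume g: "g \<in> left_inverse_hull"
    have "{\<omega> \<in> dom_set g. germ_P g \<omega> \<in> garr groupoid_P} = dom_set g"
      using g by (auto simp: garr_groupoid_P germ_pairs_iff)
    then show "openin Omega_topology {\<omega> \<in> dom_set g. germ_P g \<omega> \<in> garr groupoid_P}"
      using openin_dom_set[OF g] by simp
  qed
  then show "(garr groupoid_P :: 'a pgerm set) \<subseteq> topspace (gtop groupoid_P)" by (rule openin_subset)
qed

text \<open>A saturated set of finer germs contains \<open>germ_P g \<omega>\<close> exactly when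
  the quotient set contains \<open>germ g \<omega>\<close>, so the description by sections survives
  the quotient.\<close>

lemma openin_monoid_groupoid:
  "openin (gtop monoid_groupoid) V \<longleftrightarrow> V \<subseteq> garr monoid_groupoid \<and>
    (\<forall>g\<in>left_inverse_hull. openin Omega_topology {\<omega> \<in> dom_set g. germ g \<omega> \<in> V})"
proof -
  have garr: "garr monoid_groupoid = garr groupoid_P // germ_relation_2"
    by (simp add: monoid_groupoid_def quotient_groupoid_def)
  have 1: "openin (gtop monoid_groupoid) V \<longleftrightarrow> V \<subseteq> garr monoid_groupoid \<and> openin (gtop groupoid_P) (\<Union>V)"
    using openin_quotient_topology[of "gtop groupoid_P" germ_relation_2 V] equiv_germ_relation_2
    by (simp add: topspace_groupoid_P garr) (simp add: monoid_groupoid_def quotient_groupoid_def)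
  have 2: "germ_P g \<omega> \<in> \<Union>V \<longleftrightarrow> germ g \<omega> \<in> V"
    if V: "V \<subseteq> garr monoid_groupoid" "g \<in> left_inverse_hull" "\<omega> \<in> dom_set g" for g \<omega>
  proof
    assume "germ_P g \<omega> \<in> \<Union>V"
    then obtain c where c: "c \<in> V" "germ_P g \<omega> \<in> c" by auto
    then obtain h \<eta> where h: "c = germ h \<eta>" "h \<in> left_inverse_hull" "\<eta> \<in> dom_set h"
      using V(1) garr_cases by blast
    then obtain k where k: "k \<in> left_inverse_hull" "\<eta> \<in> dom_set k" "near \<eta> h k" "germ_P g \<omega> = germ_P k \<eta>"
      using c mem_germ by blast
    have "\<omega> = \<eta>" "near \<omega> g k" using germ_P_eq_near[of g \<omega> k \<eta>] V k by (auto simp: germ_pairs_iff)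
    then have "germ g \<omega> = germ h \<eta>"
      using germ_eq_iff V h k near_trans near_sym by blast
    then show "germ g \<omega> \<in> V" using c h by simp
  next
    assume "germ g \<omega> \<in> V"
    moreover have "germ_P g \<omega> \<in> germ g \<omega>"
      unfolding mem_germ[OF V(2,3)] using V near_refl[of \<omega> g] by blast
    ultimately show "germ_P g \<omega> \<in> \<Union>V" by blast
  qed
  have sub: "\<Union>V \<subseteq> garr groupoid_P" if "V \<subseteq> garr monoid_groupoid"
    using that unfolding garr by (metis Sup_subset_mono Union_quotient equiv_germ_relation_2)
  show ?thesis
    unfolding 1 openin_groupoid_P using 2 sub by (metis (mono_tags, lifting) Collect_cong)
qed

lemma topspace_monoid_groupoid: "topspace (gtop monoid_groupoid) = (garr monoid_groupoid :: 'a::left_cancel_monoid germ set)"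
proof
  show "topspace (gtop monoid_groupoid) \<subseteq> garr monoid_groupoid"
    using openin_topspace[of "gtop monoid_groupoid"] openin_monoid_groupoid by blast
  have "openin (gtop monoid_groupoid) (garr monoid_groupoid :: 'a germ set)"
    unfolding openin_monoid_groupoid
  proof (intro conjI subset_refl ballI)
    fix g :: "'a rel" assume g: "g \<in> left_inverse_hull"
    have "{\<omega> \<in> dom_set g. germ g \<omega> \<in> garr monoid_groupoid} = dom_set g"
      using g germ_in_garr by auto
    then show "openin Omega_topology {\<omega> \<in> dom_set g. germ g \<omega> \<in> garr monoid_groupoid}"
      using openin_dom_set[OF g] by simp
  qed
  then show "(garr monoid_groupoid :: 'a germ set) \<subseteq> topspace (gtop monoid_groupoid)" by (rule openin_subset)
qed

section \<open>Compactly supported functions and their regular representations\<close>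

section \<open>Convolution on bisections\<close>

abbreviation GG :: "('s::left_cancel_monoid germ, 's set \<Rightarrow> bool) groupoid" where "GG \<equiv> monoid_groupoid"

text \<open>The weight is a function on the whole spectrum; only its values on
  \<open>dom_set g\<close> matter. Weights remain comparable in this way when \<open>g\<close>
  changes.\<close>

definition bump :: "'s::left_cancel_monoid rel \<Rightarrow> (('s set \<Rightarrow> bool) \<Rightarrow> complex) \<Rightarrow> 's germ \<Rightarrow> complex" where
  "bump g \<phi> \<gamma> = (if \<gamma> \<in> germ g ` dom_set g then \<phi> (gsrc GG \<gamma>) else 0)"

text \<open>The sum alone, without truncation off the arrows; it also describes the action on
  vectors. \<open>gconv\<close> is the truncated product of the algebra.\<close>

definition conv :: "('s::left_cancel_monoid germ \<Rightarrow> complex) \<Rightarrow> ('s germ \<Rightarrow> complex) \<Rightarrow> 's germ \<Rightarrow> complex" where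
  "conv f \<xi> \<gamma> = (\<Sum>\<^sub>\<infinity>h\<in>{h \<in> garr GG. grng GG h = grng GG \<gamma>}. f h * \<xi> (gmult GG (ginv GG h) \<gamma>))"

lemmas hull_comp = left_inverse_hull.comp
lemmas hull_inv = left_inverse_hull.inverse

lemma bump_germ:
  assumes "g \<in> left_inverse_hull" "k \<in> left_inverse_hull" "\<omega> \<in> dom_set k"
  shows "bump g \<phi> (germ k \<omega>) = (if \<omega> \<in> dom_set g \<and> near \<omega> k g then \<phi> \<omega> else 0)"
proof -
  have "germ k \<omega> \<in> germ g ` dom_set g \<longleftrightarrow> \<omega> \<in> dom_set g \<and> near \<omega> k g"
    using germ_eq_iff[OF assms(2,3,1)] by (metis (no_types, lifting) image_iff)
  then show ?thesis using gsrc_germ[OF assms(2,3)] by (simp add: bump_def)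
qed

lemma bump_off: "g \<in> left_inverse_hull \<Longrightarrow> \<gamma> \<notin> garr GG \<Longrightarrow> bump g \<phi> \<gamma> = 0"
  using germ_in_garr by (auto simp: bump_def)

lemma dom_set_eventually:
  assumes "g \<in> left_inverse_hull" "\<omega> \<in> Omega"
  shows "\<omega> \<in> dom_set g \<longleftrightarrow> eventually (\<lambda>s. s \<in> Domain g) (char_filter \<omega>)"
  using eventually_mem_ideal(1)[OF assms(2) pdom_in_J[OF assms(1)]] assms by (simp add: dom_set_def)

text \<open>Along the filter \<open>k\<close> sends \<open>s\<close> to some \<open>t\<close>, and
  \<open>p\<close> sends \<open>s\<close> to the unique \<open>u\<close> with \<open>(u, t)\<close>
  in \<open>g\<close>; read from \<open>u\<close> this says that \<open>pcomp g p\<close> agrees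
  with \<open>k\<close>. A factor can thus be moved to the other side of an equation between
  germs.\<close>

lemma near_transpose_aux:
  assumes h: "g \<in> left_inverse_hull" "k \<in> left_inverse_hull" "p \<in> left_inverse_hull"
    and w: "\<omega> \<in> dom_set (pcomp (g\<inverse>) k)" "near \<omega> (pcomp (g\<inverse>) k) p"
  shows "\<omega> \<in> dom_set (pcomp g p)" "near \<omega> k (pcomp g p)"
proof -
  have o: "\<omega> \<in> Omega" using w dom_set_Omega by blast
  have i: "pcomp (g\<inverse>) k \<in> left_inverse_hull" using h by (intro hull_comp hull_inv)
  have e: "eventually (\<lambda>s. s \<in> Domain (pcomp g p) \<and> k `` {s} = pcomp g p `` {s}) (char_filter \<omega>)"
    using w(2)[unfolded near_def] w(1)[unfolded dom_set_eventually[OF i o]]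
  proof eventually_elim
    case (elim s)
    then obtain t u where tu: "(s, t) \<in> k" "(u, t) \<in> g" by auto
    have kt: "k `` {s} = {t}" using tu hull_functional(1)[OF h(2)] by auto
    have "g\<inverse> `` {t} = {u}" using tu hull_functional(2)[OF h(1)] by auto
    then have pu: "p `` {s} = {u}" using elim(1) kt by (simp add: relcomp_Image)
    have "g `` {u} = {t}" using tu hull_functional(1)[OF h(1)] by auto
    then have "pcomp g p `` {s} = {t}" using pu by (simp add: relcomp_Image)
    then show ?case using kt by blast
  qed
  show "\<omega> \<in> dom_set (pcomp g p)"
    unfolding dom_set_eventually[OF hull_comp[OF h(1,3)] o] using e by (rule eventually_mono) simp
  show "near \<omega> k (pcomp g p)" unfolding near_def using e by (rule eventually_mono) simp
qed

lemma near_transpose: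
  assumes h: "g \<in> left_inverse_hull" "k \<in> left_inverse_hull" "p \<in> left_inverse_hull"
  shows "\<omega> \<in> dom_set (pcomp (g\<inverse>) k) \<and> near \<omega> (pcomp (g\<inverse>) k) p \<longleftrightarrow> \<omega> \<in> dom_set (pcomp g p) \<and> near \<omega> k (pcomp g p)"
  using near_transpose_aux[OF h, of \<omega>] near_transpose_aux[OF hull_inv[OF h(1)] h(3,2), of \<omega>]
  by (auto dest: near_sym)

text \<open>A bisection contains at most one arrow with prescribed range. The convolution sum
  therefore has at most one nonzero term, with source obtained by applying
  \<open>g\<inverse>\<close> to the range.\<close>

lemma conv_bump:
  assumes k: "k \<in> left_inverse_hull" "\<omega> \<in> dom_set k" and g: "g \<in> left_inverse_hull"
  shows "conv (bump g \<phi>) \<xi> (germ k \<omega>) =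
    (if \<omega> \<in> dom_set (pcomp (g\<inverse>) k)
     then \<phi> (translate_character (pcomp (g\<inverse>) k) \<omega>) * \<xi> (germ (pcomp (g\<inverse>) k) \<omega>) else 0)"
proof -
  let ?\<eta> = "translate_character (pcomp (g\<inverse>) k) \<omega>"
  let ?y = "translate_character k \<omega>"
  let ?S = "{h \<in> garr GG. grng GG h = grng GG (germ k \<omega>)}"
  have i: "g\<inverse> \<in> left_inverse_hull" using g by (rule hull_inv)
  have rk: "grng GG (germ k \<omega>) = ?y" by (rule grng_germ[OF k])
  have supp: "\<omega> \<in> dom_set (pcomp (g\<inverse>) k) \<and> h = germ g ?\<eta>" if h: "h \<in> ?S" "bump g \<phi> h \<noteq> 0" for h
  proof -
    obtain \<eta> where e: "\<eta> \<in> dom_set g" "h = germ g \<eta>" using h(2) by (auto simp: bump_def split: if_splits)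
    have r: "translate_character g \<eta> = ?y" using h(1) e grng_germ[OF g e(1)] rk by simp
    then have "?y \<in> dom_set (g\<inverse>)" using dom_set_inverse[OF g e(1)] by simp
    then have d: "\<omega> \<in> dom_set (pcomp (g\<inverse>) k)" using dom_set_compose[OF i k] by simp
    have "?\<eta> = translate_character (g\<inverse>) ?y" by (rule translate_compose[OF i k(1)])
    also have "\<dots> = \<eta>" unfolding r[symmetric] using e(1) by (intro translate_inverse g) (auto simp: dom_set_def)
    finally show ?thesis using d e by simp
  qed
  show ?thesis
  proof (cases "\<omega> \<in> dom_set (pcomp (g\<inverse>) k)")
    case True
    have yd: "?y \<in> dom_set (g\<inverse>)" using True dom_set_compose[OF i k] by simp
    have eta: "?\<eta> = translate_character (g\<inverse>) ?y" by (rule translate_compose[OF i k(1)])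
    have ed: "?\<eta> \<in> dom_set g" using dom_set_inverse[OF i yd] unfolding eta by simp
    have rng: "translate_character g ?\<eta> = ?y"
      unfolding eta using translate_inverse[OF i, of ?y] yd by (simp add: dom_set_def)
    have h0: "germ g ?\<eta> \<in> ?S" using germ_in_garr[OF g ed] grng_germ[OF g ed] rk rng by simp
    have "conv (bump g \<phi>) \<xi> (germ k \<omega>) =
      (\<Sum>\<^sub>\<infinity>h\<in>{germ g ?\<eta>}. bump g \<phi> h * \<xi> (gmult GG (ginv GG h) (germ k \<omega>)))"
      unfolding conv_def by (rule infsum_cong_neutral) (use supp h0 in auto)
    also have "\<dots> = \<phi> ?\<eta> * \<xi> (gmult GG (germ (g\<inverse>) ?y) (germ k \<omega>))"
      using ginv_germ[OF g ed] bump_germ[OF g g ed, of \<phi>] ed by (simp add: rng)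
    also have "gmult GG (germ (g\<inverse>) ?y) (germ k \<omega>) = germ (pcomp (g\<inverse>) k) \<omega>"
      by (rule gmult_germ[OF i yd k])
    finally show ?thesis using True by simp
  next
    case False
    have "conv (bump g \<phi>) \<xi> (germ k \<omega>) = 0"
      unfolding conv_def by (rule infsum_0) (use supp False in auto)
    then show ?thesis using False by simp
  qed
qed

section \<open>The convolution algebra\<close>

definition Ocont :: "(('s::left_cancel_monoid set \<Rightarrow> bool) \<Rightarrow> complex) \<Rightarrow> bool" where
  "Ocont \<phi> \<longleftrightarrow> continuous_map Omega_topology euclidean \<phi>"

text \<open>Identified with \<open>Cc\<close> in \<open>Cc_monoid_groupoid\<close>. The inductive
  form reduces identities to single bumps.\<close>

inductive_set CG :: "('s::left_cancel_monoid germ \<Rightarrow> complex) set" where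
  zero: "(\<lambda>_. 0) \<in> CG"
| add_bump: "f \<in> CG \<Longrightarrow> g \<in> left_inverse_hull \<Longrightarrow> Ocont \<phi> \<Longrightarrow> (\<lambda>\<gamma>. bump g \<phi> \<gamma> + f \<gamma>) \<in> CG"

lemma Ocont_bounded:
  assumes "Ocont \<phi>" obtains K where "0 \<le> K" "\<And>\<omega>. \<omega> \<in> Omega \<Longrightarrow> cmod (\<phi> \<omega>) \<le> K"
proof -
  have "compactin euclidean (\<phi> ` Omega)"
    using assms compact_Omega unfolding Ocont_def compact_space_def topspace_Omega
    by (intro image_compactin)
  then have "bounded (\<phi> ` Omega)" by (simp add: compact_imp_bounded)
  then obtain K where "\<forall>x\<in>\<phi> ` Omega. cmod x \<le> K" by (auto simp: bounded_iff)
  then show thesis by (intro that[of "max K 0"]) (auto intro: max.coboundedI1)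
qed

lemma Ocont_const: "Ocont (\<lambda>_. c)" by (simp add: Ocont_def)

lemma continuous_map_complex_mult:
  fixes f g :: "'a \<Rightarrow> complex"
  shows "continuous_map X euclidean f \<Longrightarrow> continuous_map X euclidean g \<Longrightarrow> continuous_map X euclidean (\<lambda>x. f x * g x)"
  by (simp add: continuous_map_atin tendsto_mult)

lemma Ocont_mult: "Ocont \<phi> \<Longrightarrow> Ocont \<psi> \<Longrightarrow> Ocont (\<lambda>\<omega>. \<phi> \<omega> * \<psi> \<omega>)"
  unfolding Ocont_def by (rule continuous_map_complex_mult)

lemma Ocont_cases:
  assumes "openin Omega_topology U" "closedin Omega_topology U"
    and "continuous_map (subtopology Omega_topology U) euclidean \<phi>" "Ocont \<psi>"
  shows "Ocont (\<lambda>\<omega>. if \<omega> \<in> U then \<phi> \<omega> else \<psi> \<omega>)"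
  unfolding Ocont_def
proof (subst continuous_map_openin_preimage_eq, intro conjI allI impI)
  fix S :: "complex set" assume S: "openin euclidean S"
  have U: "U \<subseteq> Omega" using openin_subset[OF assms(1)] by (simp add: topspace_Omega)
  have "openin (subtopology Omega_topology U) (topspace (subtopology Omega_topology U) \<inter> \<phi> -` S)"
    using assms(3) S by (simp add: continuous_map_openin_preimage_eq)
  then have 1: "openin Omega_topology (U \<inter> \<phi> -` S)"
    using U assms(1) openin_trans_full by (fastforce simp: topspace_Omega Int_absorb1)
  have 2: "openin Omega_topology (Omega \<inter> \<psi> -` S)"
    using assms(4) S by (simp add: Ocont_def continuous_map_openin_preimage_eq topspace_Omega)
  have 3: "openin Omega_topology (Omega - U)"
    using assms(2) by (simp add: closedin_def topspace_Omega)
  have "Omega \<inter> (\<lambda>\<omega>. if \<omega> \<in> U then \<phi> \<omega> else \<psi> \<omega>) -` S = (U \<inter> \<phi> -` S) \<union> ((Omega \<inter> \<psi> -` S) \<inter> (Omega - U))"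
    using U by (auto split: if_splits)
  then show "openin Omega_topology (topspace Omega_topology \<inter> (\<lambda>\<omega>. if \<omega> \<in> U then \<phi> \<omega> else \<psi> \<omega>) -` S)"
    using 1 2 3 by (simp add: topspace_Omega openin_Un openin_Int)
qed auto

lemma continuous_translate:
  assumes g: "g \<in> left_inverse_hull"
  shows "continuous_map (subtopology Omega_topology (dom_set g)) Omega_topology (translate_character g)"
  unfolding continuous_map_openin_preimage_eq
proof (intro conjI allI impI)
  have top: "topspace (subtopology Omega_topology (dom_set g)) = dom_set g"
    by (auto simp: topspace_Omega dom_set_def)
  show "translate_character g \<in> topspace (subtopology Omega_topology (dom_set g)) \<rightarrow> topspace Omega_topology"
    using translate_in_Omega[OF g] unfolding top topspace_Omega by (auto simp: dom_set_def)
  fix T :: "('a set \<Rightarrow> bool) set" assume T: "openin Omega_topology T"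
  have "openin Omega_topology (dom_set g \<inter> translate_character g -` T)"
    unfolding openin_Omega
  proof (intro conjI ballI)
    fix \<omega> assume w: "\<omega> \<in> dom_set g \<inter> translate_character g -` T"
    then obtain X F where XF: "X \<in> \<J>" "finite F" "F \<subseteq> \<J>" "translate_character g \<omega> \<in> cylinder X F" "cylinder X F \<subseteq> T"
      using T unfolding openin_Omega by blast
    let ?X = "g\<inverse> `` X" and ?F = "(\<lambda>Y. g\<inverse> `` Y) ` F"
    have e: "{\<omega> \<in> Omega. \<omega> (Domain g) \<and> translate_character g \<omega> \<in> cylinder X F} = cylinder ?X ?F"
      by (rule eventually_translate_cylinder[OF g XF(1-3)])
    show "\<exists>X F. X \<in> \<J> \<and> finite F \<and> F \<subseteq> \<J> \<and> \<omega> \<in> cylinder X F \<and> cylinder X F \<subseteq> dom_set g \<inter> translate_character g -` T"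
    proof (intro exI[of _ ?X] exI[of _ ?F] conjI)
      show "?X \<in> \<J>" "?F \<subseteq> \<J>" using XF g hull_preimage_in_J by auto
      show "\<omega> \<in> cylinder ?X ?F" unfolding e[symmetric] using w XF by (auto simp: dom_set_def)
      show "cylinder ?X ?F \<subseteq> dom_set g \<inter> translate_character g -` T"
        unfolding e[symmetric] using XF by (auto simp: dom_set_def)
    qed (use XF in auto)
  qed (auto simp: dom_set_def)
  then show "openin (subtopology Omega_topology (dom_set g))
      (topspace (subtopology Omega_topology (dom_set g)) \<inter> translate_character g -` T)"
    unfolding top using openin_dom_set[OF g] by (subst openin_open_subtopology) auto
qed

text \<open>Domains of hull elements are clopen in the spectrum, so extension by zero keeps the
  weight continuous. This makes products and stars of bumps into bumps again.\<close>

lemma Ocont_translate: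
  assumes g: "g \<in> left_inverse_hull" and "Ocont \<phi>" "Ocont \<psi>"
  shows "Ocont (\<lambda>\<omega>. if \<omega> \<in> dom_set g then \<phi> (translate_character g \<omega>) * \<psi> \<omega> else 0)"
proof (rule Ocont_cases[OF openin_dom_set[OF g] closedin_dom_set[OF g] _ Ocont_const])
  have "continuous_map (subtopology Omega_topology (dom_set g)) euclidean (\<phi> \<circ> translate_character g)"
    using continuous_translate[OF g] assms(2) unfolding Ocont_def by (rule continuous_map_compose)
  moreover have "continuous_map (subtopology Omega_topology (dom_set g)) euclidean \<psi>"
    using assms(3) unfolding Ocont_def by (rule continuous_map_from_subtopology)
  ultimately show "continuous_map (subtopology Omega_topology (dom_set g)) euclidean
      (\<lambda>\<omega>. \<phi> (translate_character g \<omega>) * \<psi> \<omega>)"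
    by (intro continuous_map_complex_mult) (simp_all add: o_def)
qed

lemma Ocont_cnj: "Ocont \<phi> \<Longrightarrow> Ocont (\<lambda>\<omega>. cnj (\<phi> \<omega>))"
proof -
  assume "Ocont \<phi>"
  moreover have "continuous_map euclidean euclidean cnj" by (simp add: continuous_on_cnj)
  ultimately have "continuous_map Omega_topology euclidean (cnj \<circ> \<phi>)"
    unfolding Ocont_def by (rule continuous_map_compose)
  then show ?thesis by (simp add: Ocont_def o_def)
qed

lemma CG_bump: "g \<in> left_inverse_hull \<Longrightarrow> Ocont \<phi> \<Longrightarrow> bump g \<phi> \<in> CG"
  using CG.add_bump[OF CG.zero, of g \<phi>] by simp

lemma CG_plus: "f \<in> CG \<Longrightarrow> f' \<in> CG \<Longrightarrow> (\<lambda>\<gamma>. f \<gamma> + f' \<gamma>) \<in> CG"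
proof (induction rule: CG.induct)
  case (add_bump f g \<phi>)
  then show ?case using CG.add_bump[of "\<lambda>\<gamma>. f \<gamma> + f' \<gamma>" g \<phi>] by (simp add: add.assoc)
qed auto

lemma bump_scale: "c * bump g \<phi> \<gamma> = bump g (\<lambda>\<omega>. c * \<phi> \<omega>) \<gamma>"
  by (simp add: bump_def)

lemma CG_scale: "f \<in> CG \<Longrightarrow> (\<lambda>\<gamma>. c * f \<gamma>) \<in> CG"
proof (induction rule: CG.induct)
  case (add_bump f g \<phi>)
  then show ?case
    using CG.add_bump[of "\<lambda>\<gamma>. c * f \<gamma>" g "\<lambda>\<omega>. c * \<phi> \<omega>"] Ocont_mult[OF Ocont_const, of \<phi> c]
    by (simp add: distrib_left bump_scale)
qed (use CG.zero in simp)

lemma CG_sum: "finite I \<Longrightarrow> (\<And>i. i \<in> I \<Longrightarrow> f i \<in> CG) \<Longrightarrow> (\<lambda>\<gamma>. \<Sum>i\<in>I. f i \<gamma>) \<in> CG"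
  by (induction I rule: finite_induct) (auto intro: CG_plus CG.zero)

text \<open>Each bump contributes at most one arrow with a given range. All convolution sums are
  finite, which settles their linearity.\<close>

lemma CG_finite_fibre:
  "f \<in> CG \<Longrightarrow> finite {h \<in> garr GG. grng GG h = y \<and> f h \<noteq> 0}"
proof (induction rule: CG.induct)
  case (add_bump f g \<phi>)
  have "{h \<in> garr GG. grng GG h = y \<and> bump g \<phi> h \<noteq> 0} \<subseteq> {germ g (translate_character (g\<inverse>) y)}"
  proof
    fix h assume h: "h \<in> {h \<in> garr GG. grng GG h = y \<and> bump g \<phi> h \<noteq> 0}"
    then obtain \<eta> where e: "\<eta> \<in> dom_set g" "h = germ g \<eta>" by (auto simp: bump_def split: if_splits)
    then have "translate_character g \<eta> = y" using h grng_germ[OF add_bump(2) e(1)] by simp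
    then show "h \<in> {germ g (translate_character (g\<inverse>) y)}"
      using e translate_inverse[of g \<eta>] add_bump by (auto simp: dom_set_def)
  qed
  then have "finite ({h \<in> garr GG. grng GG h = y \<and> bump g \<phi> h \<noteq> 0} \<union> {h \<in> garr GG. grng GG h = y \<and> f h \<noteq> 0})"
    using add_bump finite_subset by blast
  then show ?case by (rule rev_finite_subset) auto
qed auto

lemma conv_summable:
  assumes "f \<in> CG"
  shows "(\<lambda>h. f h * \<xi> (gmult GG (ginv GG h) \<gamma>)) summable_on {h \<in> garr GG. grng GG h = y}"
  by (rule finite_nonzero_values_imp_summable_on, rule finite_subset[OF _ CG_finite_fibre[OF assms, of y]]) auto

lemma conv_plus_left: "f \<in> CG \<Longrightarrow> f' \<in> CG \<Longrightarrow> conv (\<lambda>\<gamma>. f \<gamma> + f' \<gamma>) \<xi> \<gamma> = conv f \<xi> \<gamma> + conv f' \<xi> \<gamma>"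
  unfolding conv_def by (simp add: distrib_right infsum_add conv_summable)

lemma conv_plus_right: "f \<in> CG \<Longrightarrow> conv f (\<lambda>\<gamma>. \<xi> \<gamma> + \<eta> \<gamma>) \<gamma> = conv f \<xi> \<gamma> + conv f \<eta> \<gamma>"
  unfolding conv_def by (simp add: distrib_left infsum_add conv_summable)

lemma conv_scale_left: "conv (\<lambda>\<gamma>. c * f \<gamma>) \<xi> \<gamma> = c * conv f \<xi> \<gamma>"
  unfolding conv_def by (simp add: mult.assoc infsum_cmult_right')

lemma conv_scale_right: "conv f (\<lambda>\<gamma>. c * \<xi> \<gamma>) \<gamma> = c * conv f \<xi> \<gamma>"
  unfolding conv_def by (simp add: mult.left_commute infsum_cmult_right')

lemma conv_zero_left [simp]: "conv (\<lambda>_. 0) \<xi> \<gamma> = 0" by (simp add: conv_def)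

lemma conv_zero_right [simp]: "conv f (\<lambda>_. 0) \<gamma> = 0" by (simp add: conv_def)

lemma amult_conv: "amult (groupoid_algebra GG N) f f' = (\<lambda>\<gamma>. if \<gamma> \<in> garr GG then conv f f' \<gamma> else 0)"
  by (simp add: groupoid_algebra_def conv_def fun_eq_iff)

definition gstar :: "('s::left_cancel_monoid germ \<Rightarrow> complex) \<Rightarrow> 's germ \<Rightarrow> complex" where
  "gstar f \<gamma> = (if \<gamma> \<in> garr GG then cnj (f (ginv GG \<gamma>)) else 0)"

lemma astar_gstar: "astar (groupoid_algebra GG N) f = gstar f"
  by (simp add: groupoid_algebra_def gstar_def fun_eq_iff)

definition gconv :: "('s::left_cancel_monoid germ \<Rightarrow> complex) \<Rightarrow> ('s germ \<Rightarrow> complex) \<Rightarrow> 's germ \<Rightarrow> complex" where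
  "gconv f f' \<gamma> = (if \<gamma> \<in> garr GG then conv f f' \<gamma> else 0)"

lemma amult_gconv: "amult (groupoid_algebra GG N) f f' = gconv f f'"
  by (simp add: amult_conv gconv_def fun_eq_iff)

text \<open>The product of two bisections is the bisection of the composition, and the first weight
  is evaluated at the range of the second factor.\<close>

lemma gconv_bump:
  assumes g: "g \<in> left_inverse_hull" and h: "h \<in> left_inverse_hull"
  shows "gconv (bump g \<phi>) (bump h \<psi>) =
    bump (pcomp g h) (\<lambda>\<omega>. if \<omega> \<in> dom_set h then \<phi> (translate_character h \<omega>) * \<psi> \<omega> else 0)"
proof
  fix \<gamma>
  have gh: "pcomp g h \<in> left_inverse_hull" by (rule hull_comp[OF g h])
  show "gconv (bump g \<phi>) (bump h \<psi>) \<gamma> =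
    bump (pcomp g h) (\<lambda>\<omega>. if \<omega> \<in> dom_set h then \<phi> (translate_character h \<omega>) * \<psi> \<omega> else 0) \<gamma>"
  proof (cases "\<gamma> \<in> garr GG")
    case True
    then obtain k \<omega> where k: "k \<in> left_inverse_hull" "\<omega> \<in> dom_set k" "\<gamma> = germ k \<omega>" by (rule garr_cases)
    have gk: "pcomp (g\<inverse>) k \<in> left_inverse_hull" by (intro hull_comp hull_inv g k)
    have t: "translate_character (pcomp (g\<inverse>) k) \<omega> = translate_character h \<omega>"
      if "\<omega> \<in> dom_set (pcomp (g\<inverse>) k)" "near \<omega> (pcomp (g\<inverse>) k) h"
      by (rule near_translate[OF that(2) gk that(1) h])
    have d: "\<omega> \<in> dom_set h" if "\<omega> \<in> dom_set (pcomp (g\<inverse>) k)" "near \<omega> (pcomp (g\<inverse>) k) h"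
      by (rule near_dom_set[OF that(2) gk h that(1)])
    show ?thesis
      using near_transpose[OF g k(1) h, of \<omega>] t d dom_set_compose_subset[OF g h, of \<omega>] bump_germ[OF h gk, of \<omega> \<psi>]
        bump_germ[OF gh k(1,2)]
      unfolding gconv_def k(3) conv_bump[OF k(1,2) g] using True k(3) by auto
  qed (simp add: gconv_def bump_off[OF gh])
qed

lemma gstar_zero [simp]: "gstar (\<lambda>_. 0) = (\<lambda>_. 0)" by (simp add: gstar_def fun_eq_iff)

lemma gconv_zero [simp]: "gconv (\<lambda>_. 0) f = (\<lambda>_. 0)" "gconv f (\<lambda>_. 0) = (\<lambda>_. 0)"
  by (simp_all add: gconv_def fun_eq_iff)

text \<open>The factor 1 in the weight gives it the form required by
  \<open>Ocont_translate\<close>.\<close>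

lemma gstar_bump:
  assumes g: "g \<in> left_inverse_hull"
  shows "gstar (bump g \<phi>) =
    bump (g\<inverse>) (\<lambda>\<omega>. if \<omega> \<in> dom_set (g\<inverse>) then cnj (\<phi> (translate_character (g\<inverse>) \<omega>)) * 1 else 0)"
proof
  fix \<gamma>
  have gi: "g\<inverse> \<in> left_inverse_hull" by (rule hull_inv[OF g])
  show "gstar (bump g \<phi>) \<gamma> =
    bump (g\<inverse>) (\<lambda>\<omega>. if \<omega> \<in> dom_set (g\<inverse>) then cnj (\<phi> (translate_character (g\<inverse>) \<omega>)) * 1 else 0) \<gamma>"
  proof (cases "\<gamma> \<in> garr GG")
    case True
    then obtain k \<omega> where k: "k \<in> left_inverse_hull" "\<omega> \<in> dom_set k" "\<gamma> = germ k \<omega>" by (rule garr_cases)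
    let ?y = "translate_character k \<omega>"
    have ki: "k\<inverse> \<in> left_inverse_hull" "?y \<in> dom_set (k\<inverse>)" using k hull_inv dom_set_inverse by auto
    have yk: "translate_character (k\<inverse>) ?y = \<omega>" using k translate_inverse by (auto simp: dom_set_def)
    have 1: "near \<omega> k (g\<inverse>) \<and> \<omega> \<in> dom_set (g\<inverse>)" if "?y \<in> dom_set g" "near ?y (k\<inverse>) g"
      using near_inverse[OF that(2) ki g] near_dom_set[OF _ k(1) gi k(2)] unfolding yk by simp
    have 2: "near ?y (k\<inverse>) g \<and> ?y \<in> dom_set g" if "near \<omega> k (g\<inverse>)"
      using near_inverse[OF that k(1,2) gi] near_dom_set[OF _ ki(1) g ki(2)] by simp
    have t: "translate_character (g\<inverse>) \<omega> = ?y" if "near \<omega> k (g\<inverse>)"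
      using near_translate[OF that k(1,2) gi] by simp
    have iff: "?y \<in> dom_set g \<and> near ?y (k\<inverse>) g \<longleftrightarrow> \<omega> \<in> dom_set (g\<inverse>) \<and> near \<omega> k (g\<inverse>)"
      using 1 2 by blast
    have "gstar (bump g \<phi>) \<gamma> = cnj (bump g \<phi> (germ (k\<inverse>) ?y))"
      using True by (simp add: gstar_def k(3) ginv_germ[OF k(1,2)])
    then show ?thesis
      unfolding bump_germ[OF g ki] k(3) bump_germ[OF gi k(1,2)] iff using t by simp
  qed (simp add: gstar_def bump_off[OF gi])
qed

lemma CG_gstar: "f \<in> CG \<Longrightarrow> gstar f \<in> CG"
proof (induction rule: CG.induct)
  case zero
  show ?case by (simp add: CG.zero)
next
  case (add_bump f g \<phi>)
  have "gstar (\<lambda>\<gamma>. bump g \<phi> \<gamma> + f \<gamma>) = (\<lambda>\<gamma>. gstar (bump g \<phi>) \<gamma> + gstar f \<gamma>)"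
    by (auto simp: gstar_def fun_eq_iff)
  then show ?case
    using add_bump gstar_bump[OF add_bump(2), of \<phi>] Ocont_cnj
      CG.add_bump[OF add_bump(4) hull_inv[OF add_bump(2)] Ocont_translate[OF hull_inv[OF add_bump(2)] Ocont_cnj[OF add_bump(3)] Ocont_const[of 1]]]
    by simp
qed

lemma gconv_plus_left: "f \<in> CG \<Longrightarrow> f' \<in> CG \<Longrightarrow> gconv (\<lambda>\<gamma>. f \<gamma> + f' \<gamma>) h = (\<lambda>\<gamma>. gconv f h \<gamma> + gconv f' h \<gamma>)"
  by (auto simp: gconv_def fun_eq_iff conv_plus_left)

lemma gconv_plus_right: "h \<in> CG \<Longrightarrow> gconv h (\<lambda>\<gamma>. f \<gamma> + f' \<gamma>) = (\<lambda>\<gamma>. gconv h f \<gamma> + gconv h f' \<gamma>)"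
  by (auto simp: gconv_def fun_eq_iff conv_plus_right)

lemma CG_gconv: assumes "f \<in> CG" "f' \<in> CG" shows "gconv f f' \<in> CG"
  using assms
proof (induction f rule: CG.induct)
  case zero
  show ?case by (simp add: CG.zero)
next
  case (add_bump f g \<phi>)
  have b: "bump g \<phi> \<in> CG" using add_bump by (intro CG_bump)
  have "gconv (bump g \<phi>) f' \<in> CG" using \<open>f' \<in> CG\<close>
  proof (induction f' rule: CG.induct)
    case zero
    show ?case by (simp add: CG.zero)
  next
    case (add_bump f' h \<psi>)
    have "gconv (bump g \<phi>) (bump h \<psi>) \<in> CG"
      unfolding gconv_bump[OF \<open>g \<in> left_inverse_hull\<close> add_bump(2)]
      by (intro CG_bump hull_comp Ocont_translate add_bump \<open>g \<in> left_inverse_hull\<close> \<open>Ocont \<phi>\<close>)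
    then show ?case unfolding gconv_plus_right[OF b] by (intro CG_plus add_bump)
  qed
  then show ?case unfolding gconv_plus_left[OF b add_bump(1)] using add_bump by (intro CG_plus) auto
qed

section \<open>Regular representations\<close>

definition fibre :: "('s::left_cancel_monoid set \<Rightarrow> bool) \<Rightarrow> 's germ set" where
  "fibre x = {\<gamma> \<in> garr GG. gsrc GG \<gamma> = x}"

lemma fibre_cases:
  assumes "\<gamma> \<in> fibre x" obtains k where "k \<in> left_inverse_hull" "x \<in> dom_set k" "\<gamma> = germ k x"
proof -
  have "\<gamma> \<in> garr GG" "gsrc GG \<gamma> = x" using assms by (auto simp: fibre_def)
  moreover from this(1) obtain g \<omega> where "g \<in> left_inverse_hull" "\<omega> \<in> dom_set g" "\<gamma> = germ g \<omega>"
    by (rule garr_cases)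
  ultimately show thesis using gsrc_germ[of g \<omega>] that by simp
qed

lemma germ_in_fibre: "k \<in> left_inverse_hull \<Longrightarrow> x \<in> dom_set k \<Longrightarrow> germ k x \<in> fibre x"
  by (simp add: fibre_def germ_in_garr gsrc_germ)

abbreviation rr where "rr x f \<equiv> regular_rep GG x f"

lemma rr_def: "rr x f \<xi> = Abs_ell2 (\<lambda>\<gamma>. if \<gamma> \<in> fibre x then conv f (ell2_apply \<xi>) \<gamma> else 0)"
  unfolding regular_rep_def conv_def fibre_def by simp

text \<open>The arrows that can be multiplied on the left by the inverse of the bisection of
  \<open>g\<close>. \<open>bmap g\<close> is this multiplication and \<open>bweight g\<close> the
  value of the weight on the arrow divided off.\<close>

definition bset :: "('s::left_cancel_monoid set \<Rightarrow> bool) \<Rightarrow> 's rel \<Rightarrow> 's germ set" where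
  "bset x g = {\<gamma> \<in> fibre x. grng GG \<gamma> \<in> dom_set (g\<inverse>)}"

lemma bset_fibre: "\<gamma> \<in> bset x g \<Longrightarrow> \<gamma> \<in> fibre x" by (simp add: bset_def)

definition bmap :: "'s::left_cancel_monoid rel \<Rightarrow> 's germ \<Rightarrow> 's germ" where
  "bmap g \<gamma> = gmult GG (germ (g\<inverse>) (grng GG \<gamma>)) \<gamma>"

definition bweight :: "'s::left_cancel_monoid rel \<Rightarrow> (('s set \<Rightarrow> bool) \<Rightarrow> complex) \<Rightarrow> 's germ \<Rightarrow> complex" where
  "bweight g \<phi> \<gamma> = \<phi> (translate_character (g\<inverse>) (grng GG \<gamma>))"

lemma bset_germ:
  assumes "g \<in> left_inverse_hull" "k \<in> left_inverse_hull" "x \<in> dom_set k"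
  shows "germ k x \<in> bset x g \<longleftrightarrow> x \<in> dom_set (pcomp (g\<inverse>) k)"
    "x \<in> dom_set (pcomp (g\<inverse>) k) \<Longrightarrow> bmap g (germ k x) = germ (pcomp (g\<inverse>) k) x"
    "bweight g \<phi> (germ k x) = \<phi> (translate_character (pcomp (g\<inverse>) k) x)"
  using assms dom_set_compose[OF hull_inv[OF assms(1)] assms(2,3)]
  by (simp_all add: bset_def germ_in_fibre grng_germ bmap_def bweight_def gmult_germ hull_inv translate_compose)

lemma conv_bump_fibre:
  assumes g: "g \<in> left_inverse_hull" and y: "\<gamma> \<in> fibre x"
  shows "conv (bump g \<phi>) \<xi> \<gamma> = (if \<gamma> \<in> bset x g then bweight g \<phi> \<gamma> * \<xi> (bmap g \<gamma>) else 0)"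
  using fibre_cases[OF y]
proof cases
  case (1 k)
  then show ?thesis using conv_bump[OF 1(1,2) g] bset_germ[OF g 1(1,2)] by simp
qed

lemma bmap_inverse:
  assumes g: "g \<in> left_inverse_hull" and y: "\<gamma> \<in> bset x g"
  shows "bmap g \<gamma> \<in> bset x (g\<inverse>)" "bmap (g\<inverse>) (bmap g \<gamma>) = \<gamma>" "grng GG (bmap g \<gamma>) = translate_character (g\<inverse>) (grng GG \<gamma>)"
proof -
  have "\<gamma> \<in> fibre x" using y by (simp add: bset_def)
  then obtain k where k: "k \<in> left_inverse_hull" "x \<in> dom_set k" "\<gamma> = germ k x" by (rule fibre_cases)
  let ?p = "pcomp (g\<inverse>) k"
  have p: "?p \<in> left_inverse_hull" by (intro hull_comp hull_inv g k)
  have d: "x \<in> dom_set ?p" using y bset_germ(1)[OF g k(1,2)] k by simp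
  have b: "bmap g \<gamma> = germ ?p x" using bset_germ(2)[OF g k(1,2) d] k by simp
  have n: "x \<in> dom_set (pcomp g ?p)" "near x k (pcomp g ?p)"
    using near_transpose[OF g k(1) p, of x] d by auto
  have gi: "g\<inverse> \<in> left_inverse_hull" by (rule hull_inv[OF g])
  show "bmap g \<gamma> \<in> bset x (g\<inverse>)" unfolding b using bset_germ(1)[OF gi p d] n by simp
  show "bmap (g\<inverse>) (bmap g \<gamma>) = \<gamma>"
    unfolding b using bset_germ(2)[OF gi p d] n k germ_eq_iff[OF hull_comp[OF g p] n(1) k(1,2)] near_sym by simp
  show "grng GG (bmap g \<gamma>) = translate_character (g\<inverse>) (grng GG \<gamma>)"
    using grng_germ[OF p d] grng_germ[OF k(1,2)] translate_compose[OF gi k(1)] b k(3) by simp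
qed

lemma inj_on_bmap: "g \<in> left_inverse_hull \<Longrightarrow> inj_on (bmap g) (bset x g)"
  by (metis bmap_inverse(2) inj_onI)

lemma bweight_bound:
  assumes "g \<in> left_inverse_hull" "\<And>\<omega>. \<omega> \<in> Omega \<Longrightarrow> cmod (\<phi> \<omega>) \<le> K" "\<gamma> \<in> bset x g"
  shows "cmod (bweight g \<phi> \<gamma>) \<le> K"
proof -
  have "translate_character (g\<inverse>) (grng GG \<gamma>) \<in> Omega"
    using assms translate_in_Omega[OF hull_inv[OF assms(1)]] by (auto simp: bset_def dom_set_def)
  then show ?thesis using assms by (simp add: bweight_def)
qed

text \<open>Each bump adds a weighted partial permutation, hence at most the supremum of its weight.
  The bound is independent of \<open>x\<close>, which makes the reduced norm finite; summability is
  proved alongside because \<open>rr\<close> is defined through \<open>Abs_ell2\<close>.\<close>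

lemma rr_facts:
  assumes "f \<in> CG"
  shows "\<exists>K\<ge>0. \<forall>x. (\<forall>\<xi>. square_summable (\<lambda>\<gamma>. if \<gamma> \<in> fibre x then conv f (ell2_apply \<xi>) \<gamma> else 0)) \<and>
     (\<forall>\<xi>. norm (rr x f \<xi>) \<le> K * norm \<xi>)"
  using assms
proof (induction rule: CG.induct)
  case zero
  have "rr x (\<lambda>_. 0) \<xi> = 0" for x :: "'a set \<Rightarrow> bool" and \<xi>
    by (rule ell2_eqI) (simp add: rr_def Abs_ell2_apply square_summable_zero cong: if_cong)
  then show ?case by (intro exI[of _ 0]) (simp add: square_summable_zero cong: if_cong)
next
  case (add_bump f g \<phi>)
  from add_bump(4) obtain K where K: "0 \<le> K"
    "\<And>x \<xi>. square_summable (\<lambda>\<gamma>. if \<gamma> \<in> fibre x then conv f (ell2_apply \<xi>) \<gamma> else 0)"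
    "\<And>x \<xi>. norm (rr x f \<xi>) \<le> K * norm \<xi>" by blast
  obtain L where L: "0 \<le> L" "\<And>\<omega>. \<omega> \<in> Omega \<Longrightarrow> cmod (\<phi> \<omega>) \<le> L" using Ocont_bounded[OF add_bump(3)] by blast
  have b: "bump g \<phi> \<in> CG" using add_bump by (intro CG_bump)
  show ?case
  proof (intro exI[of _ "L + K"] conjI allI)
    fix x :: "'a set \<Rightarrow> bool" and \<xi>
    define W where "W = wcomp (bset x g) (bmap g) (bweight g \<phi>) \<xi>"
    note wc = inj_on_bmap[OF add_bump(2), of x] bweight_bound[OF add_bump(2) L(2)] L(1)
    have W: "ell2_apply W \<gamma> = (if \<gamma> \<in> fibre x then conv (bump g \<phi>) (ell2_apply \<xi>) \<gamma> else 0)" for \<gamma>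
    proof -
      have "ell2_apply W \<gamma> = (if \<gamma> \<in> bset x g then bweight g \<phi> \<gamma> * ell2_apply \<xi> (bmap g \<gamma>) else 0)"
        unfolding W_def by (rule wcomp_apply[OF wc])
      then show ?thesis using bset_fibre[of \<gamma> x g] by (auto simp: conv_bump_fibre[OF add_bump(2)])
    qed
    have eq: "(\<lambda>\<gamma>. if \<gamma> \<in> fibre x then conv (\<lambda>\<gamma>. bump g \<phi> \<gamma> + f \<gamma>) (ell2_apply \<xi>) \<gamma> else 0) =
        (\<lambda>\<gamma>. ell2_apply W \<gamma> + (if \<gamma> \<in> fibre x then conv f (ell2_apply \<xi>) \<gamma> else 0))"
      by (auto simp: W fun_eq_iff conv_plus_left[OF b add_bump(1)])
    show ss: "square_summable (\<lambda>\<gamma>. if \<gamma> \<in> fibre x then conv (\<lambda>\<gamma>. bump g \<phi> \<gamma> + f \<gamma>) (ell2_apply \<xi>) \<gamma> else 0)"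
      unfolding eq by (intro square_summable_add K) simp
    have "rr x (\<lambda>\<gamma>. bump g \<phi> \<gamma> + f \<gamma>) \<xi> = W + rr x f \<xi>"
    proof (rule ell2_eqI)
      fix i
      have "ell2_apply (rr x (\<lambda>\<gamma>. bump g \<phi> \<gamma> + f \<gamma>) \<xi>) i =
          (if i \<in> fibre x then conv (\<lambda>\<gamma>. bump g \<phi> \<gamma> + f \<gamma>) (ell2_apply \<xi>) i else 0)"
        unfolding rr_def by (rule Abs_ell2_apply[OF ss])
      moreover have "ell2_apply (rr x f \<xi>) i = (if i \<in> fibre x then conv f (ell2_apply \<xi>) i else 0)"
        unfolding rr_def by (rule Abs_ell2_apply[OF K(2)])
      ultimately show "ell2_apply (rr x (\<lambda>\<gamma>. bump g \<phi> \<gamma> + f \<gamma>) \<xi>) i = ell2_apply (W + rr x f \<xi>) i"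
        using fun_cong[OF eq, of i] by (simp only: ell2_apply_simps)
    qed
    then have "norm (rr x (\<lambda>\<gamma>. bump g \<phi> \<gamma> + f \<gamma>) \<xi>) \<le> norm W + norm (rr x f \<xi>)"
      by (simp add: norm_triangle_ineq)
    also have "\<dots> \<le> L * norm \<xi> + K * norm \<xi>"
      unfolding W_def by (intro add_mono K norm_wcomp_le[OF wc])
    finally show "norm (rr x (\<lambda>\<gamma>. bump g \<phi> \<gamma> + f \<gamma>) \<xi>) \<le> (L + K) * norm \<xi>" by (simp add: distrib_right)
  qed (use L K in auto)
qed

lemma rr_apply: "f \<in> CG \<Longrightarrow> ell2_apply (rr x f \<xi>) \<gamma> = (if \<gamma> \<in> fibre x then conv f (ell2_apply \<xi>) \<gamma> else 0)"
proof -
  assume "f \<in> CG"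
  then have "square_summable (\<lambda>\<gamma>. if \<gamma> \<in> fibre x then conv f (ell2_apply \<xi>) \<gamma> else 0)"
    using rr_facts[of f] by blast
  then show ?thesis unfolding rr_def by (rule Abs_ell2_apply)
qed

lemma ell2_apply_fun:
  "ell2_apply (\<xi> + \<eta>) = (\<lambda>i. ell2_apply \<xi> i + ell2_apply \<eta> i)"
  "ell2_apply (ell2_scale c \<xi>) = (\<lambda>i. c * ell2_apply \<xi> i)"
  "ell2_apply (r *\<^sub>R \<xi>) = (\<lambda>i. complex_of_real r * ell2_apply \<xi> i)"
  by (simp_all add: fun_eq_iff)

lemma rr_bump:
  assumes g: "g \<in> left_inverse_hull" and "Ocont \<phi>"
  shows "rr x (bump g \<phi>) \<xi> = wcomp (bset x g) (bmap g) (bweight g \<phi>) \<xi>"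
proof (rule ell2_eqI)
  obtain L where L: "0 \<le> L" "\<And>\<omega>. \<omega> \<in> Omega \<Longrightarrow> cmod (\<phi> \<omega>) \<le> L" using Ocont_bounded[OF assms(2)] by blast
  show "ell2_apply (rr x (bump g \<phi>) \<xi>) \<gamma> = ell2_apply (wcomp (bset x g) (bmap g) (bweight g \<phi>) \<xi>) \<gamma>" for \<gamma>
  proof -
    have "ell2_apply (wcomp (bset x g) (bmap g) (bweight g \<phi>) \<xi>) \<gamma> =
        (if \<gamma> \<in> bset x g then bweight g \<phi> \<gamma> * ell2_apply \<xi> (bmap g \<gamma>) else 0)"
      by (rule wcomp_apply[OF inj_on_bmap[OF g] bweight_bound[OF g L(2)] L(1)])
    then show ?thesis
      unfolding rr_apply[OF CG_bump[OF assms]] using bset_fibre[of \<gamma> x g] by (auto simp: conv_bump_fibre[OF g])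
  qed
qed

lemma rr_plus: "f \<in> CG \<Longrightarrow> f' \<in> CG \<Longrightarrow> rr x (\<lambda>\<gamma>. f \<gamma> + f' \<gamma>) \<xi> = rr x f \<xi> + rr x f' \<xi>"
  by (rule ell2_eqI) (simp add: rr_apply CG_plus conv_plus_left)

lemma rr_scale: "f \<in> CG \<Longrightarrow> rr x (\<lambda>\<gamma>. c * f \<gamma>) \<xi> = ell2_scale c (rr x f \<xi>)"
  by (rule ell2_eqI) (simp add: rr_apply CG_scale conv_scale_left)

lemma rr_zero: "rr x (\<lambda>_. 0) \<xi> = 0"
  by (rule ell2_eqI) (simp add: rr_apply CG.zero)

lemma rr_vec_plus: "f \<in> CG \<Longrightarrow> rr x f (\<xi> + \<eta>) = rr x f \<xi> + rr x f \<eta>"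
  by (rule ell2_eqI) (simp add: rr_apply ell2_apply_fun conv_plus_right)

lemma rr_vec_scale: "f \<in> CG \<Longrightarrow> rr x f (ell2_scale c \<xi>) = ell2_scale c (rr x f \<xi>)"
  by (rule ell2_eqI) (simp add: rr_apply ell2_apply_fun conv_scale_right)

lemma rr_bounded_linear: assumes "f \<in> CG" shows "bounded_linear (rr x f)"
proof -
  obtain K where "\<And>\<xi>. norm (rr x f \<xi>) \<le> K * norm \<xi>" using rr_facts[OF assms] by blast
  moreover have "rr x f (r *\<^sub>R \<xi>) = r *\<^sub>R rr x f \<xi>" for r \<xi>
    by (rule ell2_eqI) (simp add: rr_apply assms ell2_apply_fun conv_scale_right)
  ultimately show ?thesis
    by (intro bounded_linear_intro[where K = K]) (auto simp: rr_vec_plus assms mult.commute)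
qed

text \<open>For two bumps both sides are explicit at an arrow \<open>germ k x\<close>, namely a
  product of two weights and one coefficient. Induction then replaces any rearrangement of double
  sums.\<close>

lemma rr_gconv_bump:
  assumes g: "g \<in> left_inverse_hull" "Ocont \<phi>" and f: "f \<in> CG"
  shows "rr x (gconv (bump g \<phi>) f) \<xi> = rr x (bump g \<phi>) (rr x f \<xi>)"
  using f
proof (induction rule: CG.induct)
  case zero
  have "rr x (bump g \<phi>) 0 = 0"
    using rr_bounded_linear[OF CG_bump[OF g]] by (simp add: bounded_linear.linear linear_0)
  then show ?case by (simp add: rr_zero)
next
  case (add_bump f h \<psi>)
  note h = add_bump(2,3)
  have b: "bump g \<phi> \<in> CG" "bump h \<psi> \<in> CG" by (intro CG_bump g h)+
  have "rr x (gconv (bump g \<phi>) (bump h \<psi>)) \<xi> = rr x (bump g \<phi>) (rr x (bump h \<psi>) \<xi>)"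
  proof (rule ell2_eqI)
    fix \<gamma>
    have c: "gconv (bump g \<phi>) (bump h \<psi>) \<in> CG" by (rule CG_gconv[OF b])
    let ?\<Phi> = "\<lambda>\<omega>. if \<omega> \<in> dom_set h then \<phi> (translate_character h \<omega>) * \<psi> \<omega> else 0"
    show "ell2_apply (rr x (gconv (bump g \<phi>) (bump h \<psi>)) \<xi>) \<gamma> = ell2_apply (rr x (bump g \<phi>) (rr x (bump h \<psi>) \<xi>)) \<gamma>"
    proof (cases "\<gamma> \<in> fibre x")
      case True
      then obtain k where k: "k \<in> left_inverse_hull" "x \<in> dom_set k" "\<gamma> = germ k x" by (rule fibre_cases)
      let ?p = "pcomp (g\<inverse>) k" and ?q = "pcomp (h\<inverse>) (pcomp (g\<inverse>) k)"
      have p: "?p \<in> left_inverse_hull" by (intro hull_comp hull_inv g k)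
      have q: "pcomp ((pcomp g h)\<inverse>) k = ?q" by (simp add: converse_relcomp O_assoc)
      have qh: "?q \<in> left_inverse_hull" by (intro hull_comp hull_inv p h)
      have sub: "x \<in> dom_set ?p" if "x \<in> dom_set ?q" by (rule dom_set_compose_subset[OF hull_inv[OF h(1)] p that])
      have tq: "translate_character ?q x = translate_character (h\<inverse>) (translate_character ?p x)"
        by (rule translate_compose[OF hull_inv[OF h(1)] p])
      have tp: "translate_character ?q x \<in> dom_set h \<and> translate_character h (translate_character ?q x) = translate_character ?p x"
        if "x \<in> dom_set ?q"
      proof -
        have y: "translate_character ?p x \<in> dom_set (h\<inverse>)"
          using dom_set_compose[OF hull_inv[OF h(1)] p sub[OF that]] that by simp
        then show ?thesis
          using dom_set_inverse[OF hull_inv[OF h(1)] y] translate_inverse[OF hull_inv[OF h(1)], of "translate_character ?p x"]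
          unfolding tq by (simp add: dom_set_def)
      qed
      have L: "conv (gconv (bump g \<phi>) (bump h \<psi>)) (ell2_apply \<xi>) \<gamma> =
         (if x \<in> dom_set ?q then ?\<Phi> (translate_character ?q x) * ell2_apply \<xi> (germ ?q x) else 0)"
        unfolding gconv_bump[OF g(1) h(1)] k(3) conv_bump[OF k(1,2) hull_comp[OF g(1) h(1)]] q ..
      have R: "conv (bump g \<phi>) (ell2_apply (rr x (bump h \<psi>) \<xi>)) \<gamma> =
         (if x \<in> dom_set ?p then \<phi> (translate_character ?p x) * conv (bump h \<psi>) (ell2_apply \<xi>) (germ ?p x) else 0)"
        unfolding k(3) conv_bump[OF k(1,2) g(1)] using germ_in_fibre[OF p] by (auto simp: rr_apply[OF b(2)])
      show ?thesis
        using True sub tp by (simp add: rr_apply[OF c] rr_apply[OF b(1)] L R conv_bump[OF p _ h(1)])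
    qed (simp add: rr_apply[OF c] rr_apply[OF b(1)])
  qed
  then show ?case
    unfolding gconv_plus_right[OF b(1)]
    by (simp add: rr_plus CG_gconv b add_bump rr_vec_plus)
qed

lemma rr_gconv:
  assumes "f \<in> CG" "f' \<in> CG"
  shows "rr x (gconv f f') \<xi> = rr x f (rr x f' \<xi>)"
  using assms(1)
proof (induction rule: CG.induct)
  case zero
  show ?case by (simp add: rr_zero)
next
  case (add_bump f g \<phi>)
  have b: "bump g \<phi> \<in> CG" by (intro CG_bump add_bump)
  show ?case
    unfolding gconv_plus_left[OF b add_bump(1)]
    by (simp add: rr_plus CG_gconv b add_bump assms rr_gconv_bump)
qed

text \<open>Inverting the bisection inverts the partial permutation \<open>bmap g\<close>, so
  \<open>wcomp_adjoint\<close> applies bump by bump.\<close>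

lemma rr_gstar:
  assumes "f \<in> CG"
  shows "inner (rr x f \<xi>) \<eta> = inner \<xi> (rr x (gstar f) \<eta>)"
  using assms
proof (induction rule: CG.induct)
  case zero
  show ?case by (simp add: rr_zero)
next
  case (add_bump f g \<phi>)
  have b: "bump g \<phi> \<in> CG" by (intro CG_bump add_bump)
  have g: "g \<in> left_inverse_hull" and gi: "g\<inverse> \<in> left_inverse_hull" using add_bump hull_inv by auto
  obtain L where L: "0 \<le> L" "\<And>\<omega>. \<omega> \<in> Omega \<Longrightarrow> cmod (\<phi> \<omega>) \<le> L" using Ocont_bounded[OF add_bump(3)] by blast
  let ?\<psi> = "\<lambda>\<omega>. if \<omega> \<in> dom_set (g\<inverse>) then cnj (\<phi> (translate_character (g\<inverse>) \<omega>)) * 1 else 0"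
  have c: "Ocont ?\<psi>" by (intro Ocont_translate gi Ocont_cnj add_bump Ocont_const)
  have "inner (rr x (bump g \<phi>) \<xi>) \<eta> = inner \<xi> (rr x (bump (g\<inverse>) ?\<psi>) \<eta>)"
    unfolding rr_bump[OF g add_bump(3)] rr_bump[OF gi c]
  proof (rule wcomp_adjoint)
    show "bij_betw (bmap g) (bset x g) (bset x (g\<inverse>))"
      by (rule bij_betw_byWitness[where f' = "bmap (g\<inverse>)"])
        (use bmap_inverse[OF g] bmap_inverse[OF gi] in auto)
    show "bmap (g\<inverse>) j \<in> bset x g \<and> bmap g (bmap (g\<inverse>) j) = j" if "j \<in> bset x (g\<inverse>)" for j
      using bmap_inverse(1,2)[OF gi that] by simp
    show "cmod (bweight g \<phi> i) \<le> L" if "i \<in> bset x g" for i by (rule bweight_bound[OF g L(2) that])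
    show "bweight (g\<inverse>) ?\<psi> j = cnj (bweight g \<phi> (bmap (g\<inverse>) j))" if j: "j \<in> bset x (g\<inverse>)" for j
    proof -
      have y: "grng GG j \<in> dom_set g" using j by (simp add: bset_def)
      then have "translate_character g (grng GG j) \<in> dom_set (g\<inverse>)" by (rule dom_set_inverse[OF g])
      then show ?thesis using bmap_inverse(3)[OF gi j] by (simp add: bweight_def)
    qed
  qed (rule L)
  moreover have "gstar (\<lambda>\<gamma>. bump g \<phi> \<gamma> + f \<gamma>) = (\<lambda>\<gamma>. gstar (bump g \<phi>) \<gamma> + gstar f \<gamma>)"
    by (auto simp: gstar_def fun_eq_iff)
  ultimately show ?case
    using rr_plus[OF b add_bump(1), of x \<xi>] rr_plus[OF CG_bump[OF gi c] CG_gstar[OF add_bump(1)], of x \<eta>] add_bump(4)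
    unfolding gstar_bump[OF g] by (simp only: inner_add_left inner_add_right)
qed

section \<open>Compactly supported functions are combinations of bumps\<close>

abbreviation TT :: "'s::left_cancel_monoid germ topology" where "TT \<equiv> gtop GG"

text \<open>A cylinder witnessing agreement at one character witnesses it at each of its characters.
  This openness makes the images of the sections \<open>germ g\<close> open.\<close>

lemma openin_near: "openin Omega_topology {\<omega> \<in> Omega. near \<omega> g h}"
  unfolding openin_Omega
proof (intro conjI ballI)
  fix \<omega> assume "\<omega> \<in> {\<omega> \<in> Omega. near \<omega> g h}"
  then have w: "\<omega> \<in> Omega" "near \<omega> g h" by auto
  then obtain X F where XF: "X \<in> \<J>" "finite F" "F \<subseteq> \<J>" "\<omega> \<in> cylinder X F"
    "\<forall>s. point_character s \<in> cylinder X F \<longrightarrow> g `` {s} = h `` {s}"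
    unfolding near_def eventually_cylinder[OF w(1)] by blast
  have "cylinder X F \<subseteq> {\<omega> \<in> Omega. near \<omega> g h}"
  proof
    fix \<eta> assume e: "\<eta> \<in> cylinder X F"
    then have "\<eta> \<in> Omega" by (simp add: cylinder_def)
    then show "\<eta> \<in> {\<omega> \<in> Omega. near \<omega> g h}"
      using e XF unfolding near_def by (auto simp: eventually_cylinder)
  qed
  then show "\<exists>X F. X \<in> \<J> \<and> finite F \<and> F \<subseteq> \<J> \<and> \<omega> \<in> cylinder X F \<and> cylinder X F \<subseteq> {\<omega> \<in> Omega. near \<omega> g h}"
    using XF by blast
qed auto

lemma openin_germ_image:
  assumes g: "g \<in> left_inverse_hull" and U: "openin Omega_topology U" "U \<subseteq> dom_set g"
  shows "openin TT (germ g ` U)"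
  unfolding openin_monoid_groupoid
proof (intro conjI ballI)
  show "germ g ` U \<subseteq> garr GG" using germ_in_garr[OF g] U by auto
  fix h :: "'a rel" assume h: "h \<in> left_inverse_hull"
  have "germ h \<omega> \<in> germ g ` U \<longleftrightarrow> \<omega> \<in> U \<and> near \<omega> h g" if "\<omega> \<in> dom_set h" for \<omega>
    using germ_eq_iff[OF h that g] U(2) by (metis (no_types, lifting) image_iff subsetD)
  then have "{\<omega> \<in> dom_set h. germ h \<omega> \<in> germ g ` U} = dom_set h \<inter> U \<inter> {\<omega> \<in> Omega. near \<omega> h g}"
    by (auto simp: dom_set_def)
  then show "openin Omega_topology {\<omega> \<in> dom_set h. germ h \<omega> \<in> germ g ` U}"
    using openin_dom_set[OF h] U openin_near by (metis openin_Int)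
qed

lemma continuous_germ:
  assumes g: "g \<in> left_inverse_hull"
  shows "continuous_map (subtopology Omega_topology (dom_set g)) TT (germ g)"
  unfolding continuous_map_openin_preimage_eq
proof (intro conjI allI impI)
  have top: "topspace (subtopology Omega_topology (dom_set g)) = dom_set g"
    by (auto simp: topspace_Omega dom_set_def)
  show "germ g \<in> topspace (subtopology Omega_topology (dom_set g)) \<rightarrow> topspace TT"
    using germ_in_garr[OF g] by (auto simp: topspace_monoid_groupoid dom_set_def)
  fix V assume "openin TT (V :: 'a germ set)"
  then have "openin Omega_topology {\<omega> \<in> dom_set g. germ g \<omega> \<in> V}"
    using g by (simp add: openin_monoid_groupoid)
  moreover have "{\<omega> \<in> dom_set g. germ g \<omega> \<in> V} = dom_set g \<inter> germ g -` V" by auto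
  ultimately show "openin (subtopology Omega_topology (dom_set g)) (topspace (subtopology Omega_topology (dom_set g)) \<inter> germ g -` V)"
    unfolding top openin_open_subtopology[OF openin_dom_set[OF g]] by simp
qed

lemma continuous_gsrc: "continuous_map TT Omega_topology (gsrc (GG :: ('a::left_cancel_monoid germ, _) groupoid))"
  unfolding continuous_map_openin_preimage_eq
proof (intro conjI allI impI)
  show "gsrc GG \<in> topspace (TT :: 'a germ topology) \<rightarrow> topspace Omega_topology"
    using gsrc_germ dom_set_Omega by (force simp: topspace_monoid_groupoid topspace_Omega garr_monoid_groupoid)
  fix U :: "('a set \<Rightarrow> bool) set" assume U: "openin Omega_topology U"
  show "openin TT (topspace TT \<inter> gsrc (GG :: ('a germ, _) groupoid) -` U)"
    unfolding openin_monoid_groupoid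
  proof (intro conjI ballI)
    fix g :: "'a rel" assume g: "g \<in> left_inverse_hull"
    have eq: "{\<omega> \<in> dom_set g. germ g \<omega> \<in> topspace TT \<inter> gsrc GG -` U} = dom_set g \<inter> U"
      by (auto simp: topspace_monoid_groupoid germ_in_garr[OF g] gsrc_germ[OF g])
    show "openin Omega_topology {\<omega> \<in> dom_set g. germ g \<omega> \<in> topspace TT \<inter> gsrc GG -` U}"
      unfolding eq by (rule openin_Int[OF openin_dom_set[OF g] U])
  qed (auto simp: topspace_monoid_groupoid)
qed

lemma compactin_clopen:
  "closedin Omega_topology C \<Longrightarrow> compactin Omega_topology C"
  by (rule closedin_compact_space[OF compact_Omega])

lemma compactin_germ_image:
  assumes g: "g \<in> left_inverse_hull" and C: "closedin Omega_topology C" "C \<subseteq> dom_set g"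
  shows "compactin TT (germ g ` C)"
proof (rule image_compactin[OF _ continuous_germ[OF g]])
  show "compactin (subtopology Omega_topology (dom_set g)) C"
    using compactin_clopen[OF C(1)] C(2) by (simp add: compactin_subtopology)
qed

text \<open>The additional information on supports is needed for functions on the complement of the boundary.\<close>

inductive_set CGV :: "'s::left_cancel_monoid germ set \<Rightarrow> ('s germ \<Rightarrow> complex) set" for V where
  zero: "(\<lambda>_. 0) \<in> CGV V"
| add_bump: "f \<in> CGV V \<Longrightarrow> g \<in> left_inverse_hull \<Longrightarrow> Ocont \<phi> \<Longrightarrow>
    (\<And>\<eta>. \<phi> \<eta> \<noteq> 0 \<Longrightarrow> \<eta> \<in> dom_set g \<and> germ g \<eta> \<in> V) \<Longrightarrow> (\<lambda>\<gamma>. bump g \<phi> \<gamma> + f \<gamma>) \<in> CGV V"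

lemma CGV_CG: "f \<in> CGV V \<Longrightarrow> f \<in> CG"
  by (induction rule: CGV.induct) (auto intro: CG.intros)

lemma CGV_mono: "f \<in> CGV V \<Longrightarrow> V \<subseteq> W \<Longrightarrow> f \<in> CGV W"
  by (induction rule: CGV.induct) (blast intro: CGV.intros)+

lemma CGV_plus: "f \<in> CGV V \<Longrightarrow> f' \<in> CGV V \<Longrightarrow> (\<lambda>\<gamma>. f \<gamma> + f' \<gamma>) \<in> CGV V"
proof (induction rule: CGV.induct)
  case (add_bump f g \<phi>)
  have "(\<lambda>\<gamma>. bump g \<phi> \<gamma> + (f \<gamma> + f' \<gamma>)) \<in> CGV V"
    by (rule CGV.add_bump) (use add_bump in auto)
  then show ?case by (simp add: add.assoc)
qed auto

lemma CGV_scale: "f \<in> CGV V \<Longrightarrow> (\<lambda>\<gamma>. c * f \<gamma>) \<in> CGV V"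
proof (induction rule: CGV.induct)
  case (add_bump f g \<phi>)
  have "(\<lambda>\<gamma>. bump g (\<lambda>\<omega>. c * \<phi> \<omega>) \<gamma> + c * f \<gamma>) \<in> CGV V"
    by (rule CGV.add_bump) (use add_bump Ocont_mult[OF Ocont_const, of \<phi> c] in auto)
  then show ?case by (simp add: distrib_left bump_scale)
qed (use CGV.zero in simp)

lemma CGV_sum: "finite I \<Longrightarrow> (\<And>i. i \<in> I \<Longrightarrow> f i \<in> CGV V) \<Longrightarrow> (\<lambda>\<gamma>. \<Sum>i\<in>I. f i \<gamma>) \<in> CGV V"
  by (induction I rule: finite_induct) (auto intro: CGV_plus CGV.zero)

text \<open>Compact open bisections are peeled off one at a time. In the Hausdorff set
  \<open>V\<close> such a piece is closed as well as open, so setting \<open>f\<close> to zero on it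
  preserves continuity, and the removed part is a bump.\<close>

lemma CGV_cover:
  assumes V: "openin TT V" "Hausdorff_space (subtopology TT V)"
    and S: "finite S"
      "\<And>g C. (g, C) \<in> S \<Longrightarrow> g \<in> left_inverse_hull \<and> openin Omega_topology C \<and> closedin Omega_topology C \<and> C \<subseteq> dom_set g \<and> germ g ` C \<subseteq> V"
    and f: "continuous_map (subtopology TT V) euclidean f" "\<And>\<gamma>. \<gamma> \<notin> V \<Longrightarrow> f \<gamma> = 0" "\<And>\<gamma>. \<gamma> \<notin> (\<Union>(g, C)\<in>S. germ g ` C) \<Longrightarrow> f \<gamma> = 0"
  shows "f \<in> CGV V"
  using S f
proof (induction S arbitrary: f rule: finite_induct)
  case empty
  then have "f = (\<lambda>_. 0)" by auto
  then show ?case by (simp add: CGV.zero)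
next
  case (insert x S)
  obtain g C where x: "x = (g, C)" by (cases x)
  have g: "g \<in> left_inverse_hull" "openin Omega_topology C" "closedin Omega_topology C" "C \<subseteq> dom_set g" "germ g ` C \<subseteq> V"
    using insert.prems(1)[of g C] x by auto
  have topV: "topspace (subtopology TT V) = V" using openin_subset[OF V(1)] by auto
  let ?N = "germ g ` C"
  have No: "openin (subtopology TT V) ?N"
    using openin_germ_image[OF g(1,2,4)] g(5) V(1) by (simp add: openin_open_subtopology)
  have Nc: "closedin (subtopology TT V) ?N"
    using compactin_germ_image[OF g(1,3,4)] g(5) V(2) by (intro compactin_imp_closedin) (auto simp: compactin_subtopology)
  define \<phi> where "\<phi> \<eta> = (if \<eta> \<in> C then f (germ g \<eta>) else 0)" for \<eta>
  have phi: "Ocont \<phi>"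
    unfolding \<phi>_def
  proof (rule Ocont_cases[OF g(2,3) _ Ocont_const])
    have "continuous_map (subtopology Omega_topology C) TT (germ g)"
      using continuous_map_from_subtopology_mono[OF continuous_germ[OF g(1)] g(4)] .
    then have "continuous_map (subtopology Omega_topology C) (subtopology TT V) (germ g)"
      using g(5) by (auto simp: continuous_map_in_subtopology)
    then show "continuous_map (subtopology Omega_topology C) euclidean (\<lambda>\<eta>. f (germ g \<eta>))"
      using continuous_map_compose[OF _ insert.prems(2)] by (simp add: o_def)
  qed
  have b: "bump g \<phi> \<gamma> = (if \<gamma> \<in> ?N then f \<gamma> else 0)" for \<gamma>
  proof (cases "\<gamma> \<in> germ g ` dom_set g")
    case True
    then obtain \<eta> where e: "\<eta> \<in> dom_set g" "\<gamma> = germ g \<eta>" by auto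
    have "\<gamma> \<in> ?N \<longleftrightarrow> \<eta> \<in> C"
      using e g(4) germ_eq_iff[OF g(1) e(1) g(1)] by (metis (no_types, lifting) image_iff subsetD)
    then show ?thesis using bump_germ[OF g(1) g(1) e(1), of \<phi>] e by (simp add: \<phi>_def)
  next
    case False
    then have "\<gamma> \<notin> ?N" using g(4) by blast
    then show ?thesis using False by (simp add: bump_def)
  qed
  define f' where "f' \<gamma> = (if \<gamma> \<in> ?N then 0 else f \<gamma>)" for \<gamma>
  have "f' \<in> CGV V"
  proof (rule insert.IH)
    show "continuous_map (subtopology TT V) euclidean f'"
      unfolding continuous_map_openin_preimage_eq
    proof (intro conjI allI impI)
      fix O' :: "complex set" assume O': "openin euclidean O'"
      have 1: "openin (subtopology TT V) (V \<inter> f -` O')"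
        using insert.prems(2) O' unfolding continuous_map_openin_preimage_eq topV by blast
      have 2: "openin (subtopology TT V) (V - ?N)" using Nc unfolding closedin_def topV by blast
      have "topspace (subtopology TT V) \<inter> f' -` O' = ((V \<inter> f -` O') \<inter> (V - ?N)) \<union> (if 0 \<in> O' then ?N else {})"
        unfolding topV f'_def using g(5) by (auto split: if_splits)
      then show "openin (subtopology TT V) (topspace (subtopology TT V) \<inter> f' -` O')"
        using 1 2 No by (simp add: openin_Un openin_Int)
    qed auto
    show "f' \<gamma> = 0" if "\<gamma> \<notin> V" for \<gamma> using that insert.prems(3) by (simp add: f'_def)
    show "f' \<gamma> = 0" if "\<gamma> \<notin> (\<Union>(g, C)\<in>S. germ g ` C)" for \<gamma>
      using that insert.prems(4)[of \<gamma>] x by (auto simp: f'_def)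
    show "h \<in> left_inverse_hull \<and> openin Omega_topology D \<and> closedin Omega_topology D \<and> D \<subseteq> dom_set h \<and> germ h ` D \<subseteq> V"
      if "(h, D) \<in> S" for h D using insert.prems(1)[of h D] that by simp
  qed
  then have "(\<lambda>\<gamma>. bump g \<phi> \<gamma> + f' \<gamma>) \<in> CGV V"
    by (rule CGV.add_bump[OF _ g(1) phi]) (use g(4,5) in \<open>auto simp: \<phi>_def split: if_splits\<close>)
  moreover have "(\<lambda>\<gamma>. bump g \<phi> \<gamma> + f' \<gamma>) = f" by (auto simp: b f'_def fun_eq_iff)
  ultimately show ?case by simp
qed

text \<open>Each arrow of the open set \<open>V\<close> lies in the image of a cylinder under a
  section inside \<open>V\<close>; finitely many such images cover the compact support.\<close>

lemma ccs_CGV: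
  assumes V: "openin TT V" "Hausdorff_space (subtopology TT V)"
    and f: "f \<in> continuous_compact_support TT V"
  shows "f \<in> CGV V"
proof -
  let ?T = "subtopology TT V"
  define K where "K = ?T closure_of {\<gamma> \<in> V. f \<gamma> \<noteq> 0}"
  have K: "compactin ?T K" using f by (simp add: continuous_compact_support_def K_def)
  have topV: "topspace ?T = V" using openin_subset[OF V(1)] by auto
  have KV: "K \<subseteq> V" using compactin_subset_topspace[OF K] topV by simp
  have fK: "{\<gamma> \<in> V. f \<gamma> \<noteq> 0} \<subseteq> K" unfolding K_def by (rule closure_of_subset) (simp only: topV, blast)
  define P where "P = {(g, C). g \<in> left_inverse_hull \<and> openin Omega_topology C \<and> closedin Omega_topology C \<and> C \<subseteq> dom_set g \<and> germ g ` C \<subseteq> V}"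
  have cover: "K \<subseteq> \<Union>((\<lambda>(g, C). germ g ` C) ` P)"
  proof
    fix \<gamma> assume "\<gamma> \<in> K"
    then have gV: "\<gamma> \<in> V" using KV by auto
    then have "\<gamma> \<in> garr GG" using V(1) openin_monoid_groupoid by blast
    then obtain g \<omega> where g: "g \<in> left_inverse_hull" "\<omega> \<in> dom_set g" "\<gamma> = germ g \<omega>" by (rule garr_cases)
    have "openin Omega_topology {\<omega> \<in> dom_set g. germ g \<omega> \<in> V}" using V(1) g(1) by (simp add: openin_monoid_groupoid)
    moreover have "\<omega> \<in> {\<omega> \<in> dom_set g. germ g \<omega> \<in> V}" using g gV by simp
    ultimately obtain X F where XF: "X \<in> \<J>" "finite F" "F \<subseteq> \<J>" "\<omega> \<in> cylinder X F" "cylinder X F \<subseteq> {\<omega> \<in> dom_set g. germ g \<omega> \<in> V}"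
      unfolding openin_Omega by blast
    then have "(g, cylinder X F) \<in> P"
      using g openin_cylinder closedin_cylinder unfolding P_def by auto
    then show "\<gamma> \<in> \<Union>((\<lambda>(g, C). germ g ` C) ` P)" using XF g by blast
  qed
  have "\<forall>U\<in>(\<lambda>(g, C). germ g ` C) ` P. openin ?T U"
    using openin_germ_image V(1) by (auto simp: P_def openin_open_subtopology)
  then obtain \<U> where U: "finite \<U>" "\<U> \<subseteq> (\<lambda>(g, C). germ g ` C) ` P" "K \<subseteq> \<Union>\<U>"
    using K cover unfolding compactin_def by meson
  then obtain S where S: "finite S" "S \<subseteq> P" "\<U> = (\<lambda>(g, C). germ g ` C) ` S"
    by (meson finite_subset_image)
  show ?thesis
  proof (rule CGV_cover[OF V S(1)])
    show "f \<gamma> = 0" if "\<gamma> \<notin> V" for \<gamma> using f that by (auto simp: continuous_compact_support_def)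
    show "f \<gamma> = 0" if "\<gamma> \<notin> (\<Union>(g, C)\<in>S. germ g ` C)" for \<gamma>
    proof -
      have "\<gamma> \<notin> \<Union>\<U>" using that unfolding S(3) by (simp add: split_def)
      then have "\<gamma> \<notin> {\<gamma> \<in> V. f \<gamma> \<noteq> 0}" using U(3) fK by blast
      then show ?thesis using f by (auto simp: continuous_compact_support_def)
    qed
    show "continuous_map ?T euclidean f" using f by (simp add: continuous_compact_support_def)
    show "g \<in> left_inverse_hull \<and> openin Omega_topology C \<and> closedin Omega_topology C \<and> C \<subseteq> dom_set g \<and> germ g ` C \<subseteq> V"
      if "(g, C) \<in> S" for g C using S(2) that by (auto simp: P_def)
  qed
qed

section \<open>Reductions\<close>

lemma Cc_zero: "(\<lambda>_. 0) \<in> Cc G"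
  unfolding Cc_def by (intro CollectI exI[of _ "{}"]) auto

lemma Cc_plus:
  assumes "f \<in> Cc G" "f' \<in> Cc G"
  shows "(\<lambda>g. f g + f' g) \<in> Cc G"
proof -
  let ?S = "(\<Union>V\<in>{V. openin (gtop G) V \<and> Hausdorff_space (subtopology (gtop G) V)}. continuous_compact_support (gtop G) V)"
  obtain B c where B: "finite B" "B \<subseteq> ?S" "f = (\<lambda>g. \<Sum>b\<in>B. c b * b g)" using assms(1) unfolding Cc_def by blast
  obtain B' c' where B': "finite B'" "B' \<subseteq> ?S" "f' = (\<lambda>g. \<Sum>b\<in>B'. c' b * b g)" using assms(2) unfolding Cc_def by blast
  \<comment> \<open>A function occurring in both families receives the sum of its two
    coefficients.\<close>
  let ?c = "\<lambda>b. (if b \<in> B then c b else 0) + (if b \<in> B' then c' b else 0)"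
  have "(\<Sum>b\<in>B \<union> B'. ?c b * b g) = f g + f' g" for g
  proof -
    have "(\<Sum>b\<in>B \<union> B'. ?c b * b g) = (\<Sum>b\<in>B \<union> B'. (if b \<in> B then c b else 0) * b g) + (\<Sum>b\<in>B \<union> B'. (if b \<in> B' then c' b else 0) * b g)"
      by (simp add: distrib_right sum.distrib)
    also have "(\<Sum>b\<in>B \<union> B'. (if b \<in> B then c b else 0) * b g) = f g"
      unfolding B(3) by (rule sum.mono_neutral_cong_right) (use B B' in auto)
    also have "(\<Sum>b\<in>B \<union> B'. (if b \<in> B' then c' b else 0) * b g) = f' g"
      unfolding B'(3) by (rule sum.mono_neutral_cong_right) (use B B' in auto)
    finally show ?thesis .
  qed
  then show ?thesis unfolding Cc_def using B B'
    by (intro CollectI exI[of _ "B \<union> B'"] exI[of _ ?c]) auto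
qed

lemma Cc_scale: assumes "f \<in> Cc G" shows "(\<lambda>g. c * f g) \<in> Cc G"
proof -
  obtain B d where B: "finite B" "B \<subseteq> (\<Union>V\<in>{V. openin (gtop G) V \<and> Hausdorff_space (subtopology (gtop G) V)}.
      continuous_compact_support (gtop G) V)" "f = (\<lambda>g. \<Sum>b\<in>B. d b * b g)"
    using assms unfolding Cc_def by blast
  then show ?thesis unfolding Cc_def
    by (intro CollectI exI[of _ B] exI[of _ "\<lambda>b. c * d b"]) (auto simp: sum_distrib_left mult.assoc)
qed

lemma Cc_single:
  assumes "openin (gtop G) V" "Hausdorff_space (subtopology (gtop G) V)" "f \<in> continuous_compact_support (gtop G) V"
  shows "f \<in> Cc G"
  unfolding Cc_def using assms by (intro CollectI exI[of _ "{f}"] exI[of _ "\<lambda>_. 1"]) auto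

lemma Hausdorff_germ_image:
  assumes g: "g \<in> left_inverse_hull"
  shows "Hausdorff_space (subtopology TT (germ g ` dom_set g))"
  unfolding Hausdorff_space_def
proof (intro allI impI)
  let ?V = "germ g ` dom_set g"
  have Vo: "openin TT ?V" by (rule openin_germ_image[OF g openin_dom_set[OF g]]) simp
  fix a b assume ab: "a \<in> topspace (subtopology TT ?V) \<and> b \<in> topspace (subtopology TT ?V) \<and> a \<noteq> b"
  then obtain \<omega> \<eta> where e: "a = germ g \<omega>" "b = germ g \<eta>" "\<omega> \<in> dom_set g" "\<eta> \<in> dom_set g" by auto
  then have "\<omega> \<noteq> \<eta>" "\<omega> \<in> topspace Omega_topology" "\<eta> \<in> topspace Omega_topology"
    using ab dom_set_Omega by (auto simp: topspace_Omega)
  then obtain U W where UW: "openin Omega_topology U" "openin Omega_topology W" "\<omega> \<in> U" "\<eta> \<in> W" "disjnt U W"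
    using Hausdorff_Omega unfolding Hausdorff_space_def by meson
  have o: "openin (subtopology TT ?V) (germ g ` (U' \<inter> dom_set g))" if "openin Omega_topology U'" for U'
    unfolding openin_open_subtopology[OF Vo]
    using openin_germ_image[OF g openin_Int[OF that openin_dom_set[OF g]]] by auto
  have "disjnt (germ g ` (U \<inter> dom_set g)) (germ g ` (W \<inter> dom_set g))"
    unfolding disjnt_iff
  proof (intro allI notI)
    fix x assume "x \<in> germ g ` (U \<inter> dom_set g) \<and> x \<in> germ g ` (W \<inter> dom_set g)"
    then obtain y z where yz: "y \<in> U" "y \<in> dom_set g" "z \<in> W" "z \<in> dom_set g" "germ g y = germ g z" by auto
    then have "y = z" using germ_eq_iff[OF g yz(2) g yz(4)] by simp
    then show False using yz UW by (auto simp: disjnt_iff)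
  qed
  then show "\<exists>U W. openin (subtopology TT ?V) U \<and> openin (subtopology TT ?V) W \<and> a \<in> U \<and> b \<in> W \<and> disjnt U W"
    using o[OF UW(1)] o[OF UW(2)] e UW by blast
qed

text \<open>The closed set \<open>A\<close> is chosen twice below: all arrows, to place bumps in
  \<open>Cc\<close>, and the arrows over the boundary, to show that restriction lands in the right
  algebra. Closedness keeps the truncated bisection compact.\<close>

lemma bump_ccs:
  assumes g: "g \<in> left_inverse_hull" and phi: "Ocont \<phi>" and A: "closedin TT A"
  defines "V \<equiv> A \<inter> germ g ` dom_set g"
  shows "openin (subtopology TT A) V" "Hausdorff_space (subtopology (subtopology TT A) V)"
    "(\<lambda>\<gamma>. if \<gamma> \<in> A then bump g \<phi> \<gamma> else 0) \<in> continuous_compact_support (subtopology TT A) V"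
proof -
  let ?W = "germ g ` dom_set g"
  have Wo: "openin TT ?W" by (rule openin_germ_image[OF g openin_dom_set[OF g]]) simp
  show "openin (subtopology TT A) V"
    unfolding V_def using Wo by (auto simp: openin_subtopology)
  have sub: "subtopology (subtopology TT A) V = subtopology (subtopology TT ?W) V"
    by (simp add: subtopology_subtopology V_def Int_commute Int_left_commute Int_absorb)
  show "Hausdorff_space (subtopology (subtopology TT A) V)"
    unfolding sub by (rule Hausdorff_space_subtopology[OF Hausdorff_germ_image[OF g]])
  have subV: "subtopology (subtopology TT A) V = subtopology TT V"
    by (simp add: subtopology_subtopology V_def Int_assoc[symmetric])
  have topV: "topspace (subtopology TT V) = V"
    using openin_subset[OF Wo] by (auto simp: V_def)
  have "compactin TT ?W" by (rule compactin_germ_image[OF g closedin_dom_set[OF g]]) simp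
  then have "compactin TT V" using A unfolding V_def by (metis closed_Int_compactin)
  then have cV: "compact_space (subtopology TT V)" by (rule compact_space_subtopology)
  show "(\<lambda>\<gamma>. if \<gamma> \<in> A then bump g \<phi> \<gamma> else 0) \<in> continuous_compact_support (subtopology TT A) V"
    unfolding continuous_compact_support_def subV
  proof (intro CollectI conjI allI impI)
    fix \<gamma> assume "\<gamma> \<notin> V"
    then show "(if \<gamma> \<in> A then bump g \<phi> \<gamma> else 0) = 0" by (auto simp: V_def bump_def)
  next
    have "continuous_map (subtopology TT V) euclidean (\<phi> \<circ> gsrc GG)"
      using continuous_map_compose[OF continuous_map_from_subtopology[OF continuous_gsrc]] phi
      unfolding Ocont_def by blast
    then show "continuous_map (subtopology TT V) euclidean (\<lambda>\<gamma>. if \<gamma> \<in> A then bump g \<phi> \<gamma> else 0)"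
      by (rule continuous_map_eq) (auto simp: topV, auto simp: V_def bump_def)
  next
    show "compactin (subtopology TT V) (subtopology TT V closure_of {\<gamma> \<in> V. (if \<gamma> \<in> A then bump g \<phi> \<gamma> else 0) \<noteq> 0})"
      by (rule closedin_compact_space[OF cV closedin_closure_of])
  qed
qed

lemma Cc_monoid_groupoid: "Cc GG = (CG :: ('a::left_cancel_monoid germ \<Rightarrow> complex) set)"
proof
  show "Cc GG \<subseteq> (CG :: ('a germ \<Rightarrow> complex) set)"
  proof
    fix f :: "'a germ \<Rightarrow> complex" assume "f \<in> Cc GG"
    then obtain B c where B: "finite B" "B \<subseteq> (\<Union>V\<in>{V. openin TT V \<and> Hausdorff_space (subtopology TT V)}.
        continuous_compact_support TT V)" "f = (\<lambda>g. \<Sum>b\<in>B. c b * b g)"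
      unfolding Cc_def by blast
    have "b \<in> CG" if "b \<in> B" for b using B(2) that ccs_CGV CGV_CG by blast
    then show "f \<in> CG" unfolding B(3) using B(1) by (intro CG_sum CG_scale)
  qed
  show "(CG :: ('a germ \<Rightarrow> complex) set) \<subseteq> Cc GG"
  proof
    fix f :: "'a germ \<Rightarrow> complex" assume "f \<in> CG"
    then show "f \<in> Cc GG"
    proof (induction rule: CG.induct)
      case (add_bump f g \<phi>)
      have A: "closedin TT (garr (GG :: ('a germ, _) groupoid))" using closedin_topspace[of TT] by (simp add: topspace_monoid_groupoid)
      have s: "subtopology TT (garr GG) = (TT :: 'a germ topology)"
        using subtopology_topspace[of TT] by (simp add: topspace_monoid_groupoid)
      have "(\<lambda>\<gamma>. if \<gamma> \<in> garr GG then bump g \<phi> \<gamma> else 0) = bump g \<phi>"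
        using bump_off[OF add_bump(2)] by (auto simp: fun_eq_iff)
      then have "bump g \<phi> \<in> Cc GG"
        using Cc_single[of GG, OF bump_ccs[OF add_bump(2,3) A, unfolded s]] by simp
      then show ?case using add_bump by (intro Cc_plus) auto
    qed (rule Cc_zero)
  qed
qed

lemma garr_source:
  assumes "\<gamma> \<in> garr GG"
  shows "gsrc GG \<gamma> \<in> Omega" "grng GG \<gamma> \<in> Omega" "grng GG \<gamma> \<in> boundary_Omega \<longleftrightarrow> gsrc GG \<gamma> \<in> boundary_Omega"
proof -
  obtain g \<omega> where g: "g \<in> left_inverse_hull" "\<omega> \<in> dom_set g" "\<gamma> = germ g \<omega>" using assms by (rule garr_cases)
  then show "gsrc GG \<gamma> \<in> Omega" "grng GG \<gamma> \<in> Omega" "grng GG \<gamma> \<in> boundary_Omega \<longleftrightarrow> gsrc GG \<gamma> \<in> boundary_Omega"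
    using translate_in_Omega[OF g(1)] translate_boundary_iff[OF g(1)]
    by (auto simp: gsrc_germ grng_germ dom_set_def)
qed

lemma same_range_boundary:
  "\<gamma> \<in> garr GG \<Longrightarrow> \<gamma>' \<in> garr GG \<Longrightarrow> grng GG \<gamma>' = grng GG \<gamma> \<Longrightarrow>
    gsrc GG \<gamma>' \<in> boundary_Omega \<longleftrightarrow> gsrc GG \<gamma> \<in> boundary_Omega"
  by (metis garr_source(3))

lemma garr_boundary: "garr boundary_groupoid = {\<gamma> \<in> garr GG. gsrc GG \<gamma> \<in> boundary_Omega}"
  using garr_source by (auto simp: boundary_groupoid_def reduction_def Let_def)

lemma garr_off_boundary: "garr off_boundary_groupoid = {\<gamma> \<in> garr GG. gsrc GG \<gamma> \<notin> boundary_Omega}"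
  using garr_source by (auto simp: off_boundary_groupoid_def reduction_def Let_def)

lemma gtop_boundary: "gtop boundary_groupoid = subtopology TT (garr boundary_groupoid)"
  by (simp add: boundary_groupoid_def reduction_def Let_def)

lemma gtop_off_boundary: "gtop off_boundary_groupoid = subtopology TT (garr off_boundary_groupoid)"
  by (simp add: off_boundary_groupoid_def reduction_def Let_def)

lemma openin_off_boundary: "openin TT (garr (off_boundary_groupoid :: ('a::left_cancel_monoid germ, _) groupoid))"
proof -
  have "openin Omega_topology (Omega - boundary_Omega :: ('a set \<Rightarrow> bool) set)"
    by (metis (no_types) closedin_boundary closedin_def topspace_Omega)
  from openin_continuous_map_preimage[OF continuous_gsrc this]
  have "openin TT {\<gamma> \<in> topspace TT. gsrc (GG :: ('a germ, _) groupoid) \<gamma> \<in> Omega - boundary_Omega}" .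
  moreover have "{\<gamma> \<in> topspace TT. gsrc (GG :: ('a germ, _) groupoid) \<gamma> \<in> Omega - boundary_Omega} = garr off_boundary_groupoid"
    using garr_source by (auto simp: garr_off_boundary topspace_monoid_groupoid)
  ultimately show ?thesis by simp
qed

lemma closedin_boundary_arrows: "closedin TT (garr (boundary_groupoid :: ('a::left_cancel_monoid germ, _) groupoid))"
proof -
  have "topspace TT - garr boundary_groupoid = garr (off_boundary_groupoid :: ('a germ, _) groupoid)"
    by (auto simp: garr_boundary garr_off_boundary topspace_monoid_groupoid)
  then show ?thesis using openin_off_boundary by (auto simp: closedin_def garr_boundary topspace_monoid_groupoid)
qed

lemma restrict_Cc:
  assumes "f \<in> CG"
  shows "restrict_to_boundary f \<in> Cc boundary_groupoid"
  using assms
proof (induction rule: CG.induct)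
  case zero
  show ?case by (simp add: restrict_to_boundary_def Cc_zero)
next
  case (add_bump f g \<phi>)
  have "(\<lambda>\<gamma>. if \<gamma> \<in> garr boundary_groupoid then bump g \<phi> \<gamma> else 0) \<in> Cc boundary_groupoid"
    using bump_ccs[OF add_bump(2,3) closedin_boundary_arrows] by (intro Cc_single) (auto simp: gtop_boundary)
  then have "(\<lambda>\<gamma>. (if \<gamma> \<in> garr boundary_groupoid then bump g \<phi> \<gamma> else 0) + restrict_to_boundary f \<gamma>) \<in> Cc boundary_groupoid"
    by (intro Cc_plus add_bump)
  moreover have "(\<lambda>\<gamma>. (if \<gamma> \<in> garr boundary_groupoid then bump g \<phi> \<gamma> else 0) + restrict_to_boundary f \<gamma>) =
      restrict_to_boundary (\<lambda>\<gamma>. bump g \<phi> \<gamma> + f \<gamma>)"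
    by (auto simp: restrict_to_boundary_def fun_eq_iff)
  ultimately show ?case by simp
qed

text \<open>The arrows off the boundary form an open set, so open Hausdorff subsets of the reduction
  are open in the groupoid. The support information in \<open>CGV\<close> is retained for
  \<open>off_boundary_BI\<close>.\<close>

lemma Cc_off_boundary:
  assumes "f \<in> Cc off_boundary_groupoid"
  shows "f \<in> CGV (garr off_boundary_groupoid)"
proof -
  let ?A = "garr (off_boundary_groupoid :: ('a germ, _) groupoid)"
  obtain B c where B: "finite B" "B \<subseteq> (\<Union>V\<in>{V. openin (subtopology TT ?A) V \<and> Hausdorff_space (subtopology (subtopology TT ?A) V)}.
        continuous_compact_support (subtopology TT ?A) V)" "f = (\<lambda>g. \<Sum>b\<in>B. c b * b g)"
    using assms unfolding Cc_def gtop_off_boundary by blast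
  have "b \<in> CGV ?A" if "b \<in> B" for b
  proof -
    obtain V where V: "openin (subtopology TT ?A) V" "Hausdorff_space (subtopology (subtopology TT ?A) V)"
        "b \<in> continuous_compact_support (subtopology TT ?A) V"
      using B(2) \<open>b \<in> B\<close> by blast
    have VA: "openin TT V" "V \<subseteq> ?A" using V(1) openin_open_subtopology[OF openin_off_boundary] by auto
    have s: "subtopology (subtopology TT ?A) V = subtopology TT V"
      using VA by (simp add: subtopology_subtopology Int_absorb1)
    have "b \<in> CGV V" by (rule ccs_CGV) (use V VA s in \<open>auto simp: continuous_compact_support_def\<close>)
    then show ?thesis using VA(2) by (rule CGV_mono)
  qed
  then show ?thesis unfolding B(3) using B(1) by (intro CGV_sum CGV_scale)
qed

text \<open>By invariance of the boundary the whole fibre over \<open>x\<close>, and every arrow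
  sharing a range with it, already belongs to the reduction.\<close>

lemma regular_rep_boundary:
  assumes "x \<in> boundary_Omega"
  shows "regular_rep boundary_groupoid x f = rr x f"
proof -
  have src: "gsrc boundary_groupoid = gsrc GG" "grng boundary_groupoid = grng GG" "gmult boundary_groupoid = gmult GG"
    "ginv boundary_groupoid = ginv GG"
    by (simp_all add: boundary_groupoid_def reduction_def Let_def)
  have 1: "\<gamma> \<in> garr boundary_groupoid \<and> gsrc GG \<gamma> = x \<longleftrightarrow> \<gamma> \<in> garr GG \<and> gsrc GG \<gamma> = x" for \<gamma>
    using assms by (auto simp: garr_boundary)
  have 2: "{h \<in> garr boundary_groupoid. grng GG h = grng GG \<gamma>} = {h \<in> garr GG. grng GG h = grng GG \<gamma>}"
    if "\<gamma> \<in> garr GG \<and> gsrc GG \<gamma> = x" for \<gamma>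
    using that assms same_range_boundary[of \<gamma>] by (auto simp: garr_boundary)
  show ?thesis unfolding regular_rep_def src 1 using 2
    by (intro ext arg_cong[where f = Abs_ell2]) (auto cong: if_cong)
qed

lemma regular_rep_off_boundary:
  assumes "x \<notin> boundary_Omega"
  shows "regular_rep off_boundary_groupoid x f = rr x f"
proof -
  have src: "gsrc off_boundary_groupoid = gsrc GG" "grng off_boundary_groupoid = grng GG" "gmult off_boundary_groupoid = gmult GG"
    "ginv off_boundary_groupoid = ginv GG"
    by (simp_all add: off_boundary_groupoid_def reduction_def Let_def)
  have 1: "\<gamma> \<in> garr off_boundary_groupoid \<and> gsrc GG \<gamma> = x \<longleftrightarrow> \<gamma> \<in> garr GG \<and> gsrc GG \<gamma> = x" for \<gamma>
    using assms by (auto simp: garr_off_boundary)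
  have 2: "{h \<in> garr off_boundary_groupoid. grng GG h = grng GG \<gamma>} = {h \<in> garr GG. grng GG h = grng GG \<gamma>}"
    if "\<gamma> \<in> garr GG \<and> gsrc GG \<gamma> = x" for \<gamma>
    using that assms same_range_boundary[of \<gamma>] by (auto simp: garr_off_boundary)
  show ?thesis unfolding regular_rep_def src 1 using 2
    by (intro ext arg_cong[where f = Abs_ell2]) (auto cong: if_cong)
qed

lemma gobj_simps: "gobj GG = Omega" "gobj boundary_groupoid = boundary_Omega"
  "gobj off_boundary_groupoid = Omega - boundary_Omega"
  using boundary_subset
  by (auto simp: boundary_groupoid_def off_boundary_groupoid_def reduction_def Let_def monoid_groupoid_def
      quotient_groupoid_def groupoid_P_def)

text \<open>The representation at \<open>x\<close> sees only arrows on the same side of the boundary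
  as \<open>x\<close>, since sources and ranges lie on the same side.\<close>

lemma rr_boundary_cong:
  assumes "x \<in> Omega" "\<And>\<gamma>. \<gamma> \<in> garr GG \<Longrightarrow> (gsrc GG \<gamma> \<in> boundary_Omega \<longleftrightarrow> x \<in> boundary_Omega) \<Longrightarrow> f \<gamma> = f' \<gamma>"
  shows "rr x f = rr x f'"
proof -
  have "conv f \<xi> \<gamma> = conv f' \<xi> \<gamma>" if "\<gamma> \<in> fibre x" for \<xi> \<gamma>
    unfolding conv_def
  proof (rule infsum_cong)
    fix h assume h: "h \<in> {h \<in> garr GG. grng GG h = grng GG \<gamma>}"
    then have "f h = f' h" using that assms same_range_boundary[of \<gamma> h] by (auto simp: fibre_def)
    then show "f h * \<xi> (gmult GG (ginv GG h) \<gamma>) = f' h * \<xi> (gmult GG (ginv GG h) \<gamma>)" by simp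
  qed
  then show ?thesis unfolding rr_def[abs_def] by (auto cong: if_cong)
qed

section \<open>Reduced norms\<close>

abbreviation RN where "RN \<equiv> reduced_norm GG"

lemma reduced_norm_bound:
  assumes "0 \<le> c" "\<And>x. x \<in> gobj G \<Longrightarrow> onorm (regular_rep G x f) \<le> c"
  shows "reduced_norm G f \<le> c"
  unfolding reduced_norm_def by (rule cSup_least) (use assms in auto)

lemma reduced_norm_upper:
  assumes "\<And>x. x \<in> gobj G \<Longrightarrow> onorm (regular_rep G x f) \<le> c"
  shows "x \<in> gobj G \<Longrightarrow> onorm (regular_rep G x f) \<le> reduced_norm G f" "0 \<le> reduced_norm G f"
  unfolding reduced_norm_def
  by (rule cSup_upper; use assms in \<open>auto intro!: bdd_aboveI[of _ "max c 0"] intro: max.coboundedI1\<close>)+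

lemma RN_upper:
  assumes "f \<in> CG"
  shows "x \<in> Omega \<Longrightarrow> norm (rr x f \<xi>) \<le> RN f * norm \<xi>" "x \<in> Omega \<Longrightarrow> onorm (rr x f) \<le> RN f" "0 \<le> RN f"
proof -
  obtain K where K: "0 \<le> K" "\<And>x \<xi>. norm (rr x f \<xi>) \<le> K * norm \<xi>" using rr_facts[OF assms] by blast
  have b: "onorm (rr x f) \<le> K" for x by (rule onorm_bound[OF K])
  show 1: "onorm (rr x f) \<le> RN f" if "x \<in> Omega" for x
    using reduced_norm_upper(1)[of GG f K x] b that by (simp add: gobj_simps)
  show "0 \<le> RN f" using reduced_norm_upper(2)[of GG f K] b by simp
  show "norm (rr x f \<xi>) \<le> RN f * norm \<xi>" if "x \<in> Omega"
    using onorm[OF rr_bounded_linear[OF assms], of x \<xi>] mult_right_mono[OF 1[OF that], of "norm \<xi>"] by simp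
qed

lemma RN_le:
  assumes "0 \<le> c" "\<And>x \<xi>. x \<in> Omega \<Longrightarrow> norm (rr x f \<xi>) \<le> c * norm \<xi>"
  shows "RN f \<le> c"
  by (rule reduced_norm_bound[OF assms(1)]) (use assms in \<open>auto simp: gobj_simps intro!: onorm_bound\<close>)

lemma groupoid_algebra_simps [simp]:
  "acarrier (groupoid_algebra G N) = Cc G" "azero (groupoid_algebra G N) = (\<lambda>_. 0)"
  "aplus (groupoid_algebra G N) f f' = (\<lambda>\<gamma>. f \<gamma> + f' \<gamma>)" "ascale (groupoid_algebra G N) c f = (\<lambda>\<gamma>. c * f \<gamma>)"
  "anorm (groupoid_algebra G N) = N" "aminus (groupoid_algebra G N) f f' = (\<lambda>\<gamma>. f \<gamma> - f' \<gamma>)"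
  by (simp_all add: groupoid_algebra_def aminus_def)

lemma vector_record_groupoid_algebra: "vector_record (groupoid_algebra G N)"
  by (rule vector_record.intro; simp only: groupoid_algebra_simps)
    (auto simp: Cc_zero Cc_plus Cc_scale algebra_simps)

lemma CG_minus: "f \<in> CG \<Longrightarrow> f' \<in> CG \<Longrightarrow> (\<lambda>\<gamma>. f \<gamma> - f' \<gamma>) \<in> CG"
  using CG_plus[OF _ CG_scale[of f' "-1"], of f] by simp

lemma gconv_minus_left: "f \<in> CG \<Longrightarrow> f' \<in> CG \<Longrightarrow> gconv (\<lambda>\<gamma>. f \<gamma> - f' \<gamma>) h = (\<lambda>\<gamma>. gconv f h \<gamma> - gconv f' h \<gamma>)"
  using gconv_plus_left[OF _ CG_scale[of f' "-1"], of f h] conv_scale_left[of "-1" f' h]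
  by (auto simp: gconv_def fun_eq_iff)

lemma gconv_minus_right: "h \<in> CG \<Longrightarrow> gconv h (\<lambda>\<gamma>. f \<gamma> - f' \<gamma>) = (\<lambda>\<gamma>. gconv h f \<gamma> - gconv h f' \<gamma>)"
  using gconv_plus_right[of h f "\<lambda>\<gamma>. - 1 * f' \<gamma>"] conv_scale_right[of h "-1" f']
  by (auto simp: gconv_def fun_eq_iff)

lemma normed_star_record_reduced: "normed_star_record (reduced_algebra GG)"
proof (intro normed_star_record.intro normed_record.intro vector_record_groupoid_algebra
    normed_record_axioms.intro normed_star_record_axioms.intro; simp only: groupoid_algebra_simps Cc_monoid_groupoid amult_gconv astar_gstar)
  fix f f' h :: "'a germ \<Rightarrow> complex" and c :: complex assume f: "f \<in> CG"
  show "0 \<le> RN f" by (rule RN_upper(3)[OF f])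
  show "gstar f \<in> CG" by (rule CG_gstar[OF f])
  show "RN (\<lambda>\<gamma>. c * f \<gamma>) = cmod c * RN f"
  proof -
    have le: "RN (\<lambda>\<gamma>. d * h \<gamma>) \<le> cmod d * RN h" if "h \<in> CG" for d and h :: "'a germ \<Rightarrow> complex"
      by (rule RN_le) (use RN_upper[OF that] in \<open>auto simp: rr_scale[OF that] norm_ell2_scale mult.assoc intro: mult_left_mono\<close>)
    show ?thesis
    proof (cases "c = 0")
      case True
      have "RN (\<lambda>\<gamma>. 0 * f \<gamma>) \<le> cmod 0 * RN f" by (rule le[OF f])
      moreover have "0 \<le> RN (\<lambda>\<gamma>. 0 * f \<gamma>)" by (rule RN_upper(3)[OF CG_scale[OF f]])
      ultimately show ?thesis using True by simp
    next
      case False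
      \<comment> \<open>The reverse inequality comes from scaling back by
        \<open>inverse c\<close>.\<close>
      have "RN (\<lambda>\<gamma>. inverse c * (c * f \<gamma>)) \<le> cmod (inverse c) * RN (\<lambda>\<gamma>. c * f \<gamma>)" by (rule le[OF CG_scale[OF f]])
      moreover have "(\<lambda>\<gamma>. inverse c * (c * f \<gamma>)) = f" using False by (auto simp: fun_eq_iff)
      ultimately have "cmod c * RN f \<le> RN (\<lambda>\<gamma>. c * f \<gamma>)" using False by (simp add: norm_divide field_simps)
      then show ?thesis using le[OF f, of c] by simp
    qed
  qed
  show "RN (gstar f) \<le> RN f"
  proof (rule RN_le[OF RN_upper(3)[OF f]])
    fix x :: "'a set \<Rightarrow> bool" and \<xi> assume x: "x \<in> Omega"
    show "norm (rr x (gstar f) \<xi>) \<le> RN f * norm \<xi>"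
      by (rule norm_adjoint_le[where S = "rr x f"]) (use rr_gstar[OF f] RN_upper[OF f] x in auto)
  qed
  assume f': "f' \<in> CG"
  show "RN (\<lambda>\<gamma>. f \<gamma> + f' \<gamma>) \<le> RN f + RN f'"
  proof (rule RN_le)
    fix x :: "'a set \<Rightarrow> bool" and \<xi> assume x: "x \<in> Omega"
    have "norm (rr x (\<lambda>\<gamma>. f \<gamma> + f' \<gamma>) \<xi>) \<le> norm (rr x f \<xi>) + norm (rr x f' \<xi>)"
      by (simp add: rr_plus f f' norm_triangle_ineq)
    also have "\<dots> \<le> (RN f + RN f') * norm \<xi>"
      using RN_upper(1)[OF f x, of \<xi>] RN_upper(1)[OF f' x, of \<xi>] by (simp add: distrib_right)
    finally show "norm (rr x (\<lambda>\<gamma>. f \<gamma> + f' \<gamma>) \<xi>) \<le> (RN f + RN f') * norm \<xi>" .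
  qed (use RN_upper(3)[OF f] RN_upper(3)[OF f'] in simp)
  show "gconv f f' \<in> CG" by (rule CG_gconv[OF f f'])
  show "RN (gconv f f') \<le> RN f * RN f'"
  proof (rule RN_le)
    fix x :: "'a set \<Rightarrow> bool" and \<xi> assume x: "x \<in> Omega"
    have "norm (rr x (gconv f f') \<xi>) \<le> RN f * norm (rr x f' \<xi>)"
      unfolding rr_gconv[OF f f'] by (rule RN_upper(1)[OF f x])
    also have "\<dots> \<le> RN f * (RN f' * norm \<xi>)" by (intro mult_left_mono RN_upper f f' x)
    finally show "norm (rr x (gconv f f') \<xi>) \<le> RN f * RN f' * norm \<xi>" by (simp add: mult.assoc)
  qed (use RN_upper(3)[OF f] RN_upper(3)[OF f'] in simp)
  show "gstar (\<lambda>\<gamma>. f \<gamma> - f' \<gamma>) = (\<lambda>\<gamma>. gstar f \<gamma> - gstar f' \<gamma>)" by (auto simp: gstar_def fun_eq_iff)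
  show "gconv f (\<lambda>\<gamma>. f' \<gamma> - h \<gamma>) = (\<lambda>\<gamma>. gconv f f' \<gamma> - gconv f h \<gamma>)" by (rule gconv_minus_right[OF f])
  assume "h \<in> CG"
  show "gconv (\<lambda>\<gamma>. f \<gamma> - f' \<gamma>) h = (\<lambda>\<gamma>. gconv f h \<gamma> - gconv f' h \<gamma>)" by (rule gconv_minus_left[OF f f'])
qed

text \<open>A function supported off the boundary is annihilated by every representation at a
  boundary character, so its two reduced norms agree. The seminorm axioms are inherited from the
  full groupoid, and the inequality is the Lipschitz bound for extension by zero.\<close>

lemma
  fixes f :: "'a::left_cancel_monoid germ \<Rightarrow> complex"
  shows normed_record_off_boundary: "normed_record (reduced_algebra (off_boundary_groupoid :: ('a germ, _) groupoid))"
  and RN_off_boundary: "f \<in> Cc off_boundary_groupoid \<Longrightarrow> RN f \<le> reduced_norm off_boundary_groupoid f"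
proof -
  let ?N = "reduced_norm (off_boundary_groupoid :: ('a germ, _) groupoid)"
  have cg: "f \<in> CG" if "f \<in> Cc off_boundary_groupoid" for f :: "'a germ \<Rightarrow> complex"
    using Cc_off_boundary[OF that] CGV_CG by blast
  have van: "rr x f \<xi> = 0" if "f \<in> Cc off_boundary_groupoid" "x \<in> boundary_Omega" for x \<xi> and f :: "'a germ \<Rightarrow> complex"
  proof -
    have "f \<gamma> = 0" if "gsrc GG \<gamma> \<in> boundary_Omega" for \<gamma>
    proof -
      have "g \<gamma> = 0" if "g \<in> CGV (garr off_boundary_groupoid)" for g :: "'a germ \<Rightarrow> complex"
        using that
      proof (induction rule: CGV.induct)
        case (add_bump f g \<phi>)
        have "bump g \<phi> \<gamma> = 0"
        proof (rule ccontr)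
          assume n: "bump g \<phi> \<gamma> \<noteq> 0"
          then obtain \<eta> where e: "\<eta> \<in> dom_set g" "\<gamma> = germ g \<eta>" "\<phi> (gsrc GG \<gamma>) \<noteq> 0"
            by (auto simp: bump_def split: if_splits)
          have "gsrc GG \<gamma> = \<eta>" unfolding e(2) by (rule gsrc_germ[OF add_bump(2) e(1)])
          then have "germ g \<eta> \<in> garr off_boundary_groupoid" using add_bump(4)[of \<eta>] e by simp
          then show False using \<open>gsrc GG \<gamma> \<in> boundary_Omega\<close> e by (simp add: garr_off_boundary)
        qed
        then show ?case using add_bump by simp
      qed simp
      then show ?thesis using Cc_off_boundary[OF \<open>f \<in> Cc off_boundary_groupoid\<close>] by blast
    qed
    then have "rr x f = rr x (\<lambda>_. 0)"
      using that(2) boundary_subset[OF that(2)] by (intro rr_boundary_cong) auto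
    then show ?thesis by (simp add: rr_zero)
  qed
  have eq: "?N f = RN f" if f: "f \<in> Cc off_boundary_groupoid" for f :: "'a germ \<Rightarrow> complex"
  proof (rule antisym)
    note c = cg[OF f]
    have o: "onorm (regular_rep off_boundary_groupoid x f) \<le> RN f" if "x \<in> gobj off_boundary_groupoid" for x
      using that RN_upper(2)[OF c, of x] by (simp add: gobj_simps regular_rep_off_boundary)
    show "?N f \<le> RN f" by (rule reduced_norm_bound[OF RN_upper(3)[OF c] o])
    show "RN f \<le> ?N f"
    proof (rule reduced_norm_bound[OF reduced_norm_upper(2)[OF o]])
      fix x :: "'a set \<Rightarrow> bool" assume x: "x \<in> gobj GG"
      show "onorm (rr x f) \<le> ?N f"
      proof (cases "x \<in> boundary_Omega")
        case True
        then have "rr x f = (\<lambda>_. 0)" using van[OF f] by (simp add: fun_eq_iff)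
        then show ?thesis using reduced_norm_upper(2)[OF o] by (simp add: onorm_zero)
      next
        case False
        then show ?thesis using reduced_norm_upper(1)[OF o, of x] x by (simp add: gobj_simps regular_rep_off_boundary)
      qed
    qed
  qed
  then show "RN f \<le> ?N f" if "f \<in> Cc off_boundary_groupoid" for f :: "'a germ \<Rightarrow> complex" using that by simp
  interpret G: normed_star_record "reduced_algebra (GG :: ('a germ, _) groupoid)" by (rule normed_star_record_reduced)
  show "normed_record (reduced_algebra (off_boundary_groupoid :: ('a germ, _) groupoid))"
  proof (intro normed_record.intro vector_record_groupoid_algebra normed_record_axioms.intro; simp only: groupoid_algebra_simps)
    fix f f' :: "'a germ \<Rightarrow> complex" and c assume f: "f \<in> Cc off_boundary_groupoid"
    show "0 \<le> ?N f" using RN_upper(3)[OF cg[OF f]] eq[OF f] by simp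
    show "?N (\<lambda>\<gamma>. c * f \<gamma>) = cmod c * ?N f"
      using G.norm_scale[of f c] cg[OF f] eq[OF f] eq[OF Cc_scale[OF f]] by (simp add: Cc_monoid_groupoid)
    assume f': "f' \<in> Cc off_boundary_groupoid"
    show "?N (\<lambda>\<gamma>. f \<gamma> + f' \<gamma>) \<le> ?N f + ?N f'"
      using G.norm_triangle[of f f'] cg[OF f] cg[OF f'] eq[OF f] eq[OF f'] eq[OF Cc_plus[OF f f']] by (simp add: Cc_monoid_groupoid)
  qed
qed

section \<open>Operators on the Hilbert space of the monoid and the boundary ideal\<close>

section \<open>The regular representation at the character of the identity\<close>

abbreviation e1 :: "'s::left_cancel_monoid set \<Rightarrow> bool" where "e1 \<equiv> point_character 1"

lemma eventually_point:
  assumes "eventually P (char_filter (point_character s))" shows "P s"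
proof -
  obtain X F where "X \<in> \<J>" "F \<subseteq> \<J>" "point_character s \<in> cylinder X F" "\<forall>t. point_character t \<in> cylinder X F \<longrightarrow> P t"
    using assms unfolding eventually_cylinder[OF point_character_in_Omega] by blast
  then show ?thesis by blast
qed

lemma point_dom_set: "g \<in> left_inverse_hull \<Longrightarrow> point_character s \<in> dom_set g \<longleftrightarrow> s \<in> Domain g"
  using pdom_in_J[of g] point_character_in_Omega[of s] by (simp add: dom_set_def point_character_def)

lemma translation_hull: "translation s \<in> left_inverse_hull" by (rule left_inverse_hull.translation)

lemma e1_translation: "e1 \<in> dom_set (translation s)"
  unfolding point_dom_set[OF translation_hull] by (auto simp: translation_def)

lemma unit_orbit_germ: "unit_orbit s = germ (translation s) e1"
  by (simp add: unit_orbit_def germ_def)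

lemma unit_orbit_fibre: "unit_orbit s \<in> fibre e1"
  unfolding unit_orbit_germ by (rule germ_in_fibre[OF translation_hull e1_translation])

text \<open>By \<open>hull_mult\<close> a hull element sending 1 to \<open>u\<close> sends every
  \<open>s\<close> to \<open>u * s\<close>. The fibre over the character of the identity is thus a
  copy of the monoid.\<close>

lemma germ_e1:
  assumes "k \<in> left_inverse_hull" "(1, u) \<in> k"
  shows "germ k e1 = unit_orbit u"
proof -
  have "k `` {s} = translation u `` {s}" for s
    using hull_mult[OF assms, of s] hull_functional(1)[OF assms(1)] by (auto simp: translation_def)
  then have "near e1 k (translation u)" by (simp add: near_def)
  moreover have "e1 \<in> dom_set k" using assms by (auto simp: point_dom_set)
  ultimately show ?thesis
    unfolding unit_orbit_germ using germ_eq_iff assms translation_hull e1_translation by blast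
qed

lemma fibre_e1: "(fibre e1 :: 'a::left_cancel_monoid germ set) = range unit_orbit"
proof
  show "(fibre e1 :: 'a germ set) \<subseteq> range unit_orbit"
  proof
    fix \<gamma> :: "'a germ" assume "\<gamma> \<in> fibre e1"
    then obtain k where k: "k \<in> left_inverse_hull" "e1 \<in> dom_set k" "\<gamma> = germ k e1" by (rule fibre_cases)
    then obtain u where "(1, u) \<in> k" by (auto simp: point_dom_set)
    then have "\<gamma> = unit_orbit u" using germ_e1[OF k(1), of u] k(3) by simp
    then show "\<gamma> \<in> range unit_orbit" by simp
  qed
qed (use unit_orbit_fibre in auto)

lemma inj_unit_orbit: "inj unit_orbit"
proof (rule injI)
  fix s t :: 'a assume "unit_orbit s = unit_orbit t"
  then have "near e1 (translation s) (translation t)"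
    by (simp only: unit_orbit_germ germ_eq_iff[OF translation_hull e1_translation translation_hull e1_translation])
  then have "translation s `` {1} = translation t `` {1}" unfolding near_def by (rule eventually_point)
  then show "s = t" by (auto simp: translation_def)
qed

definition orb_in :: "'s::left_cancel_monoid ell2 \<Rightarrow> 's germ ell2" where
  "orb_in = wcomp (range unit_orbit) (inv unit_orbit) (\<lambda>_. 1)"

definition orb_out :: "'s::left_cancel_monoid germ ell2 \<Rightarrow> 's ell2" where
  "orb_out = wcomp UNIV unit_orbit (\<lambda>_. 1)"

lemma inj_inv_orbit: "inj_on (inv unit_orbit) (range unit_orbit)"
  by (rule inj_on_inv_into) simp

lemma orb_in_apply: "ell2_apply (orb_in \<xi>) \<gamma> = (if \<gamma> \<in> range unit_orbit then ell2_apply \<xi> (inv unit_orbit \<gamma>) else 0)"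
  unfolding orb_in_def by (subst wcomp_apply[OF inj_inv_orbit, of "\<lambda>_. 1" 1]) auto

lemma orb_out_apply: "ell2_apply (orb_out \<zeta>) s = ell2_apply \<zeta> (unit_orbit s)"
  unfolding orb_out_def using wcomp_apply[OF inj_unit_orbit, of "\<lambda>_. 1" 1] by simp

lemma orb_adjoint: "inner (orb_in \<xi>) \<zeta> = inner \<xi> (orb_out \<zeta>)"
  unfolding orb_in_def orb_out_def
  by (rule wcomp_adjoint[where K = 1])
    (auto simp: inv_f_f[OF inj_unit_orbit] bij_betw_def inj_inv_orbit image_image)

lemma norm_orb_in: "norm (orb_in \<xi>) \<le> norm \<xi>"
  unfolding orb_in_def using norm_wcomp_le[OF inj_inv_orbit, of "\<lambda>_. 1" 1] by simp

lemma norm_orb_out: "norm (orb_out \<zeta>) \<le> norm \<zeta>"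
  unfolding orb_out_def using norm_wcomp_le[OF inj_unit_orbit, of "\<lambda>_. 1" 1] by simp

lemma orb_in_out: "(\<And>\<gamma>. \<gamma> \<notin> fibre e1 \<Longrightarrow> ell2_apply \<zeta> \<gamma> = 0) \<Longrightarrow> orb_in (orb_out \<zeta>) = \<zeta>"
  by (rule ell2_eqI) (auto simp: orb_in_apply orb_out_apply fibre_e1 f_inv_into_f)

lemma orb_linear:
  "orb_in (\<xi> + \<eta>) = orb_in \<xi> + orb_in \<eta>" "orb_in (ell2_scale c \<xi>) = ell2_scale c (orb_in \<xi>)"
  "orb_in (r *\<^sub>R \<xi>) = r *\<^sub>R orb_in \<xi>"
  "orb_out (\<zeta> + \<theta>) = orb_out \<zeta> + orb_out \<theta>" "orb_out (ell2_scale c \<zeta>) = ell2_scale c (orb_out \<zeta>)"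
  "orb_out (r *\<^sub>R \<zeta>) = r *\<^sub>R orb_out \<zeta>"
  by (rule ell2_eqI; simp add: orb_in_apply orb_out_apply)+

abbreviation ru where "ru \<equiv> regular_rep_unit"

lemma ru_eq: "ru f = Blinfun (\<lambda>\<xi>. orb_out (rr e1 f (orb_in \<xi>)))"
proof -
  have 1: "Abs_ell2 (\<lambda>a. if a \<in> range unit_orbit then ell2_apply \<xi> (inv unit_orbit a) else 0) = orb_in \<xi>" for \<xi>
    by (simp add: orb_in_def wcomp_def cong: if_cong)
  show ?thesis unfolding regular_rep_unit_def 1 by (simp add: orb_out_def wcomp_def)
qed

lemma ru_apply:
  assumes "f \<in> CG"
  shows "blinfun_apply (ru f) \<xi> = orb_out (rr e1 f (orb_in \<xi>))" "norm (ru f) \<le> RN f" "complex_linear (ru f)"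
proof -
  have b: "norm (orb_out (rr e1 f (orb_in \<xi>))) \<le> RN f * norm \<xi>" for \<xi>
  proof -
    have "norm (orb_out (rr e1 f (orb_in \<xi>))) \<le> RN f * norm (orb_in \<xi>)"
      using norm_orb_out RN_upper(1)[OF assms point_character_in_Omega] order_trans by blast
    also have "\<dots> \<le> RN f * norm \<xi>" by (intro mult_left_mono norm_orb_in RN_upper(3) assms)
    finally show ?thesis .
  qed
  have "bounded_linear (\<lambda>\<xi>. orb_out (rr e1 f (orb_in \<xi>)))"
    by (rule bounded_linear_intro[where K = "RN f"])
      (use b bounded_linear.linear[OF rr_bounded_linear[OF assms], of e1] in
        \<open>auto simp: orb_linear rr_vec_plus assms linear_cmul mult.commute\<close>)
  then show a: "blinfun_apply (ru f) \<xi> = orb_out (rr e1 f (orb_in \<xi>))" for \<xi>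
    unfolding ru_eq by (simp add: bounded_linear_Blinfun_apply)
  show "norm (ru f) \<le> RN f"
    by (rule norm_blinfun_bound[OF RN_upper(3)[OF assms]]) (simp add: a b)
  show "complex_linear (ru f)"
    unfolding complex_linear_def a by (simp add: orb_linear rr_vec_scale assms)
qed

lemma cscale_blinfun:
  "blinfun_apply (Blinfun (\<lambda>x. ell2_scale c (blinfun_apply T x))) \<xi> = ell2_scale c (blinfun_apply T \<xi>)"
proof -
  have "bounded_linear (\<lambda>x. ell2_scale c (blinfun_apply T x))"
    by (rule bounded_linear_compose[OF bounded_linear_ell2_scale blinfun.bounded_linear_right])
  then show ?thesis by (simp add: bounded_linear_Blinfun_apply)
qed

definition cscale :: "complex \<Rightarrow> ('a ell2 \<Rightarrow>\<^sub>L 'a ell2) \<Rightarrow> 'a ell2 \<Rightarrow>\<^sub>L 'a ell2" where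
  "cscale c T = Blinfun (\<lambda>x. ell2_scale c (blinfun_apply T x))"

lemma cscale_apply [simp]: "blinfun_apply (cscale c T) \<xi> = ell2_scale c (blinfun_apply T \<xi>)"
  unfolding cscale_def by (rule cscale_blinfun)

lemma cscale_minus_one [simp]: "cscale (-1) T = - T"
  by (rule blinfun_eqI, rule ell2_eqI) (simp add: uminus_blinfun.rep_eq)

lemma norm_cscale_le: "norm (cscale c T) \<le> cmod c * norm T"
  by (rule norm_blinfun_bound)
    (auto simp: norm_ell2_scale mult.assoc intro!: mult_left_mono norm_blinfun)

lemma norm_cscale: "norm (cscale c T) = cmod c * norm T"
proof (cases "c = 0")
  case True
  then show ?thesis using norm_cscale_le[of c T] by simp
next
  case False
  have "cscale (inverse c) (cscale c T) = T"
    by (rule blinfun_eqI, rule ell2_eqI) (simp add: False)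
  then have "norm T \<le> cmod (inverse c) * norm (cscale c T)" using norm_cscale_le[of "inverse c" "cscale c T"] by simp
  then have "cmod c * norm T \<le> norm (cscale c T)" using False by (simp add: norm_divide field_simps)
  then show ?thesis using norm_cscale_le[of c T] by simp
qed

lemma ru_plus: "f \<in> CG \<Longrightarrow> f' \<in> CG \<Longrightarrow> ru (\<lambda>\<gamma>. f \<gamma> + f' \<gamma>) = ru f + ru f'"
  by (rule blinfun_eqI) (simp add: ru_apply CG_plus rr_plus orb_linear blinfun.add_left)

lemma ru_scale: "f \<in> CG \<Longrightarrow> ru (\<lambda>\<gamma>. c * f \<gamma>) = cscale c (ru f)"
  by (rule blinfun_eqI) (simp add: ru_apply CG_scale rr_scale orb_linear)

lemma ru_zero: "ru (\<lambda>_. 0) = 0"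
  by (rule blinfun_eqI, rule ell2_eqI) (simp add: ru_apply CG.zero rr_zero orb_out_apply)

lemma ru_minus: "f \<in> CG \<Longrightarrow> f' \<in> CG \<Longrightarrow> ru (\<lambda>\<gamma>. f \<gamma> - f' \<gamma>) = ru f - ru f'"
  using ru_plus[OF _ CG_scale[of f' "-1"], of f] ru_scale[of f' "-1"] by simp

lemma ru_gconv: "f \<in> CG \<Longrightarrow> f' \<in> CG \<Longrightarrow> ru (gconv f f') = ru f o\<^sub>L ru f'"
proof (rule blinfun_eqI)
  fix \<xi> assume f: "f \<in> CG" "f' \<in> CG"
  have "orb_in (orb_out (rr e1 f' (orb_in \<xi>))) = rr e1 f' (orb_in \<xi>)"
    by (rule orb_in_out) (simp add: rr_apply f)
  then show "blinfun_apply (ru (gconv f f')) \<xi> = blinfun_apply (ru f o\<^sub>L ru f') \<xi>"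
    by (simp add: ru_apply f CG_gconv rr_gconv)
qed

lemma ru_gstar: "f \<in> CG \<Longrightarrow> is_adjoint (ru f) (ru (gstar f))"
proof -
  assume f: "f \<in> CG"
  have "inner (blinfun_apply (ru f) x) y = inner x (blinfun_apply (ru (gstar f)) y)" for x y
  proof -
    have "inner (blinfun_apply (ru f) x) y = inner (rr e1 f (orb_in x)) (orb_in y)"
      by (simp add: ru_apply f orb_adjoint inner_commute[of _ y] inner_commute[of _ "orb_in y"])
    also have "\<dots> = inner (orb_in x) (rr e1 (gstar f) (orb_in y))" by (rule rr_gstar[OF f])
    also have "\<dots> = inner x (blinfun_apply (ru (gstar f)) y)" by (simp add: ru_apply CG_gstar f orb_adjoint)
    finally show ?thesis .
  qed
  then show ?thesis using is_adjoint_iff[OF ru_apply(3)[OF CG_gstar[OF f]]] by simp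
qed

section \<open>Action on basis vectors\<close>

lemma rr_bump_delta:
  assumes g: "g \<in> left_inverse_hull" "Ocont \<phi>" and p: "p \<in> left_inverse_hull" "x \<in> dom_set p"
  shows "rr x (bump g \<phi>) (ell2_delta (germ p x)) =
    (if x \<in> dom_set (pcomp g p) then ell2_scale (\<phi> (translate_character p x)) (ell2_delta (germ (pcomp g p) x)) else 0)"
proof (rule ell2_eqI)
  fix \<gamma>
  let ?R = "if x \<in> dom_set (pcomp g p) then ell2_scale (\<phi> (translate_character p x)) (ell2_delta (germ (pcomp g p) x)) else 0"
  have gp: "pcomp g p \<in> left_inverse_hull" by (rule hull_comp[OF g(1) p(1)])
  show "ell2_apply (rr x (bump g \<phi>) (ell2_delta (germ p x))) \<gamma> = ell2_apply ?R \<gamma>"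
  proof (cases "\<gamma> \<in> fibre x")
    case True
    then obtain k where k: "k \<in> left_inverse_hull" "x \<in> dom_set k" "\<gamma> = germ k x" by (rule fibre_cases)
    have gk: "pcomp (g\<inverse>) k \<in> left_inverse_hull" by (intro hull_comp hull_inv g k)
    have L: "ell2_apply (rr x (bump g \<phi>) (ell2_delta (germ p x))) \<gamma> =
      (if x \<in> dom_set (pcomp (g\<inverse>) k)
       then \<phi> (translate_character (pcomp (g\<inverse>) k) x) * (if germ (pcomp (g\<inverse>) k) x = germ p x then 1 else 0) else 0)"
      using True unfolding rr_apply[OF CG_bump[OF g]] k(3) conv_bump[OF k(1,2) g(1)] by simp
    have A: "germ (pcomp (g\<inverse>) k) x = germ p x \<longleftrightarrow> near x (pcomp (g\<inverse>) k) p" if "x \<in> dom_set (pcomp (g\<inverse>) k)"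
      using germ_eq_iff[OF gk that p] by simp
    have B: "\<gamma> = germ (pcomp g p) x \<longleftrightarrow> near x k (pcomp g p)" if "x \<in> dom_set (pcomp g p)"
      unfolding k(3) using germ_eq_iff[OF k(1,2) gp that] by simp
    have R: "ell2_apply ?R \<gamma> = (if x \<in> dom_set (pcomp g p) \<and> near x k (pcomp g p) then \<phi> (translate_character p x) else 0)"
      using B by auto
    have C: "translate_character (pcomp (g\<inverse>) k) x = translate_character p x"
      if "x \<in> dom_set (pcomp (g\<inverse>) k)" "near x (pcomp (g\<inverse>) k) p"
      by (rule near_translate[OF that(2) gk that(1) p(1)])
    show ?thesis
      unfolding L R near_transpose[OF g(1) k(1) p(1), of x, symmetric] using A C by auto
  next
    case False
    then have "\<gamma> \<noteq> germ (pcomp g p) x" if "x \<in> dom_set (pcomp g p)" using germ_in_fibre[OF gp that] by auto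
    then show ?thesis using False by (auto simp: rr_apply[OF CG_bump[OF g]])
  qed
qed

lemma orb_in_delta: "orb_in (ell2_delta s) = ell2_delta (unit_orbit s)"
  by (rule ell2_eqI) (auto simp: orb_in_apply inv_f_f[OF inj_unit_orbit])

lemma orb_out_delta: "orb_out (ell2_delta (unit_orbit s)) = ell2_delta s"
  by (rule ell2_eqI) (auto simp: orb_out_apply inj_eq[OF inj_unit_orbit])

lemma translate_e1: "translate_character (translation t) e1 = point_character t"
  by (rule translate_point[OF translation_hull]) (simp add: translation_def)

text \<open>This is \<open>rr_bump_delta\<close> with the arrow \<open>germ p x\<close> replaced by
  the point \<open>t\<close>. The norm estimate rests on the parallel between the two
  formulas.\<close>

lemma ru_bump_delta:
  assumes g: "g \<in> left_inverse_hull" "Ocont \<phi>"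
  shows "blinfun_apply (ru (bump g \<phi>)) (ell2_delta t) =
    (if t \<in> Domain g then ell2_scale (\<phi> (point_character t)) (ell2_delta (papply g t)) else 0)"
proof -
  let ?p = "pcomp g (translation t)"
  have p: "?p \<in> left_inverse_hull" by (rule hull_comp[OF g(1) translation_hull])
  have d: "e1 \<in> dom_set ?p \<longleftrightarrow> t \<in> Domain g"
    using dom_set_compose[OF g(1) translation_hull e1_translation] by (simp add: translate_e1 point_dom_set g)
  have o: "germ ?p e1 = unit_orbit (papply g t)" if "t \<in> Domain g"
  proof (rule germ_e1[OF p])
    have "(1, t) \<in> translation t" by (simp add: translation_def)
    then show "(1, papply g t) \<in> ?p" using papply_in[OF g(1) that] by blast
  qed
  have "blinfun_apply (ru (bump g \<phi>)) (ell2_delta t) = orb_out (rr e1 (bump g \<phi>) (ell2_delta (germ (translation t) e1)))"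
    by (simp add: ru_apply CG_bump g orb_in_delta unit_orbit_germ)
  also have "\<dots> = (if t \<in> Domain g then ell2_scale (\<phi> (point_character t)) (ell2_delta (papply g t)) else 0)"
  proof (cases "t \<in> Domain g")
    case True
    then show ?thesis
      unfolding rr_bump_delta[OF g translation_hull e1_translation] using d o[OF True]
      by (simp add: translate_e1 orb_linear orb_out_delta)
  next
    case False
    have "orb_out 0 = (0 :: 'a ell2)" by (rule ell2_eqI) (simp add: orb_out_apply)
    then show ?thesis unfolding rr_bump_delta[OF g translation_hull e1_translation] using d False by simp
  qed
  finally show ?thesis .
qed

lemma blinfun_eq_on_deltas:
  assumes T: "complex_linear T" "complex_linear T'"
    and eq: "\<And>s. blinfun_apply T (ell2_delta s) = blinfun_apply T' (ell2_delta s)"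
  shows "T = T'"
proof (rule blinfun_eqI)
  fix \<xi>
  let ?D = "T - T'"
  have z: "blinfun_apply ?D (\<Sum>i\<in>F. ell2_scale (ell2_apply \<xi> i) (ell2_delta i)) = 0" for F
    using T eq by (simp add: blinfun.sum_right blinfun.diff_left complex_linear_def)
  have "norm (blinfun_apply ?D \<xi>) \<le> e" if e: "0 < e" for e
  proof -
    have "0 < e / (norm ?D + 1)" using e by (simp add: add_nonneg_pos)
    then obtain F where F: "norm (\<xi> - (\<Sum>i\<in>F. ell2_scale (ell2_apply \<xi> i) (ell2_delta i))) < e / (norm ?D + 1)"
      using ell2_finite_approx by metis
    have "norm (blinfun_apply ?D \<xi>) = norm (blinfun_apply ?D (\<xi> - (\<Sum>i\<in>F. ell2_scale (ell2_apply \<xi> i) (ell2_delta i))))"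
      by (simp add: blinfun.diff_right z)
    also have "\<dots> \<le> norm ?D * (e / (norm ?D + 1))"
      using norm_blinfun[of ?D] F by (meson less_imp_le mult_left_mono norm_ge_zero order_trans)
    also have "\<dots> \<le> e"
    proof -
      have "0 < norm (T - T') + 1" using norm_ge_zero[of "T - T'"] by linarith
      then show ?thesis using e by (simp add: pos_divide_le_eq algebra_simps)
    qed
    finally show ?thesis .
  qed
  then have "norm (blinfun_apply ?D \<xi>) \<le> 0" by (rule field_le_epsilon[of _ 0, simplified])
  then show "blinfun_apply T \<xi> = blinfun_apply T' \<xi>" by (simp add: blinfun.diff_left)
qed

lemma left_regular_linear: "complex_linear (left_regular s)"
  unfolding complex_linear_def
  by (intro allI ell2_eqI) (simp add: left_regular_apply sum_distrib_left)

lemma left_regular_bump: "left_regular s = ru (bump (translation s) (\<lambda>_. 1))"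
proof (rule blinfun_eq_on_deltas[OF left_regular_linear ru_apply(3)])
  show b: "bump (translation s) (\<lambda>_. 1) \<in> CG" by (intro CG_bump translation_hull Ocont_const)
  show "blinfun_apply (left_regular s) (ell2_delta t) = blinfun_apply (ru (bump (translation s) (\<lambda>_. 1))) (ell2_delta t)" for t
  proof -
    have "(t, s * t) \<in> translation s" by (simp add: translation_def)
    then have "t \<in> Domain (translation s)" "papply (translation s) t = s * t"
      using papply_eq[OF translation_hull] by auto
    moreover have "ell2_scale 1 x = x" for x :: "'a ell2" by (rule ell2_eqI) simp
    ultimately show ?thesis
      unfolding ru_bump_delta[OF translation_hull Ocont_const] left_regular_delta by simp
  qed
qed

lemma projection_apply: "ell2_apply (blinfun_apply (projection X) \<xi>) s = (if s \<in> X then ell2_apply \<xi> s else 0)"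
proof -
  have eq: "Abs_ell2 (\<lambda>s. if s \<in> X then ell2_apply \<xi> s else 0) = wcomp X (\<lambda>s. s) (\<lambda>_. 1) \<xi>" for \<xi> :: "'a ell2"
    by (simp add: wcomp_def cong: if_cong)
  have "bounded_linear (wcomp X (\<lambda>s. s) (\<lambda>_. 1 :: complex))" by (rule bounded_linear_wcomp[where K = 1]) auto
  then show ?thesis
    unfolding projection_def eq by (simp add: bounded_linear_Blinfun_apply wcomp_apply[where K = 1])
qed

text \<open>A function on the unit space; in the representation on the monoid it becomes the
  diagonal operator with entries \<open>\<phi> (point_character t)\<close>.\<close>

definition mop :: "(('s::left_cancel_monoid set \<Rightarrow> bool) \<Rightarrow> complex) \<Rightarrow> 's germ \<Rightarrow> complex" where
  "mop \<phi> = bump (pid UNIV) \<phi>"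

lemma mop_CG: "Ocont \<phi> \<Longrightarrow> mop \<phi> \<in> CG"
  unfolding mop_def by (intro CG_bump pid_UNIV_in_left_inverse_hull)

lemma papply_pid: "X \<in> \<J> \<Longrightarrow> s \<in> X \<Longrightarrow> papply (pid X) s = s"
  by (rule papply_eq[OF pid_in_left_inverse_hull]) (auto simp: Id_on_iff)

lemma ru_mop_delta: "Ocont \<phi> \<Longrightarrow> blinfun_apply (ru (mop \<phi>)) (ell2_delta t) = ell2_scale (\<phi> (point_character t)) (ell2_delta t)"
  unfolding mop_def
  by (subst ru_bump_delta[OF pid_UNIV_in_left_inverse_hull]) (auto simp: papply_pid UNIV_in_constructible_ideals)

text \<open>Separates the partial isometry of \<open>g\<close> from a diagonal factor. Membership in
  an ideal or a subalgebra then needs checking for diagonal operators and for bumps of weight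
  1.\<close>

lemma ru_bump_split: "g \<in> left_inverse_hull \<Longrightarrow> Ocont \<phi> \<Longrightarrow> ru (bump g \<phi>) = ru (bump g (\<lambda>_. 1)) o\<^sub>L ru (mop \<phi>)"
proof (rule blinfun_eq_on_deltas)
  assume g: "g \<in> left_inverse_hull" and p: "Ocont \<phi>"
  have c: "complex_linear (ru (bump g (\<lambda>_. 1)))" "complex_linear (ru (mop \<phi>))"
    using g p by (auto intro!: ru_apply(3) CG_bump mop_CG Ocont_const)
  show "complex_linear (ru (bump g \<phi>))" using g p by (intro ru_apply(3) CG_bump)
  show "complex_linear (ru (bump g (\<lambda>_. 1)) o\<^sub>L ru (mop \<phi>))" using c by (simp add: complex_linear_def)
  have s1: "ell2_scale 1 x = x" "ell2_scale c 0 = 0" for x :: "'a ell2" and c by (rule ell2_eqI, simp)+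
  show "blinfun_apply (ru (bump g \<phi>)) (ell2_delta t) = blinfun_apply (ru (bump g (\<lambda>_. 1)) o\<^sub>L ru (mop \<phi>)) (ell2_delta t)" for t
    using c(1) by (simp add: ru_mop_delta[OF p] complex_linear_def ru_bump_delta[OF g p] ru_bump_delta[OF g Ocont_const] s1)
qed

lemma ru_mop_norm:
  assumes "Ocont \<phi>" "\<And>\<omega>. \<omega> \<in> Omega \<Longrightarrow> cmod (\<phi> \<omega>) \<le> K" "0 \<le> K"
  shows "norm (ru (mop \<phi>)) \<le> K"
proof (rule order_trans[OF ru_apply(2)[OF mop_CG[OF assms(1)]]])
  show "RN (mop \<phi>) \<le> K"
    unfolding mop_def
    by (rule RN_le[OF assms(3)], subst rr_bump[OF pid_UNIV_in_left_inverse_hull assms(1)],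
        rule norm_wcomp_le[OF inj_on_bmap bweight_bound assms(3)])
      (use assms pid_UNIV_in_left_inverse_hull in auto)
qed

lemma Ocont_plus: "Ocont \<phi> \<Longrightarrow> Ocont \<psi> \<Longrightarrow> Ocont (\<lambda>\<omega>. \<phi> \<omega> + \<psi> \<omega>)"
  unfolding Ocont_def by (rule continuous_map_add)

lemma Ocont_diff: "Ocont \<phi> \<Longrightarrow> Ocont \<psi> \<Longrightarrow> Ocont (\<lambda>\<omega>. \<phi> \<omega> - \<psi> \<omega>)"
  using Ocont_plus[OF _ Ocont_mult[OF Ocont_const[of "-1"]], of \<phi> \<psi>] by simp

lemma Ocont_indicator:
  assumes "openin Omega_topology U" "closedin Omega_topology U" "Ocont \<phi>"
  shows "Ocont (\<lambda>\<omega>. if \<omega> \<in> U then \<phi> \<omega> else 0)"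
  by (rule Ocont_cases[OF assms(1,2) _ Ocont_const])
    (use assms(3) in \<open>simp add: Ocont_def continuous_map_from_subtopology\<close>)

lemma mop_linear:
  "mop (\<lambda>\<omega>. \<phi> \<omega> + \<psi> \<omega>) = (\<lambda>\<gamma>. mop \<phi> \<gamma> + mop \<psi> \<gamma>)" "mop (\<lambda>\<omega>. c * \<phi> \<omega>) = (\<lambda>\<gamma>. c * mop \<phi> \<gamma>)"
  "mop (\<lambda>\<omega>. \<phi> \<omega> - \<psi> \<omega>) = (\<lambda>\<gamma>. mop \<phi> \<gamma> - mop \<psi> \<gamma>)"
  by (auto simp: mop_def bump_def fun_eq_iff)

lemma ru_mop_linear:
  assumes "Ocont \<phi>" "Ocont \<psi>"
  shows "ru (mop (\<lambda>\<omega>. \<phi> \<omega> + \<psi> \<omega>)) = ru (mop \<phi>) + ru (mop \<psi>)" "ru (mop (\<lambda>\<omega>. c * \<phi> \<omega>)) = cscale c (ru (mop \<phi>))"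
    "ru (mop (\<lambda>\<omega>. \<phi> \<omega> - \<psi> \<omega>)) = ru (mop \<phi>) - ru (mop \<psi>)"
  by (simp_all add: mop_linear ru_plus ru_scale ru_minus mop_CG assms)

lemma ru_mop_mult:
  assumes "Ocont \<phi>" "Ocont \<psi>"
  shows "ru (mop (\<lambda>\<omega>. \<phi> \<omega> * \<psi> \<omega>)) = ru (mop \<phi>) o\<^sub>L ru (mop \<psi>)"
proof (rule blinfun_eq_on_deltas)
  have c: "complex_linear (ru (mop \<phi>))" "complex_linear (ru (mop \<psi>))"
    using assms by (auto intro: ru_apply(3) mop_CG)
  show "complex_linear (ru (mop (\<lambda>\<omega>. \<phi> \<omega> * \<psi> \<omega>)))" using assms by (intro ru_apply(3) mop_CG Ocont_mult)
  show "complex_linear (ru (mop \<phi>) o\<^sub>L ru (mop \<psi>))" using c by (simp add: complex_linear_def)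
  show "blinfun_apply (ru (mop (\<lambda>\<omega>. \<phi> \<omega> * \<psi> \<omega>))) (ell2_delta t) = blinfun_apply (ru (mop \<phi>) o\<^sub>L ru (mop \<psi>)) (ell2_delta t)" for t
    using c(1) by (simp add: ru_mop_delta assms Ocont_mult complex_linear_def mult.commute)
qed

lemma projection_mop:
  assumes "X \<in> \<J>" "finite F" "F \<subseteq> \<J>"
  shows "projection (X - \<Union>F) = ru (mop (\<lambda>\<omega>. if \<omega> \<in> cylinder X F then 1 else 0))"
proof (rule blinfun_eq_on_deltas)
  have c: "Ocont (\<lambda>\<omega>. if \<omega> \<in> cylinder X F then 1 else 0)"
    using assms by (intro Ocont_indicator openin_cylinder closedin_cylinder Ocont_const)
  show "complex_linear (projection (X - \<Union>F))"
    unfolding complex_linear_def by (intro allI ell2_eqI) (simp add: projection_apply)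
  show "complex_linear (ru (mop (\<lambda>\<omega>. if \<omega> \<in> cylinder X F then 1 else 0)))" by (intro ru_apply(3) mop_CG c)
  show "blinfun_apply (projection (X - \<Union>F)) (ell2_delta t) =
     blinfun_apply (ru (mop (\<lambda>\<omega>. if \<omega> \<in> cylinder X F then 1 else 0))) (ell2_delta t)" for t
  proof -
    have "point_character t \<in> cylinder X F \<longleftrightarrow> t \<in> X - \<Union>F"
      using assms point_character_in_Omega[of t] by (auto simp: cylinder_def point_character_def)
    then show ?thesis by (intro ell2_eqI) (auto simp: ru_mop_delta[OF c] projection_apply)
  qed
qed

section \<open>Simple functions on the spectrum\<close>

definition ind :: "'a set \<Rightarrow> 'a \<Rightarrow> complex" where "ind U \<omega> = (if \<omega> \<in> U then 1 else 0)"

lemma Ocont_ind: "X \<in> \<J> \<Longrightarrow> finite F \<Longrightarrow> F \<subseteq> \<J> \<Longrightarrow> Ocont (ind (cylinder X F))"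
  unfolding ind_def by (intro Ocont_indicator openin_cylinder closedin_cylinder Ocont_const)

lemma finite_cover_small:
  assumes phi: "Ocont \<phi>" and e: "0 < e"
  obtains \<U> where "finite \<U>" "\<And>X F. (X, F) \<in> \<U> \<Longrightarrow> X \<in> \<J> \<and> finite F \<and> F \<subseteq> \<J>"
    "Omega \<subseteq> (\<Union>(X, F)\<in>\<U>. cylinder X F)"
    "\<And>X F \<omega> \<eta>. (X, F) \<in> \<U> \<Longrightarrow> \<omega> \<in> cylinder X F \<Longrightarrow> \<eta> \<in> cylinder X F \<Longrightarrow> cmod (\<phi> \<omega> - \<phi> \<eta>) < e"
proof -
  define P where "P = {(X, F). X \<in> \<J> \<and> finite F \<and> F \<subseteq> \<J> \<and>
      (\<forall>\<omega>\<in>cylinder X F. \<forall>\<eta>\<in>cylinder X F. cmod (\<phi> \<omega> - \<phi> \<eta>) < e)}"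
  have "Omega \<subseteq> \<Union>((\<lambda>(X, F). cylinder X F) ` P)"
  proof
    fix \<omega> :: "'a set \<Rightarrow> bool" assume w: "\<omega> \<in> Omega"
    have "openin Omega_topology {\<eta> \<in> topspace Omega_topology. \<phi> \<eta> \<in> ball (\<phi> \<omega>) (e / 2)}"
      using phi unfolding Ocont_def by (rule openin_continuous_map_preimage) simp
    moreover have "\<omega> \<in> {\<eta> \<in> topspace Omega_topology. \<phi> \<eta> \<in> ball (\<phi> \<omega>) (e / 2)}"
      using w e by (auto simp: topspace_Omega)
    ultimately obtain X F where XF: "X \<in> \<J>" "finite F" "F \<subseteq> \<J>" "\<omega> \<in> cylinder X F"
       "cylinder X F \<subseteq> {\<eta> \<in> topspace Omega_topology. \<phi> \<eta> \<in> ball (\<phi> \<omega>) (e / 2)}"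
      unfolding openin_Omega by blast
    have "cmod (\<phi> \<eta> - \<phi> \<eta>') < e" if "\<eta> \<in> cylinder X F" "\<eta>' \<in> cylinder X F" for \<eta> \<eta>'
    proof -
      have "dist (\<phi> \<omega>) (\<phi> \<eta>) < e / 2" "dist (\<phi> \<omega>) (\<phi> \<eta>') < e / 2" using XF(5) that by auto
      then have "dist (\<phi> \<eta>) (\<phi> \<eta>') < e" by (metis dist_commute dist_triangle_half_r)
      then show ?thesis by (simp add: dist_norm)
    qed
    then have "(X, F) \<in> P" using XF unfolding P_def by blast
    then show "\<omega> \<in> \<Union>((\<lambda>(X, F). cylinder X F) ` P)" using XF(4) by blast
  qed
  moreover have "\<forall>U\<in>(\<lambda>(X, F). cylinder X F) ` P. openin Omega_topology U"
    by (auto simp: P_def intro: openin_cylinder)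
  moreover have "compactin Omega_topology (Omega :: ('a set \<Rightarrow> bool) set)"
    using compact_Omega by (simp add: compact_space_def topspace_Omega)
  ultimately obtain \<V> where V: "finite \<V>" "\<V> \<subseteq> (\<lambda>(X, F). cylinder X F) ` P" "Omega \<subseteq> \<Union>\<V>"
    unfolding compactin_def by meson
  then obtain \<U> where U: "finite \<U>" "\<U> \<subseteq> P" "\<V> = (\<lambda>(X, F). cylinder X F) ` \<U>"
    by (meson finite_subset_image)
  show thesis
  proof (rule that[of \<U>])
    show "Omega \<subseteq> (\<Union>(X, F)\<in>\<U>. cylinder X F)" using V U by simp
  qed (use U in \<open>auto simp: P_def\<close>)
qed

text \<open>An elementary Stone-Weierstrass theorem: \<open>M\<close> contains the indicators of all
  cylinders, and finitely many cylinders of small oscillation cover the compact spectrum.\<close>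

lemma simple_approx:
  assumes phi: "Ocont \<phi>" and e: "0 < e"
    and plus: "\<And>\<phi> \<psi>. \<phi> \<in> M \<Longrightarrow> \<psi> \<in> M \<Longrightarrow> (\<lambda>\<omega>. \<phi> \<omega> + \<psi> \<omega>) \<in> M"
    and scale: "\<And>\<phi> c. \<phi> \<in> M \<Longrightarrow> (\<lambda>\<omega>. c * \<phi> \<omega>) \<in> M"
    and mult: "\<And>\<phi> \<psi>. \<phi> \<in> M \<Longrightarrow> \<psi> \<in> M \<Longrightarrow> (\<lambda>\<omega>. \<phi> \<omega> * \<psi> \<omega>) \<in> M"
    and ideal: "\<And>X. X \<in> \<J> \<Longrightarrow> ind (cylinder X {}) \<in> M"
  shows "\<exists>\<psi>\<in>M. \<forall>\<omega>\<in>Omega. cmod (\<phi> \<omega> - \<psi> \<omega>) \<le> e"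
proof -
  have diff: "(\<lambda>\<omega>. \<phi> \<omega> - \<psi> \<omega>) \<in> M" if "\<phi> \<in> M" "\<psi> \<in> M" for \<phi> \<psi>
    using plus[OF that(1) scale[OF that(2), of "-1"]] by simp
  have zero: "(\<lambda>_. 0) \<in> M" using scale[OF ideal[OF UNIV_in_constructible_ideals], of 0] by simp
  have cyl: "ind (cylinder X F) \<in> M" if "X \<in> \<J>" "finite F" "F \<subseteq> \<J>" for X F
    using that(2,3)
  proof (induction F rule: finite_induct)
    case (insert Y F)
    have "(\<lambda>\<omega>. ind (cylinder X F) \<omega> - ind (cylinder X F) \<omega> * ind (cylinder Y {}) \<omega>) \<in> M"
      using insert by (intro diff mult ideal) auto
    moreover have "(\<lambda>\<omega>. ind (cylinder X F) \<omega> - ind (cylinder X F) \<omega> * ind (cylinder Y {}) \<omega>) = ind (cylinder X (insert Y F))"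
      by (auto simp: ind_def cylinder_def fun_eq_iff)
    ultimately show ?case by simp
  qed (use that ideal in auto)
  obtain \<U> where U: "finite \<U>" "\<And>X F. (X, F) \<in> \<U> \<Longrightarrow> X \<in> \<J> \<and> finite F \<and> F \<subseteq> \<J>"
    "Omega \<subseteq> (\<Union>(X, F)\<in>\<U>. cylinder X F)"
    "\<And>X F \<omega> \<eta>. (X, F) \<in> \<U> \<Longrightarrow> \<omega> \<in> cylinder X F \<Longrightarrow> \<eta> \<in> cylinder X F \<Longrightarrow> cmod (\<phi> \<omega> - \<phi> \<eta>) < e"
    by (rule finite_cover_small[OF phi e]) blast
  \<comment> \<open>The indicator of the covered part and the vanishing of \<open>\<psi>\<close>
    outside it are included so that the next cylinder can be made disjoint from what is already
    covered.\<close>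
  have "\<exists>\<psi>\<in>M. ind (\<Union>(X, F)\<in>\<U>. cylinder X F) \<in> M \<and> (\<forall>\<omega>. \<omega> \<in> (\<Union>(X, F)\<in>\<U>. cylinder X F) \<longrightarrow> cmod (\<phi> \<omega> - \<psi> \<omega>) \<le> e) \<and>
      (\<forall>\<omega>. \<omega> \<notin> (\<Union>(X, F)\<in>\<U>. cylinder X F) \<longrightarrow> \<psi> \<omega> = 0)"
    using U(1,2,4)
  proof (induction \<U> rule: finite_induct)
    case empty
    have "ind {} = (\<lambda>_ :: 'a set \<Rightarrow> bool. 0)" by (simp add: ind_def fun_eq_iff)
    then show ?case using zero by (intro bexI[of _ "\<lambda>_. 0"]) auto
  next
    case (insert u \<U>)
    obtain X F where u: "u = (X, F)" by (cases u)
    have XF: "X \<in> \<J>" "finite F" "F \<subseteq> \<J>" using insert.prems(1)[of X F] u by auto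
    let ?A = "\<Union>(X, F)\<in>\<U>. cylinder X F" and ?C = "cylinder X F"
    have "\<exists>\<psi>\<in>M. ind ?A \<in> M \<and> (\<forall>\<omega>. \<omega> \<in> ?A \<longrightarrow> cmod (\<phi> \<omega> - \<psi> \<omega>) \<le> e) \<and> (\<forall>\<omega>. \<omega> \<notin> ?A \<longrightarrow> \<psi> \<omega> = 0)"
      by (rule insert.IH) (use insert.prems in \<open>blast+\<close>)
    then obtain \<psi> where psi: "\<psi> \<in> M" "ind ?A \<in> M" "\<forall>\<omega>. \<omega> \<in> ?A \<longrightarrow> cmod (\<phi> \<omega> - \<psi> \<omega>) \<le> e" "\<forall>\<omega>. \<omega> \<notin> ?A \<longrightarrow> \<psi> \<omega> = 0"
      by blast
    \<comment> \<open>The choice is irrelevant for an empty cylinder; otherwise the small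
      oscillation makes any of its characters good enough.\<close>
    define c where "c = \<phi> (SOME \<omega>. \<omega> \<in> ?C)"
    have c: "cmod (\<phi> \<omega> - c) \<le> e" if "\<omega> \<in> ?C" for \<omega>
      unfolding c_def using insert.prems(2)[of X F \<omega> "SOME \<omega>. \<omega> \<in> ?C"] u that someI[of "\<lambda>\<omega>. \<omega> \<in> ?C" \<omega>] by (simp add: less_imp_le)
    let ?D = "\<lambda>\<omega>. ind ?C \<omega> - ind ?C \<omega> * ind ?A \<omega>"
    have D: "?D \<in> M" by (intro diff mult cyl XF psi)
    have AC: "(\<Union>(X, F)\<in>insert u \<U>. cylinder X F) = ?A \<union> ?C" by (auto simp: u)
    have "(\<lambda>\<omega>. ind ?A \<omega> + ?D \<omega>) \<in> M" by (rule plus[OF psi(2) D])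
    moreover have "(\<lambda>\<omega>. ind ?A \<omega> + ?D \<omega>) = ind (?A \<union> ?C)" by (auto simp: ind_def fun_eq_iff)
    ultimately have iM: "ind (?A \<union> ?C) \<in> M" by simp
    have new: "(\<lambda>\<omega>. \<psi> \<omega> + c * ?D \<omega>) \<in> M" by (intro plus psi scale D)
    have Dv: "?D \<omega> = (if \<omega> \<in> ?C \<and> \<omega> \<notin> ?A then 1 else 0)" for \<omega> by (simp add: ind_def)
    show ?case
      unfolding AC
    proof (rule bexI[OF _ new], intro conjI allI impI iM)
      fix \<omega> assume "\<omega> \<in> ?A \<union> ?C"
      then show "cmod (\<phi> \<omega> - (\<psi> \<omega> + c * ?D \<omega>)) \<le> e"
        unfolding Dv using psi(3,4) c[of \<omega>] by (cases "\<omega> \<in> ?A") auto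
    next
      fix \<omega> assume "\<omega> \<notin> ?A \<union> ?C"
      then show "\<psi> \<omega> + c * ?D \<omega> = 0" unfolding Dv using psi(4) by auto
    qed
  qed
  then show ?thesis using U(3) by blast
qed

section \<open>The reduced C*-algebra of the monoid\<close>

definition adj :: "('a ell2 \<Rightarrow>\<^sub>L 'a ell2) \<Rightarrow> 'a ell2 \<Rightarrow>\<^sub>L 'a ell2" where
  "adj T = (THE T'. complex_linear T' \<and> is_adjoint T T')"

lemma adj_eq: "complex_linear T' \<Longrightarrow> is_adjoint T T' \<Longrightarrow> adj T = T'"
  unfolding adj_def by (rule the_equality) (auto intro: adjoint_unique)

lemma bounded_operators_simps [simp]:
  "acarrier bounded_operators = {T. complex_linear T}" "azero bounded_operators = 0"
  "aplus bounded_operators = (+)" "ascale bounded_operators = cscale" "amult bounded_operators = (o\<^sub>L)"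
  "astar bounded_operators = adj" "anorm bounded_operators = norm"
  "aminus bounded_operators S T = S - T"
  by (auto simp: bounded_operators_def cscale_def[abs_def] adj_def[abs_def] aminus_def cscale_minus_one[unfolded cscale_def])

lemma adjoint_norm_le:
  assumes "complex_linear T'" "is_adjoint T T'" shows "norm T' \<le> norm T"
proof (rule norm_blinfun_bound)
  show "norm (blinfun_apply T' y) \<le> norm T * norm y" for y
    by (rule norm_adjoint_le[where S = "blinfun_apply T"]) (use assms is_adjoint_iff norm_blinfun in auto)
qed simp

lemma inner_scale: "inner (ell2_scale c x) y = inner x (ell2_scale (cnj c) y)"
  unfolding ell2_inner by (rule infsum_cong) (simp add: inner_complex_def algebra_simps)

lemma is_adjoint_ops:
  assumes "complex_linear S'" "complex_linear T'" "is_adjoint S S'" "is_adjoint T T'"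
  shows "complex_linear (S' + T') \<and> is_adjoint (S + T) (S' + T')"
    "complex_linear (S' - T') \<and> is_adjoint (S - T) (S' - T')"
    "complex_linear (cscale (cnj c) S') \<and> is_adjoint (cscale c S) (cscale (cnj c) S')"
    "complex_linear (T' o\<^sub>L S') \<and> is_adjoint (S o\<^sub>L T) (T' o\<^sub>L S')"
    "complex_linear S \<Longrightarrow> is_adjoint S' S"
proof -
  have cl: "complex_linear (S' + T')" "complex_linear (S' - T')" "complex_linear (cscale (cnj c) S')" "complex_linear (T' o\<^sub>L S')"
    using assms(1,2)
    by (auto simp: complex_linear_def blinfun.add_left blinfun.diff_left ell2_scale_add mult.commute intro!: ell2_eqI simp: right_diff_distrib)
  show "complex_linear (S' + T') \<and> is_adjoint (S + T) (S' + T')"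
    "complex_linear (S' - T') \<and> is_adjoint (S - T) (S' - T')"
    "complex_linear (cscale (cnj c) S') \<and> is_adjoint (cscale c S) (cscale (cnj c) S')"
    "complex_linear (T' o\<^sub>L S') \<and> is_adjoint (S o\<^sub>L T) (T' o\<^sub>L S')"
    using assms cl unfolding is_adjoint_iff[OF assms(1)] is_adjoint_iff[OF assms(2)] is_adjoint_iff[OF cl(1)]
      is_adjoint_iff[OF cl(2)] is_adjoint_iff[OF cl(3)] is_adjoint_iff[OF cl(4)]
    by (simp_all add: blinfun.add_left blinfun.diff_left inner_add_left inner_add_right inner_diff_left inner_diff_right inner_scale complex_linear_def)
  show "is_adjoint S' S" if "complex_linear S"
    using assms(3) unfolding is_adjoint_iff[OF assms(1)] is_adjoint_iff[OF that] by (metis inner_commute)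
qed

text \<open>A concrete description of the reduced algebra of the monoid through convergent
  sequences, justified in \<open>MC_carrier\<close>.\<close>

definition RC :: "('s::left_cancel_monoid ell2 \<Rightarrow>\<^sub>L 's ell2) set" where
  "RC = closure (ru ` CG)"

lemma ru_RC: "f \<in> CG \<Longrightarrow> ru f \<in> RC"
  unfolding RC_def by (rule subsetD[OF closure_subset imageI])

lemma RC_seq: "T \<in> RC \<longleftrightarrow> (\<exists>f. (\<forall>n. f n \<in> CG) \<and> (\<lambda>n. ru (f n)) \<longlonglongrightarrow> T)"
proof
  assume "T \<in> RC"
  then obtain S where S: "\<forall>n. S n \<in> ru ` CG" "S \<longlonglongrightarrow> T" unfolding RC_def closure_sequential by blast
  then have "\<forall>n. \<exists>f. f \<in> CG \<and> S n = ru f" by auto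
  then obtain f where "\<forall>n. f n \<in> CG \<and> S n = ru (f n)" by metis
  moreover from this have "S = (\<lambda>n. ru (f n))" by auto
  ultimately show "\<exists>f. (\<forall>n. f n \<in> CG) \<and> (\<lambda>n. ru (f n)) \<longlonglongrightarrow> T" using S(2) by auto
next
  assume "\<exists>f. (\<forall>n. f n \<in> CG) \<and> (\<lambda>n. ru (f n)) \<longlonglongrightarrow> T"
  then obtain f where f: "\<forall>n. f n \<in> CG" "(\<lambda>n. ru (f n)) \<longlonglongrightarrow> T" by blast
  then show "T \<in> RC" unfolding RC_def closure_sequential by (intro exI[of _ "\<lambda>n. ru (f n)"]) auto
qed

lemma RC_limit: "(\<And>n. a n \<in> RC) \<Longrightarrow> a \<longlonglongrightarrow> x \<Longrightarrow> x \<in> RC"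
  unfolding RC_def using closed_sequentially[OF closed_closure] by blast

lemma RC_linear:
  assumes "T \<in> RC" shows "complex_linear T"
  unfolding complex_linear_def
proof (intro allI)
  fix c x
  obtain f where f: "\<And>n. f n \<in> CG" "(\<lambda>n. ru (f n)) \<longlonglongrightarrow> T" using assms RC_seq by blast
  have "(\<lambda>n. blinfun_apply (ru (f n)) (ell2_scale c x)) \<longlonglongrightarrow> blinfun_apply T (ell2_scale c x)"
    by (intro tendsto_intros f)
  moreover have "(\<lambda>n. ell2_scale c (blinfun_apply (ru (f n)) x)) \<longlonglongrightarrow> ell2_scale c (blinfun_apply T x)"
    by (intro bounded_linear.tendsto[OF bounded_linear_ell2_scale] tendsto_intros f)
  moreover have "blinfun_apply (ru (f n)) (ell2_scale c x) = ell2_scale c (blinfun_apply (ru (f n)) x)" for n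
    using ru_apply(3)[OF f(1)] by (simp add: complex_linear_def)
  ultimately show "blinfun_apply T (ell2_scale c x) = ell2_scale c (blinfun_apply T x)"
    using LIMSEQ_unique by simp
qed

lemma gstar_minus: "gstar (\<lambda>\<gamma>. f \<gamma> - f' \<gamma>) = (\<lambda>\<gamma>. gstar f \<gamma> - gstar f' \<gamma>)"
  by (auto simp: gstar_def fun_eq_iff)

text \<open>If \<open>ru (f n)\<close> converges, so does \<open>ru (gstar (f n))\<close>, because
  taking adjoints does not increase norms. The limit is the adjoint and lies in \<open>RC\<close> by
  construction.\<close>

lemma RC_adj:
  assumes "T \<in> RC" shows "adj T \<in> RC" "is_adjoint T (adj T)" "norm (adj T) \<le> norm T"
proof -
  obtain f where f: "\<And>n. f n \<in> CG" "(\<lambda>n. ru (f n)) \<longlonglongrightarrow> T" using assms RC_seq by blast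
  let ?S = "\<lambda>n. ru (gstar (f n))"
  have sn: "norm (?S m - ?S n) \<le> norm (ru (f m) - ru (f n))" for m n
  proof -
    have "?S m - ?S n = ru (gstar (\<lambda>\<gamma>. f m \<gamma> - f n \<gamma>))"
      by (simp add: gstar_minus ru_minus CG_gstar f)
    also have "norm \<dots> \<le> norm (ru (\<lambda>\<gamma>. f m \<gamma> - f n \<gamma>))"
      by (rule adjoint_norm_le[OF ru_apply(3)[OF CG_gstar[OF CG_minus[OF f(1) f(1)]]] ru_gstar[OF CG_minus[OF f(1) f(1)]]])
    also have "ru (\<lambda>\<gamma>. f m \<gamma> - f n \<gamma>) = ru (f m) - ru (f n)" by (simp add: ru_minus f)
    finally show ?thesis .
  qed
  have "Cauchy ?S"
  proof (rule CauchyI)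
    fix e :: real assume "0 < e"
    then obtain M where "\<forall>m\<ge>M. \<forall>n\<ge>M. norm (ru (f m) - ru (f n)) < e"
      using CauchyD[OF LIMSEQ_imp_Cauchy[OF f(2)]] by blast
    then show "\<exists>M. \<forall>m\<ge>M. \<forall>n\<ge>M. norm (?S m - ?S n) < e" using sn le_less_trans by blast
  qed
  then obtain T' where T': "?S \<longlonglongrightarrow> T'" using Cauchy_convergent convergent_def by blast
  have R: "T' \<in> RC" unfolding RC_seq using T' CG_gstar[OF f(1)] by (intro exI[of _ "\<lambda>n. gstar (f n)"] conjI allI)
  have l: "complex_linear T'" by (rule RC_linear[OF R])
  have "inner (blinfun_apply T x) y = inner x (blinfun_apply T' y)" for x y
  proof -
    have "(\<lambda>n. inner (blinfun_apply (ru (f n)) x) y) \<longlonglongrightarrow> inner (blinfun_apply T x) y" by (intro tendsto_intros f)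
    moreover have "(\<lambda>n. inner x (blinfun_apply (?S n) y)) \<longlonglongrightarrow> inner x (blinfun_apply T' y)" by (intro tendsto_intros T')
    moreover have "inner (blinfun_apply (ru (f n)) x) y = inner x (blinfun_apply (?S n) y)" for n
      using ru_gstar[OF f(1)] is_adjoint_iff[OF ru_apply(3)[OF CG_gstar[OF f(1)]]] by blast
    ultimately show ?thesis using LIMSEQ_unique by simp
  qed
  then have a: "is_adjoint T T'" using is_adjoint_iff[OF l] by blast
  have "adj T = T'" by (rule adj_eq[OF l a])
  then show "adj T \<in> RC" "is_adjoint T (adj T)" "norm (adj T) \<le> norm T"
    using R a adjoint_norm_le[OF l a] by auto
qed

lemma adj_ru: "f \<in> CG \<Longrightarrow> adj (ru f) = ru (gstar f)"
  by (rule adj_eq) (auto intro: ru_apply(3) CG_gstar ru_gstar)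

lemma RC_plus: "S \<in> RC \<Longrightarrow> T \<in> RC \<Longrightarrow> S + T \<in> RC"
proof -
  assume "S \<in> RC" "T \<in> RC"
  then obtain f g where "\<And>n. f n \<in> CG" "(\<lambda>n. ru (f n)) \<longlonglongrightarrow> S" "\<And>n. g n \<in> CG" "(\<lambda>n. ru (g n)) \<longlonglongrightarrow> T"
    using RC_seq by metis
  then have "(\<lambda>n. ru (\<lambda>\<gamma>. f n \<gamma> + g n \<gamma>)) \<longlonglongrightarrow> S + T" "\<And>n. (\<lambda>\<gamma>. f n \<gamma> + g n \<gamma>) \<in> CG"
    by (auto simp: ru_plus intro!: tendsto_add CG_plus)
  then show "S + T \<in> RC" unfolding RC_seq by (intro exI[of _ "\<lambda>n \<gamma>. f n \<gamma> + g n \<gamma>"] conjI allI)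
qed

lemma bounded_linear_cscale: "bounded_linear (cscale c)"
  by (rule bounded_linear_intro[where K = "cmod c"])
    (auto simp: norm_cscale mult.commute blinfun.add_left blinfun.scaleR_left ell2_scale_add intro!: blinfun_eqI ell2_eqI)

lemma RC_scale: "T \<in> RC \<Longrightarrow> cscale c T \<in> RC"
proof -
  assume "T \<in> RC"
  then obtain f where f: "\<And>n. f n \<in> CG" "(\<lambda>n. ru (f n)) \<longlonglongrightarrow> T" using RC_seq by metis
  then have "(\<lambda>n. ru (\<lambda>\<gamma>. c * f n \<gamma>)) \<longlonglongrightarrow> cscale c T"
    by (simp add: ru_scale bounded_linear.tendsto[OF bounded_linear_cscale])
  then show "cscale c T \<in> RC"
    unfolding RC_seq using CG_scale[OF f(1)] by (intro exI[of _ "\<lambda>n \<gamma>. c * f n \<gamma>"] conjI allI)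
qed

lemma RC_minus: "S \<in> RC \<Longrightarrow> T \<in> RC \<Longrightarrow> S - T \<in> RC"
  using RC_plus[OF _ RC_scale[of T "-1"], of S] by simp

lemma RC_mult: "S \<in> RC \<Longrightarrow> T \<in> RC \<Longrightarrow> S o\<^sub>L T \<in> RC"
proof -
  assume "S \<in> RC" "T \<in> RC"
  then obtain f g where *: "\<And>n. f n \<in> CG" "(\<lambda>n. ru (f n)) \<longlonglongrightarrow> S" "\<And>n. g n \<in> CG" "(\<lambda>n. ru (g n)) \<longlonglongrightarrow> T"
    using RC_seq by metis
  then have "(\<lambda>n. ru (gconv (f n) (g n))) \<longlonglongrightarrow> (S o\<^sub>L T)"
    by (simp add: ru_gconv bounded_bilinear.tendsto[OF bounded_bilinear_blinfun_compose])
  then show "S o\<^sub>L T \<in> RC"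
    unfolding RC_seq using CG_gconv[OF *(1,3)] by (intro exI[of _ "\<lambda>n. gconv (f n) (g n)"] conjI allI)
qed

lemma RC_zero: "0 \<in> RC" using ru_RC[OF CG.zero] by (simp add: ru_zero)

lemma norm_tendsto_operators:
  assumes "\<And>S T. aminus A S T = S - T" "anorm A = norm"
  shows "norm_tendsto A a x \<longleftrightarrow> a \<longlonglongrightarrow> x"
  unfolding norm_tendsto_def assms using tendsto_norm_zero_iff[of "\<lambda>n. a n - x" sequentially] LIM_zero_iff[of a x sequentially] by simp

lemma RC_subalgebra: "closed_star_subalgebra bounded_operators RC"
  unfolding closed_star_subalgebra_def norm_closed_def
  using RC_linear RC_zero RC_plus RC_scale RC_mult RC_adj(1)
  by (auto simp: norm_tendsto_operators intro: RC_limit)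

lemma norm_closed_operatorsD:
  assumes "norm_closed bounded_operators B" "\<And>n. a n \<in> B" "a \<longlonglongrightarrow> x" "complex_linear x"
  shows "x \<in> B"
  using assms(1)[unfolded norm_closed_def, rule_format, of a x] assms(2-) norm_tendsto_operators[of bounded_operators a x]
  by simp

lemma bump_cong: "(\<And>\<omega>. \<omega> \<in> dom_set g \<Longrightarrow> \<phi> \<omega> = \<psi> \<omega>) \<Longrightarrow> g \<in> left_inverse_hull \<Longrightarrow> bump g \<phi> = bump g \<psi>"
  by (auto simp: bump_def fun_eq_iff gsrc_germ)

lemma bump_one_inverse: "g \<in> left_inverse_hull \<Longrightarrow> bump (g\<inverse>) (\<lambda>_. 1) = gstar (bump g (\<lambda>_. 1))"
  unfolding gstar_bump by (rule bump_cong) (auto intro: hull_inv)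

lemma bump_one_compose:
  assumes "g \<in> left_inverse_hull" "h \<in> left_inverse_hull"
  shows "bump (pcomp g h) (\<lambda>_. 1) = gconv (bump g (\<lambda>_. 1)) (bump h (\<lambda>_. 1))"
  unfolding gconv_bump[OF assms]
  by (rule bump_cong) (use assms dom_set_compose_subset hull_comp in auto)

lemma mop_tendsto:
  assumes phi: "Ocont \<phi>" and psi: "\<And>n. Ocont (\<psi> n)" "\<And>n \<omega>. \<omega> \<in> Omega \<Longrightarrow> cmod (\<phi> \<omega> - \<psi> n \<omega>) \<le> inverse (real (Suc n))"
  shows "(\<lambda>n. ru (mop (\<psi> n))) \<longlonglongrightarrow> ru (mop \<phi>)"
proof (rule LIM_zero_cancel, rule Lim_null_comparison[OF _ LIMSEQ_inverse_real_of_nat])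
  show "\<forall>\<^sub>F n in sequentially. norm (ru (mop (\<psi> n)) - ru (mop \<phi>)) \<le> inverse (real (Suc n))"
  proof (intro always_eventually allI)
    fix n
    have "norm (ru (mop (\<lambda>\<omega>. \<phi> \<omega> - \<psi> n \<omega>))) \<le> inverse (real (Suc n))"
      by (rule ru_mop_norm[OF Ocont_diff[OF phi psi(1)] psi(2)]) auto
    then show "norm (ru (mop (\<psi> n)) - ru (mop \<phi>)) \<le> inverse (real (Suc n))"
      by (simp add: ru_mop_linear(3)[OF phi psi(1)] norm_minus_commute)
  qed
qed

text \<open>Stars and products of the isometries give every weight-1 bump, by induction on the hull.
  Those of \<open>pid X\<close> are the diagonal projections of ideals, which approximate all
  diagonal operators by \<open>simple_approx\<close>; \<open>ru_bump_split\<close> does the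
  rest.\<close>

lemma ru_minimal:
  assumes B: "closed_star_subalgebra bounded_operators B" "range left_regular \<subseteq> B" and f: "f \<in> CG"
  shows "ru f \<in> B"
proof -
  have ops: "0 \<in> B" "\<And>x y. x \<in> B \<Longrightarrow> y \<in> B \<Longrightarrow> x + y \<in> B" "\<And>c x. x \<in> B \<Longrightarrow> cscale c x \<in> B"
    "\<And>x y. x \<in> B \<Longrightarrow> y \<in> B \<Longrightarrow> x o\<^sub>L y \<in> B" "\<And>x. x \<in> B \<Longrightarrow> adj x \<in> B"
    using B(1) by (auto simp: closed_star_subalgebra_def)
  have lim: "x \<in> B" if "\<And>n. a n \<in> B" "a \<longlonglongrightarrow> x" "complex_linear x" for a x
    using B(1) that by (intro norm_closed_operatorsD[of B a x]) (auto simp: closed_star_subalgebra_def)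
  have one: "ru (bump g (\<lambda>_. 1)) \<in> B" if "g \<in> left_inverse_hull" for g
    using that
  proof (induction rule: left_inverse_hull.induct)
    case (translation s)
    show ?case using B(2) left_regular_bump[of s] by (metis rangeI subsetD)
  next
    case (inverse g)
    then show ?case
      using ops(5)[OF inverse.IH] adj_ru[OF CG_bump[OF inverse.hyps Ocont_const[of 1]]] by (simp add: bump_one_inverse)
  next
    case (comp g h)
    then show ?case
      using ops(4)[OF comp.IH] ru_gconv[OF CG_bump[OF comp.hyps(1) Ocont_const[of 1]] CG_bump[OF comp.hyps(2) Ocont_const[of 1]]]
      by (simp add: bump_one_compose)
  qed
  have mopB: "ru (mop \<phi>) \<in> B" if phi: "Ocont \<phi>" for \<phi>
  proof -
    let ?M = "{\<psi>. Ocont \<psi> \<and> ru (mop \<psi>) \<in> B}"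
    have "\<exists>\<psi>\<in>?M. \<forall>\<omega>\<in>Omega. cmod (\<phi> \<omega> - \<psi> \<omega>) \<le> inverse (real (Suc n))" for n
    proof (rule simple_approx[OF phi])
      fix X :: "'a set" assume X: "X \<in> \<J>"
      have c: "Ocont (ind (cylinder X {}))" using X by (intro Ocont_ind) auto
      have "ru (mop (ind (cylinder X {}))) = ru (bump (pid X) (\<lambda>_. 1))"
      proof (rule blinfun_eq_on_deltas)
        show "complex_linear (ru (mop (ind (cylinder X {}))))" by (intro ru_apply(3) mop_CG c)
        show "complex_linear (ru (bump (pid X) (\<lambda>_. 1)))"
          by (intro ru_apply(3) CG_bump pid_in_left_inverse_hull X Ocont_const)
        show "blinfun_apply (ru (mop (ind (cylinder X {})))) (ell2_delta t) =
            blinfun_apply (ru (bump (pid X) (\<lambda>_. 1))) (ell2_delta t)" for t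
        proof -
          have "point_character t \<in> cylinder X {} \<longleftrightarrow> t \<in> X"
            using X point_character_in_Omega[of t] by (simp add: cylinder_def point_character_def)
          moreover have "ell2_scale 0 x = 0" for x :: "'a ell2" by (rule ell2_eqI) simp
          ultimately show ?thesis
            by (auto simp: ru_mop_delta[OF c] ru_bump_delta[OF pid_in_left_inverse_hull[OF X] Ocont_const] papply_pid X ind_def)
        qed
      qed
      then show "ind (cylinder X {}) \<in> ?M" using c one[OF pid_in_left_inverse_hull[OF X]] by simp
    next
      fix \<phi> \<psi> assume *: "\<phi> \<in> ?M" "\<psi> \<in> ?M"
      then show "(\<lambda>\<omega>. \<phi> \<omega> + \<psi> \<omega>) \<in> ?M" using ops(2) by (auto simp: ru_mop_linear Ocont_plus)
      show "(\<lambda>\<omega>. \<phi> \<omega> * \<psi> \<omega>) \<in> ?M" using * ops(4) by (auto simp: ru_mop_mult Ocont_mult)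
    next
      fix \<phi> c assume "\<phi> \<in> ?M"
      then show "(\<lambda>\<omega>. c * \<phi> \<omega>) \<in> ?M" using ops(3) by (auto simp: ru_mop_linear Ocont_mult[OF Ocont_const])
    qed simp
    then have "\<forall>n. \<exists>\<psi>. \<psi> \<in> ?M \<and> (\<forall>\<omega>\<in>Omega. cmod (\<phi> \<omega> - \<psi> \<omega>) \<le> inverse (real (Suc n)))" unfolding Bex_def by blast
    from choice[OF this]
    obtain \<psi> where psi: "\<forall>n. \<psi> n \<in> ?M \<and> (\<forall>\<omega>\<in>Omega. cmod (\<phi> \<omega> - \<psi> n \<omega>) \<le> inverse (real (Suc n)))"
      by (rule exE)
    have "(\<lambda>n. ru (mop (\<psi> n))) \<longlonglongrightarrow> ru (mop \<phi>)"
      by (rule mop_tendsto[OF phi]) (use psi in auto)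
    then show ?thesis by (rule lim[rotated]) (use psi in \<open>auto intro: ru_apply(3) mop_CG phi\<close>)
  qed
  show ?thesis
    using f
  proof (induction rule: CG.induct)
    case zero
    then show ?case using ops(1) by (simp add: ru_zero)
  next
    case (add_bump f g \<phi>)
    have "ru (bump g \<phi>) \<in> B" unfolding ru_bump_split[OF add_bump(2,3)] by (intro ops(4) one mopB add_bump)
    then show ?case using ops(2) add_bump by (simp add: ru_plus CG_bump)
  qed
qed

abbreviation MC :: "('s::left_cancel_monoid ell2 \<Rightarrow>\<^sub>L 's ell2) star_algebra" where "MC \<equiv> monoid_cstar_algebra"

lemma MC_carrier: "acarrier (MC :: ('s::left_cancel_monoid ell2 \<Rightarrow>\<^sub>L 's ell2) star_algebra) = RC"
proof -
  let ?I = "\<Inter>{B :: ('s ell2 \<Rightarrow>\<^sub>L 's ell2) set. closed_star_subalgebra bounded_operators B \<and> range left_regular \<subseteq> B}"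
  have "acarrier (MC :: ('s ell2 \<Rightarrow>\<^sub>L 's ell2) star_algebra) = ?I"
    by (simp add: monoid_cstar_algebra_def generated_cstar_algebra_def)
  also have "\<dots> = RC"
  proof
    have "range left_regular \<subseteq> (RC :: ('s ell2 \<Rightarrow>\<^sub>L 's ell2) set)"
      by (auto simp: left_regular_bump intro!: ru_RC CG_bump translation_hull Ocont_const)
    then show "?I \<subseteq> RC"
      using RC_subalgebra by blast
    show "RC \<subseteq> ?I"
    proof
      fix T :: "'s ell2 \<Rightarrow>\<^sub>L 's ell2" assume T: "T \<in> RC"
      then obtain f where f: "\<And>n. f n \<in> CG" "(\<lambda>n. ru (f n)) \<longlonglongrightarrow> T" using RC_seq by blast
      show "T \<in> ?I"
      proof (rule InterI)
        fix B :: "('s ell2 \<Rightarrow>\<^sub>L 's ell2) set"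
        assume B: "B \<in> {B. closed_star_subalgebra bounded_operators B \<and> range left_regular \<subseteq> B}"
        then have "ru (f n) \<in> B" for n using ru_minimal f(1) by blast
        then show "T \<in> B"
          using B f(2) RC_linear[OF T]
          by (intro norm_closed_operatorsD[of B "\<lambda>n. ru (f n)" T]) (auto simp: closed_star_subalgebra_def)
      qed
    qed
  qed
  finally show ?thesis .
qed

lemma MC_update: "MC = bounded_operators\<lparr>acarrier := RC\<rparr>"
proof -
  have "MC = bounded_operators\<lparr>acarrier := acarrier MC\<rparr>"
    by (simp add: monoid_cstar_algebra_def generated_cstar_algebra_def)
  then show ?thesis unfolding MC_carrier .
qed

lemma MC_simps [simp]:
  "acarrier MC = RC" "azero MC = 0" "aplus MC = (+)" "ascale MC = cscale" "amult MC = (o\<^sub>L)" "astar MC = adj"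
  "anorm MC = norm" "aminus MC S T = S - T"
  by (simp_all add: MC_update aminus_def)

lemma norm_tendsto_MC: "norm_tendsto MC a x \<longleftrightarrow> a \<longlonglongrightarrow> x"
  by (rule norm_tendsto_operators) auto

lemma normed_record_MC:
  fixes A :: "('s::left_cancel_monoid ell2 \<Rightarrow>\<^sub>L 's ell2) star_algebra"
  defines "A \<equiv> MC"
  shows "normed_record A" "normed_record.definite A"
proof -
  show n: "normed_record A"
    unfolding A_def
    by (unfold_locales; simp only: MC_simps)
      (auto simp: RC_zero RC_plus RC_scale norm_cscale norm_triangle_ineq blinfun.add_left ell2_scale_add distrib_right
        intro!: blinfun_eqI ell2_eqI)
  show "normed_record.definite A"
    unfolding normed_record.definite_def[OF n] by (simp add: A_def)
qed

section \<open>The boundary ideal\<close>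

definition gens :: "('s::left_cancel_monoid ell2 \<Rightarrow>\<^sub>L 's ell2) set" where
  "gens = {projection (X - \<Union>F) | X F. X \<in> \<J> \<and> F \<subseteq> \<J> \<and> F \<noteq> {} \<and> foundation_set F X}"

abbreviation BI where "BI \<equiv> boundary_ideal"

lemma gens_cases:
  assumes "p \<in> gens"
  obtains X F where "X \<in> \<J>" "finite F" "F \<subseteq> \<J>" "F \<noteq> {}" "foundation_set F X" "p = projection (X - \<Union>F)"
    "p = ru (mop (ind (cylinder X F)))"
proof -
  obtain X F where XF: "p = projection (X - \<Union>F)" "X \<in> \<J>" "F \<subseteq> \<J>" "F \<noteq> {}" "foundation_set F X"
    using assms unfolding gens_def by blast
  then have "finite F" by (simp add: foundation_set_def)
  then show thesis using that XF projection_mop[of X F] by (simp add: ind_def[abs_def])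
qed

lemma gens_RC: "gens \<subseteq> RC"
  using gens_cases by (metis Ocont_ind mop_CG ru_RC subsetI)

lemma closed_ideal_MC_iff:
  "closed_ideal MC B \<longleftrightarrow> B \<subseteq> RC \<and> 0 \<in> B \<and> (\<forall>x\<in>B. \<forall>y\<in>B. x + y \<in> B) \<and> (\<forall>c. \<forall>x\<in>B. cscale c x \<in> B) \<and>
    (\<forall>x\<in>RC. \<forall>y\<in>B. x o\<^sub>L y \<in> B \<and> y o\<^sub>L x \<in> B) \<and> (\<forall>a x. (\<forall>n. a n \<in> B) \<and> a \<longlonglongrightarrow> x \<longrightarrow> x \<in> B)"
proof -
  have "norm_closed MC B \<longleftrightarrow> (\<forall>a x. (\<forall>n. a n \<in> B) \<and> a \<longlonglongrightarrow> x \<longrightarrow> x \<in> B)" if "B \<subseteq> RC"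
  proof -
    have R: "x \<in> RC" if "\<forall>n. a n \<in> B" "a \<longlonglongrightarrow> x" for a x
      using \<open>B \<subseteq> RC\<close> that by (intro RC_limit[of a x]) auto
    show ?thesis
      unfolding norm_closed_def norm_tendsto_MC MC_simps
      by (intro iff_allI) (use R in blast)
  qed
  then show ?thesis unfolding closed_ideal_def by auto
qed

lemma BI_minimal: "closed_ideal MC B \<Longrightarrow> gens \<subseteq> B \<Longrightarrow> BI \<subseteq> B"
  unfolding boundary_ideal_def generated_closed_ideal_def gens_def[symmetric] by blast

lemma BI_closed_ideal: "closed_ideal MC (BI :: ('s::left_cancel_monoid ell2 \<Rightarrow>\<^sub>L 's ell2) set)"
  and gens_BI: "gens \<subseteq> (BI :: ('s ell2 \<Rightarrow>\<^sub>L 's ell2) set)"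
proof -
  let ?BI = "BI :: ('s ell2 \<Rightarrow>\<^sub>L 's ell2) set"
  let ?C = "{B :: ('s ell2 \<Rightarrow>\<^sub>L 's ell2) set. closed_ideal MC B \<and> gens \<subseteq> B}"
  have eq: "?BI = \<Inter>?C" unfolding boundary_ideal_def generated_closed_ideal_def gens_def[symmetric] ..
  show "gens \<subseteq> ?BI" unfolding eq by blast
  \<comment> \<open>The whole algebra takes part in the intersection and keeps it inside
    \<open>RC\<close>.\<close>
  have RCi: "closed_ideal MC RC"
    unfolding closed_ideal_MC_iff by (auto intro: RC_zero RC_plus RC_scale RC_mult RC_limit)
  have mem: "x \<in> ?BI \<longleftrightarrow> (\<forall>B\<in>?C. x \<in> B)" for x unfolding eq by blast
  show "closed_ideal MC ?BI"
    unfolding closed_ideal_MC_iff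
  proof (intro conjI ballI allI impI)
    show "?BI \<subseteq> RC" by (rule BI_minimal[OF RCi gens_RC])
    show "0 \<in> ?BI" unfolding mem by (auto simp: closed_ideal_MC_iff)
    show "x + y \<in> ?BI" if "x \<in> ?BI" "y \<in> ?BI" for x y using that unfolding mem by (auto simp: closed_ideal_MC_iff)
    show "cscale c x \<in> ?BI" if "x \<in> ?BI" for c x using that unfolding mem by (auto simp: closed_ideal_MC_iff)
    show "x o\<^sub>L y \<in> ?BI" "y o\<^sub>L x \<in> ?BI" if "x \<in> RC" "y \<in> ?BI" for x y
      using that unfolding mem by (auto simp: closed_ideal_MC_iff)
    show "x \<in> ?BI" if "(\<forall>n. a n \<in> ?BI) \<and> a \<longlonglongrightarrow> x" for a x
      unfolding mem
    proof
      fix B assume B: "B \<in> ?C"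
      then have "\<forall>n. a n \<in> B" using that unfolding mem by blast
      then show "x \<in> B" using B that by (auto simp: closed_ideal_MC_iff)
    qed
  qed
qed

lemma BI_ops:
  shows "x \<in> BI \<Longrightarrow> x \<in> RC" "0 \<in> BI" "x \<in> BI \<Longrightarrow> y \<in> BI \<Longrightarrow> x + y \<in> BI" "x \<in> BI \<Longrightarrow> cscale c x \<in> BI"
    "x \<in> RC \<Longrightarrow> y \<in> BI \<Longrightarrow> x o\<^sub>L y \<in> BI" "x \<in> RC \<Longrightarrow> y \<in> BI \<Longrightarrow> y o\<^sub>L x \<in> BI"
    "(\<And>n. a n \<in> BI) \<Longrightarrow> a \<longlonglongrightarrow> z \<Longrightarrow> z \<in> BI"
  using BI_closed_ideal unfolding closed_ideal_MC_iff by blast+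

lemma BI_minus: "x \<in> BI \<Longrightarrow> y \<in> BI \<Longrightarrow> x - y \<in> BI"
  using BI_ops(3)[OF _ BI_ops(4)[of y "-1"], of x] by simp

lemma adj_ops:
  assumes "S \<in> RC" "T \<in> RC"
  shows "adj (S + T) = adj S + adj T" "adj (S - T) = adj S - adj T" "adj (cscale c S) = cscale (cnj c) (adj S)"
    "adj (S o\<^sub>L T) = adj T o\<^sub>L adj S" "adj (adj S) = S"
  using is_adjoint_ops[OF RC_linear[OF RC_adj(1)[OF assms(1)]] RC_linear[OF RC_adj(1)[OF assms(2)]]
      RC_adj(2)[OF assms(1)] RC_adj(2)[OF assms(2)]] RC_linear[OF assms(1)]
  by (auto intro: adj_eq)

lemma adj_projection: "adj (projection X) = projection X"
proof (rule adj_eq)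
  show l: "complex_linear (projection X)"
    unfolding complex_linear_def by (intro allI ell2_eqI) (simp add: projection_apply)
  show "is_adjoint (projection X) (projection X)"
    unfolding is_adjoint_iff[OF l] ell2_inner projection_apply by (intro allI infsum_cong) auto
qed

text \<open>The definition of a closed ideal does not demand closure under stars. The operators
  whose adjoint lies in the ideal form a closed ideal, and it contains the generators since
  projections are self-adjoint.\<close>

lemma BI_adj:
  fixes T :: "'a::left_cancel_monoid ell2 \<Rightarrow>\<^sub>L 'a ell2"
  assumes "T \<in> BI" shows "adj T \<in> BI"
proof -
  let ?B = "{T :: 'a ell2 \<Rightarrow>\<^sub>L 'a ell2. T \<in> RC \<and> adj T \<in> BI}"
  have "closed_ideal MC ?B"
    unfolding closed_ideal_MC_iff
  proof (intro conjI ballI allI impI)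
    have "adj 0 = (0 :: 'a ell2 \<Rightarrow>\<^sub>L 'a ell2)" using adj_ops(2)[OF RC_zero RC_zero] by simp
    then show "0 \<in> ?B" using RC_zero BI_ops(2) by simp
    show "x + y \<in> ?B" if "x \<in> ?B" "y \<in> ?B" for x y using that by (auto simp: adj_ops RC_plus BI_ops)
    show "cscale c x \<in> ?B" if "x \<in> ?B" for c x using that by (auto simp: adj_ops RC_scale BI_ops)
    show "x o\<^sub>L y \<in> ?B" "y o\<^sub>L x \<in> ?B" if "x \<in> RC" "y \<in> ?B" for x y
      using that by (auto simp: adj_ops RC_mult BI_ops RC_adj)
    show "x \<in> ?B" if a: "(\<forall>n. a n \<in> ?B) \<and> a \<longlonglongrightarrow> x" for a x
    proof -
      have x: "x \<in> RC" using a RC_limit[of a x] by blast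
      have an: "a n \<in> RC" for n using a by blast
      have "(\<lambda>n. adj (a n) - adj x) \<longlonglongrightarrow> 0"
      proof (rule Lim_null_comparison)
        show "(\<lambda>n. norm (a n - x)) \<longlonglongrightarrow> 0" using a by (intro tendsto_norm_zero LIM_zero) auto
        show "\<forall>\<^sub>F n in sequentially. norm (adj (a n) - adj x) \<le> norm (a n - x)"
          using RC_adj(3)[OF RC_minus[OF an x]] adj_ops(2)[OF an x] by (simp add: always_eventually)
      qed
      then have "(\<lambda>n. adj (a n)) \<longlonglongrightarrow> adj x" by (rule LIM_zero_cancel)
      then have "adj x \<in> BI" by (rule BI_ops(7)[rotated]) (use a in auto)
      then show ?thesis using x by simp
    qed
  qed auto
  moreover have "gens \<subseteq> ?B"
  proof
    fix p :: "'a ell2 \<Rightarrow>\<^sub>L 'a ell2" assume p: "p \<in> gens"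
    then have "adj p = p" by (rule gens_cases) (simp add: adj_projection)
    then show "p \<in> ?B" using p gens_RC gens_BI by auto
  qed
  ultimately have "BI \<subseteq> ?B" by (rule BI_minimal)
  then show ?thesis using assms by blast
qed

text \<open>A necessary condition for membership in the boundary ideal that is tested on single
  basis vectors. It refers to all boundary characters at once, so that it survives right
  multiplication.\<close>

definition vanishes :: "('s::left_cancel_monoid ell2 \<Rightarrow>\<^sub>L 's ell2) \<Rightarrow> bool" where
  "vanishes a \<longleftrightarrow> (\<forall>\<omega>\<in>boundary_Omega. ((\<lambda>s. blinfun_apply a (ell2_delta s)) \<longlongrightarrow> 0) (char_filter \<omega>))"

lemma vanishes_approx:
  assumes "\<And>e. 0 < e \<Longrightarrow> \<exists>b. vanishes b \<and> norm (a - b) < e"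
  shows "vanishes a"
  unfolding vanishes_def
proof (intro ballI tendstoI)
  fix \<omega> :: "'a set \<Rightarrow> bool" and e :: real assume w: "\<omega> \<in> boundary_Omega" and e: "0 < e"
  then obtain b where b: "vanishes b" "norm (a - b) < e / 2" using assms[of "e / 2"] by auto
  have "eventually (\<lambda>s. dist (blinfun_apply b (ell2_delta s)) 0 < e / 2) (char_filter \<omega>)"
    using b(1) w e unfolding vanishes_def by (intro tendstoD) auto
  then show "eventually (\<lambda>s. dist (blinfun_apply a (ell2_delta s)) 0 < e) (char_filter \<omega>)"
  proof eventually_elim
    case (elim s)
    have "norm (blinfun_apply a (ell2_delta s)) \<le> norm (blinfun_apply b (ell2_delta s)) + norm (blinfun_apply (a - b) (ell2_delta s))"
      using norm_triangle_ineq[of "blinfun_apply b (ell2_delta s)" "blinfun_apply (a - b) (ell2_delta s)"] by (simp add: blinfun.diff_left)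
    also have "norm (blinfun_apply (a - b) (ell2_delta s)) \<le> norm (a - b)"
      using norm_blinfun[of "a - b" "ell2_delta s"] by simp
    finally show ?case using elim b(2) by simp
  qed
qed

text \<open>A bump sends the basis vector at \<open>s\<close> to a bounded multiple of the one at
  \<open>papply g s\<close>. As \<open>s\<close> tends to \<open>\<omega>\<close> this point tends
  to the translated character, which is again in the boundary.\<close>

lemma vanishes_compose_bump:
  assumes a: "vanishes a" "complex_linear a" and g: "g \<in> left_inverse_hull" "Ocont \<phi>" and w: "\<omega> \<in> boundary_Omega"
  shows "((\<lambda>s. blinfun_apply a (blinfun_apply (ru (bump g \<phi>)) (ell2_delta s))) \<longlongrightarrow> 0) (char_filter \<omega>)"
proof (cases "\<omega> \<in> dom_set g")
  case True
  have wO: "\<omega> \<in> Omega" "\<omega> (Domain g)" using True by (auto simp: dom_set_def)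
  obtain K where K: "0 \<le> K" "\<And>\<omega>. \<omega> \<in> Omega \<Longrightarrow> cmod (\<phi> \<omega>) \<le> K" using Ocont_bounded[OF g(2)] by blast
  have "((\<lambda>s. blinfun_apply a (ell2_delta s)) \<longlongrightarrow> 0) (char_filter (translate_character g \<omega>))"
    using a(1) translate_boundary[OF g(1) w wO(2)] unfolding vanishes_def by blast
  from filterlim_compose[OF this filterlim_translate[OF g(1) wO]]
  have lim: "((\<lambda>s. K * norm (blinfun_apply a (ell2_delta (papply g s)))) \<longlongrightarrow> 0) (char_filter \<omega>)"
    by (intro tendsto_mult_right_zero tendsto_norm_zero)
  show ?thesis
  proof (rule Lim_null_comparison[OF _ lim])
    show "eventually (\<lambda>s. norm (blinfun_apply a (blinfun_apply (ru (bump g \<phi>)) (ell2_delta s)))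
        \<le> K * norm (blinfun_apply a (ell2_delta (papply g s)))) (char_filter \<omega>)"
      using eventually_dom[OF g(1) wO]
    proof eventually_elim
      case (elim s)
      have "norm (blinfun_apply a (blinfun_apply (ru (bump g \<phi>)) (ell2_delta s)))
          = cmod (\<phi> (point_character s)) * norm (blinfun_apply a (ell2_delta (papply g s)))"
        using a(2) elim by (simp add: ru_bump_delta[OF g] complex_linear_def norm_ell2_scale)
      also have "\<dots> \<le> K * norm (blinfun_apply a (ell2_delta (papply g s)))"
        by (intro mult_right_mono K point_character_in_Omega norm_ge_zero)
      finally show ?case .
    qed
  qed
next
  case False
  have wO: "\<omega> \<in> Omega" by (rule boundary_subset[OF w])
  then have "eventually (\<lambda>s. s \<notin> Domain g) (char_filter \<omega>)"
    using False eventually_mem_ideal(2)[OF wO pdom_in_J[OF g(1)]] by (simp add: dom_set_def)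
  then show ?thesis
    by (intro tendsto_eventually, eventually_elim) (simp add: ru_bump_delta[OF g])
qed

lemma vanishes_plus: "vanishes a \<Longrightarrow> vanishes b \<Longrightarrow> vanishes (a + b)"
  unfolding vanishes_def by (simp add: blinfun.add_left tendsto_add_zero)

lemma vanishes_compose_ru:
  assumes a: "vanishes a" "complex_linear a" and f: "f \<in> CG"
  shows "vanishes (a o\<^sub>L ru f)"
  using f
proof (induction rule: CG.induct)
  case zero
  then show ?case by (simp add: ru_zero vanishes_def)
next
  case (add_bump f g \<phi>)
  have "vanishes (a o\<^sub>L ru (bump g \<phi>))"
    unfolding vanishes_def using vanishes_compose_bump[OF a add_bump(2,3)] by simp
  moreover have "a o\<^sub>L ru (\<lambda>\<gamma>. bump g \<phi> \<gamma> + f \<gamma>) = (a o\<^sub>L ru (bump g \<phi>)) + (a o\<^sub>L ru f)"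
    by (rule blinfun_eqI) (simp add: ru_plus CG_bump add_bump blinfun.add_left blinfun.add_right)
  ultimately show ?case using add_bump vanishes_plus by simp
qed

lemma vanishes_compose_RC:
  assumes a: "vanishes a" "complex_linear a" and T: "T \<in> RC"
  shows "vanishes (a o\<^sub>L T)"
proof (rule vanishes_approx)
  fix e :: real assume "0 < e"
  then have "0 < e / (norm a + 1)" by (intro divide_pos_pos add_nonneg_pos) auto
  moreover obtain f where f: "\<And>n. f n \<in> CG" "(\<lambda>n. ru (f n)) \<longlonglongrightarrow> T" using T RC_seq by blast
  ultimately obtain n where n: "norm (ru (f n) - T) < e / (norm a + 1)" using LIMSEQ_D[OF f(2)] by blast
  have "(a o\<^sub>L T) - (a o\<^sub>L ru (f n)) = a o\<^sub>L (T - ru (f n))"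
    by (rule blinfun_eqI) (simp add: blinfun.diff_left blinfun.diff_right)
  then have "norm ((a o\<^sub>L T) - (a o\<^sub>L ru (f n))) \<le> norm a * norm (T - ru (f n))"
    using norm_blinfun_compose[of a "T - ru (f n)"] by simp
  also have "\<dots> \<le> norm a * (e / (norm a + 1))"
    using n by (intro mult_left_mono) (auto simp: norm_minus_commute)
  also have "\<dots> < e"
  proof -
    have "0 < norm a + 1" using norm_ge_zero[of a] by linarith
    then show ?thesis using \<open>0 < e\<close> by (simp add: pos_divide_less_eq algebra_simps)
  qed
  finally show "\<exists>b. vanishes b \<and> norm ((a o\<^sub>L T) - b) < e" using vanishes_compose_ru[OF a f(1)] by blast
qed

text \<open>The operators that vanish form a closed ideal. For a generator,
  \<open>foundation_set_boundary\<close> shows that near a boundary character points lie outside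
  \<open>X\<close> or inside a member of \<open>F\<close>, and the projection kills their basis
  vectors.\<close>

lemma BI_vanishes:
  fixes a :: "'a::left_cancel_monoid ell2 \<Rightarrow>\<^sub>L 'a ell2"
  assumes "a \<in> BI" shows "vanishes a"
proof -
  let ?B = "{T :: 'a ell2 \<Rightarrow>\<^sub>L 'a ell2. T \<in> RC \<and> vanishes T}"
  have "closed_ideal MC ?B"
    unfolding closed_ideal_MC_iff
  proof (intro conjI ballI allI impI)
    show "0 \<in> ?B" using RC_zero by (simp add: vanishes_def)
    show "x + y \<in> ?B" if "x \<in> ?B" "y \<in> ?B" for x y using that by (auto intro: RC_plus vanishes_plus)
    show "cscale c x \<in> ?B" if "x \<in> ?B" for c x
    proof -
      have "((\<lambda>s. blinfun_apply (cscale c x) (ell2_delta s)) \<longlongrightarrow> 0) (char_filter \<omega>)" if "\<omega> \<in> boundary_Omega" for \<omega>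
        unfolding cscale_apply by (rule bounded_linear.tendsto_zero[OF bounded_linear_ell2_scale]) (use \<open>x \<in> ?B\<close> that in \<open>simp add: vanishes_def\<close>)
      then show ?thesis using that by (auto simp: vanishes_def RC_scale)
    qed
    show "x o\<^sub>L y \<in> ?B" if "x \<in> RC" "y \<in> ?B" for x y
    proof -
      have "((\<lambda>s. blinfun_apply (x o\<^sub>L y) (ell2_delta s)) \<longlongrightarrow> 0) (char_filter \<omega>)" if "\<omega> \<in> boundary_Omega" for \<omega>
        unfolding blinfun_apply_blinfun_compose o_def
        by (rule bounded_linear.tendsto_zero[OF blinfun.bounded_linear_right]) (use \<open>y \<in> ?B\<close> that in \<open>simp add: vanishes_def\<close>)
      then show ?thesis using that by (auto simp: vanishes_def RC_mult)
    qed
    show "y o\<^sub>L x \<in> ?B" if "x \<in> RC" "y \<in> ?B" for x y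
      using that by (auto intro: RC_mult vanishes_compose_RC RC_linear)
    show "x \<in> ?B" if a: "(\<forall>n. a n \<in> ?B) \<and> a \<longlonglongrightarrow> x" for a x
    proof -
      have "vanishes x"
      proof (rule vanishes_approx)
        fix e :: real assume "0 < e"
        then obtain n where "norm (a n - x) < e" using LIMSEQ_D[of a x e] a by blast
        then show "\<exists>b. vanishes b \<and> norm (x - b) < e" using a by (intro exI[of _ "a n"]) (simp add: norm_minus_commute)
      qed
      then show ?thesis using a RC_limit[of a x] by blast
    qed
  qed auto
  moreover have "gens \<subseteq> ?B"
  proof
    fix p :: "'a ell2 \<Rightarrow>\<^sub>L 'a ell2" assume p: "p \<in> gens"
    then obtain X F where XF: "X \<in> \<J>" "F \<subseteq> \<J>" "foundation_set F X" "p = projection (X - \<Union>F)"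
      by (rule gens_cases) blast
    have "((\<lambda>s. blinfun_apply p (ell2_delta s)) \<longlongrightarrow> 0) (char_filter \<omega>)" if w: "\<omega> \<in> boundary_Omega" for \<omega>
    proof -
      have "eventually (\<lambda>s. s \<notin> X - \<Union>F) (char_filter \<omega>)"
      proof (cases "\<omega> X")
        case True
        then obtain Z where Z: "Z \<in> F" "eventually (\<lambda>s. s \<in> Z) (char_filter \<omega>)"
          using foundation_set_boundary[OF w XF(3,1)] by blast
        show ?thesis using Z(2) by eventually_elim (use Z(1) in auto)
      next
        case False
        then show ?thesis using eventually_mem_ideal(2)[OF boundary_subset[OF w] XF(1)] by (auto elim: eventually_mono)
      qed
      then show ?thesis
      proof (intro tendsto_eventually, eventually_elim)
        case (elim s)
        then show ?case unfolding XF(4) by (intro ell2_eqI) (auto simp: projection_apply)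
      qed
    qed
    then show "p \<in> ?B" using p gens_RC by (auto simp: vanishes_def)
  qed
  ultimately have "BI \<subseteq> ?B" by (rule BI_minimal)
  then show ?thesis using assms by blast
qed

section \<open>Comparison of norms at boundary characters\<close>

section \<open>The norm estimate\<close>

lemma CG_sum_form:
  assumes "f \<in> CG"
  shows "\<exists>n k \<phi>. (\<forall>j<n. k j \<in> left_inverse_hull \<and> Ocont (\<phi> j)) \<and> f = (\<lambda>\<gamma>. \<Sum>j<(n::nat). bump (k j) (\<phi> j) \<gamma>)"
  using assms
proof (induction rule: CG.induct)
  case zero
  show ?case by (intro exI[of _ 0]) auto
next
  case (add_bump f g \<phi>)
  obtain n k \<psi> where *: "\<forall>j<n. k j \<in> left_inverse_hull \<and> Ocont (\<psi> j)" "f = (\<lambda>\<gamma>. \<Sum>j<(n::nat). bump (k j) (\<psi> j) \<gamma>)"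
    using add_bump.IH by (elim exE conjE) (rule that; assumption)
  have "(\<lambda>\<gamma>. bump g \<phi> \<gamma> + f \<gamma>) = (\<lambda>\<gamma>. \<Sum>j<Suc n. bump ((k(n := g)) j) ((\<psi>(n := \<phi>)) j) \<gamma>)"
    unfolding *(2) by (auto simp: fun_eq_iff add.commute intro!: sum.cong)
  moreover have "\<forall>j<Suc n. (k(n := g)) j \<in> left_inverse_hull \<and> Ocont ((\<psi>(n := \<phi>)) j)"
    using * add_bump by (auto simp: less_Suc_eq)
  ultimately show ?case by blast
qed

lemma rr_ru_sum:
  assumes "\<And>j. j < n \<Longrightarrow> k j \<in> left_inverse_hull \<and> Ocont (\<phi> j)"
  shows "rr x (\<lambda>\<gamma>. \<Sum>j<(n::nat). bump (k j) (\<phi> j) \<gamma>) \<xi> = (\<Sum>j<n. rr x (bump (k j) (\<phi> j)) \<xi>)"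
    "ru (\<lambda>\<gamma>. \<Sum>j<n. bump (k j) (\<phi> j) \<gamma>) = (\<Sum>j<n. ru (bump (k j) (\<phi> j)))"
proof -
  have c: "(\<lambda>\<gamma>. \<Sum>j<m. bump (k j) (\<phi> j) \<gamma>) \<in> CG" if "m \<le> n" for m
    using assms that by (intro CG_sum CG_bump) auto
  have "rr x (\<lambda>\<gamma>. \<Sum>j<m. bump (k j) (\<phi> j) \<gamma>) \<xi> = (\<Sum>j<m. rr x (bump (k j) (\<phi> j)) \<xi>) \<and>
    ru (\<lambda>\<gamma>. \<Sum>j<m. bump (k j) (\<phi> j) \<gamma>) = (\<Sum>j<m. ru (bump (k j) (\<phi> j)))" if "m \<le> n" for m
    using that
  proof (induction m)
    case 0
    then show ?case by (simp add: rr_zero ru_zero)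
  next
    case (Suc m)
    then have b: "bump (k m) (\<phi> m) \<in> CG" using assms[of m] by (intro CG_bump) auto
    show ?case using Suc c[of m] b by (simp add: rr_plus ru_plus)
  qed
  then show "rr x (\<lambda>\<gamma>. \<Sum>j<n. bump (k j) (\<phi> j) \<gamma>) \<xi> = (\<Sum>j<n. rr x (bump (k j) (\<phi> j)) \<xi>)"
    "ru (\<lambda>\<gamma>. \<Sum>j<n. bump (k j) (\<phi> j) \<gamma>) = (\<Sum>j<n. ru (bump (k j) (\<phi> j)))" by auto
qed

text \<open>Genericity transports a finite piece of the fibre over a boundary character into \<open>S\<close>.\<close>

lemma transport:
  assumes reg: "cstar_regular_on_boundary TYPE('s::left_cancel_monoid)"
    and w: "(\<omega> :: 's set \<Rightarrow> bool) \<in> boundary_Omega" and R: "finite R" "R \<subseteq> left_inverse_hull" "\<And>r. r \<in> R \<Longrightarrow> \<omega> \<in> dom_set r"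
    and P: "eventually P (char_filter \<omega>)"
  shows "\<exists>s. P s \<and> (\<forall>r\<in>R. s \<in> Domain r) \<and>
    (\<forall>r\<in>R. \<forall>r'\<in>R. germ r \<omega> = germ r' \<omega> \<longleftrightarrow> papply r s = papply r' s)"
proof -
  have wO: "\<omega> \<in> Omega" by (rule boundary_subset[OF w])
  have dom: "eventually (\<lambda>s. \<forall>r\<in>R. s \<in> Domain r) (char_filter \<omega>)"
    using R dom_set_eventually[OF _ wO] by (intro eventually_ball_finite) auto
  have ne: "eventually (\<lambda>s. \<forall>r\<in>R. \<forall>r'\<in>R. near \<omega> r r' \<longrightarrow> r `` {s} = r' `` {s}) (char_filter \<omega>)"
  proof -
    have "eventually (\<lambda>s. near \<omega> r r' \<longrightarrow> r `` {s} = r' `` {s}) (char_filter \<omega>)" for r r'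
      by (cases "near \<omega> r r'") (simp_all add: near_def)
    then show ?thesis using R(1) by (intro eventually_ball_finite ballI) auto
  qed
  \<comment> \<open>Fixed points of \<open>pcomp (r'\<inverse>) r\<close> are the points at which
    \<open>r\<close> and \<open>r'\<close> take the same value. Only pairs with distinct germs are
    included, hence none of these maps fixes points eventually.\<close>
  define H where "H = {pcomp (r'\<inverse>) r | r r'. r \<in> R \<and> r' \<in> R \<and> \<not> near \<omega> r r'}"
  have "H \<subseteq> (\<lambda>(r, r'). pcomp (r'\<inverse>) r) ` (R \<times> R)" unfolding H_def by auto
  then have "finite H" using R(1) by (auto intro: finite_subset)
  moreover have "H \<subseteq> left_inverse_hull" using R(2) by (auto simp: H_def intro!: hull_comp hull_inv)
  ultimately have H: "finite H" "H \<subseteq> left_inverse_hull" by auto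
  have "\<not> eventually (\<lambda>s. (s, s) \<in> h) (char_filter \<omega>)" if h: "h \<in> H" for h
  proof
    assume e: "eventually (\<lambda>s. (s, s) \<in> h) (char_filter \<omega>)"
    obtain r r' where r: "r \<in> R" "r' \<in> R" "\<not> near \<omega> r r'" "h = pcomp (r'\<inverse>) r" using h unfolding H_def by blast
    have rh: "r \<in> left_inverse_hull" "r' \<in> left_inverse_hull" using r R by auto
    have "near \<omega> r r'"
      unfolding near_def using e
    proof eventually_elim
      case (elim s)
      then obtain t where "(s, t) \<in> r" "(s, t) \<in> r'" unfolding r(4) by auto
      then show ?case using hull_functional(1)[OF rh(1)] hull_functional(1)[OF rh(2)] by blast
    qed
    then show False using r by simp
  qed
  note ex = generic_point[OF reg w H this eventually_conj[OF P eventually_conj[OF dom ne]]]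
  obtain s where s: "P s" "\<forall>r\<in>R. s \<in> Domain r" "\<forall>r\<in>R. \<forall>r'\<in>R. near \<omega> r r' \<longrightarrow> r `` {s} = r' `` {s}" "\<forall>h\<in>H. (s, s) \<notin> h"
    by (rule exE[OF ex]) (assumption, elim conjE, (rule that; assumption))
  have "germ r \<omega> = germ r' \<omega> \<longleftrightarrow> papply r s = papply r' s" if r: "r \<in> R" "r' \<in> R" for r r'
  proof -
    have rh: "r \<in> left_inverse_hull" "r' \<in> left_inverse_hull" "s \<in> Domain r" "s \<in> Domain r'" using r R s by auto
    have "germ r \<omega> = germ r' \<omega> \<longleftrightarrow> near \<omega> r r'" by (simp add: germ_eq_iff[OF rh(1) R(3)[OF r(1)] rh(2) R(3)[OF r(2)]])
    also have "\<dots> \<longleftrightarrow> papply r s = papply r' s"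
    proof
      assume "near \<omega> r r'"
      then have "r `` {s} = r' `` {s}" using s(3) r by blast
      then show "papply r s = papply r' s" using Image_single(1)[OF rh(1,3)] Image_single(1)[OF rh(2,4)] by simp
    next
      assume eq: "papply r s = papply r' s"
      have "(s, s) \<in> pcomp (r'\<inverse>) r" using papply_in[OF rh(1,3)] papply_in[OF rh(2,4)] eq by auto
      then show "near \<omega> r r'" using s(4) r unfolding H_def by blast
    qed
    finally show ?thesis .
  qed
  then show ?thesis using s by blast
qed

text \<open>A point \<open>s\<close> near the character replaces each arrow
  \<open>germ r \<omega>\<close> by the point \<open>papply r s\<close>. The vector and its image
  keep their norms, the weights change by less than \<open>e\<close>, and \<open>a\<close>
  contributes at most \<open>e\<close> per basis vector, so the estimate follows from the operator
  norm as \<open>e\<close> tends to 0.\<close>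

lemma heart_finite:
  fixes c :: "'s::left_cancel_monoid germ \<Rightarrow> complex"
  assumes reg: "cstar_regular_on_boundary TYPE('s)"
    and w: "(\<omega> :: 's set \<Rightarrow> bool) \<in> boundary_Omega" and f: "f \<in> CG" and a: "a \<in> BI"
    and G: "finite \<Gamma>" "\<Gamma> \<subseteq> fibre \<omega>"
  defines "\<xi> \<equiv> (\<Sum>\<gamma>\<in>\<Gamma>. ell2_scale (c \<gamma>) (ell2_delta \<gamma>))"
  shows "norm (rr \<omega> f \<xi>) \<le> norm (ru f + a) * norm \<xi>"
proof -
  have wO: "\<omega> \<in> Omega" by (rule boundary_subset[OF w])
  obtain n k \<phi> where k: "\<And>j. j < n \<Longrightarrow> k j \<in> left_inverse_hull \<and> Ocont (\<phi> j)" "f = (\<lambda>\<gamma>. \<Sum>j<(n::nat). bump (k j) (\<phi> j) \<gamma>)"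
    using CG_sum_form[OF f] by blast
  have "\<forall>\<gamma>\<in>\<Gamma>. \<exists>p. p \<in> left_inverse_hull \<and> \<omega> \<in> dom_set p \<and> \<gamma> = germ p \<omega>"
    using G(2) fibre_cases by (metis subsetD)
  then obtain p where p: "\<And>\<gamma>. \<gamma> \<in> \<Gamma> \<Longrightarrow> p \<gamma> \<in> left_inverse_hull \<and> \<omega> \<in> dom_set (p \<gamma>) \<and> \<gamma> = germ (p \<gamma>) \<omega>" by metis
  \<comment> \<open>An index \<open>m\<close> pairs an arrow of \<open>\<Gamma>\<close> with a
    summand of \<open>f\<close>. \<open>q m\<close> composes the two, and \<open>M\<close> collects
    the pairs whose composition is defined at the character.\<close>
  define q where "q m = pcomp (k (snd m)) (p (fst m))" for m
  define N where "N = \<Gamma> \<times> {..<n}"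
  define M where "M = {m \<in> N. \<omega> \<in> dom_set (q m)}"
  have fin: "finite N" "finite M" using G(1) by (auto simp: N_def M_def)
  have qh: "q m \<in> left_inverse_hull" if "m \<in> N" for m
    using that p k unfolding q_def N_def by (auto intro!: hull_comp)
  define tp where "tp m = translate_character (p (fst m)) \<omega>" for m :: "'s germ \<times> nat"
  define u where "u m = c (fst m) * \<phi> (snd m) (tp m)" for m
  have scale0: "ell2_scale c' 0 = 0" for c' and z :: "'b ell2" by (rule ell2_eqI) simp
  have rr_xi: "rr \<omega> f \<xi> = (\<Sum>m\<in>M. ell2_scale (u m) (ell2_delta (germ (q m) \<omega>)))"
  proof -
    have lin: "linear (rr \<omega> f)" using rr_bounded_linear[OF f] bounded_linear.linear by blast
    have "rr \<omega> f \<xi> = (\<Sum>\<gamma>\<in>\<Gamma>. ell2_scale (c \<gamma>) (rr \<omega> f (ell2_delta \<gamma>)))"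
      unfolding \<xi>_def linear_sum[OF lin] by (simp add: rr_vec_scale f)
    also have "\<dots> = (\<Sum>\<gamma>\<in>\<Gamma>. \<Sum>j<n. if (\<gamma>, j) \<in> M then ell2_scale (u (\<gamma>, j)) (ell2_delta (germ (q (\<gamma>, j)) \<omega>)) else 0)"
    proof (rule sum.cong[OF refl])
      fix \<gamma> assume g: "\<gamma> \<in> \<Gamma>"
      have "rr \<omega> f (ell2_delta \<gamma>) = (\<Sum>j<n. rr \<omega> (bump (k j) (\<phi> j)) (ell2_delta (germ (p \<gamma>) \<omega>)))"
        unfolding k(2) using rr_ru_sum(1)[of n k \<phi>, OF k(1)] p[OF g] by simp
      also have "\<dots> = (\<Sum>j<n. if (\<gamma>, j) \<in> M then ell2_scale (\<phi> j (tp (\<gamma>, j))) (ell2_delta (germ (q (\<gamma>, j)) \<omega>)) else 0)"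
      proof (rule sum.cong[OF refl])
        fix j assume "j \<in> {..<n}"
        then show "rr \<omega> (bump (k j) (\<phi> j)) (ell2_delta (germ (p \<gamma>) \<omega>)) =
            (if (\<gamma>, j) \<in> M then ell2_scale (\<phi> j (tp (\<gamma>, j))) (ell2_delta (germ (q (\<gamma>, j)) \<omega>)) else 0)"
          using rr_bump_delta[of "k j" "\<phi> j" "p \<gamma>" \<omega>] k(1)[of j] p[OF g] g by (simp add: M_def N_def q_def tp_def)
      qed
      finally show "ell2_scale (c \<gamma>) (rr \<omega> f (ell2_delta \<gamma>)) =
          (\<Sum>j<n. if (\<gamma>, j) \<in> M then ell2_scale (u (\<gamma>, j)) (ell2_delta (germ (q (\<gamma>, j)) \<omega>)) else 0)"
        by (simp add: bounded_linear.linear[OF bounded_linear_ell2_scale] linear_sum if_distrib[of "ell2_scale (c \<gamma>)"]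
            linear_0 u_def cong: if_cong)
    qed
    also have "\<dots> = (\<Sum>m\<in>N. if m \<in> M then ell2_scale (u m) (ell2_delta (germ (q m) \<omega>)) else 0)"
      unfolding N_def sum.cartesian_product by (rule sum.cong) auto
    also have "\<dots> = (\<Sum>m\<in>M. ell2_scale (u m) (ell2_delta (germ (q m) \<omega>)))"
      by (rule sum.mono_neutral_cong_right) (use fin in \<open>auto simp: M_def\<close>)
    finally show ?thesis .
  qed
  \<comment> \<open>The first sum weighs the error from moving the weights to nearby points
    (\<open>d1\<close>), the second the contribution of \<open>a\<close>
    (\<open>d2\<close>).\<close>
  define C where "C = (\<Sum>m\<in>M. cmod (c (fst m))) + (\<Sum>\<gamma>\<in>\<Gamma>. cmod (c \<gamma>))"
  have C0: "0 \<le> C" by (auto simp: C_def intro!: add_nonneg_nonneg sum_nonneg)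
  have main: "norm (rr \<omega> f \<xi>) \<le> norm (ru f + a) * norm \<xi> + e * C" if e: "0 < e" for e
  proof -
    let ?F = "char_filter \<omega>"
    have ev1: "eventually (\<lambda>s. \<forall>m\<in>N. s \<in> Domain (q m) \<longleftrightarrow> m \<in> M) ?F"
    proof (rule eventually_ball_finite[OF fin(1)], rule ballI)
      fix m assume m: "m \<in> N"
      show "eventually (\<lambda>s. s \<in> Domain (q m) \<longleftrightarrow> m \<in> M) ?F"
      proof (cases "m \<in> M")
        case True
        then show ?thesis using dom_set_eventually[OF qh[OF m] wO] by (simp add: M_def)
      next
        case False
        then have "\<not> \<omega> (Domain (q m))" using m wO by (simp add: M_def dom_set_def)
        then show ?thesis using eventually_mem_ideal(2)[OF wO pdom_in_J[OF qh[OF m]]] False by simp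
      qed
    qed
    have ev2: "eventually (\<lambda>s. \<forall>m\<in>N. cmod (\<phi> (snd m) (point_character (papply (p (fst m)) s)) - \<phi> (snd m) (tp m)) < e) ?F"
    proof (rule eventually_ball_finite[OF fin(1)], rule ballI)
      fix m assume m: "m \<in> N"
      have pm: "p (fst m) \<in> left_inverse_hull" "\<omega> (Domain (p (fst m)))" and km: "Ocont (\<phi> (snd m))"
        using m p[of "fst m"] k(1)[of "snd m"] by (auto simp: N_def dom_set_def)
      have "((\<lambda>s. \<phi> (snd m) (point_character s)) \<longlongrightarrow> \<phi> (snd m) (tp m)) (char_filter (tp m))"
        unfolding tp_def by (rule char_filter_tendsto[OF km[unfolded Ocont_def] translate_in_Omega[OF pm(1) wO pm(2)]])
      from tendstoD[OF filterlim_compose[OF this[unfolded tp_def] filterlim_translate[OF pm(1) wO pm(2)]] e]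
      show "eventually (\<lambda>s. cmod (\<phi> (snd m) (point_character (papply (p (fst m)) s)) - \<phi> (snd m) (tp m)) < e) ?F"
        by (simp add: dist_norm tp_def)
    qed
    have ev3: "eventually (\<lambda>s. \<forall>\<gamma>\<in>\<Gamma>. norm (blinfun_apply a (ell2_delta (papply (p \<gamma>) s))) < e) ?F"
    proof (rule eventually_ball_finite[OF G(1)], rule ballI)
      fix \<gamma> assume g: "\<gamma> \<in> \<Gamma>"
      have pm: "p \<gamma> \<in> left_inverse_hull" "\<omega> (Domain (p \<gamma>))" using p[OF g] by (auto simp: dom_set_def)
      have "((\<lambda>s. blinfun_apply a (ell2_delta s)) \<longlongrightarrow> 0) (char_filter (translate_character (p \<gamma>) \<omega>))"
        using BI_vanishes[OF a] translate_boundary[OF pm(1) w pm(2)] unfolding vanishes_def by blast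
      from tendstoD[OF filterlim_compose[OF this filterlim_translate[OF pm(1) wO pm(2)]] e]
      show "eventually (\<lambda>s. norm (blinfun_apply a (ell2_delta (papply (p \<gamma>) s))) < e) ?F" by simp
    qed
    \<comment> \<open>Arrows of the vector and arrows of its image must be separated by the same
      point, hence the union.\<close>
    define R where "R = p ` \<Gamma> \<union> q ` M"
    have R: "finite R" "R \<subseteq> left_inverse_hull" "\<And>r. r \<in> R \<Longrightarrow> \<omega> \<in> dom_set r"
      using G(1) fin p qh by (auto simp: R_def M_def)
    obtain s where s: "\<forall>m\<in>N. s \<in> Domain (q m) \<longleftrightarrow> m \<in> M"
      "\<forall>m\<in>N. cmod (\<phi> (snd m) (point_character (papply (p (fst m)) s)) - \<phi> (snd m) (tp m)) < e"
      "\<forall>\<gamma>\<in>\<Gamma>. norm (blinfun_apply a (ell2_delta (papply (p \<gamma>) s))) < e"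
      "\<forall>r\<in>R. s \<in> Domain r" "\<forall>r\<in>R. \<forall>r'\<in>R. germ r \<omega> = germ r' \<omega> \<longleftrightarrow> papply r s = papply r' s"
      by (rule exE[OF transport[OF reg w R eventually_conj[OF ev1 eventually_conj[OF ev2 ev3]]]])
        (assumption, elim conjE, (rule that; assumption))
    define \<xi>s where "\<xi>s = (\<Sum>\<gamma>\<in>\<Gamma>. ell2_scale (c \<gamma>) (ell2_delta (papply (p \<gamma>) s)))"
    define \<eta>s where "\<eta>s = (\<Sum>m\<in>M. ell2_scale (u m) (ell2_delta (papply (q m) s)))"
    have nxi: "norm \<xi>s = norm \<xi>"
      unfolding \<xi>s_def \<xi>_def
    proof (rule norm_sum_delta_cong[OF G(1)])
      fix \<gamma> \<gamma>' assume g: "\<gamma> \<in> \<Gamma>" "\<gamma>' \<in> \<Gamma>"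
      then have "germ (p \<gamma>) \<omega> = germ (p \<gamma>') \<omega> \<longleftrightarrow> papply (p \<gamma>) s = papply (p \<gamma>') s" using s(5) by (auto simp: R_def)
      then show "papply (p \<gamma>) s = papply (p \<gamma>') s \<longleftrightarrow> \<gamma> = \<gamma>'" using p[OF g(1)] p[OF g(2)] by simp
    qed
    have neta: "norm \<eta>s = norm (rr \<omega> f \<xi>)"
      unfolding \<eta>s_def rr_xi
      by (rule norm_sum_delta_cong[OF fin(2)]) (use s(5) in \<open>auto simp: R_def\<close>)
    define v where "v m = c (fst m) * \<phi> (snd m) (point_character (papply (p (fst m)) s))" for m
    have ru_xi: "blinfun_apply (ru f) \<xi>s = (\<Sum>m\<in>M. ell2_scale (v m) (ell2_delta (papply (q m) s)))"
    proof -
      have cl: "blinfun_apply (ru f) (ell2_scale z x) = ell2_scale z (blinfun_apply (ru f) x)" for z x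
        using ru_apply(3)[OF f] by (simp add: complex_linear_def)
      have "blinfun_apply (ru f) \<xi>s = (\<Sum>\<gamma>\<in>\<Gamma>. ell2_scale (c \<gamma>) (blinfun_apply (ru f) (ell2_delta (papply (p \<gamma>) s))))"
        unfolding \<xi>s_def blinfun.sum_right cl ..
      also have "\<dots> = (\<Sum>\<gamma>\<in>\<Gamma>. \<Sum>j<n. if (\<gamma>, j) \<in> M then ell2_scale (v (\<gamma>, j)) (ell2_delta (papply (q (\<gamma>, j)) s)) else 0)"
      proof (rule sum.cong[OF refl])
        fix \<gamma> assume g: "\<gamma> \<in> \<Gamma>"
        let ?t = "papply (p \<gamma>) s"
        have ph: "p \<gamma> \<in> left_inverse_hull" "s \<in> Domain (p \<gamma>)" using p[OF g] s(4) g by (auto simp: R_def)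
        have "blinfun_apply (ru f) (ell2_delta ?t) = (\<Sum>j<n. blinfun_apply (ru (bump (k j) (\<phi> j))) (ell2_delta ?t))"
          unfolding k(2) using rr_ru_sum(2)[of n k \<phi>, OF k(1)] by (simp add: blinfun.sum_left)
        also have "\<dots> = (\<Sum>j<n. if (\<gamma>, j) \<in> M then ell2_scale (\<phi> j (point_character ?t)) (ell2_delta (papply (q (\<gamma>, j)) s)) else 0)"
        proof (rule sum.cong[OF refl])
          fix j assume j: "j \<in> {..<n}"
          then have m: "(\<gamma>, j) \<in> N" using g by (simp add: N_def)
          have kj: "k j \<in> left_inverse_hull" "Ocont (\<phi> j)" using k(1) j by auto
          have st: "(s, ?t) \<in> p \<gamma>" by (rule papply_in[OF ph])
          have d: "?t \<in> Domain (k j) \<longleftrightarrow> (\<gamma>, j) \<in> M"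
          proof -
            have "?t \<in> Domain (k j) \<longleftrightarrow> s \<in> Domain (q (\<gamma>, j))"
              unfolding q_def using st hull_functional(1)[OF ph(1)] by auto
            then show ?thesis using s(1) m by blast
          qed
          have v: "papply (q (\<gamma>, j)) s = papply (k j) ?t" if "?t \<in> Domain (k j)"
          proof (rule papply_eq[OF qh[OF m]])
            show "(s, papply (k j) ?t) \<in> q (\<gamma>, j)" unfolding q_def using st papply_in[OF kj(1) that] by auto
          qed
          show "blinfun_apply (ru (bump (k j) (\<phi> j))) (ell2_delta ?t) =
              (if (\<gamma>, j) \<in> M then ell2_scale (\<phi> j (point_character ?t)) (ell2_delta (papply (q (\<gamma>, j)) s)) else 0)"
            unfolding ru_bump_delta[OF kj] using d v by auto
        qed
        finally show "ell2_scale (c \<gamma>) (blinfun_apply (ru f) (ell2_delta ?t)) =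
            (\<Sum>j<n. if (\<gamma>, j) \<in> M then ell2_scale (v (\<gamma>, j)) (ell2_delta (papply (q (\<gamma>, j)) s)) else 0)"
          by (simp add: bounded_linear.linear[OF bounded_linear_ell2_scale] linear_sum if_distrib[of "ell2_scale (c \<gamma>)"]
              linear_0 v_def cong: if_cong)
      qed
      also have "\<dots> = (\<Sum>m\<in>N. if m \<in> M then ell2_scale (v m) (ell2_delta (papply (q m) s)) else 0)"
        unfolding N_def sum.cartesian_product by (rule sum.cong) auto
      also have "\<dots> = (\<Sum>m\<in>M. ell2_scale (v m) (ell2_delta (papply (q m) s)))"
        by (rule sum.mono_neutral_cong_right) (use fin in \<open>auto simp: M_def\<close>)
      finally show ?thesis .
    qed
    have d1: "norm (\<eta>s - blinfun_apply (ru f) \<xi>s) \<le> e * (\<Sum>m\<in>M. cmod (c (fst m)))"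
    proof -
      have "\<eta>s - blinfun_apply (ru f) \<xi>s = (\<Sum>m\<in>M. ell2_scale (u m - v m) (ell2_delta (papply (q m) s)))"
        unfolding ru_xi \<eta>s_def sum_subtractf[symmetric] by (intro sum.cong refl ell2_eqI) (simp add: left_diff_distrib)
      also have "norm \<dots> \<le> (\<Sum>m\<in>M. norm (ell2_scale (u m - v m) (ell2_delta (papply (q m) s))))" by (rule norm_sum)
      also have "\<dots> \<le> (\<Sum>m\<in>M. e * cmod (c (fst m)))"
      proof (rule sum_mono)
        fix m assume m: "m \<in> M"
        have "norm (ell2_scale (u m - v m) (ell2_delta (papply (q m) s))) =
            cmod (c (fst m)) * cmod (\<phi> (snd m) (tp m) - \<phi> (snd m) (point_character (papply (p (fst m)) s)))"
          by (simp add: norm_ell2_scale u_def v_def flip: right_diff_distrib norm_mult)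
        also have "\<dots> \<le> cmod (c (fst m)) * e"
          using s(2) m by (intro mult_left_mono) (auto simp: M_def norm_minus_commute less_imp_le)
        finally show "norm (ell2_scale (u m - v m) (ell2_delta (papply (q m) s))) \<le> e * cmod (c (fst m))" by (simp add: mult.commute)
      qed
      finally show ?thesis by (simp add: sum_distrib_left)
    qed
    have d2: "norm (blinfun_apply a \<xi>s) \<le> e * (\<Sum>\<gamma>\<in>\<Gamma>. cmod (c \<gamma>))"
    proof -
      have cl: "blinfun_apply a (ell2_scale z x) = ell2_scale z (blinfun_apply a x)" for z x
        using RC_linear[OF BI_ops(1)[OF a]] by (simp add: complex_linear_def)
      have "norm (blinfun_apply a \<xi>s) \<le> (\<Sum>\<gamma>\<in>\<Gamma>. norm (ell2_scale (c \<gamma>) (blinfun_apply a (ell2_delta (papply (p \<gamma>) s)))))"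
        unfolding \<xi>s_def blinfun.sum_right cl by (rule norm_sum)
      also have "\<dots> \<le> (\<Sum>\<gamma>\<in>\<Gamma>. e * cmod (c \<gamma>))"
      proof (rule sum_mono)
        fix \<gamma> assume "\<gamma> \<in> \<Gamma>"
        then have "cmod (c \<gamma>) * norm (blinfun_apply a (ell2_delta (papply (p \<gamma>) s))) \<le> cmod (c \<gamma>) * e"
          using s(3) by (intro mult_left_mono) (auto intro: less_imp_le)
        then show "norm (ell2_scale (c \<gamma>) (blinfun_apply a (ell2_delta (papply (p \<gamma>) s)))) \<le> e * cmod (c \<gamma>)"
          by (simp add: norm_ell2_scale mult.commute)
      qed
      finally show ?thesis by (simp add: sum_distrib_left)
    qed
    have tri: "norm (x + y - z) \<le> norm x + norm y + norm z" for x y z :: "'s ell2"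
      using norm_triangle_ineq4[of "x + y" z] norm_triangle_ineq[of x y] by linarith
    \<comment> \<open>The vector modelling the image equals the image under \<open>ru f + a\<close>,
      plus the weight error, minus the part due to \<open>a\<close>.\<close>
    have eta: "blinfun_apply (ru f + a) \<xi>s + (\<eta>s - blinfun_apply (ru f) \<xi>s) - blinfun_apply a \<xi>s = \<eta>s"
      by (simp add: blinfun.add_left)
    have "norm \<eta>s \<le> norm (blinfun_apply (ru f + a) \<xi>s) + norm (\<eta>s - blinfun_apply (ru f) \<xi>s) + norm (blinfun_apply a \<xi>s)"
      using tri[of "blinfun_apply (ru f + a) \<xi>s" "\<eta>s - blinfun_apply (ru f) \<xi>s" "blinfun_apply a \<xi>s"]
      by (simp only: eta)
    also have "\<dots> \<le> norm (ru f + a) * norm \<xi>s + e * (\<Sum>m\<in>M. cmod (c (fst m))) + e * (\<Sum>\<gamma>\<in>\<Gamma>. cmod (c \<gamma>))"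
      by (intro add_mono d1 d2 norm_blinfun)
    finally show ?thesis unfolding neta nxi by (simp add: C_def distrib_left)
  qed
  show ?thesis
  proof (rule field_le_epsilon)
    fix e :: real assume e: "0 < e"
    have "norm (rr \<omega> f \<xi>) \<le> norm (ru f + a) * norm \<xi> + e / (C + 1) * C" using e C0 by (intro main) simp
    moreover have "e / (C + 1) * C \<le> e" using e C0 by (simp add: field_simps)
    ultimately show "norm (rr \<omega> f \<xi>) \<le> norm (ru f + a) * norm \<xi> + e" by simp
  qed
qed

text \<open>Vectors are functions on the whole type of germs, so coordinates outside the fibre have
  to be discarded. Left division by a bisection stays within the fibre.\<close>

lemma conv_fibre_cong:
  assumes "f \<in> CG" "\<And>\<gamma>. \<gamma> \<in> fibre x \<Longrightarrow> \<xi> \<gamma> = \<xi>' \<gamma>"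
  shows "\<gamma> \<in> fibre x \<Longrightarrow> conv f \<xi> \<gamma> = conv f \<xi>' \<gamma>"
  using assms(1)
proof (induction rule: CG.induct)
  case (add_bump f g \<phi>)
  have b: "bump g \<phi> \<in> CG" using add_bump by (intro CG_bump)
  have "conv (bump g \<phi>) \<xi> \<gamma> = conv (bump g \<phi>) \<xi>' \<gamma>"
    using bmap_inverse(1)[OF add_bump(2), of \<gamma> x] bset_fibre assms(2)
    by (auto simp: conv_bump_fibre[OF add_bump(2) add_bump(5)])
  then show ?case using add_bump by (simp add: conv_plus_left[OF b add_bump(1)])
qed simp

text \<open>Finitely supported vectors are dense. The truncation is cut down to the fibre, which
  does not change its image and does not increase its norm; the remainder is controlled by
  \<open>RN f\<close>.\<close>

lemma heart:
  assumes reg: "cstar_regular_on_boundary TYPE('s::left_cancel_monoid)"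
    and w: "(\<omega> :: 's set \<Rightarrow> bool) \<in> boundary_Omega" and f: "f \<in> CG" and a: "a \<in> BI"
  shows "norm (rr \<omega> f \<xi>) \<le> norm (ru f + a) * norm \<xi>"
proof (rule field_le_epsilon)
  fix e :: real assume e: "0 < e"
  have wO: "\<omega> \<in> Omega" by (rule boundary_subset[OF w])
  have RN0: "0 \<le> RN f" by (rule RN_upper(3)[OF f])
  \<comment> \<open>The added 1 allows \<open>RN f = 0\<close>.\<close>
  define d where "d = e / (RN f + 1)"
  have d: "0 < d" using e RN0 by (simp add: d_def)
  obtain F where F: "finite F" "norm (\<xi> - (\<Sum>i\<in>F. ell2_scale (ell2_apply \<xi> i) (ell2_delta i))) < d"
    by (rule ell2_finite_approx[OF d]) blast
  let ?y = "\<Sum>i\<in>F. ell2_scale (ell2_apply \<xi> i) (ell2_delta i)"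
  let ?z = "\<Sum>i\<in>F \<inter> fibre \<omega>. ell2_scale (ell2_apply \<xi> i) (ell2_delta i)"
  have ap: "ell2_apply (\<Sum>i\<in>D. ell2_scale (ell2_apply \<xi> i) (ell2_delta i)) \<gamma> = (if \<gamma> \<in> D then ell2_apply \<xi> \<gamma> else 0)"
    if "finite D" for D \<gamma>
    using that by (simp add: ell2_apply_sum if_distrib[of "(*) _"] sum.delta cong: if_cong)
  have "rr \<omega> f ?y = rr \<omega> f ?z"
  proof (rule ell2_eqI)
    fix \<gamma>
    show "ell2_apply (rr \<omega> f ?y) \<gamma> = ell2_apply (rr \<omega> f ?z) \<gamma>"
      using conv_fibre_cong[OF f, of \<omega> "ell2_apply ?y" "ell2_apply ?z" \<gamma>] F(1)
      by (simp add: rr_apply[OF f] ap)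
  qed
  then have "rr \<omega> f \<xi> = rr \<omega> f ?z + rr \<omega> f (\<xi> - ?y)"
    using rr_vec_plus[OF f, of \<omega> ?y "\<xi> - ?y"] by simp
  then have n1: "norm (rr \<omega> f \<xi>) \<le> norm (rr \<omega> f ?z) + norm (rr \<omega> f (\<xi> - ?y))"
    using norm_triangle_ineq[of "rr \<omega> f ?z" "rr \<omega> f (\<xi> - ?y)"] by simp
  have n2: "norm (rr \<omega> f ?z) \<le> norm (ru f + a) * norm ?z"
    using F(1) by (intro heart_finite[OF reg w f a]) auto
  have "norm ?z \<le> norm \<xi>"
  proof (rule norm_ell2_le)
    fix D :: "'s germ set" assume D: "finite D"
    have "(\<Sum>i\<in>D. (cmod (ell2_apply ?z i))\<^sup>2) \<le> (\<Sum>i\<in>D. (cmod (ell2_apply \<xi> i))\<^sup>2)"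
      using F(1) by (intro sum_mono) (simp add: ap)
    also have "\<dots> \<le> (norm \<xi>)\<^sup>2" by (rule ell2_finite_le[OF D])
    finally show "(\<Sum>i\<in>D. (cmod (ell2_apply ?z i))\<^sup>2) \<le> (norm \<xi>)\<^sup>2" .
  qed simp
  then have n3: "norm (ru f + a) * norm ?z \<le> norm (ru f + a) * norm \<xi>" by (rule mult_left_mono) simp
  have "norm (rr \<omega> f (\<xi> - ?y)) \<le> RN f * norm (\<xi> - ?y)" by (rule RN_upper(1)[OF f wO])
  also have "\<dots> \<le> RN f * d" using F(2) RN0 by (intro mult_left_mono) auto
  also have "\<dots> \<le> e" using e RN0 by (simp add: d_def field_simps)
  finally show "norm (rr \<omega> f \<xi>) \<le> norm (ru f + a) * norm \<xi> + e" using n1 n2 n3 by linarith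
qed

text \<open>Restriction to the boundary leaves the representations at boundary characters unchanged,
  so \<open>heart\<close> bounds each of them. As \<open>a\<close> varies over the ideal the right
  side runs over the norms of the coset of \<open>ru f\<close>.\<close>

lemma reduced_norm_boundary_le:
  assumes reg: "cstar_regular_on_boundary TYPE('s::left_cancel_monoid)"
    and f: "f \<in> CG" and a: "a \<in> BI"
  shows "reduced_norm (boundary_groupoid :: ('s germ, _) groupoid) (restrict_to_boundary f) \<le> norm (ru f + a)"
proof (rule reduced_norm_bound)
  fix x :: "'s set \<Rightarrow> bool" assume "x \<in> gobj boundary_groupoid"
  then have x: "x \<in> boundary_Omega" by (simp add: gobj_simps)
  have "regular_rep boundary_groupoid x (restrict_to_boundary f) = rr x (restrict_to_boundary f)"
    by (rule regular_rep_boundary[OF x])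
  also have "\<dots> = rr x f"
    by (rule rr_boundary_cong[OF boundary_subset[OF x]])
      (use x in \<open>auto simp: restrict_to_boundary_def garr_boundary\<close>)
  finally show "onorm (regular_rep boundary_groupoid x (restrict_to_boundary f)) \<le> norm (ru f + a)"
    using heart[OF reg x f a] by (auto intro!: onorm_bound)
qed simp

section \<open>Functions off the boundary, and bijectivity of the canonical map\<close>

section \<open>Multipliers vanishing on the boundary\<close>

text \<open>Where the modulus of the function is at least \<open>e\<close> the spectrum is compact
  and misses the boundary. It is covered by finitely many cylinders of foundation sets, whose
  indicators are generators; multiplying by the indicator of their union changes the function by at
  most \<open>e\<close>.\<close>

lemma mop_BI:
  assumes phi: "Ocont \<phi>" and van: "\<And>\<omega>. \<omega> \<in> boundary_Omega \<Longrightarrow> \<phi> \<omega> = 0"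
  shows "ru (mop \<phi>) \<in> BI"
proof -
  let ?M = "{\<psi>. Ocont \<psi> \<and> ru (mop \<psi>) \<in> BI}"
  have mult: "(\<lambda>\<omega>. \<phi> \<omega> * \<psi> \<omega>) \<in> ?M" if "Ocont \<phi>" "\<psi> \<in> ?M" for \<phi> \<psi>
    using that by (auto simp: ru_mop_mult Ocont_mult intro: BI_ops(5) ru_RC mop_CG)
  have plus: "(\<lambda>\<omega>. \<phi> \<omega> + \<psi> \<omega>) \<in> ?M" if "\<phi> \<in> ?M" "\<psi> \<in> ?M" for \<phi> \<psi>
    using that by (auto simp: ru_mop_linear Ocont_plus intro: BI_ops(3))
  have approx: "\<exists>\<psi>\<in>?M. \<forall>\<omega>\<in>Omega. cmod (\<phi> \<omega> - \<psi> \<omega>) \<le> e" if e: "0 < e" for e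
  proof -
    define S where "S = {\<omega> \<in> Omega. e \<le> cmod (\<phi> \<omega>)}"
    have "closedin Omega_topology {\<omega> \<in> topspace Omega_topology. \<phi> \<omega> \<in> - ball 0 e}"
      using phi unfolding Ocont_def by (rule closedin_continuous_map_preimage) (simp add: closed_Compl)
    moreover have "{\<omega> \<in> topspace Omega_topology. \<phi> \<omega> \<in> - ball 0 e} = S" by (auto simp: S_def topspace_Omega)
    ultimately have "compactin Omega_topology S" by (intro compactin_clopen) simp
    define P where "P = {(X, F). X \<in> \<J> \<and> finite F \<and> F \<subseteq> \<J> \<and> F \<noteq> {} \<and> foundation_set F (X :: 'a set)}"
    have "S \<subseteq> \<Union>((\<lambda>(X, F). cylinder X F) ` P)"
    proof
      fix \<omega> assume w: "\<omega> \<in> S"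
      then have "\<omega> \<in> Omega" "\<omega> \<notin> boundary_Omega" using van e by (auto simp: S_def)
      then obtain X F where "X \<in> \<J>" "finite F" "F \<subseteq> \<J>" "F \<noteq> {}" "foundation_set F X" "\<omega> \<in> cylinder X F"
        by (rule off_boundary_foundation)
      then show "\<omega> \<in> \<Union>((\<lambda>(X, F). cylinder X F) ` P)" unfolding P_def by blast
    qed
    moreover have "\<forall>U\<in>(\<lambda>(X, F). cylinder X F) ` P. openin Omega_topology U"
      by (auto simp: P_def intro: openin_cylinder)
    ultimately obtain \<V> where V: "finite \<V>" "\<V> \<subseteq> (\<lambda>(X, F). cylinder X F) ` P" "S \<subseteq> \<Union>\<V>"
      using \<open>compactin Omega_topology S\<close> unfolding compactin_def by meson
    have "ind (\<Union>\<V>) \<in> ?M"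
      using V(1,2)
    proof (induction \<V> rule: finite_induct)
      case empty
      have "ind (\<Union>{}) = (\<lambda>_ :: 'a set \<Rightarrow> bool. 0)" by (simp add: ind_def fun_eq_iff)
      moreover have "mop (\<lambda>_. 0) = (\<lambda>_ :: 'a germ. 0)" by (simp add: mop_def bump_def fun_eq_iff)
      ultimately show ?case using BI_ops(2) by (simp add: ru_zero Ocont_const)
    next
      case (insert U \<V>)
      then obtain X F where XF: "U = cylinder X F" "X \<in> \<J>" "finite F" "F \<subseteq> \<J>" "F \<noteq> {}" "foundation_set F X"
        by (auto simp: P_def)
      have IH: "ind (\<Union>\<V>) \<in> ?M" using insert by auto
      have "projection (X - \<Union>F) \<in> gens" unfolding gens_def using XF by blast
      then have U: "ind U \<in> ?M"
        using gens_BI projection_mop[OF XF(2-4)] Ocont_ind[OF XF(2-4)] XF(1) by (auto simp: ind_def[abs_def])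
      \<comment> \<open>The new cylinder is made disjoint from the earlier ones by multiplying its
        indicator with this function.\<close>
      have "Ocont (\<lambda>\<omega>. 1 - ind (\<Union>\<V>) \<omega>)" using IH by (intro Ocont_diff Ocont_const) auto
      then have "(\<lambda>\<omega>. ind (\<Union>\<V>) \<omega> + (1 - ind (\<Union>\<V>) \<omega>) * ind U \<omega>) \<in> ?M" by (intro plus IH mult U)
      moreover have "(\<lambda>\<omega>. ind (\<Union>\<V>) \<omega> + (1 - ind (\<Union>\<V>) \<omega>) * ind U \<omega>) = ind (\<Union>(insert U \<V>))"
        by (auto simp: ind_def fun_eq_iff)
      ultimately show ?case by simp
    qed
    then have "(\<lambda>\<omega>. \<phi> \<omega> * ind (\<Union>\<V>) \<omega>) \<in> ?M" by (rule mult[OF phi])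
    moreover have "cmod (\<phi> \<omega> - \<phi> \<omega> * ind (\<Union>\<V>) \<omega>) \<le> e" if "\<omega> \<in> Omega" for \<omega>
      using V(3) that e by (auto simp: ind_def S_def not_le)
    ultimately show ?thesis by (intro bexI[of _ "\<lambda>\<omega>. \<phi> \<omega> * ind (\<Union>\<V>) \<omega>"]) auto
  qed
  then have "\<exists>\<psi>\<in>?M. \<forall>\<omega>\<in>Omega. cmod (\<phi> \<omega> - \<psi> \<omega>) \<le> inverse (real (Suc n))" for n by simp
  then have "\<forall>n. \<exists>\<psi>. \<psi> \<in> ?M \<and> (\<forall>\<omega>\<in>Omega. cmod (\<phi> \<omega> - \<psi> \<omega>) \<le> inverse (real (Suc n)))" unfolding Bex_def by blast
  from choice[OF this]
  obtain \<psi> where psi: "\<forall>n. \<psi> n \<in> ?M \<and> (\<forall>\<omega>\<in>Omega. cmod (\<phi> \<omega> - \<psi> n \<omega>) \<le> inverse (real (Suc n)))"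
    by (rule exE)
  have "(\<lambda>n. ru (mop (\<psi> n))) \<longlonglongrightarrow> ru (mop \<phi>)"
    by (rule mop_tendsto[OF phi]) (use psi in auto)
  then show ?thesis by (rule BI_ops(7)[rotated]) (use psi in auto)
qed

text \<open>The weight of each bump vanishes on the boundary, so its diagonal factor is in the ideal
  by \<open>mop_BI\<close>. This inclusion is what makes the canonical map well defined.\<close>

lemma off_boundary_BI:
  assumes "f \<in> Cc off_boundary_groupoid"
  shows "ru f \<in> BI"
  using Cc_off_boundary[OF assms]
proof (induction rule: CGV.induct)
  case zero
  then show ?case using BI_ops(2) by (simp add: ru_zero)
next
  case (add_bump f g \<phi>)
  have "\<phi> \<omega> = 0" if w: "\<omega> \<in> boundary_Omega" for \<omega>
  proof (rule ccontr)
    assume "\<phi> \<omega> \<noteq> 0"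
    from add_bump(4)[OF this] have "\<omega> \<in> dom_set g" "germ g \<omega> \<in> garr off_boundary_groupoid" by auto
    then show False using w gsrc_germ[OF add_bump(2)] by (simp add: garr_off_boundary)
  qed
  then have "ru (mop \<phi>) \<in> BI" by (rule mop_BI[OF add_bump(3)])
  then have "ru (bump g \<phi>) \<in> BI"
    unfolding ru_bump_split[OF add_bump(2,3)]
    by (intro BI_ops(5) ru_RC CG_bump add_bump Ocont_const)
  then show ?case
    using add_bump BI_ops(3) CGV_CG[OF add_bump(1)] by (simp add: ru_plus CG_bump)
qed

section \<open>The canonical map\<close>

lemma restrict_linear:
  "restrict_to_boundary (\<lambda>\<gamma>. f \<gamma> + f' \<gamma>) = (\<lambda>\<gamma>. restrict_to_boundary f \<gamma> + restrict_to_boundary f' \<gamma>)"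
  "restrict_to_boundary (\<lambda>\<gamma>. f \<gamma> - f' \<gamma>) = (\<lambda>\<gamma>. restrict_to_boundary f \<gamma> - restrict_to_boundary f' \<gamma>)"
  "restrict_to_boundary (\<lambda>\<gamma>. c * f \<gamma>) = (\<lambda>\<gamma>. c * restrict_to_boundary f \<gamma>)"
  by (auto simp: restrict_to_boundary_def fun_eq_iff)

locale e2_setting =
  fixes N :: "('s::left_cancel_monoid germ \<Rightarrow> complex) \<Rightarrow> real"
  assumes e2: "is_e2_norm N"
begin

abbreviation AA :: "('s germ \<Rightarrow> complex) star_algebra" where "AA \<equiv> reduced_algebra GG"
abbreviation BB :: "('s germ \<Rightarrow> complex) star_algebra" where "BB \<equiv> groupoid_algebra boundary_groupoid N"
abbreviation UA :: "('s germ \<Rightarrow> complex) star_algebra" where "UA \<equiv> reduced_algebra off_boundary_groupoid"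

sublocale A: normed_star_record AA by (rule normed_star_record_reduced)

lemma normed_record_BB: "normed_record BB"
proof (intro normed_record.intro vector_record_groupoid_algebra normed_record_axioms.intro)
  have h: "has_cstar_norm BB" using e2 by (simp add: is_e2_norm_def)
  show "0 \<le> anorm BB x" if "x \<in> acarrier BB" for x using h that unfolding has_cstar_norm_def by blast
  show "anorm BB (ascale BB c x) = cmod c * anorm BB x" if "x \<in> acarrier BB" for c x
    using h that unfolding has_cstar_norm_def by blast
  show "anorm BB (aplus BB x y) \<le> anorm BB x + anorm BB y" if "x \<in> acarrier BB" "y \<in> acarrier BB" for x y
    using h that unfolding has_cstar_norm_def by blast
qed

sublocale B: normed_record BB by (rule normed_record_BB)
sublocale U: normed_record UA by (rule normed_record_off_boundary)
sublocale CA: normed_record "completion AA" by (rule A.normed_record_completion)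
sublocale CB: normed_record "completion BB" by (rule B.normed_record_completion)
sublocale M: normed_record "MC :: ('s ell2 \<Rightarrow>\<^sub>L 's ell2) star_algebra" by (rule normed_record_MC)

sublocale Q: quotient_record "MC :: ('s ell2 \<Rightarrow>\<^sub>L 's ell2) star_algebra" "BI :: ('s ell2 \<Rightarrow>\<^sub>L 's ell2) set"
proof (intro quotient_record.intro M.vector_record_axioms quotient_record_axioms.intro)
  show "subspace_record MC (BI :: ('s ell2 \<Rightarrow>\<^sub>L 's ell2) set)"
    unfolding subspace_record_def using BI_ops by auto
qed

abbreviation q :: "('s ell2 \<Rightarrow>\<^sub>L 's ell2) \<Rightarrow> ('s ell2 \<Rightarrow>\<^sub>L 's ell2) set" where "q \<equiv> coset MC BI"

lemma q_eq: "S \<in> RC \<Longrightarrow> T \<in> RC \<Longrightarrow> q S = q T \<longleftrightarrow> S - T \<in> BI"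
  using Q.coset_eq[of S T] by simp

lemma q_ops:
  assumes "S \<in> RC" "T \<in> RC"
  shows "aplus boundary_quotient (q S) (q T) = q (S + T)" "ascale boundary_quotient c (q S) = q (cscale c S)"
    "amult boundary_quotient (q S) (q T) = q (S o\<^sub>L T)" "astar boundary_quotient (q S) = q (adj S)"
    "q S \<in> acarrier boundary_quotient"
proof -
  show "aplus boundary_quotient (q S) (q T) = q (S + T)" "ascale boundary_quotient c (q S) = q (cscale c S)"
    "q S \<in> acarrier boundary_quotient"
    using Q.quotient_plus[of S T] Q.quotient_scale[of S c] Q.quotient_carrier assms by (simp_all add: boundary_quotient_def)
  have "amult (quotient_algebra MC BI) (q S) (q T) = q (amult MC S T)"
  proof (rule Q.quotient_mult)
    fix S' T' assume *: "S' \<in> acarrier MC" "T' \<in> acarrier MC" "aminus MC S' S \<in> BI" "aminus MC T' T \<in> BI"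
    have "(S' o\<^sub>L T') - (S o\<^sub>L T) = ((S' - S) o\<^sub>L T') + (S o\<^sub>L (T' - T))"
      by (rule blinfun_eqI) (simp add: blinfun.diff_left blinfun.diff_right blinfun.add_left)
    also have "\<dots> \<in> BI" using * assms by (intro BI_ops(3) BI_ops(5) BI_ops(6)) auto
    finally show "amult MC S' T' \<in> acarrier MC \<and> aminus MC (amult MC S' T') (amult MC S T) \<in> BI"
      using * RC_mult by simp
  qed (use assms in auto)
  then show "amult boundary_quotient (q S) (q T) = q (S o\<^sub>L T)" by (simp add: boundary_quotient_def)
  have "astar (quotient_algebra MC BI) (q S) = q (astar MC S)"
  proof (rule Q.quotient_star)
    fix S' assume *: "S' \<in> acarrier MC" "aminus MC S' S \<in> BI"
    then have "adj S' - adj S \<in> BI" using BI_adj[of "S' - S"] adj_ops(2)[of S' S] assms by simp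
    then show "astar MC S' \<in> acarrier MC \<and> aminus MC (astar MC S') (astar MC S) \<in> BI" using * RC_adj by simp
  qed (use assms in auto)
  then show "astar boundary_quotient (q S) = q (adj S)" by (simp add: boundary_quotient_def)
qed

lemma boundary_quotient_cases:
  assumes "Y \<in> acarrier boundary_quotient" obtains S where "S \<in> RC" "Y = q S"
  using assms Q.quotient_carrier by (auto simp: boundary_quotient_def)

lemma bounded_restrict: "\<exists>K\<ge>0. \<forall>f\<in>CG. N (restrict_to_boundary f) \<le> K * RN f"
proof -
  obtain K where K: "\<forall>x\<in>acarrier AA. anorm BB (restrict_to_boundary x) \<le> K * anorm AA x"
    using e2 unfolding is_e2_norm_def norm_bounded_map_def by blast
  have "N (restrict_to_boundary f) \<le> max K 0 * RN f" if "f \<in> CG" for f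
    using K[rule_format, of f] mult_right_mono[of K "max K 0" "RN f"] RN_upper(3)[OF that] that by (simp add: Cc_monoid_groupoid)
  then show ?thesis by (intro exI[of _ "max K 0"]) auto
qed

lemma phi_2_cls:
  assumes "A.cauchy a"
  shows "phi_2 N (A.cls a) = B.cls (\<lambda>n. restrict_to_boundary (a n))" "B.cauchy (\<lambda>n. restrict_to_boundary (a n))"
proof -
  obtain K where K: "0 \<le> K" "\<And>f. f \<in> CG \<Longrightarrow> N (restrict_to_boundary f) \<le> K * RN f" using bounded_restrict by blast
  have le: "N (\<lambda>\<gamma>. restrict_to_boundary f \<gamma> - restrict_to_boundary f' \<gamma>) \<le> K * RN (\<lambda>\<gamma>. f \<gamma> - f' \<gamma>)"
    if "f \<in> CG" "f' \<in> CG" for f f'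
    using K(2)[OF CG_minus[OF that]] by (simp add: restrict_linear)
  note eq = A.completion_map_eq[OF normed_record_BB, of restrict_to_boundary K a]
  show "phi_2 N (A.cls a) = B.cls (\<lambda>n. restrict_to_boundary (a n))"
    unfolding phi_2_def
    by (rule eq(1); (use assms K(1) le in \<open>simp add: Cc_monoid_groupoid restrict_Cc\<close>)?)
  show "B.cauchy (\<lambda>n. restrict_to_boundary (a n))"
    by (rule eq(2); (use assms K(1) le in \<open>simp add: Cc_monoid_groupoid restrict_Cc\<close>)?)
qed

lemma rho_2_cls:
  assumes a: "A.cauchy a"
  shows "rho_2 (A.cls a) \<in> RC" "(\<lambda>n. ru (a n)) \<longlonglongrightarrow> rho_2 (A.cls a)"
proof -
  have an: "a n \<in> CG" for n using A.cauchy_carr[OF a] by (simp add: Cc_monoid_groupoid)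
  have le: "norm (ru f - ru f') \<le> RN (\<lambda>\<gamma>. f \<gamma> - f' \<gamma>)" if "f \<in> CG" "f' \<in> CG" for f f' :: "'s germ \<Rightarrow> complex"
    using ru_apply(2)[OF CG_minus[OF that]] by (simp add: ru_minus that)
  have "Cauchy (\<lambda>n. ru (a n))"
  proof (rule CauchyI)
    fix e :: real assume "0 < e"
    then obtain M where "\<forall>m\<ge>M. \<forall>n\<ge>M. A.nrm (A.sub (a m) (a n)) < e" using a unfolding A.cauchy_def by blast
    then show "\<exists>M. \<forall>m\<ge>M. \<forall>n\<ge>M. norm (ru (a m) - ru (a n)) < e"
      by (intro exI[of _ M] allI impI le_less_trans[OF le[OF an an]]) auto
  qed
  then obtain y where y: "(\<lambda>n. ru (a n)) \<longlonglongrightarrow> y" using Cauchy_convergent convergent_def by blast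
  then have yR: "y \<in> RC" using an RC_seq by blast
  have "rho_2 (A.cls a) = y"
    unfolding rho_2_def
    by (rule A.continuous_extension_eq[where K = 1])
      (use normed_record_MC le y yR a in \<open>auto simp: Cc_monoid_groupoid ru_RC norm_tendsto_MC\<close>)
  then show "rho_2 (A.cls a) \<in> RC" "(\<lambda>n. ru (a n)) \<longlonglongrightarrow> rho_2 (A.cls a)" using y yR by auto
qed

lemma rho_2_RC: "x \<in> acarrier (completion AA) \<Longrightarrow> rho_2 x \<in> RC"
  by (erule A.completion_cases) (simp add: rho_2_cls)

lemma rho_2_eqI: "A.cauchy a \<Longrightarrow> (\<lambda>n. ru (a n)) \<longlonglongrightarrow> y \<Longrightarrow> rho_2 (A.cls a) = y"
  using rho_2_cls(2) LIMSEQ_unique by blast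

lemma rho_2_hom:
  assumes "x \<in> acarrier (completion AA)" "y \<in> acarrier (completion AA)"
  shows "rho_2 (aplus (completion AA) x y) = rho_2 x + rho_2 y"
    "rho_2 (ascale (completion AA) c x) = cscale c (rho_2 x)"
    "rho_2 (aminus (completion AA) x y) = rho_2 x - rho_2 y"
    "rho_2 (amult (completion AA) x y) = rho_2 x o\<^sub>L rho_2 y"
    "rho_2 (astar (completion AA) x) = adj (rho_2 x)"
    "amult (completion AA) x y \<in> acarrier (completion AA)" "astar (completion AA) x \<in> acarrier (completion AA)"
    "norm (rho_2 x) \<le> anorm (completion AA) x"
proof -
  obtain a where a: "A.cauchy a" "x = A.cls a" using assms(1) by (rule A.completion_cases)
  obtain b where b: "A.cauchy b" "y = A.cls b" using assms(2) by (rule A.completion_cases)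
  have ab: "a n \<in> CG" "b n \<in> CG" for n using A.cauchy_carr[OF a(1)] A.cauchy_carr[OF b(1)] by (auto simp: Cc_monoid_groupoid)
  note l = rho_2_cls(2)[OF a(1)] rho_2_cls(2)[OF b(1)]
  show "rho_2 (aplus (completion AA) x y) = rho_2 x + rho_2 y"
    unfolding a b A.completion_plus[OF a(1) b(1)]
    by (rule rho_2_eqI[OF A.cauchy_plus[OF a(1) b(1)]]) (use tendsto_add[OF l] in \<open>simp add: ru_plus ab\<close>)
  show "rho_2 (aminus (completion AA) x y) = rho_2 x - rho_2 y"
    unfolding a b A.completion_minus[OF a(1) b(1)]
    by (rule rho_2_eqI[OF A.cauchy_minus[OF a(1) b(1)]]) (use tendsto_diff[OF l] in \<open>simp add: ru_minus ab\<close>)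
  show "rho_2 (ascale (completion AA) c x) = cscale c (rho_2 x)"
    unfolding a A.completion_scale[OF a(1)]
    by (rule rho_2_eqI[OF A.cauchy_scale[OF a(1)]])
      (use bounded_linear.tendsto[OF bounded_linear_cscale l(1)] in \<open>simp add: ru_scale ab\<close>)
  have am: "amult AA f f' = gconv f f'" "astar AA f = gstar f" for f f' :: "'s germ \<Rightarrow> complex"
    by (simp_all add: amult_gconv astar_gstar)
  show "rho_2 (amult (completion AA) x y) = rho_2 x o\<^sub>L rho_2 y"
    unfolding a b A.completion_mult[OF a(1) b(1)]
    by (rule rho_2_eqI[OF A.cauchy_mult[OF a(1) b(1)]])
      (use bounded_bilinear.tendsto[OF bounded_bilinear_blinfun_compose l] in \<open>simp add: am ru_gconv ab\<close>)
  show "amult (completion AA) x y \<in> acarrier (completion AA)"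
    unfolding a b A.completion_mult[OF a(1) b(1)] using A.cauchy_mult[OF a(1) b(1)] by (auto simp: A.completion_carrier)
  show "astar (completion AA) x \<in> acarrier (completion AA)"
    unfolding a A.completion_star[OF a(1)] using A.cauchy_star[OF a(1)] by (auto simp: A.completion_carrier)
  show "rho_2 (astar (completion AA) x) = adj (rho_2 x)"
    unfolding a A.completion_star[OF a(1)]
  proof (rule rho_2_eqI[OF A.cauchy_star[OF a(1)]])
    have R: "rho_2 (A.cls a) \<in> RC" by (rule rho_2_cls(1)[OF a(1)])
    have "(\<lambda>n. adj (ru (a n)) - adj (rho_2 (A.cls a))) \<longlonglongrightarrow> 0"
    proof (rule Lim_null_comparison)
      show "(\<lambda>n. norm (ru (a n) - rho_2 (A.cls a))) \<longlonglongrightarrow> 0" using l(1) by (intro tendsto_norm_zero LIM_zero)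
      show "\<forall>\<^sub>F n in sequentially. norm (adj (ru (a n)) - adj (rho_2 (A.cls a))) \<le> norm (ru (a n) - rho_2 (A.cls a))"
        using RC_adj(3)[OF RC_minus[OF ru_RC[OF ab(1)] R]] adj_ops(2)[OF ru_RC[OF ab(1)] R] by (simp add: always_eventually)
    qed
    then have "(\<lambda>n. adj (ru (a n))) \<longlonglongrightarrow> adj (rho_2 (A.cls a))" by (rule LIM_zero_cancel)
    then show "(\<lambda>n. ru (astar AA (a n))) \<longlonglongrightarrow> adj (rho_2 (A.cls a))" by (simp add: am adj_ru ab)
  qed
  show "norm (rho_2 x) \<le> anorm (completion AA) x"
    unfolding a
    by (rule tendsto_le[OF _ A.completion_norm_lim[OF a(1)] tendsto_norm[OF l(1)]])
      (auto intro!: always_eventually ru_apply(2) ab)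
qed

lemma phi_2_hom:
  "star_hom (completion AA) (completion BB) (phi_2 N)" "phi_2 N ` acarrier (completion AA) = acarrier (completion BB)"
  "{x \<in> acarrier (completion AA). phi_2 N x = azero (completion BB)} =
     completion_map UA AA (\<lambda>f. f) ` acarrier (completion UA)"
  using e2 unfolding is_e2_norm_def short_exact_def reduced_cstar_algebra_def e2_cstar_algebra_def by auto

lemma phi_2_minus:
  assumes "x \<in> acarrier (completion AA)" "y \<in> acarrier (completion AA)"
  shows "phi_2 N (aminus (completion AA) x y) = aminus (completion BB) (phi_2 N x) (phi_2 N y)"
  using phi_2_hom(1) assms unfolding star_hom_def aminus_def by simp

text \<open>By exactness the element comes from the algebra off the boundary, where it is
  represented by a Cauchy sequence \<open>b\<close>. Its image is the limit of
  \<open>ru (b n)\<close>, and the ideal is closed.\<close>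

lemma kernel:
  assumes x: "x \<in> acarrier (completion AA)" "phi_2 N x = azero (completion BB)"
  shows "rho_2 x \<in> BI"
proof -
  obtain z where z: "z \<in> acarrier (completion UA)" "x = completion_map UA AA (\<lambda>f. f) z"
    using x phi_2_hom(3) by blast
  obtain b where b: "U.cauchy b" "z = U.cls b" using z(1) by (rule U.completion_cases)
  have cg: "f \<in> CG" if "f \<in> Cc off_boundary_groupoid" for f :: "'s germ \<Rightarrow> complex"
    using Cc_off_boundary[OF that] CGV_CG by blast
  have diff: "(\<lambda>\<gamma>. f \<gamma> - f' \<gamma>) \<in> Cc off_boundary_groupoid"
    if "f \<in> Cc off_boundary_groupoid" "f' \<in> Cc off_boundary_groupoid" for f f' :: "'s germ \<Rightarrow> complex"
    using U.minus_closed[of f f'] that by simp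
  have xb: "x = A.cls b" "A.cauchy b"
    unfolding z(2) b(2)
    using U.completion_map_eq[OF A.normed_record_axioms, of "\<lambda>f. f" 1 b] b(1) RN_off_boundary diff cg
    by (auto simp: Cc_monoid_groupoid)
  have "b n \<in> Cc off_boundary_groupoid" for n using U.cauchy_carr[OF b(1)] by simp
  then have "ru (b n) \<in> BI" for n by (intro off_boundary_BI)
  then show ?thesis unfolding xb(1) using rho_2_cls(2)[OF xb(2)] by (rule BI_ops(7))
qed

lemma kernel_eq:
  assumes "x \<in> acarrier (completion AA)" "y \<in> acarrier (completion AA)" "phi_2 N x = phi_2 N y"
  shows "rho_2 x - rho_2 y \<in> BI"
proof -
  have p: "phi_2 N y \<in> acarrier (completion BB)" using phi_2_hom(2) assms(2) by blast
  have "phi_2 N (aminus (completion AA) x y) = azero (completion BB)"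
    using phi_2_minus[OF assms(1,2)] assms(3) p by simp
  from kernel[OF CA.minus_closed[OF assms(1,2)] this] show ?thesis
    using rho_2_hom(3)[OF assms(1,2)] by simp
qed

text \<open>An explicit candidate for the canonical map, using a chosen lift along
  \<open>phi_2\<close>; \<open>kernel_eq\<close> makes the choice immaterial.\<close>

definition Psi :: "(nat \<Rightarrow> 's germ \<Rightarrow> complex) set \<Rightarrow> ('s ell2 \<Rightarrow>\<^sub>L 's ell2) set" where
  "Psi = (\<lambda>z\<in>acarrier (completion BB). q (rho_2 (SOME x. x \<in> acarrier (completion AA) \<and> phi_2 N x = z)))"

lemma Psi_phi_2: "x \<in> acarrier (completion AA) \<Longrightarrow> Psi (phi_2 N x) = q (rho_2 x)"
proof -
  assume x: "x \<in> acarrier (completion AA)"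
  let ?y = "SOME y. y \<in> acarrier (completion AA) \<and> phi_2 N y = phi_2 N x"
  have y: "?y \<in> acarrier (completion AA) \<and> phi_2 N ?y = phi_2 N x"
    by (rule someI[of _ x]) (use x in simp)
  have "phi_2 N x \<in> acarrier (completion BB)" using x phi_2_hom(2) by blast
  then have "Psi (phi_2 N x) = q (rho_2 ?y)" by (simp add: Psi_def)
  also have "\<dots> = q (rho_2 x)"
    using q_eq[OF rho_2_RC rho_2_RC] kernel_eq[of ?y x] x y by simp
  finally show ?thesis .
qed

lemma phi_2_cases:
  assumes "z \<in> acarrier (completion BB)"
  obtains x where "x \<in> acarrier (completion AA)" "z = phi_2 N x"
  using assms phi_2_hom(2) by blast

lemma Psi_star_hom: "star_hom (completion BB) boundary_quotient Psi"
  unfolding star_hom_def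
proof (intro conjI ballI allI)
  fix z assume "z \<in> acarrier (completion BB)"
  then obtain x where x: "x \<in> acarrier (completion AA)" "z = phi_2 N x" by (rule phi_2_cases)
  note h = phi_2_hom(1)[unfolded star_hom_def]
  note R = rho_2_RC[OF x(1)]
  show "Psi z \<in> acarrier boundary_quotient" unfolding x(2) Psi_phi_2[OF x(1)] by (rule q_ops(5)[OF R R])
  show "Psi (ascale (completion BB) c z) = ascale boundary_quotient c (Psi z)" for c
  proof -
    have "Psi (phi_2 N (ascale (completion AA) c x)) = q (rho_2 (ascale (completion AA) c x))"
      using x by (intro Psi_phi_2) auto
    then show ?thesis using h x Psi_phi_2 rho_2_hom(2)[OF x(1,1)] q_ops(2)[OF R R] by simp
  qed
  show "Psi (astar (completion BB) z) = astar boundary_quotient (Psi z)"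
  proof -
    have "Psi (phi_2 N (astar (completion AA) x)) = q (rho_2 (astar (completion AA) x))"
      using rho_2_hom(7)[OF x(1,1)] by (rule Psi_phi_2)
    then show ?thesis using h x Psi_phi_2 rho_2_hom(5)[OF x(1,1)] q_ops(4)[OF R R] by simp
  qed
  fix w assume "w \<in> acarrier (completion BB)"
  then obtain y where y: "y \<in> acarrier (completion AA)" "w = phi_2 N y" by (rule phi_2_cases)
  note R' = rho_2_RC[OF y(1)]
  show "Psi (aplus (completion BB) z w) = aplus boundary_quotient (Psi z) (Psi w)"
  proof -
    have "Psi (phi_2 N (aplus (completion AA) x y)) = q (rho_2 (aplus (completion AA) x y))"
      using x y by (intro Psi_phi_2) auto
    then show ?thesis using h x y Psi_phi_2 rho_2_hom(1)[OF x(1) y(1)] q_ops(1)[OF R R'] by simp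
  qed
  show "Psi (amult (completion BB) z w) = amult boundary_quotient (Psi z) (Psi w)"
  proof -
    have "Psi (phi_2 N (amult (completion AA) x y)) = q (rho_2 (amult (completion AA) x y))"
      using rho_2_hom(6)[OF x(1) y(1)] by (rule Psi_phi_2)
    then show ?thesis using h x y Psi_phi_2 rho_2_hom(4)[OF x(1) y(1)] q_ops(3)[OF R R'] by simp
  qed
qed

text \<open>Surjectivity of \<open>phi_2\<close> determines any competitor on the carrier, and
  extensionality determines it elsewhere.\<close>

lemma canonical_map_eq: "canonical_map N = Psi"
  unfolding canonical_map_def
proof (rule the_equality)
  show "Psi \<in> extensional (acarrier (e2_cstar_algebra N)) \<and> star_hom (e2_cstar_algebra N) boundary_quotient Psi \<and>
      (\<forall>x\<in>acarrier (reduced_cstar_algebra GG). Psi (phi_2 N x) = coset MC BI (rho_2 x))"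
    using Psi_star_hom Psi_phi_2 by (auto simp: e2_cstar_algebra_def reduced_cstar_algebra_def Psi_def)
  fix F assume F: "F \<in> extensional (acarrier (e2_cstar_algebra N)) \<and> star_hom (e2_cstar_algebra N) boundary_quotient F \<and>
      (\<forall>x\<in>acarrier (reduced_cstar_algebra GG). F (phi_2 N x) = coset MC BI (rho_2 x))"
  show "F = Psi"
  proof (rule extensionalityI[of _ "acarrier (completion BB)"])
    show "F \<in> extensional (acarrier (completion BB))" using F by (simp add: e2_cstar_algebra_def)
    fix z assume "z \<in> acarrier (completion BB)"
    then obtain x where "x \<in> acarrier (completion AA)" "z = phi_2 N x" by (rule phi_2_cases)
    then show "F z = Psi z" using F Psi_phi_2 by (simp add: reduced_cstar_algebra_def)
  qed (simp add: Psi_def)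
qed

text \<open>Restriction is bounded, hence so is its extension to the completions; it is onto by
  exactness, and both completions are Banach spaces.\<close>

lemma phi_2_open:
  "\<exists>C\<ge>0. \<forall>z\<in>acarrier (completion BB). \<exists>x\<in>acarrier (completion AA). phi_2 N x = z \<and>
     anorm (completion AA) x \<le> C * anorm (completion BB) z"
proof -
  obtain K where K: "0 \<le> K" "\<And>f. f \<in> CG \<Longrightarrow> N (restrict_to_boundary f) \<le> K * RN f" using bounded_restrict by blast
  have bd: "anorm (completion BB) (phi_2 N x) \<le> K * anorm (completion AA) x" if "x \<in> acarrier (completion AA)" for x
  proof -
    obtain a where a: "A.cauchy a" "x = A.cls a" using \<open>x \<in> _\<close> by (rule A.completion_cases)
    show ?thesis
      unfolding a(2) phi_2_cls(1)[OF a(1)]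
      by (rule tendsto_le[OF _ tendsto_mult_left[OF A.completion_norm_lim[OF a(1)]] B.completion_norm_lim[OF phi_2_cls(2)[OF a(1)]]])
        (use K(2) A.cauchy_carr[OF a(1)] in \<open>auto intro!: always_eventually simp: Cc_monoid_groupoid\<close>)
  qed
  show ?thesis
  proof (rule open_mapping[OF CA.normed_record_axioms A.completion_complete CB.normed_record_axioms
        B.completion_definite B.completion_complete])
    show "phi_2 N x \<in> acarrier (completion BB)" if "x \<in> acarrier (completion AA)" for x using that phi_2_hom(2) by blast
    show "phi_2 N (ascale (completion AA) c x) = ascale (completion BB) c (phi_2 N x)" if "x \<in> acarrier (completion AA)" for c x
      using phi_2_hom(1) that unfolding star_hom_def by blast
  qed (use phi_2_minus bd phi_2_hom(2) in auto)
qed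

end

text \<open>\<open>N\<close> and \<open>N'\<close> may differ outside \<open>Cc G\<close>, so the two completions need not be equal as records.\<close>

lemma completion_norm_cong:
  assumes "\<forall>f\<in>Cc G. N f = N' f"
  shows "acarrier (completion (groupoid_algebra G N)) = acarrier (completion (groupoid_algebra G N'))"
    "aplus (completion (groupoid_algebra G N)) = aplus (completion (groupoid_algebra G N'))"
    "ascale (completion (groupoid_algebra G N)) = ascale (completion (groupoid_algebra G N'))"
    "amult (completion (groupoid_algebra G N)) = amult (completion (groupoid_algebra G N'))"
    "astar (completion (groupoid_algebra G N)) = astar (completion (groupoid_algebra G N'))"
proof -
  let ?A = "groupoid_algebra G N" and ?B = "groupoid_algebra G N'"
  interpret V: vector_record ?A by (rule vector_record_groupoid_algebra)
  have minus: "(\<lambda>\<gamma>. f \<gamma> - f' \<gamma>) \<in> Cc G" if "f \<in> Cc G" "f' \<in> Cc G" for f f'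
    using V.minus_closed[of f f'] that by simp
  have same: "amult ?A = amult ?B" "astar ?A = astar ?B" by (simp_all add: groupoid_algebra_def)
  have c: "acarrier (cauchy_algebra ?A) = acarrier (cauchy_algebra ?B)"
  proof -
    have "N (\<lambda>\<gamma>. a m \<gamma> - a n \<gamma>) = N' (\<lambda>\<gamma>. a m \<gamma> - a n \<gamma>)" if "\<forall>n. a n \<in> Cc G" for a :: "nat \<Rightarrow> _" and m n
      using that by (intro assms[rule_format] minus) auto
    then show ?thesis by (auto simp: cauchy_algebra_def)
  qed
  have ops: "aplus (cauchy_algebra ?A) = aplus (cauchy_algebra ?B)" "ascale (cauchy_algebra ?A) = ascale (cauchy_algebra ?B)"
    "amult (cauchy_algebra ?A) = amult (cauchy_algebra ?B)" "astar (cauchy_algebra ?A) = astar (cauchy_algebra ?B)"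
    by (simp_all add: cauchy_algebra_def same)
  have n: "null_sequences ?A = null_sequences ?B"
    using assms by (auto simp: null_sequences_def)
  have cos: "coset (cauchy_algebra ?A) I = coset (cauchy_algebra ?B) I" for I
    by (simp add: coset_def[abs_def] ops)
  show "acarrier (completion ?A) = acarrier (completion ?B)"
    "aplus (completion ?A) = aplus (completion ?B)" "ascale (completion ?A) = ascale (completion ?B)"
    "amult (completion ?A) = amult (completion ?B)" "astar (completion ?A) = astar (completion ?B)"
    by (simp_all add: completion_def quotient_algebra_def n cos c ops)
qed

context e2_setting
begin

context
  assumes reduced: "\<forall>f\<in>Cc boundary_groupoid. N f = reduced_norm boundary_groupoid f"
    and reg: "cstar_regular_on_boundary TYPE('s)"
begin

text \<open>Both hypotheses meet here: regularity bounds the reduced norm on the boundary, and that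
  norm is the exotic one.\<close>

lemma N_le: "f \<in> CG \<Longrightarrow> a \<in> BI \<Longrightarrow> N (restrict_to_boundary f) \<le> norm (ru f + a)"
  using reduced_norm_boundary_le[OF reg, of f a] reduced restrict_Cc[of f] by simp

text \<open>If the difference \<open>?d\<close> of two lifts is mapped into the ideal by
  \<open>rho_2\<close>, then \<open>a = - rho_2 ?d\<close> is admissible in \<open>N_le\<close>. For
  a sequence representing \<open>?d\<close> the right side tends to 0, so \<open>?d\<close> is in
  the kernel of \<open>phi_2\<close>.\<close>

lemma Psi_inj: "inj_on Psi (acarrier (completion BB))"
proof (rule inj_onI)
  fix z z' assume zz: "z \<in> acarrier (completion BB)" "z' \<in> acarrier (completion BB)" "Psi z = Psi z'"
  obtain x where x: "x \<in> acarrier (completion AA)" "z = phi_2 N x" using zz(1) by (rule phi_2_cases)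
  obtain x' where x': "x' \<in> acarrier (completion AA)" "z' = phi_2 N x'" using zz(2) by (rule phi_2_cases)
  let ?d = "aminus (completion AA) x x'"
  have d: "?d \<in> acarrier (completion AA)" using x x' by simp
  have "rho_2 x - rho_2 x' \<in> BI"
    using zz(3) x x' Psi_phi_2 q_eq[OF rho_2_RC[OF x(1)] rho_2_RC[OF x'(1)]] by simp
  then have dB: "rho_2 ?d \<in> BI" using rho_2_hom(3)[OF x(1) x'(1)] by simp
  obtain a where a: "A.cauchy a" "?d = A.cls a" using d by (rule A.completion_cases)
  have an: "a n \<in> CG" for n using A.cauchy_carr[OF a(1)] by (simp add: Cc_monoid_groupoid)
  have mB: "- rho_2 ?d \<in> BI" using BI_minus[OF BI_ops(2) dB] by simp
  have "(\<lambda>n. N (restrict_to_boundary (a n))) \<longlonglongrightarrow> 0"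
  proof (rule Lim_null_comparison)
    show "(\<lambda>n. norm (ru (a n) - rho_2 ?d)) \<longlonglongrightarrow> 0"
      using rho_2_cls(2)[OF a(1)] unfolding a(2) by (intro tendsto_norm_zero LIM_zero)
    show "\<forall>\<^sub>F n in sequentially. norm (N (restrict_to_boundary (a n))) \<le> norm (ru (a n) - rho_2 ?d)"
      using N_le[OF an mB] B.norm_nonneg[of "restrict_to_boundary (a n)" for n] restrict_Cc[OF an]
      by (auto intro!: always_eventually)
  qed
  then have "phi_2 N ?d = azero (completion BB)"
    unfolding a(2) phi_2_cls(1)[OF a(1)] B.completion_zero
    using B.cls_eq_iff[OF phi_2_cls(2)[OF a(1)] B.cauchy_const[of "\<lambda>_. 0"]] by (simp add: Cc_zero)
  then have "aminus (completion BB) z z' = azero (completion BB)"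
    using phi_2_minus[OF x(1) x'(1)] x x' by simp
  then show "z = z'" using CB.minus_eq_zero_iff[OF zz(1,2)] by simp
qed

lemma Psi_surj: "Psi ` acarrier (completion BB) = acarrier boundary_quotient"
proof
  show "Psi ` acarrier (completion BB) \<subseteq> acarrier boundary_quotient"
    using Psi_star_hom unfolding star_hom_def by blast
  show "acarrier boundary_quotient \<subseteq> Psi ` acarrier (completion BB)"
  proof
    fix Y :: "('s ell2 \<Rightarrow>\<^sub>L 's ell2) set" assume "Y \<in> acarrier boundary_quotient"
    then obtain y where y: "y \<in> RC" "Y = q y" by (rule boundary_quotient_cases)
    obtain f where f: "\<And>n. f n \<in> CG" "(\<lambda>n. ru (f n)) \<longlonglongrightarrow> y" using y(1) RC_seq by blast
    let ?b = "\<lambda>n. restrict_to_boundary (f n)"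
    have bC: "?b n \<in> Cc boundary_groupoid" for n by (rule restrict_Cc[OF f(1)])
    \<comment> \<open>The estimate with the zero element of the ideal transfers the Cauchy property
      from operators on the monoid to restrictions.\<close>
    have cb: "B.cauchy ?b"
      unfolding B.cauchy_def
    proof (intro conjI allI impI)
      fix e :: real assume "0 < e"
      then obtain M where M: "\<forall>m\<ge>M. \<forall>n\<ge>M. norm (ru (f m) - ru (f n)) < e"
        using CauchyD[OF LIMSEQ_imp_Cauchy[OF f(2)]] by blast
      have "B.nrm (B.sub (?b m) (?b n)) \<le> norm (ru (f m) - ru (f n))" for m n
        using N_le[OF CG_minus[OF f(1) f(1)] BI_ops(2), of m n] by (simp add: ru_minus f restrict_linear)
      then show "\<exists>M. \<forall>m\<ge>M. \<forall>n\<ge>M. B.nrm (B.sub (?b m) (?b n)) < e" using M le_less_trans by blast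
    qed (use bC in simp)
    let ?z = "B.cls ?b"
    have z: "?z \<in> acarrier (completion BB)" using cb by (auto simp: B.completion_carrier)
    then obtain x where x: "x \<in> acarrier (completion AA)" "?z = phi_2 N x" by (rule phi_2_cases)
    obtain C where C: "0 \<le> C" "\<And>z. z \<in> acarrier (completion BB) \<Longrightarrow> \<exists>x\<in>acarrier (completion AA). phi_2 N x = z \<and>
       anorm (completion AA) x \<le> C * anorm (completion BB) z"
      using phi_2_open by blast
    let ?E = "\<lambda>n. completion_embed AA (f n)" and ?D = "\<lambda>n. aminus (completion BB) (completion_embed BB (?b n)) ?z"
    have E: "?E n \<in> acarrier (completion AA)" for n using A.embed_carrier f by (simp add: Cc_monoid_groupoid)
    have cc: "A.cauchy (\<lambda>_. f n)" for n using A.cauchy_const f by (simp add: Cc_monoid_groupoid)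
    have rE: "rho_2 (?E n) = ru (f n)" for n
      unfolding A.embed_cls by (rule rho_2_eqI[OF cc]) simp
    have pE: "phi_2 N (aminus (completion AA) (?E n) x) = ?D n" for n
      using phi_2_minus[OF E x(1)] x(2) phi_2_cls(1)[OF cc] by (simp add: A.embed_cls B.embed_cls)
    have Dc: "?D n \<in> acarrier (completion BB)" for n using z B.embed_carrier bC by simp
    \<comment> \<open>\<open>rho_2\<close> is controlled by the norm upstairs, while only
      convergence downstairs is known. Lifts of the errors \<open>?D n\<close> with norms tending to
      0 bridge the gap.\<close>
    have "\<exists>w\<in>acarrier (completion AA). phi_2 N w = ?D n \<and> anorm (completion AA) w \<le> C * anorm (completion BB) (?D n)" for n
      by (rule C(2)[OF Dc])
    then obtain w where w: "\<And>n. w n \<in> acarrier (completion AA)" "\<And>n. phi_2 N (w n) = ?D n"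
        "\<And>n. anorm (completion AA) (w n) \<le> C * anorm (completion BB) (?D n)"
      by metis
    \<comment> \<open>\<open>?E n - x\<close> and \<open>w n\<close> have the same image under
      \<open>phi_2\<close>; their images under \<open>rho_2\<close> differ by an element of the
      ideal.\<close>
    have i: "ru (f n) - rho_2 x - rho_2 (w n) \<in> BI" for n
      using kernel_eq[OF CA.minus_closed[OF E x(1)] w(1), of n n] w(2) pE rho_2_hom(3)[OF E x(1)] by (simp add: rE)
    have "(\<lambda>n. rho_2 (w n)) \<longlonglongrightarrow> 0"
    proof (rule Lim_null_comparison)
      show "(\<lambda>n. C * anorm (completion BB) (?D n)) \<longlonglongrightarrow> 0"
        using B.embed_tendsto[OF cb] unfolding norm_tendsto_def by (rule tendsto_mult_right_zero)
      show "\<forall>\<^sub>F n in sequentially. norm (rho_2 (w n)) \<le> C * anorm (completion BB) (?D n)"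
        using rho_2_hom(8)[OF w(1) w(1)] w(3) order_trans by (intro always_eventually allI) blast
    qed
    then have "(\<lambda>n. ru (f n) - rho_2 x - rho_2 (w n)) \<longlonglongrightarrow> y - rho_2 x - 0"
      by (intro tendsto_diff f tendsto_const)
    from BI_ops(7)[OF i this] have "y - rho_2 x \<in> BI" by simp
    then have "Psi ?z = Y"
      unfolding x(2) Psi_phi_2[OF x(1)] y(2) using q_eq[OF y(1) rho_2_RC[OF x(1)]] by simp
    then show "Y \<in> Psi ` acarrier (completion BB)" using z by blast
  qed
qed

lemma canonical_isomorphism:
  "star_isomorphism (reduced_cstar_algebra boundary_groupoid) boundary_quotient (canonical_map N)"
proof -
  have "star_isomorphism (completion BB) boundary_quotient (canonical_map N)"
    unfolding star_isomorphism_def canonical_map_eq bij_betw_def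
    using Psi_star_hom Psi_inj Psi_surj by blast
  \<comment> \<open>An isomorphism refers to carriers and operations only, and on these the two
    completions coincide.\<close>
  then show ?thesis
    unfolding star_isomorphism_def star_hom_def reduced_cstar_algebra_def
      completion_norm_cong[OF reduced] .
qed

end

end

theorem theorem2p23:
  fixes norm_e2 :: "('s::left_cancel_monoid germ \<Rightarrow> complex) \<Rightarrow> real"
  assumes "is_e2_norm norm_e2"
    and "\<forall>f\<in>Cc boundary_groupoid. norm_e2 f = reduced_norm boundary_groupoid f"
    and "cstar_regular_on_boundary TYPE('s)"
  shows "star_isomorphism (reduced_cstar_algebra boundary_groupoid) boundary_quotient
           (canonical_map norm_e2)"
proof -
  interpret e2_setting norm_e2 by (rule e2_setting.intro[OF assms(1)])
  show ?thesis by (rule canonical_isomorphism[OF assms(2,3)])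
qed

end
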